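(* Let $V$ be a commutative valuation domain with quotient field $F$ such that $J(V)$ is a principal ideal of $V$, let $K/F$ be a finite Galois extension with group $G$ which is tamely ramified and defectless, and suppose $V$ is indecomposed in $K$, i.e. the integral closure $S$ of $V$ in $K$ is a valuation ring. Let $f:G\times G\to S\setminus\{0\}$ be a normalized $2$-cocycle and $H=\{\sigma\in G: f(\sigma,\sigma^{-1})\in U(S)\}$. Then the following are equivalent: (1) $A_f$ is semihereditary; (2) $f(\sigma,\tau)\notin J(S)^2$ for every $\sigma,\tau\in G$; (3) $H$ is a normal subgroup of $G$ and $G/H$ is cyclic; further, either $H=G$, or there exists $\sigma\in G$ such that $G/H=\langle\sigma H\rangle$, the graph $\mathrm{Gr}(f)$ is the chain $H\le\sigma H\le\sigma^2H\le\cdots\le\sigma^{|G/H|-1}H$, and $J(A_f)=x_\sigma A_f$.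
   Context: $V$ has arbitrary Krull dimension. A normalized 2-cocycle satisfies $\sigma(f(\tau,\gamma))f(\sigma,\tau\gamma)=f(\sigma,\tau)f(\sigma\tau,\gamma)$ and $f(1,\sigma)=f(\sigma,1)=1$; its values need not be units. $A_f=\bigoplus_{\sigma\in G}Sx_\sigma$ is the free left $S$-module on symbols $x_\sigma$ with multiplication $(sx_\sigma)(tx_\tau)=s\,\sigma(t)f(\sigma,\tau)x_{\sigma\tau}$; it is a $V$-order in $(K/F,G,f)$. $J(R)$ is the Jacobson radical, $U(R)$ the unit group. $H$ is a subgroup of $G$. The graph $\mathrm{Gr}(f)$ is the partial order on the left coset space $G/H$ given by $\sigma H\le\tau H$ iff $f(\sigma,\sigma^{-1}\tau)\in U(S)$ (well defined). A ring is semihereditary if finitely generated one-sided ideals are projective. Tamely ramified and defectless: with $e=[\Gamma_S:\Gamma_V]$ the ramification index and $\overline S,\overline V$ residue fields, $[K:F]=e[\overline S:\overline V]$ (defectless, $S$ being the unique extension), $\mathrm{char}\,\overline V\nmid e$ and $\overline S/\overline V$ separable. *)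

theory Defs
  imports "HOL-Algebra.Ring" "HOL-Algebra.Coset" "HOL-Computational_Algebra.Polynomial"
begin

definition left_ideal :: "('a, 'b) ring_scheme \<Rightarrow> 'a set \<Rightarrow> bool" where
  "left_ideal R I \<longleftrightarrow> I \<subseteq> carrier R \<and> \<zero>\<^bsub>R\<^esub> \<in> I
     \<and> (\<forall>x\<in>I. \<forall>y\<in>I. x \<oplus>\<^bsub>R\<^esub> y \<in> I \<and> x \<ominus>\<^bsub>R\<^esub> y \<in> I)
     \<and> (\<forall>r\<in>carrier R. \<forall>x\<in>I. r \<otimes>\<^bsub>R\<^esub> x \<in> I)"

definition right_ideal :: "('a, 'b) ring_scheme \<Rightarrow> 'a set \<Rightarrow> bool" where
  "right_ideal R I \<longleftrightarrow> I \<subseteq> carrier R \<and> \<zero>\<^bsub>R\<^esub> \<in> I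
     \<and> (\<forall>x\<in>I. \<forall>y\<in>I. x \<oplus>\<^bsub>R\<^esub> y \<in> I \<and> x \<ominus>\<^bsub>R\<^esub> y \<in> I)
     \<and> (\<forall>r\<in>carrier R. \<forall>x\<in>I. x \<otimes>\<^bsub>R\<^esub> r \<in> I)"

definition maximal_left_ideal :: "('a, 'b) ring_scheme \<Rightarrow> 'a set \<Rightarrow> bool" where
  "maximal_left_ideal R I \<longleftrightarrow> left_ideal R I \<and> I \<noteq> carrier R
     \<and> (\<forall>J. left_ideal R J \<and> I \<subseteq> J \<longrightarrow> J = I \<or> J = carrier R)"

definition jacobson :: "('a, 'b) ring_scheme \<Rightarrow> 'a set" where
  "jacobson R = carrier R \<inter> \<Inter>{I. maximal_left_ideal R I}"

definition fg_left_ideal :: "('a, 'b) ring_scheme \<Rightarrow> 'a set \<Rightarrow> bool" where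
  "fg_left_ideal R I \<longleftrightarrow> left_ideal R I \<and>
     (\<exists>B. finite B \<and> B \<subseteq> I \<and> I = \<Inter>{J. left_ideal R J \<and> B \<subseteq> J})"

definition fg_right_ideal :: "('a, 'b) ring_scheme \<Rightarrow> 'a set \<Rightarrow> bool" where
  "fg_right_ideal R I \<longleftrightarrow> right_ideal R I \<and>
     (\<exists>B. finite B \<and> B \<subseteq> I \<and> I = \<Inter>{J. right_ideal R J \<and> B \<subseteq> J})"

definition vecs :: "('a, 'b) ring_scheme \<Rightarrow> nat \<Rightarrow> (nat \<Rightarrow> 'a) set" where
  "vecs R n = {v. (\<forall>i<n. v i \<in> carrier R) \<and> (\<forall>i\<ge>n. v i = \<zero>\<^bsub>R\<^esub>)}"

definition vadd :: "('a, 'b) ring_scheme \<Rightarrow> nat \<Rightarrow> (nat \<Rightarrow> 'a) \<Rightarrow> (nat \<Rightarrow> 'a) \<Rightarrow> nat \<Rightarrow> 'a" where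
  "vadd R n v w = (\<lambda>i. if i < n then v i \<oplus>\<^bsub>R\<^esub> w i else \<zero>\<^bsub>R\<^esub>)"

definition lsmult :: "('a, 'b) ring_scheme \<Rightarrow> nat \<Rightarrow> 'a \<Rightarrow> (nat \<Rightarrow> 'a) \<Rightarrow> nat \<Rightarrow> 'a" where
  "lsmult R n r v = (\<lambda>i. if i < n then r \<otimes>\<^bsub>R\<^esub> v i else \<zero>\<^bsub>R\<^esub>)"

definition rsmult :: "('a, 'b) ring_scheme \<Rightarrow> nat \<Rightarrow> (nat \<Rightarrow> 'a) \<Rightarrow> 'a \<Rightarrow> nat \<Rightarrow> 'a" where
  "rsmult R n v r = (\<lambda>i. if i < n then v i \<otimes>\<^bsub>R\<^esub> r else \<zero>\<^bsub>R\<^esub>)"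

text \<open>A finitely generated left ideal \<open>I\<close>, viewed as a left \<open>R\<close>-module, is projective iff
  it is a direct summand (retract) of a finitely generated free left module \<open>R^n\<close>.\<close>
definition projective_left_ideal :: "('a, 'b) ring_scheme \<Rightarrow> 'a set \<Rightarrow> bool" where
  "projective_left_ideal R I \<longleftrightarrow> (\<exists>n \<iota> \<pi>.
     (\<forall>x\<in>I. \<iota> x \<in> vecs R n) \<and> (\<forall>v\<in>vecs R n. \<pi> v \<in> I)
     \<and> (\<forall>x\<in>I. \<forall>y\<in>I. \<iota> (x \<oplus>\<^bsub>R\<^esub> y) = vadd R n (\<iota> x) (\<iota> y))
     \<and> (\<forall>r\<in>carrier R. \<forall>x\<in>I. \<iota> (r \<otimes>\<^bsub>R\<^esub> x) = lsmult R n r (\<iota> x))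
     \<and> (\<forall>v\<in>vecs R n. \<forall>w\<in>vecs R n. \<pi> (vadd R n v w) = \<pi> v \<oplus>\<^bsub>R\<^esub> \<pi> w)
     \<and> (\<forall>r\<in>carrier R. \<forall>v\<in>vecs R n. \<pi> (lsmult R n r v) = r \<otimes>\<^bsub>R\<^esub> \<pi> v)
     \<and> (\<forall>x\<in>I. \<pi> (\<iota> x) = x))"

definition projective_right_ideal :: "('a, 'b) ring_scheme \<Rightarrow> 'a set \<Rightarrow> bool" where
  "projective_right_ideal R I \<longleftrightarrow> (\<exists>n \<iota> \<pi>.
     (\<forall>x\<in>I. \<iota> x \<in> vecs R n) \<and> (\<forall>v\<in>vecs R n. \<pi> v \<in> I)
     \<and> (\<forall>x\<in>I. \<forall>y\<in>I. \<iota> (x \<oplus>\<^bsub>R\<^esub> y) = vadd R n (\<iota> x) (\<iota> y))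
     \<and> (\<forall>r\<in>carrier R. \<forall>x\<in>I. \<iota> (x \<otimes>\<^bsub>R\<^esub> r) = rsmult R n (\<iota> x) r)
     \<and> (\<forall>v\<in>vecs R n. \<forall>w\<in>vecs R n. \<pi> (vadd R n v w) = \<pi> v \<oplus>\<^bsub>R\<^esub> \<pi> w)
     \<and> (\<forall>r\<in>carrier R. \<forall>v\<in>vecs R n. \<pi> (rsmult R n v r) = \<pi> v \<otimes>\<^bsub>R\<^esub> r)
     \<and> (\<forall>x\<in>I. \<pi> (\<iota> x) = x))"

definition semihereditary :: "('a, 'b) ring_scheme \<Rightarrow> bool" where
  "semihereditary R \<longleftrightarrow>
     (\<forall>I. fg_left_ideal R I \<longrightarrow> projective_left_ideal R I) \<and>
     (\<forall>I. fg_right_ideal R I \<longrightarrow> projective_right_ideal R I)"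

definition ring_on :: "'k::field set \<Rightarrow> 'k ring" where
  "ring_on X = \<lparr>carrier = X, monoid.mult = (*), one = 1, zero = 0, add = (+)\<rparr>"

definition ideal_square :: "('a, 'b) ring_scheme \<Rightarrow> 'a set \<Rightarrow> 'a set" where
  "ideal_square R I = \<Inter>{J. left_ideal R J \<and> {x \<otimes>\<^bsub>R\<^esub> y | x y. x \<in> I \<and> y \<in> I} \<subseteq> J}"

definition is_subfield :: "'k::field set \<Rightarrow> bool" where
  "is_subfield F \<longleftrightarrow> 0 \<in> F \<and> 1 \<in> F \<and> (\<forall>x\<in>F. \<forall>y\<in>F. x + y \<in> F \<and> x - y \<in> F \<and> x * y \<in> F)
     \<and> (\<forall>x\<in>F. inverse x \<in> F)"

definition is_subring :: "'k::field set \<Rightarrow> 'k set \<Rightarrow> bool" where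
  "is_subring L R \<longleftrightarrow> R \<subseteq> L \<and> 0 \<in> R \<and> 1 \<in> R \<and> (\<forall>x\<in>R. \<forall>y\<in>R. x + y \<in> R \<and> x - y \<in> R \<and> x * y \<in> R)"

definition valuation_ring :: "'k::field set \<Rightarrow> 'k set \<Rightarrow> bool" where
  "valuation_ring L R \<longleftrightarrow> is_subring L R \<and> (\<forall>x\<in>L. x \<noteq> 0 \<longrightarrow> x \<in> R \<or> inverse x \<in> R)"

definition integral_closure :: "'k::field set \<Rightarrow> 'k set" where
  "integral_closure V = {x. \<exists>p. (\<forall>i. coeff p i \<in> V) \<and> lead_coeff p = 1 \<and> poly p x = 0}"

text \<open>\<open>[K:F] = n\<close> where \<open>K\<close> is the whole ambient field.\<close>
definition field_degree :: "'k::field set \<Rightarrow> nat \<Rightarrow> bool" where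
  "field_degree F n \<longleftrightarrow> (\<exists>b :: nat \<Rightarrow> 'k.
     (\<forall>c. (\<forall>i<n. c i \<in> F) \<longrightarrow> (\<Sum>i<n. c i * b i) = 0 \<longrightarrow> (\<forall>i<n. c i = 0))
     \<and> (\<forall>x. \<exists>c. (\<forall>i<n. c i \<in> F) \<and> x = (\<Sum>i<n. c i * b i)))"

definition field_aut :: "('k::field \<Rightarrow> 'k) \<Rightarrow> bool" where
  "field_aut \<sigma> \<longleftrightarrow> bij \<sigma> \<and> (\<forall>x y. \<sigma> (x + y) = \<sigma> x + \<sigma> y \<and> \<sigma> (x * y) = \<sigma> x * \<sigma> y)"

definition Gal :: "'k::field set \<Rightarrow> ('k \<Rightarrow> 'k) set" where
  "Gal F = {\<sigma>. field_aut \<sigma> \<and> (\<forall>a\<in>F. \<sigma> a = a)}"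

definition finite_galois :: "'k::field set \<Rightarrow> bool" where
  "finite_galois F \<longleftrightarrow> is_subfield F \<and> (\<exists>n. field_degree F n)
     \<and> {x. \<forall>\<sigma>\<in>Gal F. \<sigma> x = x} = F"

text \<open>Ramification index \<open>e = [\<Gamma>_S : \<Gamma>_V]\<close> where \<open>\<Gamma>_S = K^*/U(S)\<close> and \<open>\<Gamma>_V = F^*/U(V)\<close>
  (embedded in \<open>\<Gamma>_S\<close> as \<open>F^* U(S)/U(S)\<close>), i.e. the number of cosets of \<open>F^* U(S)\<close> in \<open>K^*\<close>.\<close>
definition ram_index :: "'k::field set \<Rightarrow> 'k set \<Rightarrow> nat" where
  "ram_index F S = card ((\<lambda>x. {x * a * u | a u. a \<in> F - {0} \<and> u \<in> Units (ring_on S)}) ` (UNIV - {0}))"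

text \<open>\<open>[S/J(S) : V/J(V)] = m\<close>: elements \<open>s_0..s_{m-1}\<close> of \<open>S\<close> whose residues form a basis.\<close>
definition residue_degree :: "'k::field set \<Rightarrow> 'k set \<Rightarrow> nat \<Rightarrow> bool" where
  "residue_degree V S m \<longleftrightarrow> (\<exists>s :: nat \<Rightarrow> 'k. (\<forall>i<m. s i \<in> S)
     \<and> (\<forall>c. (\<forall>i<m. c i \<in> V) \<longrightarrow> (\<Sum>i<m. c i * s i) \<in> jacobson (ring_on S)
            \<longrightarrow> (\<forall>i<m. c i \<in> jacobson (ring_on V)))
     \<and> (\<forall>x\<in>S. \<exists>c. (\<forall>i<m. c i \<in> V) \<and> x - (\<Sum>i<m. c i * s i) \<in> jacobson (ring_on S)))"

text \<open>\<open>S/J(S)\<close> separable over \<open>V/J(V)\<close>: every residue is a root of a monic separable polynomial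
  (separable: coprime to its derivative) over the residue field.\<close>
definition separable_residue :: "'k::field set \<Rightarrow> 'k set \<Rightarrow> bool" where
  "separable_residue V S \<longleftrightarrow> (\<forall>x\<in>S. \<exists>p a b.
     (\<forall>i. coeff p i \<in> V \<and> coeff a i \<in> V \<and> coeff b i \<in> V) \<and> lead_coeff p = 1
     \<and> poly p x \<in> jacobson (ring_on S)
     \<and> (\<forall>i. coeff (a * p + b * pderiv p - 1) i \<in> jacobson (ring_on V)))"

definition tame_defectless :: "'k::field set \<Rightarrow> 'k set \<Rightarrow> 'k set \<Rightarrow> bool" where
  "tame_defectless F V S \<longleftrightarrow>
     (\<exists>n m. field_degree F n \<and> residue_degree V S m \<and> n = ram_index F S * m)
     \<and> of_nat (ram_index F S) \<notin> jacobson (ring_on V)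
     \<and> separable_residue V S"

definition normalized_cocycle ::
  "('k::field \<Rightarrow> 'k) set \<Rightarrow> 'k set \<Rightarrow> (('k \<Rightarrow> 'k) \<Rightarrow> ('k \<Rightarrow> 'k) \<Rightarrow> 'k) \<Rightarrow> bool" where
  "normalized_cocycle G S f \<longleftrightarrow>
     (\<forall>\<sigma>\<in>G. \<forall>\<tau>\<in>G. f \<sigma> \<tau> \<in> S - {0})
     \<and> (\<forall>\<sigma>\<in>G. \<forall>\<tau>\<in>G. \<forall>\<gamma>\<in>G. \<sigma> (f \<tau> \<gamma>) * f \<sigma> (\<tau> \<circ> \<gamma>) = f \<sigma> \<tau> * f (\<sigma> \<circ> \<tau>) \<gamma>)
     \<and> (\<forall>\<sigma>\<in>G. f id \<sigma> = 1 \<and> f \<sigma> id = 1)"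

text \<open>\<open>A_f = \<Oplus>_\<sigma> S x_\<sigma>\<close>; an element \<open>\<Sum> s_\<sigma> x_\<sigma>\<close> is the coefficient function \<open>\<sigma> \<mapsto> s_\<sigma>\<close>.
  Product: \<open>(s x_\<sigma>)(t x_\<tau>) = s \<sigma>(t) f(\<sigma>,\<tau>) x_{\<sigma>\<tau>}\<close>.\<close>
definition crossed_product ::
  "('k::field \<Rightarrow> 'k) set \<Rightarrow> 'k set \<Rightarrow> (('k \<Rightarrow> 'k) \<Rightarrow> ('k \<Rightarrow> 'k) \<Rightarrow> 'k) \<Rightarrow> (('k \<Rightarrow> 'k) \<Rightarrow> 'k) ring" where
  "crossed_product G S f =
     \<lparr>carrier = {a. (\<forall>\<sigma>\<in>G. a \<sigma> \<in> S) \<and> (\<forall>\<sigma>. \<sigma> \<notin> G \<longrightarrow> a \<sigma> = 0)},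
      monoid.mult = (\<lambda>a b \<rho>. if \<rho> \<in> G then (\<Sum>\<sigma>\<in>G. a \<sigma> * \<sigma> (b (Hilbert_Choice.inv \<sigma> \<circ> \<rho>)) * f \<sigma> (Hilbert_Choice.inv \<sigma> \<circ> \<rho>)) else 0),
      one = (\<lambda>\<rho>. if \<rho> = id then 1 else 0),
      zero = (\<lambda>\<rho>. 0),
      add = (\<lambda>a b \<rho>. a \<rho> + b \<rho>)\<rparr>"

definition xbasis :: "('k::field \<Rightarrow> 'k) \<Rightarrow> ('k \<Rightarrow> 'k) \<Rightarrow> 'k" where
  "xbasis \<sigma> = (\<lambda>\<rho>. if \<rho> = \<sigma> then 1 else 0)"

definition galois_group :: "('k::field \<Rightarrow> 'k) set \<Rightarrow> ('k \<Rightarrow> 'k) monoid" where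
  "galois_group G = \<lparr>carrier = G, monoid.mult = (\<circ>), one = id\<rparr>"

end

theory Submission
  imports Defs "HOL-Library.Function_Algebras"
begin

text \<open>
  All arguments are graded by \<open>G\<close>. Tameness enters only through an element of \<open>S\<close> whose trace is a
  unit: by the theorems of Dedekind and Artin, applied to \<open>K\<close> and to the residue field, the inertia
  group has order \<open>e\<close>, and distinct automorphisms of the residue field are independent.

  If all values of \<open>f\<close> lie outside \<open>J(S)\<^sup>2 = \<omega>\<^sup>2 S\<close>, their valuations form a \<open>{0, 1}\<close>-valued cocycle on \<open>G\<close>,
  which is the coboundary of a function to \<open>\<rat>\<close> with values in \<open>[0, 1)\<close>; modulo \<open>\<int>\<close> this function is a
  character with kernel \<open>H\<close>, so \<open>G / H\<close> is cyclic and the valuations are the carries of addition modulo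
  \<open>|G / H|\<close>. The elements with nonunit coefficients along \<open>H\<close> form an ideal \<open>P = xA\<close> that is nilpotent
  modulo \<open>\<omega>\<close>. Averaging a projection of \<open>S\<close>-lattices against the trace element gives an \<open>A\<close>-linear map
  that is the identity modulo \<open>P\<close> and factors through a free module. This shows both \<open>J(A) = P\<close> and,
  by Nakayama's lemma, that finitely generated left ideals are projective; right ideals are handled
  by passing to the opposite crossed product. Conversely, if \<open>f(\<tau>\<inverse>, \<tau>)\<close> lies in \<open>J(S)\<^sup>2\<close>, the left
  ideal generated by \<open>\<omega>\<close> and \<open>x\<^sub>\<tau>\<close> is not projective.
\<close>

section \<open>Valuation rings\<close>

text \<open>The obstacle is that \<open>x\<^sub>\<alpha>\<close> is a unit of the order only for
  \<alpha> in \<open>H\<close>: for every other \<alpha> the element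
  \<open>x\<^sub>\<alpha>\<inverse>\<close> has a nonintegral coefficient, so averaging over
  \<open>G\<close> leaves the order. Two facts compensate. Outside \<open>H\<close> the left factor
  \<open>x\<^sub>\<alpha>\<close> already lies in \<open>P\<close>, so these terms are errors in
  \<open>P\<close> whatever the projection does. On \<open>H\<close> the projection differs from the
  identity by \<omega> times an element of the enlarged lattice, and \<omega>
  \<open>x\<^sub>\<alpha>\<inverse>\<close> is integral and lies in \<open>P\<close> because
  \<open>f(\<alpha>\<inverse>, \<alpha>)\<close> divides \<omega>; this is where the exclusion of
  \<open>J(S)\<^sup>2\<close> acts. Hence trace one is wanted over \<open>H\<close> only. The
  radical is not known in advance to be finitely generated over \<open>S\<close>, so the averaging
  is set up for a pair of left ideals: the radical inside \<open>A\<close> in order to compute the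
  radical, and a finitely generated ideal inside itself for projectivity. Principality of
  \<open>J(V)\<close> enters through a generator \<omega> of \<open>J(S)\<close>; \<omega> = 0 is
  allowed and is the case of the trivial valuation.\<close>

definition nonunits :: "'k::field set \<Rightarrow> 'k set" where
  "nonunits R = {x \<in> R. x = 0 \<or> inverse x \<notin> R}"

lemma ring_on_simps [simp]:
  "carrier (ring_on R) = R" "monoid.mult (ring_on R) = (*)" "one (ring_on R) = 1"
  "zero (ring_on R) = 0" "add (ring_on R) = (+)"
  by (simp_all add: ring_on_def)

lemma is_subring_closed:
  assumes "is_subring L R"
  shows "0 \<in> R" "1 \<in> R" "x \<in> R \<Longrightarrow> y \<in> R \<Longrightarrow> x + y \<in> R" "x \<in> R \<Longrightarrow> y \<in> R \<Longrightarrow> x - y \<in> R"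
    "x \<in> R \<Longrightarrow> y \<in> R \<Longrightarrow> x * y \<in> R" "x \<in> R \<Longrightarrow> - x \<in> R"
proof -
  show *: "0 \<in> R" "1 \<in> R" "x \<in> R \<Longrightarrow> y \<in> R \<Longrightarrow> x + y \<in> R" "x \<in> R \<Longrightarrow> y \<in> R \<Longrightarrow> x - y \<in> R"
    "x \<in> R \<Longrightarrow> y \<in> R \<Longrightarrow> x * y \<in> R" for x y
    using assms by (auto simp: is_subring_def)
  show "x \<in> R \<Longrightarrow> - x \<in> R" using *(4)[OF *(1), of x] by simp
qed

lemma cring_ring_on:
  assumes "is_subring L R"
  shows "cring (ring_on R)"
proof -
  note c = is_subring_closed[OF assms]
  show ?thesis
  proof (rule cringI)
    show "abelian_group (ring_on R)"
    proof (rule abelian_groupI)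
      fix x assume "x \<in> carrier (ring_on R)"
      then show "\<exists>y\<in>carrier (ring_on R). y \<oplus>\<^bsub>ring_on R\<^esub> x = \<zero>\<^bsub>ring_on R\<^esub>"
        by (intro bexI[of _ "- x"]) (auto intro: c)
    qed (auto intro: c)
    show "Group.comm_monoid (ring_on R)"
      by (rule comm_monoidI) (auto intro: c)
  qed (auto simp: algebra_simps)
qed

lemma ring_on_minus:
  assumes "is_subring L R" "x \<in> R" "y \<in> R"
  shows "x \<ominus>\<^bsub>ring_on R\<^esub> y = x - y"
proof -
  interpret cring "ring_on R" by (rule cring_ring_on[OF assms(1)])
  have "\<ominus>\<^bsub>ring_on R\<^esub> y = - y"
    using assms is_subring_closed[OF assms(1)] by (intro minus_equality) auto
  then show ?thesis by (simp add: a_minus_def)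
qed

lemma left_ideal_ring_on:
  assumes "is_subring L R"
  shows "left_ideal (ring_on R) I \<longleftrightarrow> I \<subseteq> R \<and> 0 \<in> I
     \<and> (\<forall>x\<in>I. \<forall>y\<in>I. x + y \<in> I \<and> x - y \<in> I) \<and> (\<forall>r\<in>R. \<forall>x\<in>I. r * x \<in> I)"
proof (cases "I \<subseteq> R")
  case True
  then have "\<forall>x\<in>I. \<forall>y\<in>I. x \<ominus>\<^bsub>ring_on R\<^esub> y = x - y"
    using ring_on_minus[OF assms] by blast
  then show ?thesis unfolding left_ideal_def by simp
qed (simp add: left_ideal_def)

lemma Units_ring_on:
  assumes "is_subring L R"
  shows "Units (ring_on R) = {x \<in> R. x \<noteq> 0 \<and> inverse x \<in> R}"
proof -
  have "x \<in> Units (ring_on R) \<longleftrightarrow> x \<in> R \<and> x \<noteq> 0 \<and> inverse x \<in> R" for x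
  proof
    assume "x \<in> Units (ring_on R)"
    then obtain y where y: "x \<in> R" "y \<in> R" "y * x = 1" by (auto simp: Units_def)
    then have "x \<noteq> 0" "inverse x = y" by (auto simp: inverse_unique mult.commute)
    then show "x \<in> R \<and> x \<noteq> 0 \<and> inverse x \<in> R" using y by auto
  qed (auto simp: Units_def intro!: bexI[of _ "inverse x"])
  then show ?thesis by auto
qed

lemma valuation_ring_subring: "valuation_ring L R \<Longrightarrow> is_subring L R"
  by (simp add: valuation_ring_def)

lemma is_subfield_closed:
  assumes "is_subfield L"
  shows "0 \<in> L" "1 \<in> L" "x \<in> L \<Longrightarrow> y \<in> L \<Longrightarrow> x + y \<in> L" "x \<in> L \<Longrightarrow> y \<in> L \<Longrightarrow> x - y \<in> L"
    "x \<in> L \<Longrightarrow> y \<in> L \<Longrightarrow> x * y \<in> L" "x \<in> L \<Longrightarrow> inverse x \<in> L"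
    "x \<in> L \<Longrightarrow> y \<in> L \<Longrightarrow> x / y \<in> L" "x \<in> L \<Longrightarrow> - x \<in> L"
proof -
  show *: "0 \<in> L" "1 \<in> L" "x \<in> L \<Longrightarrow> y \<in> L \<Longrightarrow> x + y \<in> L" "x \<in> L \<Longrightarrow> y \<in> L \<Longrightarrow> x - y \<in> L"
    "x \<in> L \<Longrightarrow> y \<in> L \<Longrightarrow> x * y \<in> L" "x \<in> L \<Longrightarrow> inverse x \<in> L" for x y
    using assms by (auto simp: is_subfield_def)
  show "x \<in> L \<Longrightarrow> y \<in> L \<Longrightarrow> x / y \<in> L" using *(5,6) by (simp add: divide_inverse)
  show "x \<in> L \<Longrightarrow> - x \<in> L" using *(4)[OF *(1), of x] by simp
qed

lemma valuation_ring_total: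
  assumes "is_subfield L" "valuation_ring L R" "x \<in> L" "y \<in> L" "x \<noteq> 0" "y \<noteq> 0"
  shows "x / y \<in> R \<or> y / x \<in> R"
proof -
  have "x / y \<in> L" "x / y \<noteq> 0" using assms is_subfield_closed by auto
  then have "x / y \<in> R \<or> inverse (x / y) \<in> R"
    using assms(2) unfolding valuation_ring_def by blast
  then show ?thesis by (simp add: inverse_divide)
qed

lemma nonunits_mult:
  assumes R: "is_subring L R" and r: "r \<in> R" and x: "x \<in> nonunits R"
  shows "r * x \<in> nonunits R"
proof -
  note c = is_subring_closed[OF R]
  have "inverse x \<in> R" if "r * x \<noteq> 0" "inverse (r * x) \<in> R"
  proof -
    have "r * inverse (r * x) = inverse x" using that(1) by (simp add: field_simps)
    then show ?thesis using c(5)[OF r that(2)] by metis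
  qed
  then show ?thesis using r x c unfolding nonunits_def by auto
qed

text \<open>Of the two quotients one lies in \<open>R\<close>, so the sum is a multiple, by an
  element of \<open>R\<close>, of one of the two nonunits.\<close>

lemma nonunits_add:
  assumes L: "is_subfield L" and V: "valuation_ring L R"
    and x: "x \<in> nonunits R" and y: "y \<in> nonunits R"
  shows "x + y \<in> nonunits R"
proof -
  have R: "is_subring L R" using V by (rule valuation_ring_subring)
  note c = is_subring_closed[OF R]
  have xyR: "x \<in> R" "y \<in> R" using x y by (auto simp: nonunits_def)
  have xyL: "x \<in> L" "y \<in> L" using xyR R by (auto simp: is_subring_def)
  show ?thesis
  proof (cases "x = 0 \<or> y = 0")
    case False
    then have nz: "x \<noteq> 0" "y \<noteq> 0" by auto
    from valuation_ring_total[OF L V xyL nz] show ?thesis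
    proof
      assume "x / y \<in> R"
      then have "(1 + x / y) * y \<in> nonunits R" using y by (intro nonunits_mult[OF R] c) auto
      moreover have "(1 + x / y) * y = x + y" using nz by (simp add: field_simps)
      ultimately show ?thesis by simp
    next
      assume "y / x \<in> R"
      then have "(1 + y / x) * x \<in> nonunits R" using x by (intro nonunits_mult[OF R] c) auto
      moreover have "(1 + y / x) * x = x + y" using nz by (simp add: field_simps)
      ultimately show ?thesis by simp
    qed
  qed (use x y in auto)
qed

lemma one_notin_nonunits: "1 \<notin> nonunits R"
  by (auto simp: nonunits_def)

lemma zero_in_nonunits: "is_subring L R \<Longrightarrow> 0 \<in> nonunits R"
  by (auto simp: nonunits_def is_subring_def)

lemma nonunits_ideal:
  assumes L: "is_subfield L" and V: "valuation_ring L R"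
  shows "left_ideal (ring_on R) (nonunits R)"
proof -
  have R: "is_subring L R" using V by (rule valuation_ring_subring)
  have "x - y \<in> nonunits R" if "x \<in> nonunits R" "y \<in> nonunits R" for x y
    using nonunits_add[OF L V that(1), of "-1 * y"] is_subring_closed[OF R] that
      nonunits_mult[OF R, of "-1" y] by simp
  then show ?thesis
    unfolding left_ideal_ring_on[OF R]
    using nonunits_add[OF L V] nonunits_mult[OF R] zero_in_nonunits[OF R]
    by (auto simp: nonunits_def)
qed

lemma proper_left_ideal_subset_nonunits:
  assumes R: "is_subring L R" and I: "left_ideal (ring_on R) I" "I \<noteq> R"
  shows "I \<subseteq> nonunits R"
proof
  fix x assume x: "x \<in> I"
  note I' = I(1)[unfolded left_ideal_ring_on[OF R]]
  show "x \<in> nonunits R"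
  proof (rule ccontr)
    assume "x \<notin> nonunits R"
    then have "x \<noteq> 0" "inverse x \<in> R" using x I' by (auto simp: nonunits_def)
    then have "inverse x * x \<in> I" using I' x by blast
    then have "1 \<in> I" using \<open>x \<noteq> 0\<close> by simp
    then have "r * 1 \<in> I" if "r \<in> R" for r using I' that by blast
    then show False using I I' by auto
  qed
qed

text \<open>The nonunits form an ideal containing every proper ideal, so the intersection defining
  the radical runs over a single maximal ideal.\<close>

lemma jacobson_ring_on:
  assumes L: "is_subfield L" and V: "valuation_ring L R"
  shows "jacobson (ring_on R) = nonunits R"
proof -
  have R: "is_subring L R" using V by (rule valuation_ring_subring)
  note I = nonunits_ideal[OF L V]
  have ne: "nonunits R \<noteq> R" using one_notin_nonunits is_subring_closed(2)[OF R] by metis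
  have "{I. maximal_left_ideal (ring_on R) I} = {nonunits R}"
    unfolding maximal_left_ideal_def ring_on_simps
    using I ne proper_left_ideal_subset_nonunits[OF R] by blast
  then show ?thesis unfolding jacobson_def by (auto simp: nonunits_def)
qed

lemma is_subfield_UNIV [simp]: "is_subfield UNIV"
  by (simp add: is_subfield_def)

text \<open>The valuation is handled through divisibility in \<open>S\<close>, since its value group is arbitrary.\<close>

locale val_ring =
  fixes S :: "'k::field set"
  assumes val: "valuation_ring UNIV S"
begin

abbreviation J where "J \<equiv> nonunits S"

lemma sub: "is_subring UNIV S" using val by (rule valuation_ring_subring)

lemmas S_closed [simp, intro] = is_subring_closed[OF sub]

lemma S_sum [intro]: "(\<And>i. i \<in> A \<Longrightarrow> g i \<in> S) \<Longrightarrow> sum g A \<in> S"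
  by (induction A rule: infinite_finite_induct) auto

lemma S_prod [intro]: "(\<And>i. i \<in> A \<Longrightarrow> g i \<in> S) \<Longrightarrow> prod g A \<in> S"
  by (induction A rule: infinite_finite_induct) auto

lemma S_power [intro]: "x \<in> S \<Longrightarrow> x ^ n \<in> S"
  by (induction n) auto

lemma J_S: "x \<in> J \<Longrightarrow> x \<in> S" by (simp add: nonunits_def)

lemma J_0 [simp, intro]: "0 \<in> J" using zero_in_nonunits[OF sub] .

lemma one_notin_J [simp]: "1 \<notin> J" by (rule one_notin_nonunits)

lemma J_add: "x \<in> J \<Longrightarrow> y \<in> J \<Longrightarrow> x + y \<in> J"
  using nonunits_add[OF is_subfield_UNIV val] .

lemma J_mult: "r \<in> S \<Longrightarrow> x \<in> J \<Longrightarrow> r * x \<in> J"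
  using nonunits_mult[OF sub] .

lemma J_mult': "x \<in> J \<Longrightarrow> r \<in> S \<Longrightarrow> x * r \<in> J"
  using nonunits_mult[OF sub] by (simp add: mult.commute)

lemma J_uminus: "x \<in> J \<Longrightarrow> - x \<in> J"
  using J_mult[of "-1" x] by auto

lemma J_diff: "x \<in> J \<Longrightarrow> y \<in> J \<Longrightarrow> x - y \<in> J"
  using J_add[of x "-y"] J_uminus by auto

lemma J_sum: "(\<And>i. i \<in> A \<Longrightarrow> g i \<in> J) \<Longrightarrow> sum g A \<in> J"
  by (induction A rule: infinite_finite_induct) (auto intro: J_add)

lemma unit_inverse: "x \<in> S \<Longrightarrow> x \<notin> J \<Longrightarrow> inverse x \<in> S"
  by (auto simp: nonunits_def)

lemma unit_nz: "x \<notin> J \<Longrightarrow> x \<noteq> 0" by auto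

lemma unit_mult: "x \<in> S \<Longrightarrow> y \<in> S \<Longrightarrow> x * y \<notin> J \<longleftrightarrow> x \<notin> J \<and> y \<notin> J"
proof
  assume xy: "x \<in> S" "y \<in> S" "x \<notin> J \<and> y \<notin> J"
  show "x * y \<notin> J"
  proof
    assume "x * y \<in> J"
    then have "inverse x * (x * y) \<in> J" using J_mult[OF unit_inverse] xy by blast
    moreover have "inverse x * (x * y) = y" using xy unit_nz[of x] by simp
    ultimately show False using xy by simp
  qed
qed (auto intro: J_mult J_mult')

lemma Units_S: "Units (ring_on S) = S - J"
  unfolding Units_ring_on[OF sub] nonunits_def by auto

lemma jacobson_S: "jacobson (ring_on S) = J"
  by (rule jacobson_ring_on[OF is_subfield_UNIV val])

lemma total: "x \<noteq> 0 \<Longrightarrow> y \<noteq> 0 \<Longrightarrow> x / y \<in> S \<or> y / x \<in> S"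
  using valuation_ring_total[OF is_subfield_UNIV val] by auto

text \<open>Divisibility is total, so finitely many elements have one of least value. Dividing by it
  makes all coefficients integral and one of them 1, which is how denominators are cleared later
  on.\<close>

lemma finite_min:
  assumes "finite B" "\<exists>b\<in>B. c b \<noteq> 0"
  obtains b0 where "b0 \<in> B" "c b0 \<noteq> 0" "\<And>b. b \<in> B \<Longrightarrow> c b / c b0 \<in> S"
proof -
  have "\<exists>b0\<in>B. c b0 \<noteq> 0 \<and> (\<forall>b\<in>B. c b / c b0 \<in> S)"
    using assms
  proof (induction B rule: finite_induct)
    case (insert x B)
    show ?case
    proof (cases "\<exists>b\<in>B. c b \<noteq> 0")
      case False
      then show ?thesis using insert by auto
    next
      case True
      then obtain b0 where b0: "b0 \<in> B" "c b0 \<noteq> 0" "\<forall>b\<in>B. c b / c b0 \<in> S"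
        using insert by blast
      show ?thesis
      proof (cases "c x / c b0 \<in> S")
        case True
        then show ?thesis using b0 by auto
      next
        case False
        then have x: "c x \<noteq> 0" by auto
        then have x': "c b0 / c x \<in> S" using False total[of "c x" "c b0"] b0 by auto
        have "c b / c x \<in> S" if "b \<in> B" for b
        proof -
          have "(c b / c b0) * (c b0 / c x) \<in> S" using that b0 x' by blast
          then show ?thesis using b0 by simp
        qed
        then show ?thesis using x by (intro bexI[of _ x]) auto
      qed
    qed
  qed simp
  then show ?thesis using that by blast
qed

end

section \<open>Linear algebra over a residue field\<close>

text \<open>A ring \<open>S\<close> with maximal ideal \<open>J\<close>, both inside a field. The instance \<open>(K, 0)\<close> gives the
  classical theorems of Dedekind and Artin; the instance \<open>(S, J(S))\<close> gives them for the residue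
  field without forming a quotient.\<close>

locale local_pair =
  fixes S J :: "'k::field set"
  assumes S_closed [simp, intro]: "0 \<in> S" "1 \<in> S" "x \<in> S \<Longrightarrow> y \<in> S \<Longrightarrow> x + y \<in> S"
      "x \<in> S \<Longrightarrow> y \<in> S \<Longrightarrow> x - y \<in> S" "x \<in> S \<Longrightarrow> y \<in> S \<Longrightarrow> x * y \<in> S"
    and J_S: "x \<in> J \<Longrightarrow> x \<in> S"
    and J_0 [simp, intro]: "0 \<in> J"
    and one_notin_J: "1 \<notin> J"
    and J_add: "x \<in> J \<Longrightarrow> y \<in> J \<Longrightarrow> x + y \<in> J"
    and J_diff: "x \<in> J \<Longrightarrow> y \<in> J \<Longrightarrow> x - y \<in> J"
    and J_mult: "r \<in> S \<Longrightarrow> x \<in> J \<Longrightarrow> r * x \<in> J"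
    and inverse_mod: "x \<in> S \<Longrightarrow> x \<notin> J \<Longrightarrow> \<exists>y\<in>S. y * x - 1 \<in> J"
begin

lemma J_mult': "x \<in> J \<Longrightarrow> r \<in> S \<Longrightarrow> x * r \<in> J"
  using J_mult by (simp add: mult.commute)

lemma S_sum [intro]: "(\<And>i. i \<in> A \<Longrightarrow> g i \<in> S) \<Longrightarrow> sum g A \<in> S"
  by (induction A rule: infinite_finite_induct) auto

lemma J_sum: "(\<And>i. i \<in> A \<Longrightarrow> g i \<in> J) \<Longrightarrow> sum g A \<in> J"
  by (induction A rule: infinite_finite_induct) (auto intro: J_add)

lemma J_cong: "x - y \<in> J \<Longrightarrow> x \<in> J \<longleftrightarrow> y \<in> J"
  using J_add[of "x - y" y] J_diff[of x "x - y"] by auto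

lemma J_prime:
  assumes "x \<in> S" "y \<in> S" "x * y \<in> J" shows "x \<in> J \<or> y \<in> J"
proof (rule disjCI)
  assume "y \<notin> J"
  then obtain z where z: "z \<in> S" "z * y - 1 \<in> J" using inverse_mod assms by blast
  have "z * (x * y) - x * (z * y - 1) \<in> J"
    using J_diff[OF J_mult[OF z(1) assms(3)] J_mult[OF assms(1) z(2)]] .
  then show "x \<in> J" by (simp add: algebra_simps)
qed

text \<open>Gaussian elimination modulo \<open>J\<close>, one equation at a time. An equation with
  all coefficients in \<open>J\<close> holds for every choice of integral unknowns; any other has a
  coefficient invertible modulo \<open>J\<close>, which serves as pivot.\<close>

lemma underdetermined_system:
  assumes "finite E" "finite U" "card E < card U"
    and "\<And>e u. e \<in> E \<Longrightarrow> u \<in> U \<Longrightarrow> a e u \<in> S"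
  shows "\<exists>c. (\<forall>u\<in>U. c u \<in> S) \<and> (\<exists>u\<in>U. c u \<notin> J) \<and> (\<forall>e\<in>E. (\<Sum>u\<in>U. a e u * c u) \<in> J)"
  using assms
proof (induction E arbitrary: U a rule: finite_induct)
  case empty
  then have "U \<noteq> {}" by auto
  then show ?case by (intro exI[of _ "\<lambda>_. 1"]) (auto simp: one_notin_J)
next
  case (insert e E)
  show ?case
  proof (cases "\<forall>u\<in>U. a e u \<in> J")
    case True
    obtain c where c: "\<forall>u\<in>U. c u \<in> S" "\<exists>u\<in>U. c u \<notin> J" "\<forall>e\<in>E. (\<Sum>u\<in>U. a e u * c u) \<in> J"
      using insert.IH[of U a] insert.prems insert.hyps by auto
    have "(\<Sum>u\<in>U. a e u * c u) \<in> J" using True c by (intro J_sum J_mult') auto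
    then show ?thesis using c by (intro exI[of _ c]) auto
  next
    case False
    then obtain u0 where u0: "u0 \<in> U" "a e u0 \<notin> J" by blast
    then obtain y where y: "y \<in> S" "y * a e u0 - 1 \<in> J" using inverse_mod insert.prems by blast
    \<comment> \<open>Row operation: \<open>y\<close> inverts the pivot \<open>a e u0\<close> modulo
      \<open>J\<close>, so subtracting this multiple of equation \<open>e\<close> removes
      \<open>u0\<close> from the other equations modulo \<open>J\<close>.\<close>
    let ?a = "\<lambda>e' u. a e' u - a e' u0 * y * a e u"
    have "card E < card (U - {u0})" using insert u0 by simp
    moreover have "\<And>e' u. e' \<in> E \<Longrightarrow> u \<in> U - {u0} \<Longrightarrow> ?a e' u \<in> S"
      using insert.prems u0 y by auto
    ultimately obtain c where c: "\<forall>u\<in>U - {u0}. c u \<in> S" "\<exists>u\<in>U - {u0}. c u \<notin> J"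
      "\<forall>e'\<in>E. (\<Sum>u\<in>U - {u0}. ?a e' u * c u) \<in> J"
      using insert.IH[of "U - {u0}" ?a] insert.prems by auto
    let ?s = "\<Sum>u\<in>U - {u0}. a e u * c u"
    have s: "?s \<in> S" using c(1) insert.prems(3) by (intro S_sum S_closed(5)) auto
    define c' where "c' = (\<lambda>u. if u = u0 then 0 - y * ?s else c u)"
    have split: "(\<Sum>u\<in>U. a e' u * c' u) = (\<Sum>u\<in>U - {u0}. a e' u * c u) - a e' u0 * y * ?s" for e'
    proof -
      have "(\<Sum>u\<in>U. a e' u * c' u) = a e' u0 * c' u0 + (\<Sum>u\<in>U - {u0}. a e' u * c' u)"
        using u0 insert.prems by (intro sum.remove) auto
      moreover have "(\<Sum>u\<in>U - {u0}. a e' u * c' u) = (\<Sum>u\<in>U - {u0}. a e' u * c u)"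
        by (intro sum.cong) (auto simp: c'_def)
      ultimately show ?thesis by (simp add: c'_def algebra_simps)
    qed
    have "(\<Sum>u\<in>U. a e' u * c' u) \<in> J" if "e' \<in> insert e E" for e'
    proof (cases "e' = e")
      case True
      have "0 - (y * a e u0 - 1) * ?s \<in> J" using J_diff[OF J_0 J_mult'[OF y(2) s]] .
      then show ?thesis unfolding split True by (simp add: algebra_simps)
    next
      case False
      then have "(\<Sum>u\<in>U - {u0}. ?a e' u * c u) \<in> J" using c that by auto
      then show ?thesis
        unfolding split by (simp add: left_diff_distrib sum_subtractf sum_distrib_left mult.assoc)
    qed
    moreover have "\<forall>u\<in>U. c' u \<in> S"
      using c(1) S_closed(4)[OF S_closed(1) S_closed(5)[OF y(1) s]] by (auto simp: c'_def)
    moreover have "\<exists>u\<in>U. c' u \<notin> J" using c by (auto simp: c'_def)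
    ultimately show ?thesis by blast
  qed
qed

text \<open>Shortening: the relation at \<open>x * y\<close> minus \<open>\<tau> y\<close> times the
  relation at \<open>x\<close> no longer involves \<tau>, and \<open>y\<close> can be chosen so that
  a given other coefficient is multiplied by something outside \<open>J\<close>. Once those
  coefficients lie in \<open>J\<close>, evaluation at 1 settles \<tau>.\<close>

lemma dedekind_independence:
  assumes "finite \<Gamma>"
    and "\<And>\<sigma> x. \<sigma> \<in> \<Gamma> \<Longrightarrow> x \<in> S \<Longrightarrow> \<sigma> x \<in> S"
    and "\<And>\<sigma> x y. \<sigma> \<in> \<Gamma> \<Longrightarrow> \<sigma> (x * y) = \<sigma> x * \<sigma> y" and "\<And>\<sigma>. \<sigma> \<in> \<Gamma> \<Longrightarrow> \<sigma> 1 = 1"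
    and "\<And>\<sigma> \<tau>. \<sigma> \<in> \<Gamma> \<Longrightarrow> \<tau> \<in> \<Gamma> \<Longrightarrow> \<sigma> \<noteq> \<tau> \<Longrightarrow> \<exists>x\<in>S. \<sigma> x - \<tau> x \<notin> J"
    and "\<And>\<sigma>. \<sigma> \<in> \<Gamma> \<Longrightarrow> c \<sigma> \<in> S"
    and "\<And>x. x \<in> S \<Longrightarrow> (\<Sum>\<sigma>\<in>\<Gamma>. c \<sigma> * \<sigma> x) \<in> J"
  shows "\<forall>\<sigma>\<in>\<Gamma>. c \<sigma> \<in> J"
  using assms
proof (induction \<Gamma> arbitrary: c rule: finite_induct)
  case (insert \<tau> \<Gamma>)
  have *: "c \<sigma>0 \<in> J" if s0: "\<sigma>0 \<in> \<Gamma>" for \<sigma>0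
  proof -
    obtain y where y: "y \<in> S" "\<sigma>0 y - \<tau> y \<notin> J"
      using insert.prems(4)[of \<sigma>0 \<tau>] s0 insert.hyps by auto
    let ?c = "\<lambda>\<sigma>. c \<sigma> * (\<sigma> y - \<tau> y)"
    have "(\<Sum>\<sigma>\<in>\<Gamma>. ?c \<sigma> * \<sigma> x) \<in> J" if x: "x \<in> S" for x
    proof -
      have "(\<Sum>\<sigma>\<in>insert \<tau> \<Gamma>. c \<sigma> * \<sigma> (x * y)) - \<tau> y * (\<Sum>\<sigma>\<in>insert \<tau> \<Gamma>. c \<sigma> * \<sigma> x) \<in> J"
        using x y insert.prems by (intro J_diff J_mult) auto
      also have "(\<Sum>\<sigma>\<in>insert \<tau> \<Gamma>. c \<sigma> * \<sigma> (x * y)) - \<tau> y * (\<Sum>\<sigma>\<in>insert \<tau> \<Gamma>. c \<sigma> * \<sigma> x)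
         = (\<Sum>\<sigma>\<in>insert \<tau> \<Gamma>. c \<sigma> * \<sigma> (x * y) - \<tau> y * (c \<sigma> * \<sigma> x))"
        by (simp only: sum_subtractf sum_distrib_left)
      also have "\<dots> = (\<Sum>\<sigma>\<in>insert \<tau> \<Gamma>. ?c \<sigma> * \<sigma> x)"
        using insert.prems by (intro sum.cong) (auto simp: algebra_simps)
      also have "\<dots> = (\<Sum>\<sigma>\<in>\<Gamma>. ?c \<sigma> * \<sigma> x)" using insert.hyps by simp
      finally show ?thesis .
    qed
    then have "\<forall>\<sigma>\<in>\<Gamma>. ?c \<sigma> \<in> J"
      using insert.prems y by (intro insert.IH) auto
    then have "c \<sigma>0 * (\<sigma>0 y - \<tau> y) \<in> J" using s0 by blast
    then show ?thesis using y J_prime[of "c \<sigma>0" "\<sigma>0 y - \<tau> y"] insert.prems s0 by auto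
  qed
  have "(\<Sum>\<sigma>\<in>insert \<tau> \<Gamma>. c \<sigma> * \<sigma> 1) - (\<Sum>\<sigma>\<in>\<Gamma>. c \<sigma> * \<sigma> 1) \<in> J"
  proof (rule J_diff)
    show "(\<Sum>\<sigma>\<in>insert \<tau> \<Gamma>. c \<sigma> * \<sigma> 1) \<in> J" using insert.prems(6)[of 1] by blast
    show "(\<Sum>\<sigma>\<in>\<Gamma>. c \<sigma> * \<sigma> 1) \<in> J" using insert.prems(1)[of _ 1] * by (intro J_sum J_mult') auto
  qed
  then have "c \<tau> \<in> J" using insert.hyps insert.prems(3)[of \<tau>] by simp
  then show ?case using * by blast
qed simp

end

section \<open>Groups of field automorphisms\<close>

definition aut_group :: "('k::field \<Rightarrow> 'k) set \<Rightarrow> bool" where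
  "aut_group G \<longleftrightarrow> id \<in> G \<and> (\<forall>\<sigma>\<in>G. \<forall>\<tau>\<in>G. \<sigma> \<circ> \<tau> \<in> G)
     \<and> (\<forall>\<sigma>\<in>G. field_aut \<sigma> \<and> Hilbert_Choice.inv \<sigma> \<in> G)"

lemma field_aut_simps:
  assumes "field_aut \<sigma>"
  shows "\<sigma> (x + y) = \<sigma> x + \<sigma> y" "\<sigma> (x * y) = \<sigma> x * \<sigma> y" "\<sigma> 0 = 0" "\<sigma> 1 = 1" "\<sigma> (- x) = - \<sigma> x"
    "\<sigma> (x - y) = \<sigma> x - \<sigma> y" "\<sigma> x = 0 \<longleftrightarrow> x = 0" "\<sigma> (inverse x) = inverse (\<sigma> x)"
    "\<sigma> (x / y) = \<sigma> x / \<sigma> y" "bij \<sigma>"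
proof -
  show add: "\<sigma> (x + y) = \<sigma> x + \<sigma> y" and mult: "\<sigma> (x * y) = \<sigma> x * \<sigma> y" and bij: "bij \<sigma>" for x y
    using assms by (auto simp: field_aut_def)
  show z: "\<sigma> 0 = 0" using add[of 0 0] by (metis add_cancel_right_left add_0)
  show eq0: "\<sigma> x = 0 \<longleftrightarrow> x = 0" for x using bij z by (metis bij_pointE)
  have "\<sigma> 1 \<noteq> 0" using eq0[of 1] by simp
  then show o: "\<sigma> 1 = 1" using mult[of 1 1] by simp
  show neg: "\<sigma> (- x) = - \<sigma> x" for x using add[of x "-x"] z by (simp add: eq_neg_iff_add_eq_0 add.commute)
  show "\<sigma> (x - y) = \<sigma> x - \<sigma> y" using add[of x "-y"] neg by simp
  show inv: "\<sigma> (inverse x) = inverse (\<sigma> x)" for x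
  proof (cases "x = 0")
    case False
    then have "\<sigma> x * \<sigma> (inverse x) = 1" using mult[of x "inverse x"] o by simp
    then show ?thesis by (simp add: inverse_unique)
  qed (simp add: z)
  show "\<sigma> (x / y) = \<sigma> x / \<sigma> y" by (simp add: divide_inverse mult inv)
qed

lemma field_aut_sum: "field_aut \<sigma> \<Longrightarrow> \<sigma> (sum g A) = (\<Sum>i\<in>A. \<sigma> (g i))"
  by (induction A rule: infinite_finite_induct) (auto simp: field_aut_simps)

lemma field_aut_prod: "field_aut \<sigma> \<Longrightarrow> \<sigma> (prod g A) = (\<Prod>i\<in>A. \<sigma> (g i))"
  by (induction A rule: infinite_finite_induct) (auto simp: field_aut_simps)

lemma Gal_aut_group: "aut_group (Gal F)"
proof -
  have "field_aut id" by (simp add: field_aut_def)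
  moreover have "field_aut (\<sigma> \<circ> \<tau>)" if "field_aut \<sigma>" "field_aut \<tau>" for \<sigma> \<tau> :: "'a \<Rightarrow> 'a"
    using that by (auto simp: field_aut_def intro: bij_comp)
  moreover have "field_aut (Hilbert_Choice.inv \<sigma>)" if "field_aut \<sigma>" for \<sigma> :: "'a \<Rightarrow> 'a"
  proof -
    note s = field_aut_simps[OF that]
    have "\<sigma> (Hilbert_Choice.inv \<sigma> x + Hilbert_Choice.inv \<sigma> y) = x + y"
      "\<sigma> (Hilbert_Choice.inv \<sigma> x * Hilbert_Choice.inv \<sigma> y) = x * y" for x y
      using s(10) by (simp_all add: s bij_is_surj surj_f_inv_f)
    then show ?thesis using s(10)
      by (auto simp: field_aut_def bij_imp_bij_inv intro!: inv_f_eq bij_is_inj)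
  qed
  moreover have "Hilbert_Choice.inv \<sigma> a = a" if "field_aut \<sigma>" "\<sigma> a = a" for \<sigma> and a :: 'a
    using field_aut_simps(10)[OF that(1)] that(2) by (metis bij_is_inj inv_f_f)
  ultimately show ?thesis unfolding aut_group_def Gal_def by auto
qed

lemma aut_groupD:
  assumes "aut_group G"
  shows "id \<in> G" "\<sigma> \<in> G \<Longrightarrow> \<tau> \<in> G \<Longrightarrow> \<sigma> \<circ> \<tau> \<in> G" "\<sigma> \<in> G \<Longrightarrow> Hilbert_Choice.inv \<sigma> \<in> G"
    "\<sigma> \<in> G \<Longrightarrow> field_aut \<sigma>" "\<sigma> \<in> G \<Longrightarrow> \<sigma> (Hilbert_Choice.inv \<sigma> x) = x"
    "\<sigma> \<in> G \<Longrightarrow> Hilbert_Choice.inv \<sigma> (\<sigma> x) = x"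
    "\<sigma> \<in> G \<Longrightarrow> \<sigma> \<circ> Hilbert_Choice.inv \<sigma> = id" "\<sigma> \<in> G \<Longrightarrow> Hilbert_Choice.inv \<sigma> \<circ> \<sigma> = id"
    "\<sigma> \<in> G \<Longrightarrow> Hilbert_Choice.inv (Hilbert_Choice.inv \<sigma>) = \<sigma>"
    "\<sigma> \<in> G \<Longrightarrow> \<tau> \<in> G \<Longrightarrow> Hilbert_Choice.inv (\<sigma> \<circ> \<tau>) = Hilbert_Choice.inv \<tau> \<circ> Hilbert_Choice.inv \<sigma>"
proof -
  show *: "id \<in> G" "\<sigma> \<in> G \<Longrightarrow> \<tau> \<in> G \<Longrightarrow> \<sigma> \<circ> \<tau> \<in> G" "\<sigma> \<in> G \<Longrightarrow> Hilbert_Choice.inv \<sigma> \<in> G"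
    "\<sigma> \<in> G \<Longrightarrow> field_aut \<sigma>" for \<sigma> \<tau> using assms by (auto simp: aut_group_def)
  have b: "\<sigma> \<in> G \<Longrightarrow> bij \<sigma>" for \<sigma> using *(4) field_aut_simps(10) by blast
  show "\<sigma> \<in> G \<Longrightarrow> \<sigma> (Hilbert_Choice.inv \<sigma> x) = x" "\<sigma> \<in> G \<Longrightarrow> Hilbert_Choice.inv \<sigma> (\<sigma> x) = x"
    using b[of \<sigma>] by (auto simp: bij_is_surj surj_f_inv_f bij_is_inj)
  show "\<sigma> \<in> G \<Longrightarrow> \<sigma> \<circ> Hilbert_Choice.inv \<sigma> = id"
    using bij_is_surj[OF b, of \<sigma>] surj_iff[of \<sigma>] by blast
  show "\<sigma> \<in> G \<Longrightarrow> Hilbert_Choice.inv \<sigma> \<circ> \<sigma> = id"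
    using bij_is_inj[OF b, of \<sigma>] inj_iff[of \<sigma>] by blast
  show "\<sigma> \<in> G \<Longrightarrow> Hilbert_Choice.inv (Hilbert_Choice.inv \<sigma>) = \<sigma>"
    using inv_inv_eq[OF b] .
  show "\<sigma> \<in> G \<Longrightarrow> \<tau> \<in> G \<Longrightarrow> Hilbert_Choice.inv (\<sigma> \<circ> \<tau>) = Hilbert_Choice.inv \<tau> \<circ> Hilbert_Choice.inv \<sigma>"
    using b by (intro o_inv_distrib) auto
qed

section \<open>The bounds of Dedekind and Artin for a group acting on residues\<close>

locale local_action = local_pair +
  fixes G :: "('k::field \<Rightarrow> 'k) set"
  assumes G: "aut_group G"
    and GS: "\<sigma> \<in> G \<Longrightarrow> x \<in> S \<Longrightarrow> \<sigma> x \<in> S"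
    and GJ: "\<sigma> \<in> G \<Longrightarrow> x \<in> J \<Longrightarrow> \<sigma> x \<in> J"
begin

text \<open>Invariance is required only modulo \<open>J\<close>: these elements represent the fixed
  field of the induced action on the residue field.\<close>

definition fixed where "fixed = {c \<in> S. \<forall>\<sigma>\<in>G. \<sigma> c - c \<in> J}"

text \<open>With more elements \<open>s i\<close> than automorphisms modulo \<open>J\<close>, the
  conjugated system has a nontrivial solution. One of minimal support, scaled so that an entry is 1
  modulo \<open>J\<close>, must be invariant modulo \<open>J\<close>, because its difference with a
  conjugate solves the system too and has smaller support. This contradicts independence over the
  invariants.\<close>

lemma artin_bound:
  assumes fin: "finite \<Gamma>" "finite U" and \<Gamma>: "\<Gamma> \<subseteq> G" "\<And>\<sigma>. \<sigma> \<in> G \<Longrightarrow> \<exists>\<gamma>\<in>\<Gamma>. \<forall>x\<in>S. \<sigma> x - \<gamma> x \<in> J"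
    and s: "\<And>i. i \<in> U \<Longrightarrow> s i \<in> S"
    and indep: "\<And>c. (\<And>i. i \<in> U \<Longrightarrow> c i \<in> fixed) \<Longrightarrow> (\<Sum>i\<in>U. c i * s i) \<in> J \<Longrightarrow> \<forall>i\<in>U. c i \<in> J"
  shows "card U \<le> card \<Gamma>"
proof (rule ccontr)
  assume "\<not> card U \<le> card \<Gamma>"
  then have less: "card \<Gamma> < card U" by simp
  define sol where "sol c \<longleftrightarrow> (\<forall>i\<in>U. c i \<in> S) \<and> (\<forall>\<sigma>\<in>G. (\<Sum>i\<in>U. \<sigma> (s i) * c i) \<in> J)" for c
  define supp where "supp c = {i \<in> U. c i \<notin> J}" for c :: "_ \<Rightarrow> 'k"
  have "\<exists>c. (\<forall>u\<in>U. c u \<in> S) \<and> (\<exists>u\<in>U. c u \<notin> J) \<and> (\<forall>e\<in>\<Gamma>. (\<Sum>u\<in>U. e (s u) * c u) \<in> J)"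
    using underdetermined_system[OF fin less, of "\<lambda>\<sigma> i. \<sigma> (s i)"] GS s \<Gamma> by blast
  then obtain c0 where c0: "\<forall>i\<in>U. c0 i \<in> S" "\<exists>i\<in>U. c0 i \<notin> J"
      "\<forall>\<sigma>\<in>\<Gamma>. (\<Sum>i\<in>U. \<sigma> (s i) * c0 i) \<in> J" by blast
  have "sol c0" unfolding sol_def
  proof (intro conjI ballI)
    fix \<sigma> assume "\<sigma> \<in> G"
    then obtain \<gamma> where \<gamma>: "\<gamma> \<in> \<Gamma>" "\<forall>x\<in>S. \<sigma> x - \<gamma> x \<in> J" using \<Gamma> by blast
    have "(\<Sum>i\<in>U. (\<sigma> (s i) - \<gamma> (s i)) * c0 i) \<in> J" using \<gamma> s c0 by (intro J_sum J_mult') auto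
    then have "(\<Sum>i\<in>U. \<sigma> (s i) * c0 i) - (\<Sum>i\<in>U. \<gamma> (s i) * c0 i) \<in> J"
      by (simp add: left_diff_distrib sum_subtractf)
    then show "(\<Sum>i\<in>U. \<sigma> (s i) * c0 i) \<in> J" using J_cong c0 \<gamma> by blast
  qed (use c0 in auto)
  then have "sol c0 \<and> supp c0 \<noteq> {}" using c0 by (auto simp: supp_def)
  then obtain c where c: "sol c" "supp c \<noteq> {}"
    and min: "\<And>d. sol d \<Longrightarrow> supp d \<noteq> {} \<Longrightarrow> card (supp c) \<le> card (supp d)"
    using ex_has_least_nat[of "\<lambda>c. sol c \<and> supp c \<noteq> {}" c0 "\<lambda>c. card (supp c)"] by blast
  obtain i0 where i0: "i0 \<in> U" "c i0 \<notin> J" using c by (auto simp: supp_def)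
  obtain y where y: "y \<in> S" "y * c i0 - 1 \<in> J" using i0 c inverse_mod unfolding sol_def by blast
  define d where "d i = y * c i" for i
  have yn: "y \<notin> J"
  proof
    assume "y \<in> J"
    then have "y * c i0 \<in> J" using i0 c by (intro J_mult') (auto simp: sol_def)
    then show False using y J_cong one_notin_J by blast
  qed
  have dsol: "sol d" unfolding sol_def
  proof (intro conjI ballI)
    fix \<sigma> assume "\<sigma> \<in> G"
    then have "y * (\<Sum>i\<in>U. \<sigma> (s i) * c i) \<in> J" using c y by (intro J_mult) (auto simp: sol_def)
    then show "(\<Sum>i\<in>U. \<sigma> (s i) * d i) \<in> J" by (simp add: d_def sum_distrib_left mult.left_commute)
  qed (use c y in \<open>auto simp: sol_def d_def\<close>)
  have "y * c i \<in> J \<longleftrightarrow> c i \<in> J" if "i \<in> U" for i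
  proof -
    have "c i \<in> S" using c that by (simp add: sol_def)
    then show ?thesis using J_prime[of y "c i"] J_mult[of y "c i"] y(1) yn by blast
  qed
  then have "supp d = supp c" by (simp add: supp_def d_def cong: conj_cong)
  have d0: "d i0 - 1 \<in> J" using y by (simp add: d_def)
  have fixed: "\<tau> (d i) - d i \<in> J" if "\<tau> \<in> G" "i \<in> U" for \<tau> i
  proof -
    define e where "e i = \<tau> (d i) - d i" for i
    have \<tau>: "field_aut \<tau>" using that G aut_groupD by blast
    have dS: "\<forall>i\<in>U. d i \<in> S" using dsol by (auto simp: sol_def)
    have "sol e" unfolding sol_def
    proof (intro conjI ballI)
      fix \<sigma> assume \<sigma>: "\<sigma> \<in> G"
      \<comment> \<open>Applying \<tau> to the equation indexed by \<tau>\<inverse>\<sigma> gives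
        the equation indexed by \<sigma> for the conjugated solution.\<close>
      let ?\<rho> = "Hilbert_Choice.inv \<tau> \<circ> \<sigma>"
      have \<rho>: "?\<rho> \<in> G" using aut_groupD[OF G] \<sigma> that by blast
      have "(\<Sum>i\<in>U. ?\<rho> (s i) * d i) \<in> J" using dsol \<rho> unfolding sol_def by blast
      then have "\<tau> (\<Sum>i\<in>U. ?\<rho> (s i) * d i) \<in> J" using GJ that by blast
      moreover have "\<tau> (\<Sum>i\<in>U. ?\<rho> (s i) * d i) = (\<Sum>i\<in>U. \<sigma> (s i) * \<tau> (d i))"
        using aut_groupD(5)[OF G that(1)] by (simp add: field_aut_sum[OF \<tau>] field_aut_simps[OF \<tau>])
      moreover have "(\<Sum>i\<in>U. \<sigma> (s i) * d i) \<in> J" using dsol \<sigma> unfolding sol_def by blast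
      ultimately have "(\<Sum>i\<in>U. \<sigma> (s i) * \<tau> (d i)) - (\<Sum>i\<in>U. \<sigma> (s i) * d i) \<in> J"
        using J_diff by metis
      then show "(\<Sum>i\<in>U. \<sigma> (s i) * e i) \<in> J"
        by (simp add: e_def right_diff_distrib sum_subtractf)
    qed (use dS GS that in \<open>auto simp: e_def\<close>)
    have "supp e \<subseteq> supp d" unfolding supp_def e_def using GJ that J_diff by blast
    moreover have "i0 \<notin> supp e"
    proof -
      have "\<tau> (d i0 - 1) - (d i0 - 1) \<in> J" using J_diff[OF GJ[OF that(1) d0] d0] .
      then show ?thesis by (simp add: supp_def e_def field_aut_simps[OF \<tau>])
    qed
    moreover have "i0 \<in> supp d" using i0 \<open>supp d = supp c\<close> by (auto simp: supp_def)
    moreover have "finite (supp d)" using fin by (auto simp: supp_def)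
    ultimately have "card (supp e) < card (supp d)" by (intro psubset_card_mono) auto
    then have "supp e = {}" using min[OF \<open>sol e\<close>] \<open>supp d = supp c\<close> by fastforce
    then show ?thesis using that by (auto simp: supp_def e_def)
  qed
  have "id \<in> G" using G by (rule aut_groupD)
  then have "(\<Sum>i\<in>U. id (s i) * d i) \<in> J" using dsol unfolding sol_def by blast
  then have "(\<Sum>i\<in>U. d i * s i) \<in> J" by (simp add: mult.commute)
  moreover have "\<And>i. i \<in> U \<Longrightarrow> d i \<in> fixed" using fixed dsol by (auto simp: fixed_def sol_def)
  ultimately have "\<forall>i\<in>U. d i \<in> J" using indep by blast
  then show False using d0 i0 J_cong one_notin_J by blast
qed

text \<open>Dual to the previous bound: with more automorphisms than generators, some nontrivial
  combination of automorphisms vanishes modulo \<open>J\<close> on all generators. The coordinates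
  of any \<open>x\<close> are invariant modulo \<open>J\<close>, so the combination vanishes
  everywhere, against independence.\<close>

lemma dedekind_bound:
  assumes fin: "finite \<Gamma>" "finite U" and \<Gamma>: "\<Gamma> \<subseteq> G"
    and dist: "\<And>\<sigma> \<tau>. \<sigma> \<in> \<Gamma> \<Longrightarrow> \<tau> \<in> \<Gamma> \<Longrightarrow> \<sigma> \<noteq> \<tau> \<Longrightarrow> \<exists>x\<in>S. \<sigma> x - \<tau> x \<notin> J"
    and s: "\<And>i. i \<in> U \<Longrightarrow> s i \<in> S"
    and span: "\<And>x. x \<in> S \<Longrightarrow> \<exists>c. (\<forall>i\<in>U. c i \<in> fixed) \<and> x - (\<Sum>i\<in>U. c i * s i) \<in> J"
  shows "card \<Gamma> \<le> card U"
proof (rule ccontr)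
  assume "\<not> card \<Gamma> \<le> card U"
  then have less: "card U < card \<Gamma>" by simp
  have "\<exists>c. (\<forall>\<sigma>\<in>\<Gamma>. c \<sigma> \<in> S) \<and> (\<exists>\<sigma>\<in>\<Gamma>. c \<sigma> \<notin> J) \<and> (\<forall>i\<in>U. (\<Sum>\<sigma>\<in>\<Gamma>. \<sigma> (s i) * c \<sigma>) \<in> J)"
    using underdetermined_system[OF fin(2,1) less, of "\<lambda>i \<sigma>. \<sigma> (s i)"] GS s \<Gamma> by blast
  then obtain c where c: "\<And>\<sigma>. \<sigma> \<in> \<Gamma> \<Longrightarrow> c \<sigma> \<in> S" "\<exists>\<sigma>\<in>\<Gamma>. c \<sigma> \<notin> J"
    "\<And>i. i \<in> U \<Longrightarrow> (\<Sum>\<sigma>\<in>\<Gamma>. \<sigma> (s i) * c \<sigma>) \<in> J" by blast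
  have "\<forall>\<sigma>\<in>\<Gamma>. c \<sigma> \<in> J"
  proof (rule dedekind_independence[OF fin(1) _ _ _ dist])
    fix x assume "x \<in> S"
    then obtain a where a: "\<forall>i\<in>U. a i \<in> fixed" "x - (\<Sum>i\<in>U. a i * s i) \<in> J" using span by blast
    have aS: "\<forall>i\<in>U. a i \<in> S" using a by (auto simp: fixed_def)
    have \<sigma>: "\<sigma> x - (\<Sum>i\<in>U. a i * \<sigma> (s i)) \<in> J" if "\<sigma> \<in> \<Gamma>" for \<sigma>
    proof -
      have \<sigma>: "\<sigma> \<in> G" using that \<Gamma> by blast
      have aut: "field_aut \<sigma>" using \<sigma> G aut_groupD by blast
      have "\<sigma> (x - (\<Sum>i\<in>U. a i * s i)) \<in> J" using a GJ \<sigma> by blast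
      then have 1: "\<sigma> x - (\<Sum>i\<in>U. \<sigma> (a i) * \<sigma> (s i)) \<in> J"
        by (simp add: field_aut_sum[OF aut] field_aut_simps[OF aut])
      have "(\<Sum>i\<in>U. (\<sigma> (a i) - a i) * \<sigma> (s i)) \<in> J"
        using a \<sigma> GS s by (intro J_sum J_mult') (auto simp: fixed_def)
      then have "(\<sigma> x - (\<Sum>i\<in>U. \<sigma> (a i) * \<sigma> (s i))) + (\<Sum>i\<in>U. (\<sigma> (a i) - a i) * \<sigma> (s i)) \<in> J"
        using 1 J_add by blast
      then show ?thesis by (simp add: left_diff_distrib sum_subtractf)
    qed
    have 1: "(\<Sum>\<sigma>\<in>\<Gamma>. c \<sigma> * (\<sigma> x - (\<Sum>i\<in>U. a i * \<sigma> (s i)))) \<in> J"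
    proof (rule J_sum)
      fix \<tau> assume \<tau>: "\<tau> \<in> \<Gamma>"
      show "c \<tau> * (\<tau> x - (\<Sum>i\<in>U. a i * \<tau> (s i))) \<in> J" using J_mult[OF c(1)[OF \<tau>] \<sigma>[OF \<tau>]] .
    qed
    have 2: "(\<Sum>i\<in>U. a i * (\<Sum>\<sigma>\<in>\<Gamma>. \<sigma> (s i) * c \<sigma>)) \<in> J"
    proof (rule J_sum)
      fix i assume i: "i \<in> U"
      show "a i * (\<Sum>\<sigma>\<in>\<Gamma>. \<sigma> (s i) * c \<sigma>) \<in> J" using J_mult[OF _ c(3)[OF i]] aS i by blast
    qed
    have 3: "(\<Sum>i\<in>U. a i * (\<Sum>\<sigma>\<in>\<Gamma>. \<sigma> (s i) * c \<sigma>)) = (\<Sum>\<sigma>\<in>\<Gamma>. c \<sigma> * (\<Sum>i\<in>U. a i * \<sigma> (s i)))"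
      unfolding sum_distrib_left by (rule trans[OF sum.swap]) (simp add: mult_ac)
    have "(\<Sum>\<sigma>\<in>\<Gamma>. c \<sigma> * (\<sigma> x - (\<Sum>i\<in>U. a i * \<sigma> (s i))))
        + (\<Sum>\<sigma>\<in>\<Gamma>. c \<sigma> * (\<Sum>i\<in>U. a i * \<sigma> (s i))) \<in> J" using J_add[OF 1 2[unfolded 3]] .
    then show "(\<Sum>\<sigma>\<in>\<Gamma>. c \<sigma> * \<sigma> x) \<in> J"
      by (simp add: right_diff_distrib sum_subtractf)
  next
    fix \<sigma> assume "\<sigma> \<in> \<Gamma>"
    then have "\<sigma> \<in> G" using \<Gamma> by blast
    then show "\<sigma> x \<in> S" if "x \<in> S" for x using GS that by blast
    show "\<sigma> (x * y) = \<sigma> x * \<sigma> y" "\<sigma> 1 = 1" for x y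
      using field_aut_simps[OF aut_groupD(4)[OF G \<open>\<sigma> \<in> G\<close>]] by simp_all
    show "c \<sigma> \<in> S" using c \<open>\<sigma> \<in> \<Gamma>\<close> by blast
  qed
  then show False using c by blast
qed

end

section \<open>Invariants of the residue field\<close>

definition coeffs_in :: "'a::zero set \<Rightarrow> 'a poly \<Rightarrow> bool" where
  "coeffs_in B p \<longleftrightarrow> (\<forall>i. coeff p i \<in> B)"

lemma coeffs_in_add:
  fixes p q :: "'a::comm_monoid_add poly"
  assumes "\<And>x y. x \<in> B \<Longrightarrow> y \<in> B \<Longrightarrow> x + y \<in> B" "coeffs_in B p" "coeffs_in B q"
  shows "coeffs_in B (p + q)"
  using assms by (simp add: coeffs_in_def)

lemma coeffs_in_diff:
  fixes p q :: "'a::ab_group_add poly"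
  assumes "\<And>x y. x \<in> B \<Longrightarrow> y \<in> B \<Longrightarrow> x - y \<in> B" "coeffs_in B p" "coeffs_in B q"
  shows "coeffs_in B (p - q)"
  using assms by (simp add: coeffs_in_def)

lemma coeffs_in_mult:
  fixes p q :: "'a::comm_ring_1 poly"
  assumes "\<And>x y. x \<in> B \<Longrightarrow> y \<in> B \<Longrightarrow> x + y \<in> B" "0 \<in> B"
    and "\<And>x y. x \<in> C \<Longrightarrow> y \<in> B \<Longrightarrow> x * y \<in> B" "coeffs_in C p" "coeffs_in B q"
  shows "coeffs_in B (p * q)"
proof -
  have "(\<Sum>i\<le>n. coeff p i * coeff q (n - i)) \<in> B" for n
  proof -
    have "sum g A \<in> B" if "\<And>i. i \<in> A \<Longrightarrow> g i \<in> B" for g and A :: "nat set"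
      using that assms(1,2) by (induction A rule: infinite_finite_induct) auto
    then show ?thesis using assms(3-5) by (simp add: coeffs_in_def)
  qed
  then show ?thesis by (simp add: coeffs_in_def coeff_mult)
qed

lemma coeffs_in_mono: "coeffs_in B p \<Longrightarrow> B \<subseteq> C \<Longrightarrow> coeffs_in C p"
  by (auto simp: coeffs_in_def)

lemma coeffs_in_monom: "c \<in> B \<Longrightarrow> 0 \<in> B \<Longrightarrow> coeffs_in B (monom c n)"
  by (simp add: coeffs_in_def)

lemma coeffs_in_linear: "a \<in> B \<Longrightarrow> b \<in> B \<Longrightarrow> 0 \<in> B \<Longrightarrow> coeffs_in B [:a, b:]"
  by (simp add: coeffs_in_def coeff_pCons split: nat.split)

context val_ring
begin

lemma coeffs_S_mult: "coeffs_in S p \<Longrightarrow> coeffs_in S q \<Longrightarrow> coeffs_in S (p * q)"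
  by (rule coeffs_in_mult[of S S]) auto

lemma coeffs_J_mult: "coeffs_in S p \<Longrightarrow> coeffs_in J q \<Longrightarrow> coeffs_in J (p * q)"
  by (rule coeffs_in_mult[of J S]) (auto intro: J_add J_mult)

lemma coeffs_J_mult': "coeffs_in J p \<Longrightarrow> coeffs_in S q \<Longrightarrow> coeffs_in J (p * q)"
  using coeffs_J_mult[of q p] by (simp add: mult.commute)

lemma coeffs_J_add: "coeffs_in J p \<Longrightarrow> coeffs_in J q \<Longrightarrow> coeffs_in J (p + q)"
  by (rule coeffs_in_add) (auto intro: J_add)

lemma poly_J: "coeffs_in J p \<Longrightarrow> x \<in> S \<Longrightarrow> poly p x \<in> J"
  unfolding poly_altdef coeffs_in_def by (intro J_sum J_mult') auto

lemma poly_S: "coeffs_in S p \<Longrightarrow> x \<in> S \<Longrightarrow> poly p x \<in> S"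
  unfolding poly_altdef coeffs_in_def by (intro S_sum S_closed) auto

lemma of_nat_S [intro, simp]: "of_nat n \<in> S"
  by (induction n) auto

lemma coeffs_J_pderiv: "coeffs_in J p \<Longrightarrow> coeffs_in J (pderiv p)"
  unfolding coeffs_in_def coeff_pderiv by (intro allI J_mult of_nat_S) auto

lemma coeffs_S_pderiv: "coeffs_in S p \<Longrightarrow> coeffs_in S (pderiv p)"
  unfolding coeffs_in_def coeff_pderiv by (intro allI S_closed of_nat_S) auto

text \<open>Each coefficient of \<open>r\<close> is a coefficient of the product plus
  \<open>x\<close> times the next higher coefficient of \<open>r\<close>, so membership in
  \<open>B\<close> descends from above the degree. The cases of interest are \<open>B = S\<close>
  and \<open>B = J\<close>.\<close>

lemma linear_factor_cancel:
  assumes B: "\<And>u v. u \<in> B \<Longrightarrow> v \<in> B \<Longrightarrow> u + v \<in> B" "\<And>u v. u \<in> S \<Longrightarrow> v \<in> B \<Longrightarrow> u * v \<in> B" "0 \<in> B"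
    and x: "x \<in> S" and r: "coeffs_in B ([:-x, 1:] * r)"
  shows "coeffs_in B r"
proof -
  have step: "coeff r i = coeff ([:-x, 1:] * r) (Suc i) + x * coeff r (Suc i)" for i
    by simp
  \<comment> \<open>The index starts one above the degree, where the coefficient vanishes; truncated
    subtraction keeps it at 0 once \<open>k\<close> has passed
    \<open>Suc (degree r)\<close>.\<close>
  have "coeff r (Suc (degree r) - k) \<in> B" for k
  proof (induction k)
    case 0
    then show ?case using B by (simp add: coeff_eq_0)
  next
    case (Suc k)
    show ?case
    proof (cases "k < Suc (degree r)")
      case True
      then have e: "Suc (Suc (degree r) - Suc k) = Suc (degree r) - k" by simp
      have "coeff ([:-x, 1:] * r) (Suc (Suc (degree r) - Suc k)) + x * coeff r (Suc (Suc (degree r) - Suc k)) \<in> B"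
        using r Suc.IH unfolding e coeffs_in_def by (intro B x) auto
      then show ?thesis unfolding step[of "Suc (degree r) - Suc k", symmetric] .
    next
      case False
      then show ?thesis using Suc.IH by simp
    qed
  qed
  from this[of "Suc (degree r) - i" for i] have "coeff r i \<in> B" if "i \<le> Suc (degree r)" for i
    using that by (metis diff_diff_cancel)
  then show ?thesis unfolding coeffs_in_def using B(3)
    by (metis coeff_eq_0 le_SucI not_le)
qed

lemma coeffs_S_synthetic_div:
  assumes "coeffs_in S q" "x \<in> S" shows "coeffs_in S (synthetic_div q x)"
proof (rule linear_factor_cancel[of S x])
  have "[:-x, 1:] * synthetic_div q x = q - [:poly q x:]"
    using synthetic_div_correct'[of x q] by (simp add: algebra_simps)
  moreover have "coeffs_in S [:poly q x:]"
    using poly_S[OF assms] by (simp add: coeffs_in_def coeff_pCons split: nat.split)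
  ultimately show "coeffs_in S ([:-x, 1:] * synthetic_div q x)"
    using assms coeffs_in_diff[of S q "[:poly q x:]"] by simp
qed (use assms in auto)

text \<open>Evaluation at \<open>x\<close> puts \<open>poly q x\<close> in \<open>J\<close>, as
  \<open>poly h x\<close> is a unit; so a factor \<open>X - x\<close> splits off \<open>q\<close>
  and cancels against one of the \<open>k\<close> factors. With none left, \<open>q * h\<close> is 1
  modulo \<open>J\<close>, and degrees modulo \<open>J\<close> add up because \<open>h\<close> is
  monic.\<close>

lemma monic_dividing_power_of_linear:
  assumes "x \<in> S" "coeffs_in S q" "coeffs_in S h" "lead_coeff h = 1" "poly h x \<notin> J"
    and "coeffs_in J ([:-x, 1:] ^ k - q * h)"
  shows "degree h = 0"
  using assms(2,6)
proof (induction k arbitrary: q)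
  case 0
  show ?case
  proof (rule ccontr)
    assume D: "degree h \<noteq> 0"
    have "\<not> coeffs_in J q"
    proof
      assume "coeffs_in J q"
      then have "coeffs_in J (q * h)" using coeffs_J_mult' assms by blast
      then have "coeffs_in J ([:-x, 1:] ^ 0 - q * h + q * h)" using coeffs_J_add 0 by blast
      then have "coeffs_in J (1 :: 'k poly)" by simp
      then have "coeff (1 :: 'k poly) 0 \<in> J" unfolding coeffs_in_def by blast
      then show False by simp
    qed
    then obtain i where i: "coeff q i \<notin> J" by (auto simp: coeffs_in_def)
    have bd: "coeff q j \<notin> J \<Longrightarrow> j \<le> degree q" for j using J_0 le_degree by metis
    \<comment> \<open>The degree of \<open>q\<close> modulo \<open>J\<close>. The coefficient of
      \<open>q * h\<close> at \<open>t + degree h\<close> is \<open>coeff q t\<close> modulo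
      \<open>J\<close>, hence outside \<open>J\<close>.\<close>
    define t where "t = (GREATEST j. coeff q j \<notin> J)"
    have t: "coeff q t \<notin> J" unfolding t_def using GreatestI_nat[of "\<lambda>j. coeff q j \<notin> J"] i bd by blast
    have tmax: "coeff q j \<in> J" if "t < j" for j
      using Greatest_le_nat[of "\<lambda>j. coeff q j \<notin> J"] bd that unfolding t_def by (metis not_le)
    let ?n = "t + degree h"
    have "coeff (q * h) ?n = (\<Sum>i\<le>?n. coeff q i * coeff h (?n - i))" by (rule coeff_mult)
    also have "\<dots> = coeff q t * coeff h (?n - t) + (\<Sum>i\<in>{..?n} - {t}. coeff q i * coeff h (?n - i))"
      by (rule sum.remove) auto
    finally have eq: "coeff (q * h) ?n = coeff q t + (\<Sum>i\<in>{..?n} - {t}. coeff q i * coeff h (?n - i))"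
      using assms by simp
    have "(\<Sum>i\<in>{..?n} - {t}. coeff q i * coeff h (?n - i)) \<in> J"
    proof (rule J_sum)
      fix j assume j: "j \<in> {..?n} - {t}"
      show "coeff q j * coeff h (?n - j) \<in> J"
      proof (cases "j < t")
        case True
        then have "coeff h (?n - j) = 0" by (intro coeff_eq_0) auto
        then show ?thesis by simp
      next
        case False
        then show ?thesis using j assms(3) by (intro J_mult' tmax) (auto simp: coeffs_in_def)
      qed
    qed
    moreover have "coeff ([:-x, 1:] ^ 0 - q * h) ?n \<in> J" using 0 unfolding coeffs_in_def by blast
    then have "- coeff (q * h) ?n \<in> J" using D by simp
    then have "coeff (q * h) ?n \<in> J" using J_uminus by fastforce
    ultimately have "coeff q t \<in> J" using eq J_diff by (metis add_diff_cancel_right')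
    then show False using t by blast
  qed
next
  case (Suc k)
  let ?q = "synthetic_div q x"
  have q: "q = [:-x, 1:] * ?q + [:poly q x:]" using synthetic_div_correct'[of x q] by simp
  have qS: "coeffs_in S ?q" using coeffs_S_synthetic_div Suc.prems assms by blast
  have "poly ([:-x, 1:] ^ Suc k - q * h) x \<in> J" using poly_J Suc.prems assms by blast
  then have "- (poly q x * poly h x) \<in> J" by simp
  then have "poly q x * poly h x \<in> J" using J_uminus by fastforce
  then have qx: "poly q x \<in> J" using unit_mult[of "poly q x" "poly h x"] poly_S assms Suc.prems by blast
  have "coeffs_in J ([:poly q x:] * h)"
    using qx assms by (intro coeffs_J_mult') (auto simp: coeffs_in_def coeff_pCons split: nat.split)
  then have "coeffs_in J ([:-x, 1:] ^ Suc k - q * h + [:poly q x:] * h)" using coeffs_J_add Suc.prems by blast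
  also have "[:-x, 1:] ^ Suc k - q * h + [:poly q x:] * h = [:-x, 1:] * ([:-x, 1:] ^ k - ?q * h)"
  proof -
    have "q * h = [:-x, 1:] * (?q * h) + [:poly q x:] * h"
      by (subst q) (simp only: distrib_right mult.assoc)
    then show ?thesis by (simp only: power_Suc right_diff_distrib) simp
  qed
  finally have "coeffs_in J ([:-x, 1:] ^ k - ?q * h)"
    by (rule linear_factor_cancel[rotated -1]) (use J_add J_mult assms in auto)
  then show ?case using Suc.IH qS by blast
qed

text \<open>Long division modulo \<open>J\<close>, where the residue of \<open>g\<close> is the
  minimal polynomial of the residue of \<open>x\<close>. A top coefficient in \<open>J\<close> is
  discarded; one outside \<open>J\<close> is invertible in \<open>V\<close>, so by minimality the
  degree is at least that of \<open>g\<close> and a multiple of \<open>g\<close> can be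
  subtracted.\<close>

lemma minimal_poly_mod:
  assumes V: "is_subring L V" "V \<subseteq> S" "\<And>c. c \<in> V \<Longrightarrow> c \<notin> J \<Longrightarrow> inverse c \<in> V"
    and x: "x \<in> S" and g: "coeffs_in V g" "lead_coeff g = 1" "poly g x \<in> J"
    and min: "\<And>g'. coeffs_in V g' \<Longrightarrow> lead_coeff g' = 1 \<Longrightarrow> poly g' x \<in> J \<Longrightarrow> degree g \<le> degree g'"
    and h: "coeffs_in V h" "poly h x \<in> J"
  shows "\<exists>q. coeffs_in V q \<and> coeffs_in J (h - q * g)"
proof -
  note c = is_subring_closed[OF V(1)]
  have "\<exists>q. coeffs_in V q \<and> coeffs_in J (h - q * g)"
    if "coeffs_in V h" "poly h x \<in> J" "\<forall>i\<ge>n. coeff h i = 0" for n h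
    using that
  proof (induction n arbitrary: h)
    case 0
    then have "h = 0" by (simp add: poly_eq_iff)
    then show ?case by (intro exI[of _ 0]) (auto simp: coeffs_in_def c)
  next
    case (Suc n)
    let ?c = "coeff h n"
    have cV: "?c \<in> V" using Suc.prems by (simp add: coeffs_in_def)
    show ?case
    proof (cases "?c \<in> J")
      case True
      let ?h = "h - monom ?c n"
      have m: "coeffs_in J (monom ?c n)" using True by (intro coeffs_in_monom) auto
      have "coeffs_in V ?h" using Suc.prems cV c by (intro coeffs_in_diff coeffs_in_monom) auto
      moreover have "poly ?h x \<in> J" using Suc.prems poly_J[OF m x] J_diff by simp
      moreover have "\<forall>i\<ge>n. coeff ?h i = 0"
      proof (intro allI impI)
        fix i assume "n \<le> i"
        then show "coeff ?h i = 0" using Suc.prems(3) by (cases "i = n") auto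
      qed
      ultimately obtain q where q: "coeffs_in V q" "coeffs_in J (?h - q * g)" using Suc.IH by blast
      have "coeffs_in J (?h - q * g + monom ?c n)" using coeffs_J_add q m by blast
      moreover have "?h - q * g + monom ?c n = h - q * g" by simp
      ultimately show ?thesis using q by metis
    next
      case False
      have cn: "?c \<noteq> 0" using False by auto
      have deg: "degree h = n"
        using Suc.prems(3) cn by (intro antisym degree_le le_degree) auto
      have le: "degree g \<le> n"
      proof -
        have "coeffs_in V (smult (inverse ?c) h)"
          using Suc.prems V(3)[OF cV False] c by (simp add: coeffs_in_def)
        moreover have "lead_coeff (smult (inverse ?c) h) = 1" using deg cn by simp
        moreover have "poly (smult (inverse ?c) h) x \<in> J"
          using Suc.prems V(3)[OF cV False] V(2) by (auto intro: J_mult)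
        ultimately have "degree g \<le> degree (smult (inverse ?c) h)" by (rule min)
        then show ?thesis using deg cn by simp
      qed
      let ?m = "monom ?c (n - degree g)"
      let ?h = "h - ?m * g"
      have mV: "coeffs_in V ?m" using cV c by (intro coeffs_in_monom) auto
      have "coeffs_in V (?m * g)" using mV g c by (intro coeffs_in_mult[of V V]) auto
      then have "coeffs_in V ?h" using Suc.prems c by (intro coeffs_in_diff) auto
      moreover have "poly ?h x \<in> J"
      proof -
        have "coeffs_in S ?m" using mV V coeffs_in_mono by blast
        then have "poly ?m x * poly g x \<in> J" using g x poly_S by (intro J_mult) auto
        then show ?thesis using Suc.prems(2) J_diff by simp
      qed
      moreover have "coeff ?h i = 0" if "n \<le> i" for i
      proof (cases "i = n")
        case True
        have "coeff (?m * g) n = ?c * lead_coeff g"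
          using le by (simp add: coeff_monom_mult)
        then show ?thesis using True g by simp
      next
        case False
        have "coeff (?m * g) i = ?c * coeff g (i - (n - degree g))"
          using that by (simp add: coeff_monom_mult)
        also have "coeff g (i - (n - degree g)) = 0" using False that le by (intro coeff_eq_0) auto
        finally show ?thesis using False that Suc.prems(3) by simp
      qed
      ultimately obtain q where q: "coeffs_in V q" "coeffs_in J (?h - q * g)" using Suc.IH by blast
      have "?h - q * g = h - (q + ?m) * g" by (simp add: algebra_simps)
      moreover have "coeffs_in V (q + ?m)" using q mV c by (intro coeffs_in_add) auto
      ultimately show ?thesis using q by metis
    qed
  qed
  from this[OF h, of "Suc (degree h)"] show ?thesis by (simp add: coeff_eq_0)
qed

text \<open>The minimal polynomial \<open>g\<close> of the residue of \<open>x\<close> divides that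
  of \<open>p\<close>, so its root is simple; it also divides a power of \<open>X - x\<close>. Thus
  the cofactor of \<open>X - x\<close> in \<open>g\<close> is constant, \<open>g\<close> is linear,
  and its constant term supplies the element of \<open>V\<close>.\<close>

lemma separable_purely_inseparable:
  assumes V: "is_subring L V" "V \<subseteq> S" "\<And>c. c \<in> V \<Longrightarrow> c \<notin> J \<Longrightarrow> inverse c \<in> V"
    and x: "x \<in> S" and p: "coeffs_in V p" "lead_coeff p = 1" "poly p x \<in> J" "poly (pderiv p) x \<notin> J"
    and \<chi>: "coeffs_in V \<chi>" "poly \<chi> x \<in> J" "coeffs_in J ([:-x, 1:] ^ N - \<chi>)"
  shows "\<exists>c\<in>V. x - c \<in> J"
proof -
  let ?P = "\<lambda>g. coeffs_in V g \<and> lead_coeff g = 1 \<and> poly g x \<in> J"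
  obtain g where g: "coeffs_in V g" "lead_coeff g = 1" "poly g x \<in> J"
    and min: "\<And>g'. coeffs_in V g' \<Longrightarrow> lead_coeff g' = 1 \<Longrightarrow> poly g' x \<in> J \<Longrightarrow> degree g \<le> degree g'"
    using ex_has_least_nat[of ?P p degree] p by blast
  have div: "\<exists>q. coeffs_in V q \<and> coeffs_in J (h - q * g)" if "coeffs_in V h" "poly h x \<in> J" for h
    by (rule minimal_poly_mod[OF V(1,2) _ x g _ that]) (fact V(3), fact min)
  obtain q where q: "coeffs_in V q" "coeffs_in J (p - q * g)" using div[OF p(1,3)] by blast
  obtain q2 where q2: "coeffs_in V q2" "coeffs_in J (\<chi> - q2 * g)" using div[OF \<chi>(1,2)] by blast
  have S: "coeffs_in S g" "coeffs_in S q" "coeffs_in S q2"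
    using g(1) q(1) q2(1) coeffs_in_mono[OF _ V(2)] by auto
  have g': "poly (pderiv g) x \<notin> J"
  proof
    assume a: "poly (pderiv g) x \<in> J"
    have "poly (pderiv (p - q * g)) x \<in> J" using q coeffs_J_pderiv poly_J x by blast
    moreover have "poly (pderiv (p - q * g)) x
        = poly (pderiv p) x - (poly q x * poly (pderiv g) x + poly (pderiv q) x * poly g x)"
      by (simp add: pderiv_diff pderiv_mult)
    moreover have "poly q x * poly (pderiv g) x + poly (pderiv q) x * poly g x \<in> J"
      using S a g x by (intro J_add J_mult poly_S coeffs_S_pderiv) auto
    ultimately show False using p(4) J_add[of "poly (pderiv (p - q * g)) x"] by fastforce
  qed
  obtain h y where hd: "h = synthetic_div g x" and y: "y = poly g x" by blast
  have gh: "g = [:-x, 1:] * h + [:y:]" using synthetic_div_correct'[of x g] by (simp add: hd y)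
  have hS: "coeffs_in S h" using coeffs_S_synthetic_div S x hd by blast
  have "pderiv g = pderiv ([:-x, 1:] * h)" by (subst gh) (simp add: pderiv_add pderiv_pCons)
  then have "pderiv g = [:-x, 1:] * pderiv h + h * pderiv [:-x, 1:]" by (simp only: pderiv_mult)
  then have "poly (pderiv g) x = poly h x" by (simp add: pderiv_pCons)
  then have hx: "poly h x \<notin> J" using g' by simp
  have dg: "degree g \<noteq> 0"
  proof
    assume "degree g = 0"
    then obtain a where "g = [:a:]" by (rule degree_eq_zeroE)
    then show False using g by simp
  qed
  have hm: "lead_coeff h = 1"
  proof -
    have "h \<noteq> 0" using hx by auto
    have "degree ([:-x, 1:] * h) = Suc (degree h)" using \<open>h \<noteq> 0\<close> by (subst degree_mult_eq) auto
    moreover have d: "degree g = Suc (degree h)" using dg by (simp add: degree_synthetic_div hd)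
    moreover have "coeff g (degree g) = coeff ([:-x, 1:] * h) (degree g)"
      by (subst (1) gh) (use dg in \<open>simp add: coeff_pCons split: nat.split\<close>)
    ultimately have "lead_coeff ([:-x, 1:] * h) = 1" using g by simp
    then show ?thesis by (simp only: lead_coeff_mult) simp
  qed
  have yJ: "y \<in> J" using g y by simp
  then have "coeffs_in J [:y:]" by (simp add: coeffs_in_def coeff_pCons split: nat.split)
  then have "coeffs_in J (q2 * [:y:])" using coeffs_J_mult S(3) by blast
  then have X: "coeffs_in J ([:-x, 1:] ^ N - \<chi> + (\<chi> - q2 * g) + q2 * [:y:])"
    by (rule coeffs_J_add[OF coeffs_J_add[OF \<chi>(3) q2(2)]])
  have Y: "[:-x, 1:] ^ N - \<chi> + (\<chi> - q2 * g) + q2 * [:y:]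
      = [:-x, 1:] ^ N - (q2 * [:-x, 1:]) * h"
  proof -
    have "q2 * g = (q2 * [:-x, 1:]) * h + q2 * [:y:]"
      by (subst (1) gh) (simp only: distrib_left mult.assoc)
    moreover have "a - c + (c - u) + w = a - t" if "u = t + w" for a c u w t :: "'k poly"
      using that by simp
    ultimately show ?thesis by blast
  qed
  have Z: "coeffs_in J ([:-x, 1:] ^ N - (q2 * [:-x, 1:]) * h)" using X by (simp only: Y)
  have "coeffs_in S (q2 * [:-x, 1:])"
    using S x by (intro coeffs_S_mult coeffs_in_linear) auto
  from monic_dividing_power_of_linear[OF x this hS hm hx Z] have "degree h = 0" .
  then obtain a where "h = [:a:]" by (rule degree_eq_zeroE)
  then have h1: "h = [:1:]" using hm by simp
  have "coeff g 0 = y - x" by (subst gh) (simp add: h1)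
  moreover have "coeff g 0 \<in> V" using g(1) unfolding coeffs_in_def by blast
  ultimately have "y - x \<in> V" by simp
  then have "- (y - x) \<in> V" by (rule is_subring_closed(6)[OF V(1)])
  moreover have "x - (- (y - x)) \<in> J" using yJ by simp
  ultimately show ?thesis by blast
qed

end

section \<open>Tame defectless extensions\<close>

lemma field_aut_power: "field_aut \<sigma> \<Longrightarrow> \<sigma> (x ^ n) = \<sigma> x ^ n"
  by (induction n) (auto simp: field_aut_simps)

lemma aut_group_bij_left:
  assumes "aut_group G" "\<tau> \<in> G"
  shows "bij_betw (\<lambda>\<sigma>. \<tau> \<circ> \<sigma>) G G"
proof (rule bij_betw_byWitness[where f' = "\<lambda>\<sigma>. Hilbert_Choice.inv \<tau> \<circ> \<sigma>"])
  show "\<forall>\<sigma>\<in>G. Hilbert_Choice.inv \<tau> \<circ> (\<tau> \<circ> \<sigma>) = \<sigma>" "\<forall>\<sigma>\<in>G. \<tau> \<circ> (Hilbert_Choice.inv \<tau> \<circ> \<sigma>) = \<sigma>"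
    using aut_groupD(7,8)[OF assms] by (auto simp: o_assoc)
  show "(\<lambda>\<sigma>. \<tau> \<circ> \<sigma>) ` G \<subseteq> G" "(\<lambda>\<sigma>. Hilbert_Choice.inv \<tau> \<circ> \<sigma>) ` G \<subseteq> G"
    using aut_groupD(2,3)[OF assms(1)] assms(2) by blast+
qed

text \<open>Both bounds applied to the whole field with zero ideal, and to an
  \<open>F\<close>-basis: Dedekind bounds the group from above, Artin from below. Finiteness of
  \<open>Gal F\<close> is not part of its definition, so the upper bound is first shown for finite
  subsets.\<close>

lemma finite_galois_card:
  assumes "is_subfield F" and deg: "field_degree F n" and fix_F: "{x. \<forall>\<sigma>\<in>Gal F. \<sigma> x = x} = F"
  shows "finite (Gal F)" "card (Gal F) = n"
proof -
  interpret K: local_action UNIV "{0}" "Gal F"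
  proof
    show "aut_group (Gal F)" by (rule Gal_aut_group)
    show "\<sigma> x \<in> {0}" if "\<sigma> \<in> Gal F" "x \<in> {0}" for \<sigma> x
      using that field_aut_simps(3) by (auto simp: Gal_def)
    show "\<exists>y\<in>UNIV. y * x - 1 \<in> {0}" if "x \<notin> {0}" for x :: 'a
      using that by (intro bexI[of _ "inverse x"]) auto
  qed auto
  have fixed: "K.fixed = F" using fix_F by (auto simp: K.fixed_def)
  obtain b where b: "\<And>c. (\<forall>i<n. c i \<in> F) \<Longrightarrow> (\<Sum>i<n. c i * b i) = 0 \<Longrightarrow> \<forall>i<n. c i = 0"
    and sp: "\<And>x. \<exists>c. (\<forall>i<n. c i \<in> F) \<and> x = (\<Sum>i<n. c i * b i)"
    using deg unfolding field_degree_def by blast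
  have bound: "card \<Gamma> \<le> n" if "finite \<Gamma>" "\<Gamma> \<subseteq> Gal F" for \<Gamma>
  proof -
    have "card \<Gamma> \<le> card {..<n}"
    proof (rule K.dedekind_bound[OF that(1) _ that(2), of _ b])
      show "\<exists>x\<in>UNIV. \<sigma> x - \<tau> x \<notin> {0}" if "\<sigma> \<noteq> \<tau>" for \<sigma> \<tau> :: "'a \<Rightarrow> 'a"
        using that by (auto simp: fun_eq_iff)
      show "\<exists>c. (\<forall>i\<in>{..<n}. c i \<in> K.fixed) \<and> x - (\<Sum>i<n. c i * b i) \<in> {0}" for x
        using sp[of x] fixed by auto
    qed auto
    then show ?thesis by simp
  qed
  show fin: "finite (Gal F)"
  proof (rule ccontr)
    assume "infinite (Gal F)"
    then obtain \<Gamma> where "finite \<Gamma>" "card \<Gamma> = Suc n" "\<Gamma> \<subseteq> Gal F"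
      using infinite_arbitrarily_large by blast
    then show False using bound[of \<Gamma>] by simp
  qed
  have "card {..<n} \<le> card (Gal F)"
  proof (rule K.artin_bound[OF fin, of _ b])
    show "\<exists>\<gamma>\<in>Gal F. \<forall>x\<in>UNIV. \<sigma> x - \<gamma> x \<in> {0}" if "\<sigma> \<in> Gal F" for \<sigma>
      using that by (intro bexI[of _ \<sigma>]) auto
    show "\<forall>i\<in>{..<n}. c i \<in> {0}" if "\<And>i. i \<in> {..<n} \<Longrightarrow> c i \<in> K.fixed" "(\<Sum>i<n. c i * b i) \<in> {0}" for c
    proof -
      have "\<forall>i<n. c i = 0" using that fixed by (intro b) auto
      then show ?thesis by simp
    qed
  qed auto
  then show "card (Gal F) = n" using bound[OF fin] by simp
qed

section \<open>The unique extension of a valuation ring to a Galois extension\<close>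

locale indecomposed_ext = val_ring S for S :: "'k::field set" +
  fixes F V :: "'k set"
  assumes F: "is_subfield F" and V: "valuation_ring F V" and S: "S = integral_closure V"
    and gal: "finite_galois F"
begin

abbreviation G where "G \<equiv> Gal F"

lemma Vsub: "is_subring F V" using V by (rule valuation_ring_subring)

lemmas V_closed = is_subring_closed[OF Vsub]

lemma V_sum: "(\<And>i. i \<in> A \<Longrightarrow> g i \<in> V) \<Longrightarrow> sum g A \<in> V"
  by (induction A rule: infinite_finite_induct) (auto intro: V_closed)

lemma V_power: "x \<in> V \<Longrightarrow> x ^ n \<in> V"
  by (induction n) (auto intro: V_closed)

lemma V_F: "V \<subseteq> F" using Vsub by (simp add: is_subring_def)

lemma V_S: "V \<subseteq> S"
proof
  fix v assume "v \<in> V"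
  then have "\<forall>i. coeff [:-v, 1:] i \<in> V" using V_closed by (simp add: coeff_pCons split: nat.split)
  moreover have "lead_coeff [:-v, 1:] = 1" "poly [:-v, 1:] v = 0" by auto
  ultimately show "v \<in> S" unfolding S integral_closure_def by blast
qed

text \<open>Valuation rings are integrally closed: if \<open>x\<close> is not in \<open>V\<close>,
  its inverse is, and dividing an integral equation of degree \<open>d + 1\<close> by
  \<open>x ^ d\<close> expresses \<open>x\<close> through powers of
  \<open>inverse x\<close>.\<close>

lemma F_Int_S: assumes "x \<in> F" "x \<in> S" shows "x \<in> V"
proof (rule ccontr)
  assume n: "x \<notin> V"
  then have x0: "x \<noteq> 0" using V_closed by auto
  then have inv: "inverse x \<in> V" using V assms(1) n unfolding valuation_ring_def by blast
  obtain p where p: "\<forall>i. coeff p i \<in> V" "lead_coeff p = 1" "poly p x = 0"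
    using assms(2) unfolding S integral_closure_def by blast
  obtain d where d: "degree p = Suc d"
  proof (cases "degree p")
    case 0
    then obtain a where "p = [:a:]" by (rule degree_eq_zeroE)
    then show ?thesis using p by simp
  qed
  have "(\<Sum>i\<le>d. coeff p i * x ^ i) + x ^ Suc d = 0"
    using p(2,3) d by (simp add: poly_altdef)
  then have "inverse (x ^ d) * ((\<Sum>i\<le>d. coeff p i * x ^ i) + x ^ Suc d) = 0" by simp
  then have "(\<Sum>i\<le>d. coeff p i * (x ^ i * inverse (x ^ d))) + x = 0"
    using x0 by (simp add: distrib_left sum_distrib_left mult_ac)
  moreover have "x ^ i * inverse (x ^ d) = inverse x ^ (d - i)" if "i \<le> d" for i
  proof -
    have "x ^ d = x ^ i * x ^ (d - i)" using that by (simp add: power_add[symmetric])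
    then show ?thesis using x0 by (simp add: power_inverse)
  qed
  ultimately have "x = - (\<Sum>i\<le>d. coeff p i * inverse x ^ (d - i))"
    by (simp add: eq_neg_iff_add_eq_0 add.commute)
  also have "\<dots> \<in> V" using p inv by (intro V_closed V_sum V_power) auto
  finally show False using n by simp
qed

lemma nonunits_V: "nonunits V = J \<inter> V"
proof -
  have "inverse x \<in> S \<longleftrightarrow> inverse x \<in> V" if "x \<in> V" for x
  proof -
    have "inverse x \<in> F" using that V_F is_subfield_closed(6)[OF F] by blast
    then show ?thesis using F_Int_S V_S by blast
  qed
  then show ?thesis using V_S unfolding nonunits_def by blast
qed

lemma jacobson_V: "jacobson (ring_on V) = J \<inter> V"
  using jacobson_ring_on[OF F V] nonunits_V by simp

lemma unit_V: "c \<in> V \<Longrightarrow> c \<notin> J \<Longrightarrow> inverse c \<in> V"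
  using nonunits_V by (auto simp: nonunits_def)

lemma autG: "aut_group G" by (rule Gal_aut_group)

lemma aut: "\<sigma> \<in> G \<Longrightarrow> field_aut \<sigma>" by (simp add: Gal_def)

lemma finG: "finite G"
  using finite_galois_card(1)[OF F] gal unfolding finite_galois_def by blast

lemma fixF: "(\<And>\<sigma>. \<sigma> \<in> G \<Longrightarrow> \<sigma> x = x) \<Longrightarrow> x \<in> F"
  using gal unfolding finite_galois_def by blast

lemma GS: assumes "\<sigma> \<in> G" "x \<in> S" shows "\<sigma> x \<in> S"
proof -
  obtain p where p: "\<forall>i. coeff p i \<in> V" "lead_coeff p = 1" "poly p x = 0"
    using assms(2) unfolding S integral_closure_def by blast
  have fx: "\<sigma> (coeff p i) = coeff p i" for i using p assms(1) V_F by (auto simp: Gal_def)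
  have "\<sigma> (poly p x) = poly p (\<sigma> x)"
    unfolding poly_altdef
    by (simp add: field_aut_sum[OF aut[OF assms(1)]] field_aut_simps[OF aut[OF assms(1)]]
        field_aut_power[OF aut[OF assms(1)]] fx)
  then have "poly p (\<sigma> x) = 0" using p field_aut_simps[OF aut[OF assms(1)]] by simp
  then show ?thesis using p unfolding S integral_closure_def by blast
qed

lemma GJ: assumes "\<sigma> \<in> G" "x \<in> J" shows "\<sigma> x \<in> J"
proof -
  note a = field_aut_simps[OF aut[OF assms(1)]]
  have "Hilbert_Choice.inv \<sigma> (inverse (\<sigma> x)) = inverse x"
    using aut_groupD(6)[OF autG assms(1), of "inverse x"] a by simp
  then have "inverse x \<in> S" if "inverse (\<sigma> x) \<in> S"
    using GS[OF aut_groupD(3)[OF autG assms(1)] that] by simp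
  then show ?thesis using assms GS a unfolding nonunits_def by auto
qed

text \<open>A conjugate \<open>\<tau> y\<close> of least value divides all the others, and the
  inverse of \<tau> carries the quotient of \<open>\<tau> (\<sigma> y)\<close> by it to the one
  wanted. In effect \<open>G\<close> preserves the valuation.\<close>

lemma orbit_ratio:
  assumes "y \<noteq> 0" "\<sigma> \<in> G" shows "\<sigma> y / y \<in> S"
proof -
  have "\<exists>\<rho>\<in>G. \<rho> y \<noteq> 0" using aut_groupD(1)[OF autG] assms by (intro bexI[of _ id]) auto
  then obtain \<tau> where \<tau>: "\<tau> \<in> G" "\<tau> y \<noteq> 0" "\<And>\<rho>. \<rho> \<in> G \<Longrightarrow> \<rho> y / \<tau> y \<in> S"
    using finite_min[OF finG, where c = "\<lambda>\<rho>. \<rho> y"] by metis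
  have "\<tau> \<circ> \<sigma> \<in> G" using aut_groupD(2)[OF autG] \<tau> assms by blast
  then have "Hilbert_Choice.inv \<tau> ((\<tau> \<circ> \<sigma>) y / \<tau> y) \<in> S"
    using GS aut_groupD(3)[OF autG \<tau>(1)] \<tau>(3) by blast
  moreover have "(\<tau> \<circ> \<sigma>) y / \<tau> y = \<tau> (\<sigma> y / y)"
    using field_aut_simps(9)[OF aut[OF \<tau>(1)]] by simp
  ultimately show ?thesis using aut_groupD(6)[OF autG \<tau>(1)] by simp
qed

lemma norm_V: assumes "y \<in> S" shows "(\<Prod>\<sigma>\<in>G. \<sigma> y) \<in> V"
proof (rule F_Int_S)
  show "(\<Prod>\<sigma>\<in>G. \<sigma> y) \<in> S" using GS assms by auto
  show "(\<Prod>\<sigma>\<in>G. \<sigma> y) \<in> F"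
  proof (rule fixF)
    fix \<tau> assume \<tau>: "\<tau> \<in> G"
    have "\<tau> (\<Prod>\<sigma>\<in>G. \<sigma> y) = (\<Prod>\<sigma>\<in>G. (\<tau> \<circ> \<sigma>) y)" by (simp add: field_aut_prod[OF aut[OF \<tau>]])
    also have "\<dots> = (\<Prod>\<sigma>\<in>G. \<sigma> y)"
      using prod.reindex_bij_betw[OF aut_group_bij_left[OF autG \<tau>], of "\<lambda>\<sigma>. \<sigma> y"] .
    finally show "\<tau> (\<Prod>\<sigma>\<in>G. \<sigma> y) = (\<Prod>\<sigma>\<in>G. \<sigma> y)" .
  qed
qed

lemma norm_J: assumes "y \<in> J" shows "(\<Prod>\<sigma>\<in>G. \<sigma> y) \<in> J"
proof -
  have id: "id \<in> G" by (rule aut_groupD(1)[OF autG])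
  have "(\<Prod>\<sigma>\<in>G. \<sigma> y) = id y * (\<Prod>\<sigma>\<in>G - {id}. \<sigma> y)" using finG id by (rule prod.remove)
  moreover have "(\<Prod>\<sigma>\<in>G - {id}. \<sigma> y) \<in> S" using GS J_S assms by (intro S_prod) auto
  ultimately show ?thesis using J_mult' assms by simp
qed

text \<open>All conjugates have the same value, so the norm has the value of
  \<open>y ^ card G\<close>. This compares elements of \<open>S\<close> with elements of
  \<open>V\<close>, which \<pi> controls.\<close>

lemma power_norm: assumes "y \<noteq> 0" shows "y ^ card G / (\<Prod>\<sigma>\<in>G. \<sigma> y) \<in> S"
proof -
  have "y / \<sigma> y \<in> S" if "\<sigma> \<in> G" for \<sigma>
  proof -
    have i: "Hilbert_Choice.inv \<sigma> \<in> G" using aut_groupD(3)[OF autG that] .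
    have "\<sigma> (Hilbert_Choice.inv \<sigma> y / y) \<in> S" using orbit_ratio[OF assms i] GS that by blast
    then show ?thesis using field_aut_simps(9)[OF aut[OF that]] aut_groupD(5)[OF autG that] by simp
  qed
  then have "(\<Prod>\<sigma>\<in>G. y / \<sigma> y) \<in> S" by auto
  then show ?thesis by (simp add: prod_dividef)
qed

text \<open>If \<open>J(S)\<close> were not principal, \<open>\<pi>\<close> would be divisible by arbitrarily high powers of elements
  of \<open>J(S)\<close>, whereas taking norms shows that \<open>\<pi>\<close> divides \<open>y ^ [K : F]\<close> for all such \<open>y\<close>.\<close>

lemma J_principal:
  assumes \<pi>: "\<pi> \<in> V" "jacobson (ring_on V) = {\<pi> * v | v. v \<in> V}"
  shows "\<exists>\<omega>\<in>S. J = {\<omega> * s | s. s \<in> S}"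
proof (cases "\<pi> = 0")
  case True
  have "y = 0" if "y \<in> J" for y
  proof -
    have "(\<Prod>\<sigma>\<in>G. \<sigma> y) \<in> J \<inter> V" using norm_J norm_V J_S that by auto
    then have "(\<Prod>\<sigma>\<in>G. \<sigma> y) = 0" using \<pi> jacobson_V True by auto
    then obtain \<sigma> where "\<sigma> \<in> G" "\<sigma> y = 0" using finG by auto
    then show ?thesis using field_aut_simps(7)[OF aut] by blast
  qed
  then have "J = {0}" by auto
  then show ?thesis by (intro bexI[of _ 0]) auto
next
  case False
  have \<pi>J: "\<pi> \<in> J"
  proof -
    have "\<pi> = \<pi> * 1" by simp
    then have "\<pi> \<in> {\<pi> * v | v. v \<in> V}" using V_closed(2) by blast
    then show ?thesis unfolding \<pi>(2)[symmetric] jacobson_V by blast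
  qed
  show ?thesis
  proof (rule ccontr)
    assume np: "\<not> ?thesis"
    \<comment> \<open>If \<open>J\<close> is not principal, some \<open>y\<close> in
      \<open>J\<close> is not a multiple of \<open>x\<close>; then \<open>x / y\<close> lies in
      \<open>J\<close>. So every nonzero element of \<open>J\<close> is a product of two elements of
      \<open>J\<close>.\<close>
    have split: "\<exists>y\<in>J. y \<noteq> 0 \<and> x / y \<in> J" if x: "x \<in> J" "x \<noteq> 0" for x
    proof -
      have "{x * s | s. s \<in> S} \<subseteq> J" using J_mult' x by auto
      moreover have "J \<noteq> {x * s | s. s \<in> S}" using np J_S x by blast
      ultimately obtain y where y: "y \<in> J" "y \<notin> {x * s | s. s \<in> S}" by blast
      have y0: "y \<noteq> 0"
      proof
        assume "y = 0"
        then have "y = x * 0" "0 \<in> S" by auto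
        then show False using y by blast
      qed
      have ns: "y / x \<notin> S"
      proof
        assume "y / x \<in> S"
        moreover have "y = x * (y / x)" using x by simp
        ultimately show False using y by blast
      qed
      then have "x / y \<in> S" using total[of x y] x y0 by blast
      moreover have "inverse (x / y) \<notin> S" using ns by simp
      ultimately have "x / y \<in> J" by (simp add: nonunits_def)
      then show ?thesis using y y0 by blast
    qed
    have "\<exists>y\<in>J. y \<noteq> 0 \<and> \<pi> / y ^ (2 ^ k) \<in> S" for k
    proof (induction k)
      case 0
      then show ?case using \<pi>J False by (intro bexI[of _ \<pi>]) auto
    next
      case (Suc k)
      then obtain y where y: "y \<in> J" "y \<noteq> 0" "\<pi> / y ^ (2 ^ k) \<in> S" by blast
      then obtain u where u: "u \<in> J" "u \<noteq> 0" "y / u \<in> J" using split by blast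
      \<comment> \<open>Of the two factors \<open>u\<close> and \<open>y / u\<close> of
        \<open>y\<close>, one divides the other; its square divides \<open>y\<close>.\<close>
      obtain t where t: "t \<in> J" "t \<noteq> 0" "y / t ^ 2 \<in> S"
      proof (cases "y / u / u \<in> S")
        case True
        then show ?thesis using that[of u] u by (simp add: power2_eq_square)
      next
        case f: False
        then have "u / (y / u) \<in> S" using total[of "y / u" u] y u by auto
        moreover have "u / (y / u) = y / (y / u) ^ 2" using y u by (simp add: field_simps power2_eq_square)
        ultimately show ?thesis using that[of "y / u"] y u by auto
      qed
      have "\<pi> / y ^ (2 ^ k) * (y / t ^ 2) ^ (2 ^ k) \<in> S" using y(3) t(3) by (intro S_closed S_power)
      moreover have "\<pi> / y ^ (2 ^ k) * (y / t ^ 2) ^ (2 ^ k) = \<pi> / t ^ (2 ^ Suc k)"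
        using y by (simp add: power_divide power_mult[symmetric])
      ultimately show ?case using t by auto
    qed
    from this[of "card G"] obtain y where y: "y \<in> J" "y \<noteq> 0" "\<pi> / y ^ (2 ^ card G) \<in> S" by blast
    have "(\<Prod>\<sigma>\<in>G. \<sigma> y) \<in> J \<inter> V" using norm_J norm_V J_S y by auto
    then obtain v where v: "v \<in> V" "(\<Prod>\<sigma>\<in>G. \<sigma> y) = \<pi> * v" using \<pi> jacobson_V by auto
    have "(\<Prod>\<sigma>\<in>G. \<sigma> y) \<noteq> 0" using finG y field_aut_simps(7)[OF aut] by auto
    then have "y ^ card G / (\<pi> * v) * v = y ^ card G / \<pi>" using v by (auto simp: field_simps)
    moreover have "y ^ card G / (\<pi> * v) \<in> S" using power_norm[OF y(2)] by (simp only: v(2))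
    then have "y ^ card G / (\<pi> * v) * v \<in> S" using v(1) V_S by (intro S_closed(5)) auto
    ultimately have 1: "y ^ card G / \<pi> \<in> S" by simp
    \<comment> \<open>\<open>2 ^ card G\<close> exceeds \<open>card G\<close>; the factor
      \<open>y ^ d\<close> pads the product below so that exactly \<open>inverse y\<close>
      results.\<close>
    obtain d where d: "2 ^ card G = Suc (card G + d)"
      using less_exp[of "card G"] less_imp_Suc_add by blast
    have "\<pi> / y ^ (2 ^ card G) * (y ^ card G / \<pi>) * y ^ d \<in> S"
      using y(3) 1 J_S[OF y(1)] by (intro S_closed S_power)
    moreover have "\<pi> / y ^ (2 ^ card G) * (y ^ card G / \<pi>) * y ^ d = inverse y"
      unfolding d using y False by (simp add: field_simps power_add)
    ultimately show False using y by (simp add: nonunits_def)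
  qed
qed

text \<open>The product of the \<open>X - \<sigma> x\<close> has \<open>G\<close>-invariant integral
  coefficients, hence coefficients in \<open>V\<close>; replacing each \<open>\<sigma> x\<close> by
  the congruent \<open>x\<close> changes it only by coefficients in \<open>J\<close>.\<close>

lemma charpoly_mod:
  assumes x: "x \<in> S" and fx: "\<And>\<sigma>. \<sigma> \<in> G \<Longrightarrow> \<sigma> x - x \<in> J"
  shows "coeffs_in V (\<Prod>\<sigma>\<in>G. [:-\<sigma> x, 1:])" "poly (\<Prod>\<sigma>\<in>G. [:-\<sigma> x, 1:]) x \<in> J"
    "coeffs_in J ([:-x, 1:] ^ card G - (\<Prod>\<sigma>\<in>G. [:-\<sigma> x, 1:]))"
proof -
  let ?\<chi> = "\<lambda>A. \<Prod>\<sigma>\<in>A. [:-\<sigma> x, 1:]"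
  have lin: "coeffs_in S [:-\<sigma> x, 1:]" if "\<sigma> \<in> G" for \<sigma>
    using GS[OF that x] by (intro coeffs_in_linear) auto
  have linx: "coeffs_in S [:-x, 1:]" using x by (intro coeffs_in_linear) auto
  have one: "coeffs_in S 1"
    unfolding one_pCons by (simp add: coeffs_in_def coeff_pCons split: nat.split)
  have \<chi>S: "coeffs_in S (?\<chi> A)" if "A \<subseteq> G" for A
    using finite_subset[OF that finG] that
    by (induction A rule: finite_induct) (simp_all add: one coeffs_S_mult lin del: mult_pCons_left)
  have "\<tau> (coeff (?\<chi> G) i) = coeff (?\<chi> G) i" if \<tau>: "\<tau> \<in> G" for \<tau> i
  proof -
    note a = field_aut_simps[OF aut[OF \<tau>]]
    have mp: "map_poly \<tau> (p * q) = map_poly \<tau> p * map_poly \<tau> q" for p q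
      by (rule poly_eqI) (simp add: coeff_map_poly a coeff_mult field_aut_sum[OF aut[OF \<tau>]])
    have "map_poly \<tau> (prod h A) = (\<Prod>a\<in>A. map_poly \<tau> (h a))" for h and A :: "('k \<Rightarrow> 'k) set"
      by (induction A rule: infinite_finite_induct) (auto simp: mp map_poly_1 a)
    then have "map_poly \<tau> (?\<chi> G) = (\<Prod>\<sigma>\<in>G. map_poly \<tau> [:-\<sigma> x, 1:])" .
    also have "\<dots> = (\<Prod>\<sigma>\<in>G. [:-(\<tau> \<circ> \<sigma>) x, 1:])" by (simp add: map_poly_pCons a)
    also have "\<dots> = ?\<chi> G"
      using prod.reindex_bij_betw[OF aut_group_bij_left[OF autG \<tau>], of "\<lambda>\<sigma>. [:-\<sigma> x, 1:]"] .
    finally have "coeff (map_poly \<tau> (?\<chi> G)) i = coeff (?\<chi> G) i" by simp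
    then show ?thesis by (simp add: coeff_map_poly a)
  qed
  then show "coeffs_in V (?\<chi> G)"
    using fixF F_Int_S \<chi>S[of G] unfolding coeffs_in_def by blast
  have "poly (?\<chi> G) x = (\<Prod>\<sigma>\<in>G. x - \<sigma> x)" by (simp add: poly_prod)
  also have "\<dots> = 0" using finG aut_groupD(1)[OF autG] by (auto intro!: bexI[of _ id])
  finally show "poly (?\<chi> G) x \<in> J" by simp
  have "coeffs_in J ([:-x, 1:] ^ card A - ?\<chi> A)" if "A \<subseteq> G" for A
    using finite_subset[OF that finG] that
  proof (induction A rule: finite_induct)
    case empty
    then show ?case by (simp add: coeffs_in_def)
  next
    case (insert \<sigma> A)
    have "\<sigma> x - x \<in> J" using fx insert by blast
    then have "coeffs_in J [:\<sigma> x - x:]" by (simp add: coeffs_in_def coeff_pCons split: nat.split)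
    then have 1: "coeffs_in J ([:\<sigma> x - x:] * ?\<chi> A)" using coeffs_J_mult' \<chi>S insert by blast
    have 2: "coeffs_in J ([:-x, 1:] * ([:-x, 1:] ^ card A - ?\<chi> A))"
      using coeffs_J_mult linx insert by blast
    have ring: "a * b - d * c = a * (b - c) + (a - d) * c" for a b c d :: "'k poly"
      by (simp add: algebra_simps)
    have "[:-x, 1:] ^ card (insert \<sigma> A) - ?\<chi> (insert \<sigma> A)
        = [:-x, 1:] * [:-x, 1:] ^ card A - [:-\<sigma> x, 1:] * ?\<chi> A"
      by (simp only: card_insert_disjoint[OF insert.hyps] prod.insert[OF insert.hyps] power_Suc)
    also have "\<dots> = [:-x, 1:] * ([:-x, 1:] ^ card A - ?\<chi> A) + ([:-x, 1:] - [:-\<sigma> x, 1:]) * ?\<chi> A"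
      by (rule ring)
    also have "[:-x, 1:] - [:-\<sigma> x, 1:] = [:\<sigma> x - x:]" by simp
    finally show ?case using coeffs_J_add[OF 2 1] by (simp only:)
  qed
  then show "coeffs_in J ([:-x, 1:] ^ card G - ?\<chi> G)" by blast
qed

sublocale res: local_action S J G
proof
  show "\<exists>y\<in>S. y * x - 1 \<in> J" if "x \<in> S" "x \<notin> J" for x
  proof -
    have "x \<noteq> 0" using that by auto
    then show ?thesis using unit_inverse[OF that] by (intro bexI[of _ "inverse x"]) auto
  qed
qed (auto intro: J_add J_diff J_mult J_S GS GJ autG)

text \<open>The characteristic polynomial makes an invariant residue purely inseparable over the
  residue field of \<open>V\<close>; separability then forces degree one. Artin's bound on residues
  needs this, because the residue degree is taken over \<open>V\<close> and not over the
  invariants.\<close>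

lemma fixed_mod:
  assumes "separable_residue V S" "x \<in> res.fixed"
  shows "\<exists>c\<in>V. x - c \<in> J"
proof -
  have x: "x \<in> S" "\<And>\<sigma>. \<sigma> \<in> G \<Longrightarrow> \<sigma> x - x \<in> J" using assms(2) by (auto simp: res.fixed_def)
  obtain p a b where p: "\<And>i. coeff p i \<in> V \<and> coeff a i \<in> V \<and> coeff b i \<in> V" "lead_coeff p = 1"
    "poly p x \<in> J" "\<And>i. coeff (a * p + b * pderiv p - 1) i \<in> J \<inter> V"
    using assms(1) x unfolding separable_residue_def jacobson_S jacobson_V by blast
  have c: "coeffs_in S p" "coeffs_in S a" "coeffs_in S b" using p(1) V_S by (auto simp: coeffs_in_def)
  have "coeffs_in J (a * p + b * pderiv p - 1)" using p(4) by (simp add: coeffs_in_def)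
  then have 1: "poly (a * p + b * pderiv p - 1) x \<in> J" using poly_J x by blast
  have "poly (pderiv p) x \<notin> J"
  proof
    assume "poly (pderiv p) x \<in> J"
    then have "poly a x * poly p x + poly b x * poly (pderiv p) x \<in> J"
      using p c x poly_S by (intro J_add J_mult) auto
    then have "(poly a x * poly p x + poly b x * poly (pderiv p) x) - poly (a * p + b * pderiv p - 1) x \<in> J"
      using 1 by (rule J_diff)
    then show False by simp
  qed
  moreover have "coeffs_in V p" using p(1) by (simp add: coeffs_in_def)
  moreover have "coeffs_in V (\<Prod>\<sigma>\<in>G. [:-\<sigma> x, 1:])" "poly (\<Prod>\<sigma>\<in>G. [:-\<sigma> x, 1:]) x \<in> J"
    "coeffs_in J ([:-x, 1:] ^ card G - (\<Prod>\<sigma>\<in>G. [:-\<sigma> x, 1:]))"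
    by (rule charpoly_mod; fact x)+
  ultimately show ?thesis
    by (intro separable_purely_inseparable[OF Vsub V_S unit_V x(1) _ p(2,3)])
qed

text \<open>By the two bounds, the number of automorphisms induced on the residue field is the
  residue degree \<open>m\<close>. So each is induced by exactly \<open>n / m = e\<close> elements
  of \<open>G\<close>, and modulo \<open>J\<close> the trace is \<open>e\<close> times the sum of
  the distinct induced automorphisms. The factor \<open>e\<close> is a unit by tameness, and the sum
  is not identically 0 by independence.\<close>

lemma trace_unit:
  assumes "tame_defectless F V S"
  shows "\<exists>s\<in>S. (\<Sum>\<sigma>\<in>G. \<sigma> s) \<notin> J"
proof -
  let ?e = "ram_index F S"
  obtain n m where n: "field_degree F n" and m: "residue_degree V S m" and nm: "n = ?e * m"
    using assms unfolding tame_defectless_def by blast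
  have e: "of_nat ?e \<notin> J \<inter> V" and sep: "separable_residue V S"
    using assms unfolding tame_defectless_def jacobson_V by auto
  have "of_nat k \<in> V" for k by (induction k) (auto intro: V_closed)
  then have e: "of_nat ?e \<notin> J" using e by blast
  have card_G: "card G = n" using finite_galois_card(2)[OF F n] gal unfolding finite_galois_def by blast
  define eqv where "eqv \<sigma> \<tau> \<longleftrightarrow> (\<forall>x\<in>S. \<sigma> x - \<tau> x \<in> J)" for \<sigma> \<tau> :: "'k \<Rightarrow> 'k"
  have refl: "eqv \<sigma> \<sigma>" for \<sigma> by (simp add: eqv_def)
  have sym: "eqv \<tau> \<sigma>" if "eqv \<sigma> \<tau>" for \<sigma> \<tau>
  proof -
    have "\<tau> x - \<sigma> x \<in> J" if "x \<in> S" for x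
      using J_uminus[of "\<sigma> x - \<tau> x"] \<open>eqv \<sigma> \<tau>\<close> that by (simp add: eqv_def)
    then show ?thesis by (simp add: eqv_def)
  qed
  have trans: "eqv \<sigma> \<rho>" if "eqv \<sigma> \<tau>" "eqv \<tau> \<rho>" for \<sigma> \<tau> \<rho>
  proof -
    have "\<sigma> x - \<rho> x \<in> J" if "x \<in> S" for x
      using J_add[of "\<sigma> x - \<tau> x" "\<tau> x - \<rho> x"] \<open>eqv \<sigma> \<tau>\<close> \<open>eqv \<tau> \<rho>\<close> that by (simp add: eqv_def)
    then show ?thesis by (simp add: eqv_def)
  qed
  \<comment> \<open>The choice depends on \<sigma> only through its congruence class, so congruent
    automorphisms receive literally the same representative.\<close>
  define r where "r \<sigma> = (SOME \<tau>. \<tau> \<in> G \<and> eqv \<tau> \<sigma>)" for \<sigma>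
  have r: "r \<sigma> \<in> G" "eqv (r \<sigma>) \<sigma>" if "\<sigma> \<in> G" for \<sigma>
  proof -
    have "r \<sigma> \<in> G \<and> eqv (r \<sigma>) \<sigma>" unfolding r_def by (rule someI[of _ \<sigma>]) (use that refl in auto)
    then show "r \<sigma> \<in> G" "eqv (r \<sigma>) \<sigma>" by auto
  qed
  have r_eq: "r \<sigma> = r \<tau> \<longleftrightarrow> eqv \<sigma> \<tau>" if "\<sigma> \<in> G" "\<tau> \<in> G" for \<sigma> \<tau>
  proof
    assume "r \<sigma> = r \<tau>" then show "eqv \<sigma> \<tau>" using r that sym trans by metis
  next
    assume "eqv \<sigma> \<tau>"
    then have "eqv \<rho> \<sigma> \<longleftrightarrow> eqv \<rho> \<tau>" for \<rho> using sym trans by blast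
    then show "r \<sigma> = r \<tau>" by (simp add: r_def)
  qed
  define \<Gamma> where "\<Gamma> = r ` G"
  have \<Gamma>: "finite \<Gamma>" "\<Gamma> \<subseteq> G" using finG r by (auto simp: \<Gamma>_def)
  have dist: "\<exists>x\<in>S. \<sigma> x - \<tau> x \<notin> J" if st: "\<sigma> \<in> \<Gamma>" "\<tau> \<in> \<Gamma>" "\<sigma> \<noteq> \<tau>" for \<sigma> \<tau>
  proof -
    obtain \<alpha> \<beta> where a: "\<sigma> = r \<alpha>" "\<tau> = r \<beta>" "\<alpha> \<in> G" "\<beta> \<in> G" using st by (auto simp: \<Gamma>_def)
    have "\<not> eqv (r \<alpha>) (r \<beta>)"
    proof
      assume "eqv (r \<alpha>) (r \<beta>)"
      then have "eqv \<alpha> \<beta>" using r a sym trans by metis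
      then show False using r_eq a st by simp
    qed
    then show ?thesis using a by (simp add: eqv_def)
  qed
  define I where "I = {\<sigma> \<in> G. eqv \<sigma> id}"
  \<comment> \<open>Left translation by \<gamma> carries the inertia group \<open>I\<close> onto the
    congruence class of \<gamma>.\<close>
  have fiber: "card {\<sigma> \<in> G. r \<sigma> = \<gamma>} = card I" if g: "\<gamma> \<in> \<Gamma>" for \<gamma>
  proof -
    obtain \<alpha> where \<alpha>: "\<alpha> \<in> G" "\<gamma> = r \<alpha>" using g by (auto simp: \<Gamma>_def)
    have \<gamma>: "\<gamma> \<in> G" using g \<Gamma> by blast
    have rg: "r \<gamma> = \<gamma>" using r_eq[OF \<gamma> \<alpha>(1)] r \<alpha> by simp
    have eq: "{\<sigma> \<in> G. r \<sigma> = \<gamma>} = {\<sigma> \<in> G. eqv \<sigma> \<gamma>}" using r_eq[OF _ \<gamma>] rg by auto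
    have shift: "eqv (\<rho> \<circ> \<sigma>) (\<rho> \<circ> \<tau>)" if "eqv \<sigma> \<tau>" "\<rho> \<in> G" for \<rho> \<sigma> \<tau>
    proof -
      have "\<rho> (\<sigma> x) - \<rho> (\<tau> x) \<in> J" if "x \<in> S" for x
        using GJ[OF \<open>\<rho> \<in> G\<close>, of "\<sigma> x - \<tau> x"] \<open>eqv \<sigma> \<tau>\<close> that
        by (simp add: eqv_def field_aut_simps[OF aut[OF \<open>\<rho> \<in> G\<close>]])
      then show ?thesis by (simp add: eqv_def)
    qed
    have "bij_betw (\<lambda>\<sigma>. \<gamma> \<circ> \<sigma>) I {\<sigma> \<in> G. eqv \<sigma> \<gamma>}"
    proof (rule bij_betw_byWitness[where f' = "\<lambda>\<sigma>. Hilbert_Choice.inv \<gamma> \<circ> \<sigma>"])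
      note g = aut_groupD[OF autG]
      show "\<forall>\<sigma>\<in>I. Hilbert_Choice.inv \<gamma> \<circ> (\<gamma> \<circ> \<sigma>) = \<sigma>"
        "\<forall>\<sigma>\<in>{\<sigma> \<in> G. eqv \<sigma> \<gamma>}. \<gamma> \<circ> (Hilbert_Choice.inv \<gamma> \<circ> \<sigma>) = \<sigma>"
        using g(7,8)[OF \<gamma>] by (auto simp: o_assoc)
      show "(\<lambda>\<sigma>. \<gamma> \<circ> \<sigma>) ` I \<subseteq> {\<sigma> \<in> G. eqv \<sigma> \<gamma>}"
        using shift[of _ id \<gamma>] g(2) \<gamma> by (auto simp: I_def)
      show "(\<lambda>\<sigma>. Hilbert_Choice.inv \<gamma> \<circ> \<sigma>) ` {\<sigma> \<in> G. eqv \<sigma> \<gamma>} \<subseteq> I"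
        using shift[of _ \<gamma> "Hilbert_Choice.inv \<gamma>"] g(2,3) g(8)[OF \<gamma>] \<gamma> by (auto simp: I_def)
    qed
    then show ?thesis using eq bij_betw_same_card by metis
  qed
  have group: "(\<Sum>\<sigma>\<in>G. g (r \<sigma>)) = of_nat (card I) * (\<Sum>\<gamma>\<in>\<Gamma>. g \<gamma>)" for g :: "_ \<Rightarrow> 'b::comm_semiring_1"
  proof -
    have "(\<Sum>\<sigma>\<in>G. g (r \<sigma>)) = (\<Sum>\<gamma>\<in>\<Gamma>. \<Sum>\<sigma>\<in>{\<sigma> \<in> G. r \<sigma> = \<gamma>}. g (r \<sigma>))"
      unfolding \<Gamma>_def by (rule sum.image_gen[OF finG])
    also have "\<dots> = (\<Sum>\<gamma>\<in>\<Gamma>. of_nat (card I) * g \<gamma>)" using fiber by (intro sum.cong) auto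
    finally show ?thesis by (simp add: sum_distrib_left)
  qed
  obtain s where s: "\<And>i. i < m \<Longrightarrow> s i \<in> S"
    and ind: "\<And>c. (\<forall>i<m. c i \<in> V) \<Longrightarrow> (\<Sum>i<m. c i * s i) \<in> J \<Longrightarrow> \<forall>i<m. c i \<in> J"
    and sp: "\<And>x. x \<in> S \<Longrightarrow> \<exists>c. (\<forall>i<m. c i \<in> V) \<and> x - (\<Sum>i<m. c i * s i) \<in> J"
    using m unfolding residue_degree_def jacobson_S jacobson_V by blast
  have V_fixed: "c \<in> res.fixed" if "c \<in> V" for c
  proof -
    have "\<sigma> c - c \<in> J" if "\<sigma> \<in> G" for \<sigma>
    proof -
      have "\<sigma> c = c" using that \<open>c \<in> V\<close> V_F by (auto simp: Gal_def)
      then show ?thesis by simp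
    qed
    then show ?thesis using that V_S unfolding res.fixed_def by blast
  qed
  have "card \<Gamma> \<le> card {..<m}"
  proof (rule res.dedekind_bound[OF \<Gamma>(1) _ \<Gamma>(2) dist, of _ s])
    fix x assume "x \<in> S"
    then obtain c where "\<forall>i<m. c i \<in> V" "x - (\<Sum>i<m. c i * s i) \<in> J" using sp by blast
    then show "\<exists>c. (\<forall>i\<in>{..<m}. c i \<in> res.fixed) \<and> x - (\<Sum>i<m. c i * s i) \<in> J"
      using V_fixed by (intro exI[of _ c]) auto
  qed (use s in auto)
  moreover have "card {..<m} \<le> card \<Gamma>"
  proof (rule res.artin_bound[OF \<Gamma>(1) _ \<Gamma>(2), of _ s])
    show "\<exists>\<gamma>\<in>\<Gamma>. \<forall>x\<in>S. \<sigma> x - \<gamma> x \<in> J" if "\<sigma> \<in> G" for \<sigma>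
      using that r sym unfolding \<Gamma>_def eqv_def by blast
    show "\<forall>i\<in>{..<m}. c i \<in> J"
      if c: "\<And>i. i \<in> {..<m} \<Longrightarrow> c i \<in> res.fixed" "(\<Sum>i<m. c i * s i) \<in> J" for c
    proof -
      have "\<forall>i. \<exists>v. i < m \<longrightarrow> v \<in> V \<and> c i - v \<in> J" using fixed_mod[OF sep c(1)] by auto
      then have "\<exists>v. \<forall>i<m. v i \<in> V \<and> c i - v i \<in> J" by metis
      then obtain v where v: "\<forall>i<m. v i \<in> V \<and> c i - v i \<in> J" by blast
      have "(\<Sum>i<m. (c i - v i) * s i) \<in> J" using v s by (intro J_sum J_mult') auto
      then have "(\<Sum>i<m. c i * s i) - (\<Sum>i<m. (c i - v i) * s i) \<in> J" using c(2) J_diff by blast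
      then have "(\<Sum>i<m. v i * s i) \<in> J" by (simp add: left_diff_distrib sum_subtractf)
      then have "\<forall>i<m. v i \<in> J" using ind v by blast
      then show ?thesis using v res.J_cong by blast
    qed
  qed (use s in auto)
  ultimately have cm: "card \<Gamma> = m" by simp
  \<comment> \<open>For \<open>m = 0\<close> the empty sum would have to be congruent to 1.\<close>
  have mp: "m > 0"
  proof (rule ccontr)
    assume "\<not> m > 0"
    then show False using sp[of 1] by simp
  qed
  have "card G = card I * card \<Gamma>" using group[of "\<lambda>_. 1 :: nat"] by simp
  then have cI: "card I = ?e" using card_G nm cm mp by simp
  obtain x where x: "x \<in> S" "(\<Sum>\<gamma>\<in>\<Gamma>. 1 * \<gamma> x) \<notin> J"
  proof (rule ccontr)
    assume "\<not> thesis"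
    then have all: "\<And>x. x \<in> S \<Longrightarrow> (\<Sum>\<gamma>\<in>\<Gamma>. 1 * \<gamma> x) \<in> J" using that by blast
    have "\<forall>\<gamma>\<in>\<Gamma>. (1::'k) \<in> J"
    proof (rule res.dedekind_independence[OF \<Gamma>(1) _ _ _ dist _ all])
      fix \<sigma> assume "\<sigma> \<in> \<Gamma>"
      then have \<sigma>: "\<sigma> \<in> G" using \<Gamma> by blast
      show "\<sigma> x \<in> S" if "x \<in> S" for x using GS \<sigma> that by blast
      show "\<sigma> (x * y) = \<sigma> x * \<sigma> y" "\<sigma> 1 = 1" for x y using field_aut_simps[OF aut[OF \<sigma>]] by auto
    qed auto
    then have "\<Gamma> = {}" by auto
    then show False using cm mp by simp
  qed
  have "(\<Sum>\<gamma>\<in>\<Gamma>. \<gamma> x) \<in> S" using GS \<Gamma> x by (intro S_sum) auto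
  then have 1: "(\<Sum>\<sigma>\<in>G. (r \<sigma>) x) \<notin> J"
    using group[of "\<lambda>\<gamma>. \<gamma> x"] cI e x unit_mult[of "of_nat ?e" "\<Sum>\<gamma>\<in>\<Gamma>. \<gamma> x"] by simp
  have "(\<Sum>\<sigma>\<in>G. (r \<sigma>) x - \<sigma> x) \<in> J" using r x by (intro J_sum) (auto simp: eqv_def)
  then have "(\<Sum>\<sigma>\<in>G. (r \<sigma>) x) - (\<Sum>\<sigma>\<in>G. \<sigma> x) \<in> J" by (simp add: sum_subtractf)
  then have "(\<Sum>\<sigma>\<in>G. \<sigma> x) \<notin> J" using 1 res.J_cong by blast
  then show ?thesis using x by blast
qed

end

section \<open>Lattices over a valuation ring\<close>

definition sc :: "'k::field \<Rightarrow> ('i \<Rightarrow> 'k) \<Rightarrow> 'i \<Rightarrow> 'k" where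
  "sc c a = (\<lambda>\<rho>. c * a \<rho>)"

lemma sc_apply [simp]: "sc c a \<rho> = c * a \<rho>" by (simp add: sc_def)

lemma sum_fun_apply [simp]: "(\<Sum>i\<in>A. g i) \<rho> = (\<Sum>i\<in>A. g i \<rho> :: 'k::comm_monoid_add)"
  by (induction A rule: infinite_finite_induct) auto

lemma sc_add: "sc c (a + b) = sc c a + sc c b" by (auto simp: fun_eq_iff distrib_left)
lemma sc_diff: "sc c (a - b) = sc c a - sc c b" by (auto simp: fun_eq_iff right_diff_distrib)
lemma sc_add_left: "sc (c + d) a = sc c a + sc d a" by (auto simp: fun_eq_iff distrib_right)
lemma sc_diff_left: "sc (c - d) a = sc c a - sc d a" by (auto simp: fun_eq_iff left_diff_distrib)
lemma sc_0 [simp]: "sc c 0 = 0" and sc_0_left [simp]: "sc 0 a = 0" and sc_1 [simp]: "sc 1 a = a"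
  by (auto simp: fun_eq_iff)
lemma sc_sc: "sc c (sc d a) = sc (c * d) a" by (auto simp: fun_eq_iff)
lemma sc_sum: "sc c (\<Sum>i\<in>A. g i) = (\<Sum>i\<in>A. sc c (g i))"
  by (auto simp: fun_eq_iff sum_distrib_left)
lemma sc_sum_left: "sc (\<Sum>i\<in>A. g i) a = (\<Sum>i\<in>A. sc (g i) a)"
  by (auto simp: fun_eq_iff sum_distrib_right)

context val_ring
begin

definition smod :: "('i \<Rightarrow> 'k) set \<Rightarrow> bool" where
  "smod N \<longleftrightarrow> 0 \<in> N \<and> (\<forall>a\<in>N. \<forall>b\<in>N. a + b \<in> N) \<and> (\<forall>c\<in>S. \<forall>a\<in>N. sc c a \<in> N)"

definition spn :: "('i \<Rightarrow> 'k) set \<Rightarrow> ('i \<Rightarrow> 'k) set" where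
  "spn B = {\<Sum>b\<in>B. sc (c b) b | c. \<forall>b\<in>B. c b \<in> S}"

text \<open>Coefficients range over the whole field. For finite \<open>B\<close> this agrees with
  independence over \<open>S\<close>, since a relation can be divided by its coefficient of least
  value.\<close>

definition indep :: "('i \<Rightarrow> 'k) set \<Rightarrow> bool" where
  "indep B \<longleftrightarrow> (\<forall>c. (\<Sum>b\<in>B. sc (c b) b) = 0 \<longrightarrow> (\<forall>b\<in>B. c b = 0))"

lemma smodD:
  assumes "smod N"
  shows "0 \<in> N" "a \<in> N \<Longrightarrow> b \<in> N \<Longrightarrow> a + b \<in> N" "c \<in> S \<Longrightarrow> a \<in> N \<Longrightarrow> sc c a \<in> N"
    "a \<in> N \<Longrightarrow> b \<in> N \<Longrightarrow> a - b \<in> N"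
proof -
  show *: "0 \<in> N" "a \<in> N \<Longrightarrow> b \<in> N \<Longrightarrow> a + b \<in> N" "c \<in> S \<Longrightarrow> a \<in> N \<Longrightarrow> sc c a \<in> N" for a b c
    using assms by (auto simp: smod_def)
  have "sc (-1) b = - b" by (auto simp: fun_eq_iff)
  then show "a \<in> N \<Longrightarrow> b \<in> N \<Longrightarrow> a - b \<in> N" using *(2)[of a "- b"] *(3)[of "-1" b] by auto
qed

lemma smod_sum: "smod N \<Longrightarrow> (\<And>i. i \<in> A \<Longrightarrow> g i \<in> N) \<Longrightarrow> (\<Sum>i\<in>A. g i) \<in> N"
  by (induction A rule: infinite_finite_induct) (auto intro: smodD)

lemma smod_spn: "smod (spn B)"
  unfolding smod_def
proof (intro conjI ballI)
  show "0 \<in> spn B" unfolding spn_def by (rule CollectI, rule exI[of _ "\<lambda>_. 0"]) auto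
next
  fix a b assume "a \<in> spn B" "b \<in> spn B"
  then obtain c d where "\<forall>x\<in>B. c x \<in> S" "a = (\<Sum>x\<in>B. sc (c x) x)"
    "\<forall>x\<in>B. d x \<in> S" "b = (\<Sum>x\<in>B. sc (d x) x)" unfolding spn_def by blast
  then show "a + b \<in> spn B" unfolding spn_def
    by (intro CollectI exI[of _ "\<lambda>x. c x + d x"]) (auto simp: sc_add_left sum.distrib)
next
  fix r a assume "r \<in> S" "a \<in> spn B"
  then obtain c where "\<forall>x\<in>B. c x \<in> S" "a = (\<Sum>x\<in>B. sc (c x) x)" unfolding spn_def by blast
  then show "sc r a \<in> spn B" unfolding spn_def using \<open>r \<in> S\<close>
    by (intro CollectI exI[of _ "\<lambda>x. r * c x"]) (auto simp: sc_sum sc_sc)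
qed

lemma spn_base:
  assumes "finite B" "b \<in> B" shows "b \<in> spn B"
proof -
  have "(\<Sum>x\<in>B. sc (if x = b then 1 else 0) x) = (\<Sum>x\<in>B. if x = b then b else 0)"
    by (intro sum.cong) auto
  also have "\<dots> = b" using assms by simp
  finally show ?thesis unfolding spn_def
    by (intro CollectI exI[of _ "\<lambda>x. if x = b then 1 else 0"]) auto
qed

lemma spn_least: assumes "smod N" "B \<subseteq> N" shows "spn B \<subseteq> N"
proof
  fix a assume "a \<in> spn B"
  then obtain c where "\<forall>x\<in>B. c x \<in> S" "a = (\<Sum>x\<in>B. sc (c x) x)" unfolding spn_def by blast
  then show "a \<in> N" using smod_sum[OF assms(1), of B "\<lambda>x. sc (c x) x"] smodD(3)[OF assms(1)] assms(2) by auto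
qed

lemma spn_insertE:
  assumes "finite B" "b0 \<notin> B" "x \<in> spn (insert b0 B)"
  obtains c y where "c \<in> S" "y \<in> spn B" "x = sc c b0 + y"
proof -
  obtain c where c: "\<forall>x\<in>insert b0 B. c x \<in> S" "x = (\<Sum>x\<in>insert b0 B. sc (c x) x)"
    using assms(3) unfolding spn_def by blast
  have "(\<Sum>x\<in>B. sc (c x) x) \<in> spn B" unfolding spn_def using c(1) by blast
  moreover have "x = sc (c b0) b0 + (\<Sum>x\<in>B. sc (c x) x)" using assms c by simp
  ultimately show ?thesis using that c(1) by blast
qed

text \<open>Induction on the generators: as \<open>1 - \<omega> * c0\<close> is a unit, the equation
  for \<open>b0\<close> can be solved for \<open>b0\<close> modulo \<open>N\<close> and substituted
  into the others.\<close>

lemma nakayama: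
  assumes N: "smod N" and \<omega>: "\<omega> \<in> J" and "finite B"
    and "\<And>b. b \<in> B \<Longrightarrow> \<exists>n\<in>N. \<exists>y\<in>spn B. b = n + sc \<omega> y"
  shows "B \<subseteq> N"
  using assms(3,4)
proof (induction B rule: finite_induct)
  case (insert b0 B)
  note m = smodD[OF N] and s = smodD[OF smod_spn[of B]]
  have \<omega>S: "\<omega> \<in> S" using \<omega> by (rule J_S)
  obtain n0 y where n0: "n0 \<in> N" "y \<in> spn (insert b0 B)" "b0 = n0 + sc \<omega> y"
    using insert.prems[of b0] by blast
  obtain c0 y0 where c0: "c0 \<in> S" "y0 \<in> spn B" "y = sc c0 b0 + y0"
    using spn_insertE[OF insert.hyps n0(2)] .
  have "\<omega> * c0 \<in> J" using \<omega> c0 by (intro J_mult')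
  then have u1: "1 - \<omega> * c0 \<notin> J" using J_add[of "1 - \<omega> * c0" "\<omega> * c0"] by auto
  define u where "u = inverse (1 - \<omega> * c0)"
  have uS: "u \<in> S" unfolding u_def using u1 \<omega>S c0 by (intro unit_inverse) auto
  have b0: "b0 = sc u n0 + sc \<omega> (sc u y0)"
  proof -
    have "sc (1 - \<omega> * c0) b0 = n0 + sc \<omega> y0"
      using n0(3) c0(3) by (simp add: sc_add sc_sc sc_diff_left algebra_simps)
    then have "sc u (sc (1 - \<omega> * c0) b0) = sc u n0 + sc \<omega> (sc u y0)"
      by (simp add: sc_add sc_sc mult.commute)
    moreover have "u * (1 - \<omega> * c0) = 1" using unit_nz[OF u1] by (simp add: u_def)
    ultimately show ?thesis by (simp add: sc_sc)
  qed
  have "\<exists>n\<in>N. \<exists>y\<in>spn B. b = n + sc \<omega> y" if b: "b \<in> B" for b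
  proof -
    obtain n z where n: "n \<in> N" "z \<in> spn (insert b0 B)" "b = n + sc \<omega> z"
      using insert.prems[of b] b by blast
    obtain c y1 where c: "c \<in> S" "y1 \<in> spn B" "z = sc c b0 + y1"
      using spn_insertE[OF insert.hyps n(2)] .
    have "b = (n + sc (\<omega> * c) (sc u n0)) + sc \<omega> (sc (c * \<omega> * u) y0 + y1)"
    proof -
      have "sc (\<omega> * c) b0 = sc (\<omega> * c) (sc u n0) + sc (\<omega> * c) (sc \<omega> (sc u y0))"
        by (subst (1) b0) (rule sc_add)
      moreover have "b = n + (sc (\<omega> * c) b0 + sc \<omega> y1)" using n(3) c(3) by (simp add: sc_add sc_sc)
      ultimately show ?thesis by (simp add: sc_add sc_sc mult_ac add_ac)
    qed
    moreover have "n + sc (\<omega> * c) (sc u n0) \<in> N" using m n0 n c uS \<omega>S by auto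
    moreover have "sc (c * \<omega> * u) y0 + y1 \<in> spn B" using s c0 c uS \<omega>S by auto
    ultimately show ?thesis by blast
  qed
  then have BN: "B \<subseteq> N" by (rule insert.IH)
  then have "sc \<omega> (sc u y0) \<in> N" using spn_least[OF N BN] c0 m uS \<omega>S by auto
  then have "sc u n0 + sc \<omega> (sc u y0) \<in> N" using m n0 uS by auto
  then have "b0 \<in> N" using b0 by simp
  then show ?case using BN by blast
qed simp

text \<open>A unit coordinate can be divided by, so \<open>b0\<close> is recovered from
  \<open>i\<close> and the remaining generators.\<close>

lemma spn_exchange:
  assumes B: "finite B" "b0 \<in> B" and c: "\<forall>b\<in>B. c b \<in> S" "c b0 \<notin> J" and i: "i = (\<Sum>b\<in>B. sc (c b) b)"
  shows "spn (insert i (B - {b0})) = spn B"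
proof (rule antisym; rule spn_least[OF smod_spn])
  let ?B = "insert i (B - {b0})"
  have "i \<in> spn B" using c i unfolding spn_def by blast
  then show "?B \<subseteq> spn B" using B spn_base by auto
  note s = smodD[OF smod_spn[of ?B]]
  have base: "b \<in> spn ?B" if "b \<in> ?B" for b using that B by (intro spn_base) auto
  have "i = sc (c b0) b0 + (\<Sum>b\<in>B - {b0}. sc (c b) b)" using B i by (simp add: sum.remove)
  then have "sc (c b0) b0 = i - (\<Sum>b\<in>B - {b0}. sc (c b) b)" by simp
  moreover have "(\<Sum>b\<in>B - {b0}. sc (c b) b) \<in> spn ?B"
    using c s(3) base by (intro smod_sum[OF smod_spn]) auto
  ultimately have "sc (c b0) b0 \<in> spn ?B" using s(4)[OF base] by simp
  then have "sc (inverse (c b0)) (sc (c b0) b0) \<in> spn ?B"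
    using s(3)[OF unit_inverse] c B by blast
  then have "b0 \<in> spn ?B" using unit_nz[OF c(2)] by (simp add: sc_sc)
  then show "B \<subseteq> spn ?B" using base by auto
qed

text \<open>A generating set of minimal size is a basis; if moreover it meets \<open>N\<close> in as many elements as
  possible, an element of \<open>N\<close> with a unit coordinate outside \<open>N\<close> could be exchanged into it.\<close>

lemma adapted_basis:
  assumes "finite B0" "N \<subseteq> spn B0"
  obtains B where "finite B" "spn B = spn B0" "indep B"
    "\<And>i c b. i \<in> N \<Longrightarrow> \<forall>b\<in>B. c b \<in> S \<Longrightarrow> i = (\<Sum>b\<in>B. sc (c b) b) \<Longrightarrow> b \<in> B - N \<Longrightarrow> c b \<in> J"
proof -
  let ?P = "\<lambda>B. finite B \<and> spn B = spn B0"
  obtain B1 where B1: "?P B1" "\<And>C. ?P C \<Longrightarrow> card B1 \<le> card C"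
    using ex_has_least_nat[of ?P B0 card] assms(1) by blast
  let ?R = "\<lambda>B. ?P B \<and> card B = card B1"
  obtain B where B: "?R B" and max: "\<And>C. ?R C \<Longrightarrow> card (B - N) \<le> card (C - N)"
    using ex_has_least_nat[of ?R B1 "\<lambda>B. card (B - N)"] B1(1) by blast
  have min: "card B \<le> card C" if "finite C" "spn C = spn B" for C using B1(2)[of C] B that by auto
  have fin: "finite B" using B by blast
  have "c b \<in> J" if h: "i \<in> N" "\<forall>b\<in>B. c b \<in> S" "i = (\<Sum>b\<in>B. sc (c b) b)" "b \<in> B - N" for i c b
  proof (rule ccontr)
    assume n: "c b \<notin> J"
    let ?C = "insert i (B - {b})"
    have bB: "b \<in> B" "b \<notin> N" using h by auto
    have sp: "spn ?C = spn B" using spn_exchange[OF fin bB(1) h(2) n h(3)] .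
    have finC: "finite ?C" using fin by simp
    have cB: "Suc (card (B - {b})) = card B" using fin bB by (intro card_Suc_Diff1)
    have "card B \<le> card ?C" using min finC sp by blast
    moreover have "card ?C \<le> Suc (card (B - {b}))" using fin card_insert_if[of "B - {b}" i] by auto
    ultimately have "card ?C = card B" using cB by simp
    then have "card (B - N) \<le> card (?C - N)" using max[of ?C] B sp finC by auto
    moreover have "?C - N = (B - N) - {b}" using h by auto
    moreover have "card ((B - N) - {b}) < card (B - N)" using fin h(4) by (intro card_Diff1_less) auto
    ultimately show False by simp
  qed
  moreover have "indep B" unfolding indep_def
  proof (intro allI impI ballI, rule ccontr)
    fix c b1 assume z: "(\<Sum>b\<in>B. sc (c b) b) = 0" and b1: "b1 \<in> B" "c b1 \<noteq> 0"
    \<comment> \<open>Dividing a relation by its coefficient of least value writes \<open>b0\<close>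
      through the other generators over \<open>S\<close>, against the minimal number of
      generators.\<close>
    obtain b0 where b0: "b0 \<in> B" "c b0 \<noteq> 0" "\<And>b. b \<in> B \<Longrightarrow> c b / c b0 \<in> S"
      using finite_min[OF fin, of c] b1 by metis
    have "sc (1 / c b0) (\<Sum>b\<in>B. sc (c b) b) = 0" using z by simp
    then have "(\<Sum>b\<in>B. sc (c b / c b0) b) = 0" by (simp add: sc_sum sc_sc)
    then have "b0 + (\<Sum>b\<in>B - {b0}. sc (c b / c b0) b) = 0" using sum.remove[OF fin b0(1), of "\<lambda>b. sc (c b / c b0) b"] b0(2) by simp
    then have "b0 = 0 - (\<Sum>b\<in>B - {b0}. sc (c b / c b0) b)" by (simp add: eq_neg_iff_add_eq_0)
    also have "\<dots> \<in> spn (B - {b0})"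
    proof (rule smodD(4)[OF smod_spn smodD(1)[OF smod_spn]], rule smod_sum[OF smod_spn])
      fix b assume "b \<in> B - {b0}"
      then show "sc (c b / c b0) b \<in> spn (B - {b0})"
        using b0(3) fin spn_base[of "B - {b0}" b] smodD(3)[OF smod_spn] by auto
    qed
    finally have "B \<subseteq> spn (B - {b0})" using spn_base[of "B - {b0}"] fin by auto
    then have "spn B \<subseteq> spn (B - {b0})" by (rule spn_least[OF smod_spn])
    moreover have "spn (B - {b0}) \<subseteq> spn B" using spn_base[OF fin] by (intro spn_least[OF smod_spn]) auto
    ultimately have "card B \<le> card (B - {b0})" using min[of "B - {b0}"] fin by auto
    then show False using fin b0(1) card_Diff1_less[of B b0] by simp
  qed
  moreover have "spn B = spn B0" using B by blast
  ultimately show ?thesis using that fin by blast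
qed

lemma indep_unique:
  assumes "indep B" "(\<Sum>b\<in>B. sc (c b) b) = (\<Sum>b\<in>B. sc (d b) b)" "b \<in> B"
  shows "c b = d b"
proof -
  have "(\<Sum>b\<in>B. sc (c b - d b) b) = 0" using assms(2) by (simp add: sc_diff_left sum_subtractf)
  from assms(1)[unfolded indep_def, rule_format, OF this assms(3)] have "c b - d b = 0" .
  then show ?thesis by simp
qed

definition coord :: "('i \<Rightarrow> 'k) set \<Rightarrow> ('i \<Rightarrow> 'k) \<Rightarrow> ('i \<Rightarrow> 'k) \<Rightarrow> 'k" where
  "coord B x = (SOME c. (\<forall>b\<in>B. c b \<in> S) \<and> x = (\<Sum>b\<in>B. sc (c b) b))"

lemma coord:
  assumes "x \<in> spn B"
  shows "\<And>b. b \<in> B \<Longrightarrow> coord B x b \<in> S" "x = (\<Sum>b\<in>B. sc (coord B x b) b)"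
proof -
  have "\<exists>c. (\<forall>b\<in>B. c b \<in> S) \<and> x = (\<Sum>b\<in>B. sc (c b) b)" using assms unfolding spn_def by blast
  then have "(\<forall>b\<in>B. coord B x b \<in> S) \<and> x = (\<Sum>b\<in>B. sc (coord B x b) b)"
    unfolding coord_def by (rule someI_ex)
  then show "\<And>b. b \<in> B \<Longrightarrow> coord B x b \<in> S" "x = (\<Sum>b\<in>B. sc (coord B x b) b)" by blast+
qed

lemma coord_eq:
  assumes "indep B" "\<forall>b\<in>B. c b \<in> S" "x = (\<Sum>b\<in>B. sc (c b) b)" "b \<in> B"
  shows "coord B x b = c b"
proof -
  have "x \<in> spn B" using assms unfolding spn_def by blast
  then have "(\<Sum>b\<in>B. sc (coord B x b) b) = (\<Sum>b\<in>B. sc (c b) b)" using coord(2) assms(3) by metis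
  then show ?thesis by (rule indep_unique[OF assms(1) _ assms(4)])
qed

lemma coord_add:
  assumes "indep B" "x \<in> spn B" "y \<in> spn B" "b \<in> B"
  shows "coord B (x + y) b = coord B x b + coord B y b"
proof (rule coord_eq[OF assms(1) _ _ assms(4)])
  show "\<forall>b\<in>B. coord B x b + coord B y b \<in> S" using coord(1)[OF assms(2)] coord(1)[OF assms(3)] by blast
  show "x + y = (\<Sum>b\<in>B. sc (coord B x b + coord B y b) b)"
    unfolding sc_add_left sum.distrib using coord(2)[OF assms(2)] coord(2)[OF assms(3)] by simp
qed

lemma coord_sc:
  assumes "indep B" "x \<in> spn B" "r \<in> S" "b \<in> B"
  shows "coord B (sc r x) b = r * coord B x b"
proof (rule coord_eq[OF assms(1) _ _ assms(4)])
  show "\<forall>b\<in>B. r * coord B x b \<in> S" using coord(1)[OF assms(2)] assms(3) by blast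
  have "sc r x = sc r (\<Sum>b\<in>B. sc (coord B x b) b)" using coord(2)[OF assms(2)] by metis
  then show "sc r x = (\<Sum>b\<in>B. sc (r * coord B x b) b)" by (simp add: sc_sum sc_sc)
qed

end

section \<open>The crossed product order\<close>

abbreviation (input) "iv \<equiv> Hilbert_Choice.inv"

lemma comp_iv:
  assumes "aut_group G" "\<sigma> \<in> G"
  shows "\<sigma> \<circ> (iv \<sigma> \<circ> \<tau>) = \<tau>" "iv \<sigma> \<circ> (\<sigma> \<circ> \<tau>) = \<tau>" "(\<tau> \<circ> \<sigma>) \<circ> iv \<sigma> = \<tau>" "(\<tau> \<circ> iv \<sigma>) \<circ> \<sigma> = \<tau>"
  using aut_groupD(7,8)[OF assms] by (auto simp: o_assoc) (auto simp: o_assoc[symmetric])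

locale crossed = val_ring S for S :: "'k::field set" +
  fixes G :: "('k \<Rightarrow> 'k) set" and f :: "('k \<Rightarrow> 'k) \<Rightarrow> ('k \<Rightarrow> 'k) \<Rightarrow> 'k" and \<omega> :: 'k
  assumes autG: "aut_group G" and finG: "finite G"
    and GS: "\<sigma> \<in> G \<Longrightarrow> x \<in> S \<Longrightarrow> \<sigma> x \<in> S"
    and J_eq: "J = {\<omega> * s | s. s \<in> S}"
    and coc: "normalized_cocycle G S f"
begin

lemmas G = aut_groupD[OF autG]
lemmas G_iv = comp_iv[OF autG]

lemma \<omega>: "\<omega> \<in> J" "\<omega> \<in> S"
proof -
  have "\<omega> = \<omega> * 1" by simp
  then show "\<omega> \<in> J" unfolding J_eq by blast
  then show "\<omega> \<in> S" by (rule J_S)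
qed

lemma in_J_iff: "x \<in> J \<longleftrightarrow> (\<exists>s\<in>S. x = \<omega> * s)" using J_eq by blast

lemma GJ: assumes "\<sigma> \<in> G" "x \<in> J" shows "\<sigma> x \<in> J"
proof -
  note a = field_aut_simps[OF G(4)[OF assms(1)]]
  have "iv \<sigma> (inverse (\<sigma> x)) = inverse x" using G(6)[OF assms(1), of "inverse x"] a by simp
  then have "inverse x \<in> S" if "inverse (\<sigma> x) \<in> S" using GS[OF G(3)[OF assms(1)] that] by simp
  then show ?thesis using assms GS a unfolding nonunits_def by auto
qed

lemma GJ_iff: assumes "\<sigma> \<in> G" shows "\<sigma> x \<in> J \<longleftrightarrow> x \<in> J"
  using GJ[OF assms] GJ[OF G(3)[OF assms], of "\<sigma> x"] G(6)[OF assms] by auto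

lemma pow_G: "\<sigma> \<in> G \<Longrightarrow> \<sigma> ^^ k \<in> G"
  by (induction k) (auto intro: G(1,2))

lemma f_S: "\<sigma> \<in> G \<Longrightarrow> \<tau> \<in> G \<Longrightarrow> f \<sigma> \<tau> \<in> S" and f_nz: "\<sigma> \<in> G \<Longrightarrow> \<tau> \<in> G \<Longrightarrow> f \<sigma> \<tau> \<noteq> 0"
  and f_id [simp]: "\<sigma> \<in> G \<Longrightarrow> f id \<sigma> = 1" "\<sigma> \<in> G \<Longrightarrow> f \<sigma> id = 1"
  and cocycle: "\<sigma> \<in> G \<Longrightarrow> \<tau> \<in> G \<Longrightarrow> \<gamma> \<in> G \<Longrightarrow> \<sigma> (f \<tau> \<gamma>) * f \<sigma> (\<tau> \<circ> \<gamma>) = f \<sigma> \<tau> * f (\<sigma> \<circ> \<tau>) \<gamma>"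
  using coc unfolding normalized_cocycle_def by auto

text \<open>The cocycle identity at \<sigma>, \<tau>, \<tau>\<inverse>. It makes
  \<open>f \<sigma> \<tau>\<close> a divisor of a conjugate of \<open>f \<tau> (iv \<tau>)\<close>,
  so that being a unit, or lying outside the square of \<open>J\<close>, can be tested on these
  diagonal values.\<close>

lemma f_right_dvd: "\<sigma> \<in> G \<Longrightarrow> \<tau> \<in> G \<Longrightarrow> \<sigma> (f \<tau> (iv \<tau>)) = f \<sigma> \<tau> * f (\<sigma> \<circ> \<tau>) (iv \<tau>)"
  using cocycle[of \<sigma> \<tau> "iv \<tau>"] G(3,7) by simp

lemma f_left_dvd: "\<sigma> \<in> G \<Longrightarrow> \<tau> \<in> G \<Longrightarrow> f (iv \<sigma>) \<sigma> = iv \<sigma> (f \<sigma> \<tau>) * f (iv \<sigma>) (\<sigma> \<circ> \<tau>)"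
  using cocycle[of "iv \<sigma>" \<sigma> \<tau>] G(3,8) by simp

lemma f_inv_swap: "\<sigma> \<in> G \<Longrightarrow> \<sigma> (f (iv \<sigma>) \<sigma>) = f \<sigma> (iv \<sigma>)"
  using cocycle[of \<sigma> "iv \<sigma>" \<sigma>] G(3,7,8) by simp

definition mul where
  "mul a b = (\<lambda>\<rho>. if \<rho> \<in> G then (\<Sum>\<sigma>\<in>G. a \<sigma> * \<sigma> (b (iv \<sigma> \<circ> \<rho>)) * f \<sigma> (iv \<sigma> \<circ> \<rho>)) else 0)"

definition mon :: "'k \<Rightarrow> ('k \<Rightarrow> 'k) \<Rightarrow> ('k \<Rightarrow> 'k) \<Rightarrow> 'k" where
  "mon c \<alpha> = (\<lambda>\<rho>. if \<rho> = \<alpha> then c else 0)"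

text \<open>The crossed product algebra over the whole field. Computations take place here, because
  the inverse of a homogeneous element need not be integral.\<close>

definition "Q = {a :: ('k \<Rightarrow> 'k) \<Rightarrow> 'k. \<forall>\<sigma>. \<sigma> \<notin> G \<longrightarrow> a \<sigma> = 0}"
definition "AC = {a \<in> Q. \<forall>\<sigma>\<in>G. a \<sigma> \<in> S}"

abbreviation "A \<equiv> crossed_product G S f"

lemma A_simps [simp]: "carrier A = AC" "monoid.mult A = mul" "add A = (+)" "zero A = 0" "one A = mon 1 id"
  by (auto simp: crossed_product_def AC_def Q_def mul_def[abs_def] mon_def fun_eq_iff)

lemma xbasis_mon: "xbasis \<sigma> = mon 1 \<sigma>" by (simp add: xbasis_def mon_def)

lemma mul_apply: "\<rho> \<in> G \<Longrightarrow> mul a b \<rho> = (\<Sum>\<sigma>\<in>G. a \<sigma> * \<sigma> (b (iv \<sigma> \<circ> \<rho>)) * f \<sigma> (iv \<sigma> \<circ> \<rho>))"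
  by (simp add: mul_def)

lemma mul_Q [simp]: "mul a b \<in> Q" by (simp add: Q_def mul_def)

lemma Q_eqI: "a \<in> Q \<Longrightarrow> b \<in> Q \<Longrightarrow> (\<And>\<rho>. \<rho> \<in> G \<Longrightarrow> a \<rho> = b \<rho>) \<Longrightarrow> a = b"
  by (rule ext) (metis (mono_tags, lifting) Q_def mem_Collect_eq)

lemma Q_closed [simp]: "0 \<in> Q" "a \<in> Q \<Longrightarrow> b \<in> Q \<Longrightarrow> a + b \<in> Q" "a \<in> Q \<Longrightarrow> b \<in> Q \<Longrightarrow> a - b \<in> Q"
   "a \<in> Q \<Longrightarrow> sc c a \<in> Q" "\<alpha> \<in> G \<Longrightarrow> mon c \<alpha> \<in> Q" "a \<in> Q \<Longrightarrow> - a \<in> Q"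
  by (auto simp: Q_def mon_def)

lemma Q_sum: "(\<And>i. i \<in> B \<Longrightarrow> g i \<in> Q) \<Longrightarrow> (\<Sum>i\<in>B. g i) \<in> Q"
  by (induction B rule: infinite_finite_induct) auto

lemma AC_Q: "a \<in> AC \<Longrightarrow> a \<in> Q" and AC_S: "a \<in> AC \<Longrightarrow> \<sigma> \<in> G \<Longrightarrow> a \<sigma> \<in> S"
  by (auto simp: AC_def)

lemma mon_AC: "c \<in> S \<Longrightarrow> \<alpha> \<in> G \<Longrightarrow> mon c \<alpha> \<in> AC"
  by (auto simp: AC_def Q_def mon_def)

lemma AC_mul: "a \<in> AC \<Longrightarrow> b \<in> AC \<Longrightarrow> mul a b \<in> AC"
  unfolding AC_def using G(2,3) GS f_S by (auto simp: mul_apply intro!: S_sum)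

lemma AC_closed: "0 \<in> AC" "a \<in> AC \<Longrightarrow> b \<in> AC \<Longrightarrow> a + b \<in> AC" "a \<in> AC \<Longrightarrow> b \<in> AC \<Longrightarrow> a - b \<in> AC"
   "a \<in> AC \<Longrightarrow> c \<in> S \<Longrightarrow> sc c a \<in> AC"
  by (auto simp: AC_def)

lemma smod_AC: "smod AC" using AC_closed by (auto simp: smod_def)

lemma aut_G:
  assumes "\<sigma> \<in> G"
  shows "\<sigma> (x + y) = \<sigma> x + \<sigma> y" "\<sigma> (x * y) = \<sigma> x * \<sigma> y" "\<sigma> 0 = 0" "\<sigma> 1 = 1"
    "\<sigma> (x - y) = \<sigma> x - \<sigma> y" "\<sigma> (inverse x) = inverse (\<sigma> x)" "\<sigma> (sum g B) = (\<Sum>i\<in>B. \<sigma> (g i))"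
    "\<sigma> x = 0 \<longleftrightarrow> x = 0" "\<sigma> (x / y) = \<sigma> x / \<sigma> y"
  using field_aut_simps[OF G(4)[OF assms]] field_aut_sum[OF G(4)[OF assms]] by auto

lemma mul_add_left: "mul (a + b) c = mul a c + mul b c"
  by (auto simp: fun_eq_iff mul_def distrib_right sum.distrib)

lemma mul_add_right: "mul a (b + c) = mul a b + mul a c"
proof (rule Q_eqI)
  fix \<rho> assume \<rho>: "\<rho> \<in> G"
  have "mul a (b + c) \<rho> = (\<Sum>\<sigma>\<in>G. a \<sigma> * \<sigma> (b (iv \<sigma> \<circ> \<rho>)) * f \<sigma> (iv \<sigma> \<circ> \<rho>) + a \<sigma> * \<sigma> (c (iv \<sigma> \<circ> \<rho>)) * f \<sigma> (iv \<sigma> \<circ> \<rho>))"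
    unfolding mul_apply[OF \<rho>] by (intro sum.cong refl) (simp add: aut_G(1) algebra_simps)
  then show "mul a (b + c) \<rho> = (mul a b + mul a c) \<rho>" using \<rho> by (simp add: mul_apply sum.distrib)
qed auto

lemma mul_0 [simp]: "mul 0 a = 0" "mul a 0 = 0"
proof -
  show "mul 0 a = 0" by (auto simp: fun_eq_iff mul_def)
  have "mul a 0 + mul a 0 = mul a 0" using mul_add_right[of a 0 0] by simp
  then show "mul a 0 = 0" by simp
qed

lemma mul_diff_right: "mul a (b - c) = mul a b - mul a c"
  using mul_add_right[of a "b - c" c] by (simp add: eq_diff_eq)

lemma mul_sum_left: "mul (\<Sum>i\<in>B. g i) c = (\<Sum>i\<in>B. mul (g i) c)"
  by (induction B rule: infinite_finite_induct)
    (simp_all only: sum.infinite sum.empty sum.insert mul_0 mul_add_left not_False_eq_True)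

lemma mul_sum_right: "mul a (\<Sum>i\<in>B. g i) = (\<Sum>i\<in>B. mul a (g i))"
  by (induction B rule: infinite_finite_induct)
    (simp_all only: sum.infinite sum.empty sum.insert mul_0 mul_add_right not_False_eq_True)

lemma mul_sc: "mul (sc c a) b = sc c (mul a b)"
  by (auto simp: fun_eq_iff mul_def sum_distrib_left mult.assoc)

text \<open>Substituting \<tau> = \<sigma>\<gamma> in the double sum reduces associativity to the
  cocycle identity for \<sigma>, \<gamma>, \<delta>, where \<sigma>\<gamma>\<delta> =
  \<rho>.\<close>

lemma mul_assoc: "mul (mul a b) c = mul a (mul b c)"
proof (rule Q_eqI)
  fix \<rho> assume \<rho>: "\<rho> \<in> G"
  have "mul (mul a b) c \<rho> = (\<Sum>\<tau>\<in>G. \<Sum>\<sigma>\<in>G. a \<sigma> * \<sigma> (b (iv \<sigma> \<circ> \<tau>)) * f \<sigma> (iv \<sigma> \<circ> \<tau>) * \<tau> (c (iv \<tau> \<circ> \<rho>)) * f \<tau> (iv \<tau> \<circ> \<rho>))"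
    unfolding mul_apply[OF \<rho>] by (intro sum.cong refl) (simp add: mul_apply sum_distrib_right)
  also have "\<dots> = (\<Sum>\<sigma>\<in>G. \<Sum>\<tau>\<in>G. a \<sigma> * \<sigma> (b (iv \<sigma> \<circ> \<tau>)) * f \<sigma> (iv \<sigma> \<circ> \<tau>) * \<tau> (c (iv \<tau> \<circ> \<rho>)) * f \<tau> (iv \<tau> \<circ> \<rho>))"
    by (rule sum.swap)
  also have "\<dots> = mul a (mul b c) \<rho>"
    unfolding mul_apply[OF \<rho>, of a]
  proof (intro sum.cong refl)
    fix \<sigma> assume \<sigma>: "\<sigma> \<in> G"
    have \<sigma>\<rho>: "iv \<sigma> \<circ> \<rho> \<in> G" using G(2,3) \<sigma> \<rho> by blast
    let ?F = "\<lambda>\<tau>. a \<sigma> * \<sigma> (b (iv \<sigma> \<circ> \<tau>)) * f \<sigma> (iv \<sigma> \<circ> \<tau>) * \<tau> (c (iv \<tau> \<circ> \<rho>)) * f \<tau> (iv \<tau> \<circ> \<rho>)"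
    have "sum ?F G = (\<Sum>\<gamma>\<in>G. ?F (\<sigma> \<circ> \<gamma>))"
      using sum.reindex_bij_betw[OF aut_group_bij_left[OF autG \<sigma>], of ?F] by simp
    also have "\<dots> = (\<Sum>\<gamma>\<in>G. a \<sigma> * \<sigma> (b \<gamma> * \<gamma> (c (iv \<gamma> \<circ> (iv \<sigma> \<circ> \<rho>))) * f \<gamma> (iv \<gamma> \<circ> (iv \<sigma> \<circ> \<rho>))) * f \<sigma> (iv \<sigma> \<circ> \<rho>))"
    proof (intro sum.cong refl)
      fix \<gamma> assume \<gamma>: "\<gamma> \<in> G"
      let ?\<delta> = "iv \<gamma> \<circ> (iv \<sigma> \<circ> \<rho>)"
      have \<delta>: "?\<delta> \<in> G" using G(2,3) \<gamma> \<sigma>\<rho> by blast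
      have 1: "iv (\<sigma> \<circ> \<gamma>) \<circ> \<rho> = ?\<delta>" using G(10)[OF \<sigma> \<gamma>] by (simp add: o_assoc)
      have 2: "\<sigma> (f \<gamma> ?\<delta>) * f \<sigma> (iv \<sigma> \<circ> \<rho>) = f \<sigma> \<gamma> * f (\<sigma> \<circ> \<gamma>) ?\<delta>"
        using cocycle[OF \<sigma> \<gamma> \<delta>] G_iv(1)[OF \<gamma>] by simp
      have "?F (\<sigma> \<circ> \<gamma>) = a \<sigma> * \<sigma> (b \<gamma>) * \<sigma> (\<gamma> (c ?\<delta>)) * (f \<sigma> \<gamma> * f (\<sigma> \<circ> \<gamma>) ?\<delta>)"
        unfolding 1 G_iv(2)[OF \<sigma>] by (simp add: mult_ac)
      then show "?F (\<sigma> \<circ> \<gamma>) = a \<sigma> * \<sigma> (b \<gamma> * \<gamma> (c ?\<delta>) * f \<gamma> ?\<delta>) * f \<sigma> (iv \<sigma> \<circ> \<rho>)"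
        unfolding 2[symmetric] by (simp add: aut_G(2)[OF \<sigma>] mult_ac)
    qed
    also have "\<dots> = a \<sigma> * \<sigma> (mul b c (iv \<sigma> \<circ> \<rho>)) * f \<sigma> (iv \<sigma> \<circ> \<rho>)"
      unfolding mul_apply[OF \<sigma>\<rho>] aut_G(7)[OF \<sigma>] by (simp add: sum_distrib_left sum_distrib_right)
    finally show "sum ?F G = a \<sigma> * \<sigma> (mul b c (iv \<sigma> \<circ> \<rho>)) * f \<sigma> (iv \<sigma> \<circ> \<rho>)" .
  qed
  finally show "mul (mul a b) c \<rho> = mul a (mul b c) \<rho>" .
qed auto

lemma mul_mon:
  assumes "\<alpha> \<in> G" "\<rho> \<in> G"
  shows "mul (mon c \<alpha>) b \<rho> = c * \<alpha> (b (iv \<alpha> \<circ> \<rho>)) * f \<alpha> (iv \<alpha> \<circ> \<rho>)"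
proof -
  have "mul (mon c \<alpha>) b \<rho> = (\<Sum>\<sigma>\<in>G. if \<sigma> = \<alpha> then c * \<alpha> (b (iv \<alpha> \<circ> \<rho>)) * f \<alpha> (iv \<alpha> \<circ> \<rho>) else 0)"
    unfolding mul_apply[OF assms(2)] by (intro sum.cong) (auto simp: mon_def)
  then show ?thesis using finG assms by simp
qed

lemma mon_mon:
  assumes "\<alpha> \<in> G" "\<beta> \<in> G"
  shows "mul (mon c \<alpha>) (mon d \<beta>) = mon (c * \<alpha> d * f \<alpha> \<beta>) (\<alpha> \<circ> \<beta>)"
proof (rule Q_eqI)
  fix \<rho> assume \<rho>: "\<rho> \<in> G"
  have "iv \<alpha> \<circ> \<rho> = \<beta> \<longleftrightarrow> \<rho> = \<alpha> \<circ> \<beta>" using G_iv(1,2)[OF assms(1)] by metis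
  then show "mul (mon c \<alpha>) (mon d \<beta>) \<rho> = mon (c * \<alpha> d * f \<alpha> \<beta>) (\<alpha> \<circ> \<beta>) \<rho>"
    unfolding mul_mon[OF assms(1) \<rho>] using aut_G(3)[OF assms(1)] by (auto simp: mon_def)
qed (use G(2) assms in auto)

lemma mon_id_mul: assumes "a \<in> Q" shows "mul (mon c id) a = sc c a"
  using assms G(1) by (intro Q_eqI) (auto simp: mul_mon)

lemma Q_decomp: assumes "a \<in> Q" shows "a = (\<Sum>\<alpha>\<in>G. mon (a \<alpha>) \<alpha>)"
proof (rule Q_eqI[OF assms])
  fix \<rho> assume "\<rho> \<in> G"
  then show "a \<rho> = (\<Sum>\<alpha>\<in>G. mon (a \<alpha>) \<alpha>) \<rho>" using finG by (simp add: mon_def)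
qed (auto intro: Q_sum)

lemma mul_one: assumes "a \<in> Q" shows "mul a (mon 1 id) = a" "mul (mon 1 id) a = a"
proof -
  have "mul a (mon 1 id) = (\<Sum>\<alpha>\<in>G. mul (mon (a \<alpha>) \<alpha>) (mon 1 id))"
    by (subst Q_decomp[OF assms]) (rule mul_sum_left)
  also have "\<dots> = (\<Sum>\<alpha>\<in>G. mon (a \<alpha>) \<alpha>)" using G(1) by (intro sum.cong) (auto simp: mon_mon aut_G(4))
  finally show "mul a (mon 1 id) = a" using Q_decomp[OF assms] by simp
  show "mul (mon 1 id) a = a" using mon_id_mul[OF assms] by simp
qed

lemma ring_A: "ring A"
proof (rule ringI)
  show "abelian_group A"
  proof (rule abelian_groupI)
    fix a assume "a \<in> carrier A"
    then show "\<exists>b\<in>carrier A. b \<oplus>\<^bsub>A\<^esub> a = \<zero>\<^bsub>A\<^esub>"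
      using AC_closed(1) AC_closed(3)[of 0 a] by (intro bexI[of _ "0 - a"]) auto
  qed (auto intro: AC_closed simp: add_ac)
  show "monoid A"
    by (rule monoidI) (auto intro: AC_mul mon_AC G(1) simp: mul_assoc mul_one AC_Q)
qed (auto simp: mul_add_left mul_add_right)

lemma A_minus: assumes "a \<in> AC" "b \<in> AC" shows "a \<ominus>\<^bsub>A\<^esub> b = a - b"
proof -
  interpret ring A by (rule ring_A)
  have "\<ominus>\<^bsub>A\<^esub> b = 0 - b" using assms AC_closed(1) AC_closed(3)[of 0 b] by (intro minus_equality) auto
  then show ?thesis by (simp add: a_minus_def)
qed

lemma left_ideal_A:
  "left_ideal A I \<longleftrightarrow> I \<subseteq> AC \<and> 0 \<in> I \<and> (\<forall>x\<in>I. \<forall>y\<in>I. x + y \<in> I \<and> x - y \<in> I)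
     \<and> (\<forall>r\<in>AC. \<forall>x\<in>I. mul r x \<in> I)"
proof (cases "I \<subseteq> AC")
  case True
  then have "\<forall>x\<in>I. \<forall>y\<in>I. x \<ominus>\<^bsub>A\<^esub> y = x - y" using A_minus by blast
  then show ?thesis unfolding left_ideal_def by simp
qed (simp add: left_ideal_def)

lemma left_idealD:
  assumes "left_ideal A I"
  shows "I \<subseteq> AC" "0 \<in> I" "x \<in> I \<Longrightarrow> y \<in> I \<Longrightarrow> x + y \<in> I" "x \<in> I \<Longrightarrow> y \<in> I \<Longrightarrow> x - y \<in> I"
    "r \<in> AC \<Longrightarrow> x \<in> I \<Longrightarrow> mul r x \<in> I" "c \<in> S \<Longrightarrow> x \<in> I \<Longrightarrow> sc c x \<in> I" "smod I"
proof -
  show *: "I \<subseteq> AC" "0 \<in> I" "x \<in> I \<Longrightarrow> y \<in> I \<Longrightarrow> x + y \<in> I" "x \<in> I \<Longrightarrow> y \<in> I \<Longrightarrow> x - y \<in> I"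
    "r \<in> AC \<Longrightarrow> x \<in> I \<Longrightarrow> mul r x \<in> I" for x y r using assms[unfolded left_ideal_A] by auto
  show "c \<in> S \<Longrightarrow> x \<in> I \<Longrightarrow> sc c x \<in> I" for c x
    using *(5)[OF mon_AC[OF _ G(1)], of c x] mon_id_mul[of x c] *(1) AC_Q by auto
  then show "smod I" using * by (auto simp: smod_def)
qed

lemma left_idealI:
  assumes "smod I" "I \<subseteq> AC" "\<And>\<alpha> x. \<alpha> \<in> G \<Longrightarrow> x \<in> I \<Longrightarrow> mul (mon 1 \<alpha>) x \<in> I"
  shows "left_ideal A I"
proof -
  have "mul r x \<in> I" if "r \<in> AC" "x \<in> I" for r x
  proof -
    have "r = (\<Sum>\<alpha>\<in>G. sc (r \<alpha>) (mon 1 \<alpha>))"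
      by (subst Q_decomp[OF AC_Q[OF that(1)]]) (auto intro!: sum.cong simp: fun_eq_iff mon_def)
    then have "mul r x = (\<Sum>\<alpha>\<in>G. sc (r \<alpha>) (mul (mon 1 \<alpha>) x))" by (metis (no_types, lifting) mul_sc mul_sum_left sum.cong)
    also have "\<dots> \<in> I" using smodD(3)[OF assms(1)] AC_S[OF that(1)] assms(3) that(2)
      by (intro smod_sum[OF assms(1)]) auto
    finally show ?thesis .
  qed
  then have "\<forall>r\<in>AC. \<forall>x\<in>I. mul r x \<in> I" by blast
  moreover have "\<forall>x\<in>I. \<forall>y\<in>I. x + y \<in> I \<and> x - y \<in> I" using smodD(2,4)[OF assms(1)] by blast
  ultimately show ?thesis unfolding left_ideal_A using smodD(1)[OF assms(1)] assms(2) by simp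
qed

text \<open>The inverse of \<open>x\<^sub>\<alpha>\<close> in the algebra over the field; it is
  integral exactly for \<alpha> in \<open>H\<close>.\<close>

definition u :: "('k \<Rightarrow> 'k) \<Rightarrow> ('k \<Rightarrow> 'k) \<Rightarrow> 'k" where
  "u \<alpha> = mon (inverse (f (iv \<alpha>) \<alpha>)) (iv \<alpha>)"

lemma mul_u: assumes "\<alpha> \<in> G" shows "mul (mon c \<alpha>) (u \<alpha>) = mon c id"
proof -
  have "\<alpha> (inverse (f (iv \<alpha>) \<alpha>)) * f \<alpha> (iv \<alpha>) = 1"
    using aut_G(6)[OF assms] f_inv_swap[OF assms] f_nz[OF assms G(3)[OF assms]] by simp
  then show ?thesis unfolding u_def using G(3,7)[OF assms] by (simp add: mon_mon assms mult.assoc)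
qed

text \<open>With \<gamma> = \<beta>\<inverse>\<rho>, the product of \<open>x\<^sub>\<beta>\<close>
  and \<open>x\<^sub>\<gamma>\<close> is \<open>f \<beta> \<gamma>\<close> times
  \<open>x\<^sub>\<rho>\<close>; multiplying by the inverses on both sides gives the formula. It is
  the substitution rule that makes averages \<open>A\<close>-linear.\<close>

lemma u_mon:
  assumes \<rho>: "\<rho> \<in> G" and \<beta>: "\<beta> \<in> G"
  shows "mul (u \<rho>) (mon t \<beta>) = sc (iv \<rho> (t * f \<beta> (iv \<beta> \<circ> \<rho>))) (u (iv \<beta> \<circ> \<rho>))"
proof -
  let ?\<gamma> = "iv \<beta> \<circ> \<rho>"
  have g: "iv \<rho> \<in> G" "iv \<beta> \<in> G" "?\<gamma> \<in> G" "iv \<rho> \<circ> \<beta> \<in> G" using G(2,3) \<rho> \<beta> by blast+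
  have iv: "iv ?\<gamma> = iv \<rho> \<circ> \<beta>" using G(10)[OF g(2) \<rho>] G(9)[OF \<beta>] by simp
  have c: "iv \<rho> (f \<beta> ?\<gamma>) * f (iv \<rho>) \<rho> = f (iv \<rho>) \<beta> * f (iv \<rho> \<circ> \<beta>) ?\<gamma>"
    using cocycle[OF g(1) \<beta> g(3)] G_iv(1)[OF \<beta>] by simp
  have nz: "f (iv \<rho>) \<rho> \<noteq> 0" "f (iv \<rho> \<circ> \<beta>) ?\<gamma> \<noteq> 0" using f_nz g \<rho> by blast+
  have "inverse (f (iv \<rho>) \<rho>) * iv \<rho> t * f (iv \<rho>) \<beta> = iv \<rho> t * iv \<rho> (f \<beta> ?\<gamma>) * inverse (f (iv \<rho> \<circ> \<beta>) ?\<gamma>)"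
    using c nz by (simp add: field_simps)
  then show ?thesis unfolding u_def iv
    by (simp add: mon_mon g \<beta> aut_G(2)[OF g(1)]) (simp add: fun_eq_iff mon_def)
qed

section \<open>The subgroup of degrees with invertible basis elements\<close>

definition "H = {\<sigma> \<in> G. f \<sigma> (iv \<sigma>) \<notin> J}"

lemma H_G: "h \<in> H \<Longrightarrow> h \<in> G" by (simp add: H_def)

lemma H_inv: assumes "h \<in> H" shows "iv h \<in> H"
proof -
  have h: "h \<in> G" "f h (iv h) \<notin> J" using assms by (auto simp: H_def)
  have "h (f (iv h) h) \<notin> J" using f_inv_swap[OF h(1)] h by simp
  then have "f (iv h) h \<notin> J" using GJ_iff[OF h(1)] by simp
  then show ?thesis using G(3,9)[OF h(1)] by (simp add: H_def)
qed

lemma f_H_right: assumes "h \<in> H" "\<sigma> \<in> G" shows "f \<sigma> h \<notin> J"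
proof -
  have h: "h \<in> G" "f h (iv h) \<notin> J" using assms by (auto simp: H_def)
  have "\<sigma> (f h (iv h)) \<notin> J" using GJ_iff[OF assms(2)] h by simp
  then have "f \<sigma> h * f (\<sigma> \<circ> h) (iv h) \<notin> J" using f_right_dvd[OF assms(2) h(1)] by simp
  then show ?thesis using unit_mult f_S G(2,3) h assms by metis
qed

lemma f_H_left: assumes "h \<in> H" "\<sigma> \<in> G" shows "f h \<sigma> \<notin> J"
proof -
  have h: "h \<in> G" using assms by (auto simp: H_def)
  have "f (iv h) h \<notin> J" using H_inv[OF assms(1)] G(9)[OF h] by (simp add: H_def)
  then have "iv h (f h \<sigma>) * f (iv h) (h \<circ> \<sigma>) \<notin> J" using f_left_dvd[OF h assms(2)] by simp
  then have "iv h (f h \<sigma>) \<notin> J" using unit_mult f_S G(2,3) GS h assms by metis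
  then show ?thesis using GJ_iff[OF G(3)[OF h]] by simp
qed

lemma H_comp: assumes "h \<in> H" "k \<in> H" shows "h \<circ> k \<in> H"
proof -
  have hk: "h \<in> G" "k \<in> G" using assms H_G by auto
  have i: "iv (h \<circ> k) = iv k \<circ> iv h" using G(10)[OF hk] .
  have e: "k \<circ> (iv k \<circ> iv h) = iv h" using G_iv(1)[OF hk(2)] .
  have c: "h (f k (iv k \<circ> iv h)) * f h (iv h) = f h k * f (h \<circ> k) (iv k \<circ> iv h)"
    using cocycle[OF hk, of "iv k \<circ> iv h"] G(2,3) hk e by simp
  have "f k (iv k \<circ> iv h) \<notin> J" "f h (iv h) \<notin> J" using f_H_left assms G(2,3) hk by auto
  then have "h (f k (iv k \<circ> iv h)) * f h (iv h) \<notin> J"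
    using unit_mult[of "h (f k (iv k \<circ> iv h))" "f h (iv h)"] GJ_iff[OF hk(1)] GS f_S G(2,3) hk by auto
  then have "f (h \<circ> k) (iv k \<circ> iv h) \<notin> J"
    unfolding c using unit_mult[of "f h k" "f (h \<circ> k) (iv k \<circ> iv h)"] f_S G(2,3) hk by auto
  then show ?thesis using i G(2) hk by (simp add: H_def)
qed

lemma H_id: "id \<in> H"
  using G(1) by (simp add: H_def)

lemma autH: "aut_group H"
  using H_id H_comp H_inv G(4) H_G unfolding aut_group_def by blast

end

section \<open>Cocycles with values outside \<open>J(S)\<^sup>2\<close>\<close>

locale crossed_reduced = crossed S G f \<omega> for S :: "'k::field set" and G f \<omega> +
  assumes f_not_square: "\<sigma> \<in> G \<Longrightarrow> \<tau> \<in> G \<Longrightarrow> f \<sigma> \<tau> \<notin> {\<omega> * \<omega> * s | s. s \<in> S}"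
begin

text \<open>\<open>vl x k\<close> says that \<open>x\<close> has the value of
  \<open>\<omega> ^ k\<close>. The cocycle only takes such values, so the value group itself never
  has to be named.\<close>

definition vl :: "'k \<Rightarrow> nat \<Rightarrow> bool" where
  "vl x k \<longleftrightarrow> (\<exists>v\<in>S. v \<notin> J \<and> x = \<omega> ^ k * v)"

lemma vl_mult: assumes "vl x j" "vl y k" shows "vl (x * y) (j + k)"
proof -
  obtain v v' where v: "v \<in> S" "v \<notin> J" "x = \<omega> ^ j * v" "v' \<in> S" "v' \<notin> J" "y = \<omega> ^ k * v'"
    using assms by (auto simp: vl_def)
  have "v * v' \<in> S" "v * v' \<notin> J" using v unit_mult by auto
  moreover have "x * y = \<omega> ^ (j + k) * (v * v')" using v by (simp add: power_add mult_ac)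
  ultimately show ?thesis unfolding vl_def by blast
qed

text \<open>\<open>\<sigma> \<omega>\<close> and \<omega> divide each other because \<sigma> and its
  inverse both preserve \<open>J\<close>. For \<omega> = 0 nothing can be cancelled, but then
  \<sigma> fixes \<omega>.\<close>

lemma vl_aut: assumes "\<sigma> \<in> G" "vl x k" shows "vl (\<sigma> x) k"
proof -
  obtain v where v: "v \<in> S" "v \<notin> J" "x = \<omega> ^ k * v" using assms by (auto simp: vl_def)
  obtain t where t: "t \<in> S" "\<sigma> \<omega> = \<omega> * t" using GJ[OF assms(1) \<omega>(1)] in_J_iff by blast
  have pw: "\<sigma> (\<omega> ^ k) = \<sigma> \<omega> ^ k" using field_aut_power[OF G(4)[OF assms(1)]] .
  have "vl (\<sigma> \<omega> ^ k) k"
  proof (cases "\<omega> = 0")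
    case True
    then have "\<sigma> \<omega> = \<omega>" using aut_G(3)[OF assms(1)] by simp
    then show ?thesis unfolding vl_def by (intro bexI[of _ 1]) auto
  next
    case False
    obtain s where s: "s \<in> S" "iv \<sigma> \<omega> = \<omega> * s" using GJ[OF G(3)[OF assms(1)] \<omega>(1)] in_J_iff by blast
    have "\<omega> = \<sigma> (\<omega> * s)" using s G(5)[OF assms(1)] by metis
    also have "\<dots> = \<omega> * (t * \<sigma> s)" using aut_G(2)[OF assms(1)] t by simp
    finally have "t * \<sigma> s = 1" using False by simp
    then have "t \<notin> J" using J_mult'[OF _ GS[OF assms(1) s(1)], of t] one_notin_J by auto
    then have "t ^ k \<notin> J" using t by (induction k) (auto simp: unit_mult S_power)
    then show ?thesis unfolding vl_def t(2) using t(1)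
      by (intro bexI[of _ "t ^ k"]) (auto simp: power_mult_distrib)
  qed
  moreover have "vl (\<sigma> v) 0" unfolding vl_def using v GS GJ_iff assms(1) by auto
  ultimately have "vl (\<sigma> \<omega> ^ k * \<sigma> v) (k + 0)" by (rule vl_mult)
  then show ?thesis using v aut_G(2)[OF assms(1)] pw by simp
qed

lemma vl_less: assumes "vl x j" "vl x k" "x \<noteq> 0" shows "\<not> j < k"
proof
  assume jk: "j < k"
  obtain v v' where v: "v \<in> S" "v \<notin> J" "x = \<omega> ^ j * v" "v' \<in> S" "v' \<notin> J" "x = \<omega> ^ k * v'"
    using assms by (auto simp: vl_def)
  obtain d where d: "k = j + Suc d" using jk less_iff_Suc_add by (metis add_Suc_right)
  have z: "\<omega> ^ j \<noteq> 0" using v assms(3) by auto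
  have "\<omega> ^ j * v = \<omega> ^ k * v'" using v(3,6) by metis
  also have "\<dots> = \<omega> ^ j * (\<omega> ^ Suc d * v')" by (simp only: d power_add mult.assoc)
  finally have "\<omega> ^ j * v = \<omega> ^ j * (\<omega> ^ Suc d * v')" .
  then have "v = \<omega> ^ Suc d * v'" using mult_left_cancel[OF z] by blast
  then have "v = \<omega> * (\<omega> ^ d * v')" by (simp only: power_Suc mult.assoc)
  moreover have "\<omega> * (\<omega> ^ d * v') \<in> J" using \<omega> v S_power by (intro J_mult') auto
  ultimately show False using v by simp
qed

lemma vl_unique: "vl x j \<Longrightarrow> vl x k \<Longrightarrow> x \<noteq> 0 \<Longrightarrow> j = k"
  using vl_less[of x j k] vl_less[of x k j] by simp

definition w :: "('k \<Rightarrow> 'k) \<Rightarrow> ('k \<Rightarrow> 'k) \<Rightarrow> nat" where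
  "w \<sigma> \<tau> = (if f \<sigma> \<tau> \<in> J then 1 else 0)"

lemma vl_f: assumes "\<sigma> \<in> G" "\<tau> \<in> G" shows "vl (f \<sigma> \<tau>) (w \<sigma> \<tau>)"
proof (cases "f \<sigma> \<tau> \<in> J")
  case True
  then obtain s where s: "s \<in> S" "f \<sigma> \<tau> = \<omega> * s" using in_J_iff by blast
  have "s \<notin> J"
  proof
    assume "s \<in> J"
    then obtain s' where "s' \<in> S" "s = \<omega> * s'" using in_J_iff by blast
    then show False using f_not_square[OF assms] s by (auto simp: mult.assoc)
  qed
  then show ?thesis using s True unfolding vl_def w_def by auto
next
  case False
  then show ?thesis using f_S[OF assms] unfolding vl_def w_def by auto
qed

text \<open>Compare the values of both sides of the cocycle identity. Automorphisms do not change
  values, so \<open>w\<close> is a cocycle for the trivial action.\<close>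

lemma w_cocycle:
  assumes "\<sigma> \<in> G" "\<tau> \<in> G" "\<gamma> \<in> G"
  shows "w \<tau> \<gamma> + w \<sigma> (\<tau> \<circ> \<gamma>) = w \<sigma> \<tau> + w (\<sigma> \<circ> \<tau>) \<gamma>"
proof (rule vl_unique)
  have g: "\<tau> \<circ> \<gamma> \<in> G" "\<sigma> \<circ> \<tau> \<in> G" using G(2) assms by auto
  show "vl (\<sigma> (f \<tau> \<gamma>) * f \<sigma> (\<tau> \<circ> \<gamma>)) (w \<tau> \<gamma> + w \<sigma> (\<tau> \<circ> \<gamma>))"
    using vl_mult[OF vl_aut[OF assms(1) vl_f[OF assms(2,3)]] vl_f[OF assms(1) g(1)]] .
  show "vl (\<sigma> (f \<tau> \<gamma>) * f \<sigma> (\<tau> \<circ> \<gamma>)) (w \<sigma> \<tau> + w (\<sigma> \<circ> \<tau>) \<gamma>)"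
    unfolding cocycle[OF assms] using vl_mult[OF vl_f[OF assms(1,2)] vl_f[OF g(2) assms(3)]] .
  show "\<sigma> (f \<tau> \<gamma>) * f \<sigma> (\<tau> \<circ> \<gamma>) \<noteq> 0"
    using f_nz g assms aut_G(8)[OF assms(1)] by simp
qed

text \<open>Summing the cocycle identity over the last variable shows that \<open>\<Phi> / |G|\<close> is a cochain with
  coboundary \<open>w\<close>. Since \<open>w\<close> is \<open>{0, 1}\<close>-valued, \<open>\<Phi>\<close> takes values in \<open>{0, \<dots>, |G| - 1}\<close>, so it embeds
  \<open>G / H\<close> into the cyclic group \<open>\<int> / |G|\<close>, and \<open>w\<close> is the carry cocycle.\<close>

definition \<Phi> :: "('k \<Rightarrow> 'k) \<Rightarrow> nat" where "\<Phi> \<sigma> = (\<Sum>\<gamma>\<in>G. w \<sigma> \<gamma>)"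

abbreviation "n \<equiv> card G"

lemma \<Phi>_add: assumes "\<sigma> \<in> G" "\<tau> \<in> G" shows "\<Phi> \<sigma> + \<Phi> \<tau> = n * w \<sigma> \<tau> + \<Phi> (\<sigma> \<circ> \<tau>)"
proof -
  have "(\<Sum>\<gamma>\<in>G. w \<tau> \<gamma> + w \<sigma> (\<tau> \<circ> \<gamma>)) = (\<Sum>\<gamma>\<in>G. w \<sigma> \<tau> + w (\<sigma> \<circ> \<tau>) \<gamma>)"
    using w_cocycle[OF assms] by (intro sum.cong) auto
  moreover have "(\<Sum>\<gamma>\<in>G. w \<sigma> (\<tau> \<circ> \<gamma>)) = \<Phi> \<sigma>" unfolding \<Phi>_def
    using sum.reindex_bij_betw[OF aut_group_bij_left[OF autG assms(2)], of "w \<sigma>"] .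
  ultimately show ?thesis by (simp add: sum.distrib \<Phi>_def)
qed

lemma w_le: "w \<sigma> \<tau> \<le> 1" by (simp add: w_def)

lemma w_id: "\<sigma> \<in> G \<Longrightarrow> w \<sigma> id = 0" by (simp add: w_def)

lemma \<Phi>_less: assumes "\<sigma> \<in> G" shows "\<Phi> \<sigma> < n"
proof -
  have "\<Phi> \<sigma> = w \<sigma> id + (\<Sum>\<gamma>\<in>G - {id}. w \<sigma> \<gamma>)" unfolding \<Phi>_def using finG G(1) by (rule sum.remove)
  also have "\<dots> \<le> 0 + (\<Sum>\<gamma>\<in>G - {id}. 1)" using w_id[OF assms] w_le by (intro add_mono sum_mono) auto
  also have "\<dots> = card (G - {id})" by simp
  also have "\<dots> < n" using finG G(1) by (intro card_Diff1_less) auto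
  finally show ?thesis .
qed

lemma \<Phi>_id: "\<Phi> id = 0"
  using \<Phi>_add[OF G(1) G(1)] w_id[OF G(1)] by simp

text \<open>\<open>\<Phi> \<sigma>\<close> counts the carries against \<sigma>. If there are none,
  the one at \<sigma>\<inverse> is absent; conversely, no carry at \<sigma>\<inverse> gives
  \<open>\<Phi> \<sigma> + \<Phi> (iv \<sigma>) = 0\<close>.\<close>

lemma mem_H: assumes "\<sigma> \<in> G" shows "\<sigma> \<in> H \<longleftrightarrow> \<Phi> \<sigma> = 0"
proof
  assume "\<sigma> \<in> H"
  then have "w \<sigma> (iv \<sigma>) = 0" by (auto simp: H_def w_def)
  then show "\<Phi> \<sigma> = 0" using \<Phi>_add[OF assms G(3)[OF assms]] G(7)[OF assms] \<Phi>_id by simp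
next
  assume "\<Phi> \<sigma> = 0"
  then have "w \<sigma> (iv \<sigma>) = 0" unfolding \<Phi>_def using finG G(3)[OF assms] by simp
  then show "\<sigma> \<in> H" using assms by (auto simp: H_def w_def split: if_splits)
qed

lemma \<Phi>_mod: "\<sigma> \<in> G \<Longrightarrow> \<tau> \<in> G \<Longrightarrow> \<Phi> (\<sigma> \<circ> \<tau>) = (\<Phi> \<sigma> + \<Phi> \<tau>) mod n"
  using \<Phi>_add \<Phi>_less[OF G(2)] by simp

lemma w_0_iff: assumes "\<sigma> \<in> G" "\<tau> \<in> G" shows "w \<sigma> \<tau> = 0 \<longleftrightarrow> \<Phi> \<sigma> + \<Phi> \<tau> < n"
proof -
  have "w \<sigma> \<tau> = 0 \<or> w \<sigma> \<tau> = 1" by (simp add: w_def)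
  then show ?thesis using \<Phi>_add[OF assms] \<Phi>_less[OF G(2)[OF assms]] by auto
qed

lemma H_normal: assumes "\<sigma> \<in> G" "h \<in> H" shows "\<sigma> \<circ> h \<circ> iv \<sigma> \<in> H"
proof -
  have h: "h \<in> G" "\<Phi> h = 0" using assms H_G mem_H by auto
  note g = G(2)[OF assms(1) h(1)] G(3)[OF assms(1)]
  have "\<Phi> (\<sigma> \<circ> h \<circ> iv \<sigma>) = (\<Phi> (\<sigma> \<circ> h) + \<Phi> (iv \<sigma>)) mod n" by (rule \<Phi>_mod[OF g])
  also have "\<Phi> (\<sigma> \<circ> h) = \<Phi> \<sigma>" using \<Phi>_mod[OF assms(1) h(1)] h \<Phi>_less[OF assms(1)] by simp
  also have "(\<Phi> \<sigma> + \<Phi> (iv \<sigma>)) mod n = \<Phi> (\<sigma> \<circ> iv \<sigma>)" using \<Phi>_mod[OF assms(1) g(2)] by simp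
  also have "\<dots> = 0" using G(7)[OF assms(1)] \<Phi>_id by simp
  finally show ?thesis using mem_H[OF G(2)[OF g]] by blast
qed

definition "P = {a \<in> AC. \<forall>h\<in>H. a h \<in> J}"

text \<open>A least positive value generates the image of \<Phi> in the integers modulo
  \<open>n\<close>. Minimality, rather than mere generation of \<open>G / H\<close>, is what makes
  \<open>x\<^sub>\<sigma>\<close> generate \<open>P\<close>.\<close>

definition generator :: "('k \<Rightarrow> 'k) \<Rightarrow> bool" where
  "generator \<sigma> \<longleftrightarrow> \<sigma> \<in> G \<and> \<Phi> \<sigma> > 0 \<and> (\<forall>\<tau>\<in>G. \<Phi> \<tau> > 0 \<longrightarrow> \<Phi> \<sigma> \<le> \<Phi> \<tau>)"

lemma generator_exists: assumes "H \<noteq> G" shows "\<exists>\<sigma>. generator \<sigma>"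
proof -
  obtain \<tau> where \<tau>: "\<tau> \<in> G" "\<tau> \<notin> H" using assms H_G by blast
  have "\<exists>\<sigma>. (\<sigma> \<in> G \<and> \<Phi> \<sigma> > 0) \<and> (\<forall>\<tau>. \<tau> \<in> G \<and> \<Phi> \<tau> > 0 \<longrightarrow> \<Phi> \<sigma> \<le> \<Phi> \<tau>)"
    by (rule ex_has_least_nat[of _ \<tau>]) (use \<tau> mem_H in auto)
  then show ?thesis unfolding generator_def by blast
qed

context
  fixes \<sigma> assumes gen: "generator \<sigma>"
begin

lemma gen_G: "\<sigma> \<in> G" and gen_pos: "\<Phi> \<sigma> > 0" and gen_min: "\<tau> \<in> G \<Longrightarrow> \<Phi> \<tau> > 0 \<Longrightarrow> \<Phi> \<sigma> \<le> \<Phi> \<tau>"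
  using gen by (auto simp: generator_def)

lemma \<Phi>_pow: "\<Phi> (\<sigma> ^^ k) = (k * \<Phi> \<sigma>) mod n"
proof (induction k)
  case 0
  then show ?case using \<Phi>_id by (simp add: id_def)
next
  case (Suc k)
  have "\<Phi> (\<sigma> ^^ Suc k) = (\<Phi> \<sigma> + \<Phi> (\<sigma> ^^ k)) mod n"
    unfolding funpow.simps(2) by (rule \<Phi>_mod[OF gen_G pow_G[OF gen_G]])
  then show ?case using Suc by (simp add: mod_add_right_eq del: funpow.simps)
qed

text \<open>Otherwise the first multiple of \<open>\<Phi> \<sigma>\<close> beyond \<open>n\<close>
  would leave a positive residue smaller than \<open>\<Phi> \<sigma>\<close>, attained by a power of
  \<sigma>.\<close>

lemma n_dvd: "\<Phi> \<sigma> dvd n"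
proof -
  let ?d = "\<Phi> \<sigma>"
  let ?k = "Suc (n div ?d)"
  have n: "n div ?d * ?d + n mod ?d = n" by (rule div_mult_mod_eq)
  show ?thesis
  proof (cases "n mod ?d = 0")
    case False
    have r: "n mod ?d < ?d" using gen_pos by simp
    have e: "?k * ?d = n + (?d - n mod ?d)" using n r mult_Suc[of "n div ?d" ?d] by linarith
    have l: "?d - n mod ?d < n" using \<Phi>_less[OF gen_G] by linarith
    have "\<Phi> (\<sigma> ^^ ?k) = (n + (?d - n mod ?d)) mod n" unfolding \<Phi>_pow e ..
    then have "\<Phi> (\<sigma> ^^ ?k) = ?d - n mod ?d" using l by simp
    then have "?d \<le> ?d - n mod ?d" using gen_min[OF pow_G[OF gen_G], of ?k] r by simp
    then show ?thesis using False r by simp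
  qed (simp add: dvd_eq_mod_eq_0)
qed

abbreviation "m \<equiv> n div \<Phi> \<sigma>"

lemma n_eq: "n = m * \<Phi> \<sigma>" using n_dvd by simp

lemma \<Phi>_pow_less: "k < m \<Longrightarrow> \<Phi> (\<sigma> ^^ k) = k * \<Phi> \<sigma>"
  unfolding \<Phi>_pow using n_eq gen_pos by (intro mod_less) (metis mult_less_cancel2)

text \<open>Division with remainder: with \<open>k\<close> the quotient of
  \<open>\<Phi> \<tau>\<close> by \<open>\<Phi> \<sigma>\<close>, the value of \<Phi> at
  \<sigma>^(-k) \<tau> is the remainder, which minimality forces to be 0.\<close>

lemma \<Phi>_div: assumes "\<tau> \<in> G" shows "\<exists>k<m. \<Phi> \<tau> = k * \<Phi> \<sigma>"
proof -
  let ?d = "\<Phi> \<sigma>" and ?k = "\<Phi> \<tau> div \<Phi> \<sigma>"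
  have km: "?k < m" using \<Phi>_less[OF assms] n_eq gen_pos by (metis less_mult_imp_div_less)
  let ?\<rho> = "iv (\<sigma> ^^ ?k) \<circ> \<tau>"
  have pk: "\<sigma> ^^ ?k \<in> G" by (rule pow_G[OF gen_G])
  have \<rho>: "?\<rho> \<in> G" using G(2,3) pk assms by blast
  have "\<Phi> (\<sigma> ^^ ?k) + \<Phi> ?\<rho> = n * w (\<sigma> ^^ ?k) ?\<rho> + \<Phi> \<tau>"
    using \<Phi>_add[OF pk \<rho>] G_iv(1)[OF pk] by simp
  then have eq: "?k * ?d + \<Phi> ?\<rho> = n * w (\<sigma> ^^ ?k) ?\<rho> + \<Phi> \<tau>" using \<Phi>_pow_less[OF km] by simp
  have "?k * ?d + \<Phi> \<tau> mod ?d = \<Phi> \<tau>" by (rule div_mult_mod_eq)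
  then have "\<Phi> ?\<rho> = n * w (\<sigma> ^^ ?k) ?\<rho> + \<Phi> \<tau> mod ?d" using eq by linarith
  moreover have "w (\<sigma> ^^ ?k) ?\<rho> = 0 \<or> w (\<sigma> ^^ ?k) ?\<rho> = 1" by (simp add: w_def)
  ultimately have r: "\<Phi> ?\<rho> = \<Phi> \<tau> mod ?d" using \<Phi>_less[OF \<rho>] by auto
  have "\<Phi> \<tau> mod ?d = 0"
  proof (rule ccontr)
    assume "\<Phi> \<tau> mod ?d \<noteq> 0"
    then have "?d \<le> \<Phi> \<tau> mod ?d" using gen_min[OF \<rho>] r by simp
    then show False using gen_pos mod_less_divisor[of ?d "\<Phi> \<tau>"] by linarith
  qed
  then have "\<Phi> \<tau> = ?k * ?d" by auto
  then show ?thesis using km by blast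
qed

text \<open>Adding \<open>\<Phi> (\<sigma> ^^ i)\<close> and the value at \<sigma>^(j-i) gives
  \<open>j * \<Phi> \<sigma>\<close>, with a carry just when the first summand exceeds the
  result.\<close>

lemma chain:
  assumes "i < m" "j < m"
  shows "f (\<sigma> ^^ i) (iv (\<sigma> ^^ i) \<circ> \<sigma> ^^ j) \<notin> J \<longleftrightarrow> i \<le> j"
proof -
  let ?\<rho> = "iv (\<sigma> ^^ i) \<circ> \<sigma> ^^ j"
  have p: "\<sigma> ^^ i \<in> G" "\<sigma> ^^ j \<in> G" using pow_G[OF gen_G] by auto
  have \<rho>: "?\<rho> \<in> G" using G(2,3) p by blast
  have eq: "i * \<Phi> \<sigma> + \<Phi> ?\<rho> = n * w (\<sigma> ^^ i) ?\<rho> + j * \<Phi> \<sigma>"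
    using \<Phi>_add[OF p(1) \<rho>] G_iv(1)[OF p(1)] \<Phi>_pow_less[OF assms(1)] \<Phi>_pow_less[OF assms(2)] by simp
  have "f (\<sigma> ^^ i) ?\<rho> \<notin> J \<longleftrightarrow> w (\<sigma> ^^ i) ?\<rho> = 0" by (simp add: w_def)
  also have "\<dots> \<longleftrightarrow> i \<le> j"
  proof
    assume "w (\<sigma> ^^ i) ?\<rho> = 0"
    then have "i * \<Phi> \<sigma> + \<Phi> ?\<rho> = j * \<Phi> \<sigma>" using eq by simp
    then have "i * \<Phi> \<sigma> \<le> j * \<Phi> \<sigma>" by linarith
    then show "i \<le> j" using gen_pos by simp
  next
    assume "i \<le> j"
    then have "i * \<Phi> \<sigma> \<le> j * \<Phi> \<sigma>" by simp
    then have "n * w (\<sigma> ^^ i) ?\<rho> \<le> \<Phi> ?\<rho>" using eq by linarith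
    then have "n * w (\<sigma> ^^ i) ?\<rho> < n * 1" using \<Phi>_less[OF \<rho>] by linarith
    then show "w (\<sigma> ^^ i) ?\<rho> = 0" by (simp only: mult_less_cancel1) simp
  qed
  finally show ?thesis .
qed

text \<open>A carry makes \<open>\<Phi> \<rho>\<close> smaller than \<open>\<Phi> \<sigma>\<close>,
  hence 0 by minimality; without one it is at least \<open>\<Phi> \<sigma>\<close>, hence positive.
  So left multiplication by \<open>x\<^sub>\<sigma>\<close> gains a factor \<omega> exactly in the
  degrees of \<open>H\<close>.\<close>

lemma gen_w: assumes "\<rho> \<in> G" shows "w \<sigma> (iv \<sigma> \<circ> \<rho>) = 0 \<longleftrightarrow> \<rho> \<notin> H"
proof -
  have g: "iv \<sigma> \<circ> \<rho> \<in> G" using G(2,3) gen_G assms by blast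
  have eq: "\<Phi> \<sigma> + \<Phi> (iv \<sigma> \<circ> \<rho>) = n * w \<sigma> (iv \<sigma> \<circ> \<rho>) + \<Phi> \<rho>"
    using \<Phi>_add[OF gen_G g] G_iv(1)[OF gen_G] by simp
  have "w \<sigma> (iv \<sigma> \<circ> \<rho>) = 0 \<or> w \<sigma> (iv \<sigma> \<circ> \<rho>) = 1" by (simp add: w_def)
  then show ?thesis
  proof
    assume "w \<sigma> (iv \<sigma> \<circ> \<rho>) = 0"
    then show ?thesis using eq gen_pos mem_H[OF assms] by auto
  next
    assume one: "w \<sigma> (iv \<sigma> \<circ> \<rho>) = 1"
    then have "\<Phi> \<rho> < \<Phi> \<sigma>" using eq \<Phi>_less[OF g] by simp
    then have "\<Phi> \<rho> = 0" using gen_min[OF assms] by (cases "\<Phi> \<rho> > 0") auto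
    then show ?thesis using one mem_H[OF assms] by simp
  qed
qed

lemma generator_ideal: "{mul (mon 1 \<sigma>) a | a. a \<in> AC} = P"
proof (intro equalityI subsetI)
  fix b assume "b \<in> {mul (mon 1 \<sigma>) a | a. a \<in> AC}"
  then obtain a where a: "a \<in> AC" "b = mul (mon 1 \<sigma>) a" by blast
  have "b h \<in> J" if "h \<in> H" for h
  proof -
    have h: "h \<in> G" using that H_G by blast
    then have g: "iv \<sigma> \<circ> h \<in> G" using G(2,3) gen_G by blast
    have "f \<sigma> (iv \<sigma> \<circ> h) \<in> J" using gen_w[OF h] that by (auto simp: w_def split: if_splits)
    then show ?thesis unfolding a(2) mul_mon[OF gen_G h]
      using GS[OF gen_G AC_S[OF a(1) g]] by (intro J_mult) auto
  qed
  then show "b \<in> P" using a AC_mul mon_AC gen_G by (auto simp: P_def)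
next
  fix b assume b: "b \<in> P"
  then have bA: "b \<in> AC" by (simp add: P_def)
  \<comment> \<open>The solution of \<open>x\<^sub>\<sigma> a = b\<close> in the algebra, read off
    degree by degree. It is integral because \<open>b\<close> supplies the factor \<omega> in the
    degrees of \<open>H\<close>, where \<open>f\<close> contains it.\<close>
  define a where "a = (\<lambda>\<rho>. if \<rho> \<in> G then iv \<sigma> (b (\<sigma> \<circ> \<rho>) / f \<sigma> \<rho>) else 0)"
  have "b (\<sigma> \<circ> \<rho>) / f \<sigma> \<rho> \<in> S" if \<rho>: "\<rho> \<in> G" for \<rho>
  proof -
    have g: "\<sigma> \<circ> \<rho> \<in> G" using G(2) gen_G \<rho> by blast
    have w: "w \<sigma> \<rho> = 0 \<longleftrightarrow> \<sigma> \<circ> \<rho> \<notin> H" using gen_w[OF g] G_iv(2)[OF gen_G] by simp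
    obtain v where v: "v \<in> S" "v \<notin> J" "f \<sigma> \<rho> = \<omega> ^ w \<sigma> \<rho> * v" using vl_f[OF gen_G \<rho>] by (auto simp: vl_def)
    have iS: "inverse v \<in> S" using v unit_inverse by blast
    show ?thesis
    proof (cases "\<sigma> \<circ> \<rho> \<in> H")
      case True
      then have "w \<sigma> \<rho> = 1" using w w_le[of \<sigma> \<rho>] by auto
      moreover obtain s where s: "s \<in> S" "b (\<sigma> \<circ> \<rho>) = \<omega> * s" using b True in_J_iff by (auto simp: P_def)
      moreover have "\<omega> \<noteq> 0" using f_nz[OF gen_G \<rho>] v(3) calculation(1) by auto
      ultimately have "b (\<sigma> \<circ> \<rho>) / f \<sigma> \<rho> = s * inverse v" using v(3) by (simp add: divide_inverse)
      then show ?thesis using s iS by auto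
    next
      case False
      then have "b (\<sigma> \<circ> \<rho>) / f \<sigma> \<rho> = b (\<sigma> \<circ> \<rho>) * inverse v" using w v(3) by (simp add: divide_inverse)
      then show ?thesis using AC_S[OF bA g] iS by auto
    qed
  qed
  then have aA: "a \<in> AC" using GS[OF G(3)[OF gen_G]] by (auto simp: AC_def Q_def a_def)
  have "mul (mon 1 \<sigma>) a = b"
  proof (rule Q_eqI)
    fix \<rho> assume \<rho>: "\<rho> \<in> G"
    have g: "iv \<sigma> \<circ> \<rho> \<in> G" using G(2,3) gen_G \<rho> by blast
    show "mul (mon 1 \<sigma>) a \<rho> = b \<rho>" unfolding mul_mon[OF gen_G \<rho>]
      using g G(5)[OF gen_G] G_iv(1)[OF gen_G] f_nz[OF gen_G g] by (simp add: a_def)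
  qed (use AC_Q[OF bA] in auto)
  then show "b \<in> {mul (mon 1 \<sigma>) a | a. a \<in> AC}" using aA by blast
qed

text \<open>Powers of \<open>x\<^sub>\<sigma>\<close> are homogeneous, with coefficients built from
  conjugates of the values \<open>f \<sigma> (\<sigma> ^^ k)\<close>. One of these values is in
  \<open>J\<close>, since without any carry \<open>\<Phi> (\<sigma> ^^ k)\<close> would grow beyond
  \<open>n\<close>.\<close>

lemma generator_nilpotent: "\<exists>N. \<exists>y\<in>AC. \<forall>a\<in>Q. (mul (mon 1 \<sigma>) ^^ N) a = sc \<omega> (mul y a)"
proof -
  have "\<exists>k. f \<sigma> (\<sigma> ^^ k) \<in> J"
  proof (rule ccontr)
    assume "\<not> ?thesis"
    then have w0: "w \<sigma> (\<sigma> ^^ k) = 0" for k by (simp add: w_def)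
    have "k \<le> \<Phi> (\<sigma> ^^ k)" for k
    proof (induction k)
      case (Suc k)
      have "\<Phi> \<sigma> + \<Phi> (\<sigma> ^^ k) = \<Phi> (\<sigma> ^^ Suc k)"
        unfolding funpow.simps(2) using \<Phi>_add[OF gen_G pow_G[OF gen_G], of k] by (simp only: w0 mult_0_right add_0)
      then show ?case using Suc gen_pos by linarith
    qed simp
    from this[of n] show False using \<Phi>_less[OF pow_G[OF gen_G], of n] by simp
  qed
  then obtain k where k: "f \<sigma> (\<sigma> ^^ k) \<in> J" by blast
  have step: "(mul (mon 1 \<sigma>) ^^ Suc j) a = mul (mon (1 * \<sigma> c * f \<sigma> (\<sigma> ^^ j)) (\<sigma> ^^ Suc j)) a"
    if "(mul (mon 1 \<sigma>) ^^ j) a = mul (mon c (\<sigma> ^^ j)) a" for a c j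
    unfolding funpow.simps(2) comp_apply that mul_assoc[symmetric] mon_mon[OF gen_G pow_G[OF gen_G]] ..
  have "\<exists>c\<in>S. \<forall>a\<in>Q. (mul (mon 1 \<sigma>) ^^ j) a = mul (mon c (\<sigma> ^^ j)) a" for j
  proof (induction j)
    case 0
    then show ?case using mul_one(2) by (intro bexI[of _ 1]) (auto simp: id_def[symmetric])
  next
    case (Suc j)
    then obtain c where c: "c \<in> S" "\<And>a. a \<in> Q \<Longrightarrow> (mul (mon 1 \<sigma>) ^^ j) a = mul (mon c (\<sigma> ^^ j)) a" by blast
    then have "(mul (mon 1 \<sigma>) ^^ Suc j) a = mul (mon (1 * \<sigma> c * f \<sigma> (\<sigma> ^^ j)) (\<sigma> ^^ Suc j)) a" if "a \<in> Q" for a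
      using step[OF c(2)] that by blast
    moreover have "1 * \<sigma> c * f \<sigma> (\<sigma> ^^ j) \<in> S" using c(1) GS[OF gen_G] f_S[OF gen_G pow_G[OF gen_G]] by simp
    ultimately show ?case by blast
  qed
  from this[of k] obtain c where c: "c \<in> S" "\<And>a. a \<in> Q \<Longrightarrow> (mul (mon 1 \<sigma>) ^^ k) a = mul (mon c (\<sigma> ^^ k)) a" by blast
  have e: "(mul (mon 1 \<sigma>) ^^ Suc k) a = mul (mon (\<sigma> c * f \<sigma> (\<sigma> ^^ k)) (\<sigma> ^^ Suc k)) a" if "a \<in> Q" for a
    using step[OF c(2)[OF that]] by (simp only: mult_1_left)
  have "\<sigma> c * f \<sigma> (\<sigma> ^^ k) \<in> J" using k c(1) GS gen_G by (intro J_mult) auto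
  then obtain s where s: "s \<in> S" "\<sigma> c * f \<sigma> (\<sigma> ^^ k) = \<omega> * s" using in_J_iff by blast
  have "mon (\<omega> * s) (\<sigma> ^^ Suc k) = sc \<omega> (mon s (\<sigma> ^^ Suc k))" by (auto simp: fun_eq_iff mon_def)
  then have "(mul (mon 1 \<sigma>) ^^ Suc k) a = sc \<omega> (mul (mon s (\<sigma> ^^ Suc k)) a)" if "a \<in> Q" for a
    using e[OF that] s(2) by (simp only: mul_sc)
  then show ?thesis using mon_AC[OF s(1) pow_G[OF gen_G]] by blast
qed

end

text \<open>When \<open>H = G\<close> no positive value of \<Phi> exists and \<omega> itself takes
  the place of \<open>x\<^sub>\<sigma>\<close>; the common form spares later case
  distinctions.\<close>

lemma prime_element:
  "\<exists>x\<in>AC. {mul x a | a. a \<in> AC} = P \<and> (\<exists>N. \<exists>y\<in>AC. \<forall>a\<in>Q. (mul x ^^ N) a = sc \<omega> (mul y a))"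
proof (cases "H = G")
  case False
  then obtain \<sigma> where "generator \<sigma>" using generator_exists by blast
  then show ?thesis using generator_ideal generator_nilpotent mon_AC[OF S_closed(2)] gen_G by blast
next
  case True
  have m: "mul (mon \<omega> id) a = sc \<omega> a" if "a \<in> Q" for a by (rule mon_id_mul[OF that])
  have "{mul (mon \<omega> id) a | a. a \<in> AC} = P"
  proof (intro equalityI subsetI)
    fix b assume "b \<in> {mul (mon \<omega> id) a | a. a \<in> AC}"
    then obtain a where a: "a \<in> AC" "b = sc \<omega> a" using m AC_Q by auto
    then show "b \<in> P" using AC_closed(4)[OF a(1) \<omega>(2)] J_mult'[OF \<omega>(1) AC_S[OF a(1)]] True
      by (auto simp: P_def)
  next
    fix b assume b: "b \<in> P"
    have "\<forall>\<rho>. \<exists>s. (\<rho> \<in> G \<longrightarrow> s \<in> S \<and> b \<rho> = \<omega> * s) \<and> (\<rho> \<notin> G \<longrightarrow> s = 0)"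
      using b True in_J_iff unfolding P_def by blast
    then obtain a where a: "\<And>\<rho>. (\<rho> \<in> G \<longrightarrow> a \<rho> \<in> S \<and> b \<rho> = \<omega> * a \<rho>) \<and> (\<rho> \<notin> G \<longrightarrow> a \<rho> = 0)" by metis
    have "a \<in> AC" using a by (auto simp: AC_def Q_def)
    moreover have "b = sc \<omega> a" using a b by (intro Q_eqI) (auto simp: P_def AC_def Q_def)
    ultimately show "b \<in> {mul (mon \<omega> id) a | a. a \<in> AC}" using m AC_Q by (auto intro!: exI[of _ a])
  qed
  moreover have "\<forall>a\<in>Q. (mul (mon \<omega> id) ^^ 1) a = sc \<omega> (mul (mon 1 id) a)" using m mul_one(2) by simp
  ultimately show ?thesis using mon_AC[OF \<omega>(2) G(1)] mon_AC[OF S_closed(2) G(1)] by blast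
qed

end

section \<open>Averaging\<close>

locale crossed_tame = crossed_reduced S G f \<omega> for S :: "'k::field set" and G f \<omega> +
  assumes trace: "\<exists>s\<in>S. (\<Sum>\<sigma>\<in>G. \<sigma> s) \<notin> J"
begin

text \<open>The \<open>G\<close>-trace of \<open>t\<close> is a sum over the right cosets of
  \<open>H\<close> of \<open>H\<close>-traces of conjugates of \<open>t\<close>, so some
  \<open>H\<close>-trace is a unit. It is \<open>H\<close>-invariant, hence dividing by it
  normalises the trace to 1.\<close>

lemma H_trace: "\<exists>s\<in>S. (\<Sum>h\<in>H. h s) = 1"
proof -
  have finH: "finite H" using finG H_G by (meson finite_subset subsetI)
  have "\<exists>s\<in>S. (\<Sum>h\<in>H. h s) \<notin> J"
  proof (rule ccontr)
    assume "\<not> ?thesis"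
    then have all: "(\<Sum>h\<in>H. h s) \<in> J" if "s \<in> S" for s using that by blast
    obtain t where t: "t \<in> S" "(\<Sum>\<sigma>\<in>G. \<sigma> t) \<notin> J" using trace by blast
    define C where "C \<sigma> = (\<lambda>h. h \<circ> \<sigma>) ` H" for \<sigma> :: "'k \<Rightarrow> 'k"
    have "(\<Sum>\<sigma>\<in>{\<sigma> \<in> G. C \<sigma> = C \<gamma>}. \<sigma> t) \<in> J" if \<gamma>: "\<gamma> \<in> G" for \<gamma>
    proof -
      have "{\<sigma> \<in> G. C \<sigma> = C \<gamma>} = C \<gamma>"
      proof (intro equalityI subsetI)
        fix \<sigma> assume "\<sigma> \<in> {\<sigma> \<in> G. C \<sigma> = C \<gamma>}"
        moreover have "\<sigma> \<in> C \<sigma>" unfolding C_def using H_id by (intro image_eqI[of _ _ id]) auto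
        ultimately show "\<sigma> \<in> C \<gamma>" by blast
      next
        fix \<sigma> assume "\<sigma> \<in> C \<gamma>"
        then obtain h where h: "h \<in> H" "\<sigma> = h \<circ> \<gamma>" unfolding C_def by blast
        have "C \<sigma> \<subseteq> C \<gamma>"
          unfolding C_def h(2) using H_comp[OF _ h(1)] by (auto simp: o_assoc)
        moreover have "C \<gamma> \<subseteq> C \<sigma>"
        proof
          fix \<rho> assume "\<rho> \<in> C \<gamma>"
          then obtain k where k: "k \<in> H" "\<rho> = k \<circ> \<gamma>" unfolding C_def by blast
          have "\<rho> = (k \<circ> iv h) \<circ> (h \<circ> \<gamma>)"
            using k(2) G_iv(2)[OF H_G[OF h(1)], of \<gamma>] by (metis comp_assoc)
          then show "\<rho> \<in> C \<sigma>" unfolding C_def h(2) using H_comp[OF k(1) H_inv[OF h(1)]] by blast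
        qed
        ultimately show "\<sigma> \<in> {\<sigma> \<in> G. C \<sigma> = C \<gamma>}" using G(2)[OF H_G[OF h(1)] \<gamma>] h(2) by blast
      qed
      moreover have "inj_on (\<lambda>h. h \<circ> \<gamma>) H"
        using G_iv(3)[OF \<gamma>] by (metis inj_onI)
      ultimately have "(\<Sum>\<sigma>\<in>{\<sigma> \<in> G. C \<sigma> = C \<gamma>}. \<sigma> t) = (\<Sum>h\<in>H. h (\<gamma> t))"
        unfolding C_def by (simp add: sum.reindex)
      then show ?thesis using all[OF GS[OF \<gamma> t(1)]] by simp
    qed
    then have "(\<Sum>c\<in>C ` G. \<Sum>\<sigma>\<in>{\<sigma> \<in> G. C \<sigma> = c}. \<sigma> t) \<in> J"
      by (intro J_sum[of "C ` G"]) (erule imageE, simp only:)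
    then show False using t(2) sum.image_gen[OF finG, of "\<lambda>\<sigma>. \<sigma> t" C] by simp
  qed
  then obtain s where s: "s \<in> S" "(\<Sum>h\<in>H. h s) \<notin> J" by blast
  define v where "v = (\<Sum>h\<in>H. h s)"
  have vS: "v \<in> S" unfolding v_def using GS[OF H_G s(1)] by (intro S_sum) auto
  have v: "h v = v" if "h \<in> H" for h
  proof -
    have "h v = (\<Sum>k\<in>H. (h \<circ> k) s)" unfolding v_def using aut_G(7)[OF H_G[OF that]] by simp
    also have "\<dots> = v" unfolding v_def
      using sum.reindex_bij_betw[OF aut_group_bij_left[OF autH that], of "\<lambda>k. k s"] .
    finally show ?thesis .
  qed
  have vJ: "v \<notin> J" using s(2) by (simp only: v_def not_False_eq_True)
  then have v0: "v \<noteq> 0" by (rule unit_nz)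
  have "(\<Sum>h\<in>H. h (s / v)) = (\<Sum>h\<in>H. h s / v)"
  proof (intro sum.cong refl)
    fix h assume "h \<in> H"
    then show "h (s / v) = h s / v" using aut_G(9)[OF H_G] v by metis
  qed
  also have "\<dots> = v / v" by (simp only: sum_divide_distrib[symmetric] v_def)
  also have "\<dots> = 1" using v0 by simp
  finally have "(\<Sum>h\<in>H. h (s / v)) = 1" .
  moreover have "s / v \<in> S" using s(1) unit_inverse[OF vS vJ] by (simp add: divide_inverse)
  ultimately show ?thesis by blast
qed

lemma mon_mul_sc: assumes "\<alpha> \<in> G" shows "mul (mon c \<alpha>) (sc t a) = sc (\<alpha> t) (mul (mon c \<alpha>) a)"
  by (rule Q_eqI) (auto simp: mul_mon[OF assms] aut_G(2)[OF assms])

lemma u_mul_sc: assumes "\<alpha> \<in> G" shows "mul (u \<alpha>) (sc t a) = sc (iv \<alpha> t) (mul (u \<alpha>) a)"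
  unfolding u_def by (rule mon_mul_sc[OF G(3)[OF assms]])

lemma coord_sum:
  assumes "indep B" "b \<in> B" "\<And>i. i \<in> X \<Longrightarrow> g i \<in> spn B"
  shows "coord B (\<Sum>i\<in>X. g i) b = (\<Sum>i\<in>X. coord B (g i) b)"
proof -
  have z: "coord B 0 b = 0" using coord_sc[OF assms(1) smodD(1)[OF smod_spn] S_closed(1) assms(2)] by simp
  show ?thesis using assms(3)
  proof (induction X rule: infinite_finite_induct)
    case (insert i X)
    have "coord B (g i + sum g X) b = coord B (g i) b + coord B (sum g X) b"
      using insert.prems by (intro coord_add[OF assms(1) _ _ assms(2)] smod_sum[OF smod_spn]) auto
    moreover have "coord B (sum g X) b = (\<Sum>i\<in>X. coord B (g i) b)" using insert by blast
    ultimately show ?case by (simp only: sum.insert[OF insert.hyps])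
  qed (simp_all only: sum.infinite sum.empty z not_False_eq_True)
qed

lemma u_AC: assumes "h \<in> H" shows "u h \<in> AC"
proof -
  have h: "h \<in> G" using assms H_G by blast
  have "f (iv h) h \<notin> J" using f_H_right[OF assms G(3)[OF h]] .
  then show ?thesis unfolding u_def using f_S[OF G(3)[OF h] h] unit_inverse G(3)[OF h] by (intro mon_AC) auto
qed

text \<open>In \<omega> \<open>x\<^sub>\<alpha>\<inverse>\<close> the denominator is
  \<open>f (iv \<alpha>) \<alpha>\<close>. For \<alpha> in \<open>H\<close> it is a unit and the
  coefficient stays in \<open>J\<close>; otherwise it has exactly the value of \<omega> and cancels
  it, while the degree stays outside \<open>H\<close>. A denominator in \<open>J(S)\<^sup>2\<close>
  would break the second case.\<close>

lemma scaled_u_P: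
  assumes h: "h \<in> H" and \<alpha>: "\<alpha> \<in> G" and s: "s \<in> S"
  shows "mul (mon 1 h) (sc (s * \<omega>) (u \<alpha>)) \<in> P"
proof -
  have hG: "h \<in> G" and i: "iv \<alpha> \<in> G" using H_G h G(3) \<alpha> by auto
  have gG: "h \<circ> iv \<alpha> \<in> G" using G(2) hG i by blast
  let ?c = "s * \<omega> * inverse (f (iv \<alpha>) \<alpha>)"
  have e: "mul (mon 1 h) (sc (s * \<omega>) (u \<alpha>)) = mon (h ?c * f h (iv \<alpha>)) (h \<circ> iv \<alpha>)"
  proof -
    have "sc (s * \<omega>) (u \<alpha>) = mon ?c (iv \<alpha>)" by (auto simp: u_def mon_def fun_eq_iff)
    then show ?thesis by (simp only: mon_mon[OF hG i] mult_1_left)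
  qed
  have fS: "f (iv \<alpha>) \<alpha> \<in> S" using f_S i \<alpha> by blast
  have mH: "f (iv \<alpha>) \<alpha> \<notin> J \<longleftrightarrow> iv \<alpha> \<in> H" using G(9)[OF \<alpha>] i by (simp add: H_def)
  show ?thesis
  proof (cases "iv \<alpha> \<in> H")
    case True
    then have "inverse (f (iv \<alpha>) \<alpha>) \<in> S" using mH fS unit_inverse by blast
    then have "?c \<in> J" using s \<omega> J_mult J_mult' by simp
    then have "h ?c * f h (iv \<alpha>) \<in> J" using GJ[OF hG] f_S[OF hG i] by (intro J_mult') auto
    then show ?thesis unfolding e P_def using mon_AC[OF J_S gG] by (auto simp: mon_def)
  next
    case False
    then have "f (iv \<alpha>) \<alpha> \<in> J" using mH by blast
    then have "w (iv \<alpha>) \<alpha> = 1" by (simp add: w_def)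
    then obtain v where v: "v \<in> S" "v \<notin> J" "f (iv \<alpha>) \<alpha> = \<omega> * v" using vl_f[OF i \<alpha>] by (auto simp: vl_def)
    have "\<omega> \<noteq> 0" using v f_nz[OF i \<alpha>] by auto
    then have "?c = s * inverse v" using v(3) by simp
    moreover have "s * inverse v \<in> S" using s unit_inverse[OF v(1,2)] by blast
    ultimately have "?c \<in> S" by (simp only:)
    then have cS: "h ?c * f h (iv \<alpha>) \<in> S" using GS[OF hG] f_S[OF hG i] by auto
    have "h \<circ> iv \<alpha> \<notin> H"
    proof
      assume "h \<circ> iv \<alpha> \<in> H"
      then have "iv h \<circ> (h \<circ> iv \<alpha>) \<in> H" using H_comp H_inv h by blast
      then show False using False G_iv(2)[OF hG] by metis
    qed
    then show ?thesis unfolding e P_def using mon_AC[OF cS gG] by (auto simp: mon_def)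
  qed
qed

text \<open>For \<open>s\<close> of \<open>H\<close>-trace one and an \<open>S\<close>-linear map \<open>\<theta>\<close>, the map \<open>i \<mapsto> \<Sum> x\<^sub>\<alpha> s \<theta>(x\<^sub>\<alpha>\<inverse> i)\<close> is left
  \<open>A\<close>-linear. Here \<open>\<theta>\<close> is the projection of the lattice \<open>\<Sum> x\<^sub>\<alpha>\<inverse> I\<^sub>2\<close> onto the part of an adapted basis
  that lies in \<open>I\<close>; it is the identity on \<open>I\<close> modulo \<open>\<omega>\<close>, so the average is the identity modulo \<open>P\<close>.\<close>

lemma relative_trace:
  assumes I: "left_ideal A I" and I2: "left_ideal A I2" and sub: "I \<subseteq> I2"
    and fg: "finite B0" "I2 = spn B0" and x: "x \<in> AC" "{mul x a | a. a \<in> AC} = P"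
  shows "\<exists>E \<phi>. finite E \<and> E \<subseteq> I \<and> (\<forall>e\<in>E. \<forall>i\<in>I2. \<phi> e i \<in> AC)
    \<and> (\<forall>e\<in>E. \<forall>i\<in>I2. \<forall>j\<in>I2. \<phi> e (i + j) = \<phi> e i + \<phi> e j)
    \<and> (\<forall>e\<in>E. \<forall>a\<in>AC. \<forall>i\<in>I2. \<phi> e (mul a i) = mul a (\<phi> e i))
    \<and> (\<forall>i\<in>I. \<exists>j\<in>I2. (\<Sum>e\<in>E. mul (\<phi> e i) e) - i = mul x j)"
proof -
  note I2D = left_idealD[OF I2] and ID = left_idealD[OF I]
  obtain s where s: "s \<in> S" "(\<Sum>h\<in>H. h s) = 1" using H_trace by blast
  \<comment> \<open>The lattice has to contain every \<open>x\<^sub>\<alpha>\<inverse> i\<close>, so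
    that coordinates are available there. It may leave the order, but is still finitely generated
    over \<open>S\<close>.\<close>
  define M where "M = {\<Sum>\<alpha>\<in>G. mul (u \<alpha>) (g \<alpha>) | g. \<forall>\<alpha>\<in>G. g \<alpha> \<in> I2}"
  have M_E: "\<exists>g. (\<forall>\<alpha>\<in>G. g \<alpha> \<in> I2) \<and> m = (\<Sum>\<alpha>\<in>G. mul (u \<alpha>) (g \<alpha>))" if "m \<in> M" for m
    using that unfolding M_def by blast
  have smodM: "smod M" unfolding smod_def
  proof (intro conjI ballI)
    have "(\<Sum>\<alpha>\<in>G. mul (u \<alpha>) 0) = 0" by simp
    then show "0 \<in> M" unfolding M_def using I2D(2) by (intro CollectI exI[of _ "\<lambda>_. 0"]) simp
    fix a b assume "a \<in> M" "b \<in> M"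
    then obtain g g' where g: "\<forall>\<alpha>\<in>G. g \<alpha> \<in> I2" "a = (\<Sum>\<alpha>\<in>G. mul (u \<alpha>) (g \<alpha>))"
      "\<forall>\<alpha>\<in>G. g' \<alpha> \<in> I2" "b = (\<Sum>\<alpha>\<in>G. mul (u \<alpha>) (g' \<alpha>))" using M_E by meson
    then have "a + b = (\<Sum>\<alpha>\<in>G. mul (u \<alpha>) (g \<alpha> + g' \<alpha>))" by (simp only: mul_add_right sum.distrib)
    then show "a + b \<in> M" unfolding M_def using g(1,3) I2D(3)
      by (intro CollectI exI[of _ "\<lambda>\<alpha>. g \<alpha> + g' \<alpha>"]) simp
  next
    fix c a assume c: "c \<in> S" and "a \<in> M"
    then obtain g where g: "\<forall>\<alpha>\<in>G. g \<alpha> \<in> I2" "a = (\<Sum>\<alpha>\<in>G. mul (u \<alpha>) (g \<alpha>))" using M_E by meson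
    have "sc c a = (\<Sum>\<alpha>\<in>G. mul (u \<alpha>) (sc (\<alpha> c) (g \<alpha>)))"
      unfolding g(2) sc_sum by (intro sum.cong refl) (simp only: u_mul_sc G(6))
    then show "sc c a \<in> M" unfolding M_def using g(1) I2D(6) GS c
      by (intro CollectI exI[of _ "\<lambda>\<alpha>. sc (\<alpha> c) (g \<alpha>)"]) simp
  qed
  have uM: "mul (u \<alpha>) i \<in> M" if "\<alpha> \<in> G" "i \<in> I2" for \<alpha> i
  proof -
    have "(\<Sum>\<beta>\<in>G. mul (u \<beta>) (if \<beta> = \<alpha> then i else 0)) = (\<Sum>\<beta>\<in>G. if \<beta> = \<alpha> then mul (u \<alpha>) i else 0)"
      by (intro sum.cong) auto
    also have "\<dots> = mul (u \<alpha>) i" using finG that by simp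
    finally show ?thesis unfolding M_def using that I2D(2)
      by (intro CollectI exI[of _ "\<lambda>\<beta>. if \<beta> = \<alpha> then i else 0"]) simp
  qed
  define BM where "BM = (\<lambda>(\<alpha>, b). mul (u \<alpha>) b) ` (G \<times> B0)"
  have BM: "finite BM" "BM \<subseteq> M"
    using finG fg spn_base[OF fg(1)] uM unfolding BM_def by auto
  have M_spn: "M = spn BM"
  proof
    show "spn BM \<subseteq> M" by (rule spn_least[OF smodM BM(2)])
    show "M \<subseteq> spn BM"
    proof
      fix m assume "m \<in> M"
      then obtain g where g: "\<forall>\<alpha>\<in>G. g \<alpha> \<in> I2" "m = (\<Sum>\<alpha>\<in>G. mul (u \<alpha>) (g \<alpha>))" using M_E by meson
      show "m \<in> spn BM" unfolding g(2)
      proof (rule smod_sum[OF smod_spn])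
        fix \<alpha> assume \<alpha>: "\<alpha> \<in> G"
        have gs: "g \<alpha> \<in> spn B0" using g \<alpha> fg by blast
        have "mul (u \<alpha>) (g \<alpha>) = mul (u \<alpha>) (\<Sum>b\<in>B0. sc (coord B0 (g \<alpha>) b) b)"
          using coord(2)[OF gs] by (rule arg_cong)
        also have "\<dots> = (\<Sum>b\<in>B0. sc (iv \<alpha> (coord B0 (g \<alpha>) b)) (mul (u \<alpha>) b))"
          by (simp only: mul_sum_right u_mul_sc[OF \<alpha>])
        also have "\<dots> \<in> spn BM"
        proof (rule smod_sum[OF smod_spn])
          fix b assume b: "b \<in> B0"
          have "mul (u \<alpha>) b \<in> spn BM" using \<alpha> b unfolding BM_def
            by (intro spn_base BM(1)[unfolded BM_def]) auto
          then show "sc (iv \<alpha> (coord B0 (g \<alpha>) b)) (mul (u \<alpha>) b) \<in> spn BM"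
            by (intro smodD(3)[OF smod_spn] GS[OF G(3)[OF \<alpha>]] coord(1)[OF gs b])
        qed
        finally show "mul (u \<alpha>) (g \<alpha>) \<in> spn BM" .
      qed
    qed
  qed
  have I2_M: "I2 \<subseteq> M"
  proof
    fix i assume i: "i \<in> I2"
    have "u id = mon 1 id" using G(1) by (simp add: u_def)
    then have "mul (u id) i = i" using mul_one(2) I2D(1) i AC_Q by auto
    then show "i \<in> M" using uM[OF G(1) i] by simp
  qed
  \<comment> \<open>The basis of the large lattice is adapted to the small ideal: elements of
    \<open>I\<close> have coordinates in \<open>J\<close> at all basis elements outside
    \<open>I\<close>.\<close>
  obtain B where B: "finite B" "spn B = spn BM" "indep B"
    and adapted: "\<And>i c b. i \<in> I \<Longrightarrow> \<forall>b\<in>B. c b \<in> S \<Longrightarrow> i = (\<Sum>b\<in>B. sc (c b) b) \<Longrightarrow> b \<in> B - I \<Longrightarrow> c b \<in> J"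
    using adapted_basis[OF BM(1), of I] sub I2_M M_spn by blast
  have MB: "M = spn B" using M_spn B(2) by simp
  define E where "E = B \<inter> I"
  have E: "finite E" "E \<subseteq> I" "E \<subseteq> B" using B(1) by (auto simp: E_def)
  \<comment> \<open>Since \<open>x\<^sub>\<alpha> c = \<alpha>(c) x\<^sub>\<alpha>\<close>, this is
    the coefficient of \<open>e\<close> in the average: at \<alpha> it is \<alpha> applied to
    \<open>s\<close> times the \<open>e\<close>-coordinate of
    \<open>x\<^sub>\<alpha>\<inverse> i\<close>.\<close>
  define \<phi> where "\<phi> e i = (\<lambda>\<alpha>. if \<alpha> \<in> G then \<alpha> (s * coord B (mul (u \<alpha>) i) e) else 0)" for e i
  have uB: "mul (u \<alpha>) i \<in> spn B" if "\<alpha> \<in> G" "i \<in> I2" for \<alpha> i using uM that MB by simp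
  have cS: "coord B (mul (u \<alpha>) i) b \<in> S" if "\<alpha> \<in> G" "i \<in> I2" "b \<in> B" for \<alpha> i b
    using coord(1)[OF uB[OF that(1,2)] that(3)] .
  have 1: "\<phi> e i \<in> AC" if "e \<in> E" "i \<in> I2" for e i
    using cS[OF _ that(2)] GS s(1) E(3) that(1) by (auto simp: \<phi>_def AC_def Q_def)
  have 2: "\<phi> e (i + j) = \<phi> e i + \<phi> e j" if h: "e \<in> E" "i \<in> I2" "j \<in> I2" for e i j
  proof (rule Q_eqI)
    fix \<alpha> assume \<alpha>: "\<alpha> \<in> G"
    have "coord B (mul (u \<alpha>) (i + j)) e = coord B (mul (u \<alpha>) i) e + coord B (mul (u \<alpha>) j) e"
      unfolding mul_add_right using h E(3) by (intro coord_add[OF B(3) uB[OF \<alpha>] uB[OF \<alpha>]]) auto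
    then show "\<phi> e (i + j) \<alpha> = (\<phi> e i + \<phi> e j) \<alpha>" using \<alpha> by (simp add: \<phi>_def distrib_left aut_G(1)[OF \<alpha>])
  qed (use 1 h I2D(3) AC_Q in auto)
  \<comment> \<open>Expanding \<open>x\<^sub>\<rho>\<inverse> a\<close> through the inverses of
    degree \<beta>\<inverse>\<rho> yields, term by term, the product formula for \<open>a\<close>
    and \<open>\<phi> e i\<close>.\<close>
  have 3: "\<phi> e (mul a i) = mul a (\<phi> e i)" if h: "e \<in> E" "a \<in> AC" "i \<in> I2" for e a i
  proof (rule Q_eqI)
    have eB: "e \<in> B" using h E(3) by blast
    fix \<rho> assume \<rho>: "\<rho> \<in> G"
    let ?\<gamma> = "\<lambda>\<beta>. iv \<beta> \<circ> \<rho>"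
    have \<gamma>: "?\<gamma> \<beta> \<in> G" if "\<beta> \<in> G" for \<beta> using G(2,3) \<rho> that by blast
    let ?t = "\<lambda>\<beta>. a \<beta> * f \<beta> (?\<gamma> \<beta>)"
    have tS: "?t \<beta> \<in> S" if "\<beta> \<in> G" for \<beta> using AC_S[OF h(2) that] f_S[OF that \<gamma>[OF that]] by auto
    have "mul (u \<rho>) a = mul (u \<rho>) (\<Sum>\<beta>\<in>G. mon (a \<beta>) \<beta>)" using Q_decomp[OF AC_Q[OF h(2)]] by (rule arg_cong)
    also have "\<dots> = (\<Sum>\<beta>\<in>G. sc (iv \<rho> (?t \<beta>)) (u (?\<gamma> \<beta>)))"
      unfolding mul_sum_right by (intro sum.cong refl u_mon[OF \<rho>])
    finally have "mul (u \<rho>) (mul a i) = (\<Sum>\<beta>\<in>G. sc (iv \<rho> (?t \<beta>)) (mul (u (?\<gamma> \<beta>)) i))"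
      by (simp only: mul_assoc[symmetric] mul_sum_left mul_sc)
    then have "coord B (mul (u \<rho>) (mul a i)) e = coord B (\<Sum>\<beta>\<in>G. sc (iv \<rho> (?t \<beta>)) (mul (u (?\<gamma> \<beta>)) i)) e"
      by (rule arg_cong)
    also have "\<dots> = (\<Sum>\<beta>\<in>G. coord B (sc (iv \<rho> (?t \<beta>)) (mul (u (?\<gamma> \<beta>)) i)) e)"
      using GS[OF G(3)[OF \<rho>] tS] uB[OF \<gamma> h(3)] by (intro coord_sum[OF B(3) eB] smodD(3)[OF smod_spn])
    also have "\<dots> = (\<Sum>\<beta>\<in>G. iv \<rho> (?t \<beta>) * coord B (mul (u (?\<gamma> \<beta>)) i) e)"
      using GS[OF G(3)[OF \<rho>] tS] uB[OF \<gamma> h(3)] eB by (intro sum.cong refl coord_sc[OF B(3)])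
    finally have "\<phi> e (mul a i) \<rho> = \<rho> (s * (\<Sum>\<beta>\<in>G. iv \<rho> (?t \<beta>) * coord B (mul (u (?\<gamma> \<beta>)) i) e))"
      using \<rho> by (simp only: \<phi>_def if_True)
    also have "\<dots> = (\<Sum>\<beta>\<in>G. ?t \<beta> * \<rho> (s * coord B (mul (u (?\<gamma> \<beta>)) i) e))"
      unfolding sum_distrib_left aut_G(7)[OF \<rho>]
      by (intro sum.cong refl) (simp only: aut_G(2)[OF \<rho>] G(5)[OF \<rho>] mult.left_commute)
    also have "\<dots> = mul a (\<phi> e i) \<rho>" unfolding mul_apply[OF \<rho>]
    proof (intro sum.cong refl)
      fix \<beta> assume \<beta>: "\<beta> \<in> G"
      have "\<beta> (\<phi> e i (?\<gamma> \<beta>)) = (\<beta> \<circ> ?\<gamma> \<beta>) (s * coord B (mul (u (?\<gamma> \<beta>)) i) e)"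
        using \<gamma>[OF \<beta>] by (simp only: \<phi>_def if_True comp_apply)
      also have "\<dots> = \<rho> (s * coord B (mul (u (?\<gamma> \<beta>)) i) e)" by (simp only: G_iv(1)[OF \<beta>])
      finally show "?t \<beta> * \<rho> (s * coord B (mul (u (?\<gamma> \<beta>)) i) e) = a \<beta> * \<beta> (\<phi> e i (?\<gamma> \<beta>)) * f \<beta> (?\<gamma> \<beta>)"
        by (simp only: mult_ac)
    qed
    finally show "\<phi> e (mul a i) \<rho> = mul a (\<phi> e i) \<rho>" .
  qed (use 1 h I2D(5) AC_Q in auto)
  define X where "X = {mul x j | j. j \<in> I2}"
  have X_sum: "(\<Sum>i\<in>Y. g i) \<in> X" if "\<And>i. i \<in> Y \<Longrightarrow> g i \<in> X" for Y and g :: "('k \<Rightarrow> 'k) \<Rightarrow> _"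
  proof -
    have "\<forall>i. \<exists>j. i \<in> Y \<longrightarrow> j \<in> I2 \<and> g i = mul x j" using that unfolding X_def by blast
    then obtain j where j: "\<And>i. i \<in> Y \<Longrightarrow> j i \<in> I2 \<and> g i = mul x (j i)" by metis
    have "(\<Sum>i\<in>Y. g i) = (\<Sum>i\<in>Y. mul x (j i))" by (rule sum.cong) (use j in auto)
    then have "(\<Sum>i\<in>Y. g i) = mul x (\<Sum>i\<in>Y. j i)" by (simp only: mul_sum_right)
    moreover have "(\<Sum>i\<in>Y. j i) \<in> I2" using j by (intro smod_sum[OF I2D(7)]) auto
    ultimately show ?thesis unfolding X_def by blast
  qed
  have X_P: "mul p j \<in> X" if "p \<in> P" "j \<in> I2" for p j
  proof -
    obtain a where "a \<in> AC" "p = mul x a" using \<open>p \<in> P\<close> x(2) by blast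
    then show ?thesis unfolding X_def using I2D(5) that(2) by (auto simp: mul_assoc)
  qed
  have 4: "(\<Sum>e\<in>E. mul (\<phi> e i) e) - i \<in> X" if i: "i \<in> I" for i
  proof -
    have i2: "i \<in> I2" using i sub by blast
    have iQ: "i \<in> Q" using i ID(1) AC_Q by blast
    let ?c = "\<lambda>\<alpha>. coord B (mul (u \<alpha>) i)"
    define \<theta> where "\<theta> \<alpha> = (\<Sum>e\<in>E. sc (?c \<alpha> e) e)" for \<alpha>
    have \<theta>I: "\<theta> \<alpha> \<in> I2" if "\<alpha> \<in> G" for \<alpha>
      unfolding \<theta>_def using cS[OF that i2] E sub by (intro smod_sum[OF I2D(7)] I2D(6)) auto
    have "mul (\<phi> e i) e = (\<Sum>\<alpha>\<in>G. mul (mon 1 \<alpha>) (sc s (sc (?c \<alpha> e) e)))" if e: "e \<in> E" for e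
    proof -
      have eQ: "e \<in> Q" using e E(2) ID(1) AC_Q by blast
      have "mul (\<phi> e i) e = mul (\<Sum>\<alpha>\<in>G. mon (\<phi> e i \<alpha>) \<alpha>) e"
        using Q_decomp[OF AC_Q[OF 1[OF e i2]]] by (rule arg_cong)
      also have "\<dots> = (\<Sum>\<alpha>\<in>G. mul (mon (\<phi> e i \<alpha>) \<alpha>) e)" by (rule mul_sum_left)
      also have "\<dots> = (\<Sum>\<alpha>\<in>G. mul (mon 1 \<alpha>) (sc s (sc (?c \<alpha> e) e)))"
      proof (intro sum.cong refl)
        fix \<alpha> assume \<alpha>: "\<alpha> \<in> G"
        have "mon (\<phi> e i \<alpha>) \<alpha> = sc (\<alpha> (s * ?c \<alpha> e)) (mon 1 \<alpha>)" using \<alpha> by (auto simp: mon_def \<phi>_def fun_eq_iff)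
        then show "mul (mon (\<phi> e i \<alpha>) \<alpha>) e = mul (mon 1 \<alpha>) (sc s (sc (?c \<alpha> e) e))"
          by (simp only: sc_sc mon_mul_sc[OF \<alpha>] mul_sc)
      qed
      finally show ?thesis .
    qed
    then have "(\<Sum>e\<in>E. mul (\<phi> e i) e) = (\<Sum>e\<in>E. \<Sum>\<alpha>\<in>G. mul (mon 1 \<alpha>) (sc s (sc (?c \<alpha> e) e)))"
      by (intro sum.cong refl)
    also have "\<dots> = (\<Sum>\<alpha>\<in>G. \<Sum>e\<in>E. mul (mon 1 \<alpha>) (sc s (sc (?c \<alpha> e) e)))" by (rule sum.swap)
    also have "\<dots> = (\<Sum>\<alpha>\<in>G. mul (mon 1 \<alpha>) (sc s (\<theta> \<alpha>)))"
      by (intro sum.cong refl) (simp only: \<theta>_def sc_sum mul_sum_right)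
    also have "\<dots> = (\<Sum>\<alpha>\<in>G - H. mul (mon 1 \<alpha>) (sc s (\<theta> \<alpha>))) + (\<Sum>h\<in>H. mul (mon 1 h) (sc s (\<theta> h)))"
      using finG H_G by (intro sum.subset_diff) auto
    finally have T: "(\<Sum>e\<in>E. mul (\<phi> e i) e)
      = (\<Sum>\<alpha>\<in>G - H. mul (mon 1 \<alpha>) (sc s (\<theta> \<alpha>))) + (\<Sum>h\<in>H. mul (mon 1 h) (sc s (\<theta> h)))" .
    \<comment> \<open>Since \<open>s\<close> has \<open>H\<close>-trace 1, averaging over
      \<open>H\<close> with the identity in place of \<theta> returns \<open>i\<close>; only the
      deviation of \<theta> from the identity remains to be estimated there.\<close>
    have "(\<Sum>h\<in>H. mul (mon 1 h) (sc s (mul (u h) i))) = (\<Sum>h\<in>H. sc (h s) i)"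
    proof (intro sum.cong refl)
      fix h assume "h \<in> H"
      then have h: "h \<in> G" using H_G by blast
      show "mul (mon 1 h) (sc s (mul (u h) i)) = sc (h s) i"
        by (simp only: mon_mul_sc[OF h] mul_assoc[symmetric] mul_u[OF h] mul_one(2)[OF iQ])
    qed
    also have "\<dots> = i" unfolding sc_sum_left[symmetric] s(2) by (rule sc_1)
    finally have iH: "(\<Sum>h\<in>H. mul (mon 1 h) (sc s (mul (u h) i))) = i" .
    have "(\<Sum>e\<in>E. mul (\<phi> e i) e) - i = (\<Sum>\<alpha>\<in>G - H. mul (mon 1 \<alpha>) (sc s (\<theta> \<alpha>)))
        + ((\<Sum>h\<in>H. mul (mon 1 h) (sc s (\<theta> h))) - (\<Sum>h\<in>H. mul (mon 1 h) (sc s (mul (u h) i))))"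
      unfolding T iH by (rule add_diff_eq[symmetric])
    also have "(\<Sum>h\<in>H. mul (mon 1 h) (sc s (\<theta> h))) - (\<Sum>h\<in>H. mul (mon 1 h) (sc s (mul (u h) i)))
        = (\<Sum>h\<in>H. mul (mon 1 h) (sc s (\<theta> h - mul (u h) i)))"
      by (simp only: sc_diff mul_diff_right sum_subtractf)
    finally have eq: "(\<Sum>e\<in>E. mul (\<phi> e i) e) - i = (\<Sum>\<alpha>\<in>G - H. mul (mon 1 \<alpha>) (sc s (\<theta> \<alpha>)))
        + (\<Sum>h\<in>H. mul (mon 1 h) (sc s (\<theta> h - mul (u h) i)))" .
    have X1: "(\<Sum>\<alpha>\<in>G - H. mul (mon 1 \<alpha>) (sc s (\<theta> \<alpha>))) \<in> X"
    proof (rule X_sum)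
      fix \<alpha> assume \<alpha>: "\<alpha> \<in> G - H"
      then have "mon 1 \<alpha> \<in> P" unfolding P_def using mon_AC[of 1 \<alpha>] by (auto simp: mon_def)
      then show "mul (mon 1 \<alpha>) (sc s (\<theta> \<alpha>)) \<in> X" using \<alpha> by (intro X_P I2D(6)[OF s(1)] \<theta>I) auto
    qed
    have X2: "(\<Sum>h\<in>H. mul (mon 1 h) (sc s (\<theta> h - mul (u h) i))) \<in> X"
    proof (rule X_sum)
      fix h assume h: "h \<in> H"
      then have hG: "h \<in> G" using H_G by blast
      \<comment> \<open>For \<open>h\<close> in \<open>H\<close> the inverse of
        \<open>x\<^sub>h\<close> is integral, so \<open>x\<^sub>h\<inverse> i\<close> stays in
        \<open>I\<close> and the adapted basis applies: \<theta> moves it only by \<omega> times an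
        element of \<open>M\<close>.\<close>
      have uI: "mul (u h) i \<in> I" using ID(5)[OF u_AC[OF h] i] .
      have ui: "mul (u h) i = (\<Sum>b\<in>B. sc (?c h b) b)" by (rule coord(2)[OF uB[OF hG i2]])
      have cJ: "?c h b \<in> J" if "b \<in> B - I" for b
        by (rule adapted[OF uI _ ui that]) (use cS[OF hG i2] in blast)
      have "\<forall>b. \<exists>t. b \<in> B - I \<longrightarrow> t \<in> S \<and> ?c h b = \<omega> * t" using cJ in_J_iff by blast
      then obtain t where t: "\<And>b. b \<in> B - I \<Longrightarrow> t b \<in> S \<and> ?c h b = \<omega> * t b" by metis
      have BE: "B - E = B - I" by (auto simp: E_def)
      have "mul (u h) i = (\<Sum>b\<in>B - E. sc (?c h b) b) + \<theta> h"
        unfolding \<theta>_def using ui sum.subset_diff[OF E(3) B(1), of "\<lambda>b. sc (?c h b) b"] by (rule trans)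
      moreover have "p - q = 0 - r" if "q = r + p" for p q r :: "('k \<Rightarrow> 'k) \<Rightarrow> 'k" using that by simp
      ultimately have "\<theta> h - mul (u h) i = 0 - (\<Sum>b\<in>B - E. sc (?c h b) b)" by blast
      also have "(\<Sum>b\<in>B - E. sc (?c h b) b) = sc \<omega> (\<Sum>b\<in>B - E. sc (t b) b)"
        unfolding sc_sum BE by (intro sum.cong refl) (use t in \<open>simp only: sc_sc\<close>)
      also have "0 - \<dots> = sc \<omega> (0 - (\<Sum>b\<in>B - E. sc (t b) b))" by (simp only: sc_diff sc_0)
      finally have d: "\<theta> h - mul (u h) i = sc \<omega> (0 - (\<Sum>b\<in>B - E. sc (t b) b))" .
      have "0 - (\<Sum>b\<in>B - E. sc (t b) b) \<in> M" unfolding MB BE using t spn_base[OF B(1)]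
        by (intro smodD(4)[OF smod_spn] smodD(1)[OF smod_spn] smod_sum[OF smod_spn] smodD(3)[OF smod_spn]) auto
      then obtain g where g: "\<forall>\<alpha>\<in>G. g \<alpha> \<in> I2" "0 - (\<Sum>b\<in>B - E. sc (t b) b) = (\<Sum>\<alpha>\<in>G. mul (u \<alpha>) (g \<alpha>))"
        using M_E by meson
      have "mul (mon 1 h) (sc s (\<theta> h - mul (u h) i)) = (\<Sum>\<alpha>\<in>G. mul (mul (mon 1 h) (sc (s * \<omega>) (u \<alpha>))) (g \<alpha>))"
        unfolding d g(2) sc_sc by (simp only: sc_sum mul_sum_right mul_sc mul_assoc)
      also have "\<dots> \<in> X"
      proof (rule X_sum)
        fix \<alpha> assume \<alpha>: "\<alpha> \<in> G"
        show "mul (mul (mon 1 h) (sc (s * \<omega>) (u \<alpha>))) (g \<alpha>) \<in> X"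
          using g(1) \<alpha> by (intro X_P scaled_u_P[OF h \<alpha> s(1)]) blast
      qed
      finally show "mul (mon 1 h) (sc s (\<theta> h - mul (u h) i)) \<in> X" .
    qed
    have "a + b \<in> X" if "a \<in> X" "b \<in> X" for a b
      using that I2D(3) mul_add_right[of x] unfolding X_def by (auto simp del: plus_fun_apply) metis
    then show ?thesis unfolding eq using X1 X2 by blast
  qed
  have "\<forall>i\<in>I. \<exists>j\<in>I2. (\<Sum>e\<in>E. mul (\<phi> e i) e) - i = mul x j" using 4 unfolding X_def by blast
  then show ?thesis using E(1,2) 1 2 3 by (intro exI[of _ E] exI[of _ \<phi>] conjI ballI) auto
qed

end

section \<open>Jacobson radical and projectivity\<close>

context crossed
begin

lemma AC_spn: "AC = spn (mon 1 ` G)"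
proof
  show "spn (mon 1 ` G) \<subseteq> AC" using mon_AC[OF S_closed(2)] by (intro spn_least[OF smod_AC]) auto
  show "AC \<subseteq> spn (mon 1 ` G)"
  proof
    fix a assume a: "a \<in> AC"
    have "a = (\<Sum>\<alpha>\<in>G. mon (a \<alpha>) \<alpha>)" by (rule Q_decomp[OF AC_Q[OF a]])
    also have "\<dots> = (\<Sum>\<alpha>\<in>G. sc (a \<alpha>) (mon 1 \<alpha>))"
      by (intro sum.cong refl) (auto simp: mon_def fun_eq_iff)
    also have "\<dots> \<in> spn (mon 1 ` G)" using AC_S[OF a] finG
      by (intro smod_sum[OF smod_spn] smodD(3)[OF smod_spn] spn_base) auto
    finally show "a \<in> spn (mon 1 ` G)" .
  qed
qed

lemma one_AC: "mon 1 id \<in> AC" using mon_AC[OF S_closed(2) G(1)] .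

lemma left_ideal_eq_AC: "left_ideal A M \<Longrightarrow> mon 1 id \<in> M \<Longrightarrow> M = AC"
proof -
  assume M: "left_ideal A M" and one: "mon 1 id \<in> M"
  have "a \<in> M" if "a \<in> AC" for a
    using left_idealD(5)[OF M that one] mul_one(1)[OF AC_Q[OF that]] by simp
  then show ?thesis using left_idealD(1)[OF M] by blast
qed

lemma nakayama_AC:
  assumes M: "left_ideal A M" and "\<And>a. a \<in> AC \<Longrightarrow> \<exists>m\<in>M. \<exists>b\<in>AC. a = m + sc \<omega> b"
  shows "M = AC"
proof -
  have "mon 1 ` G \<subseteq> M"
  proof (rule nakayama[OF left_idealD(7)[OF M] \<omega>(1)])
    show "finite (mon 1 ` G)" using finG by simp
    fix b assume "b \<in> mon 1 ` G"
    then have "b \<in> AC" using mon_AC[OF S_closed(2)] by auto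
    then show "\<exists>n\<in>M. \<exists>y\<in>spn (mon 1 ` G). b = n + sc \<omega> y" using assms(2) AC_spn by blast
  qed
  then show ?thesis using G(1) by (intro left_ideal_eq_AC[OF M]) auto
qed

lemma left_ideal_sum:
  assumes M: "left_ideal A M" and L: "left_ideal A L"
  shows "left_ideal A {m + l | m l. m \<in> M \<and> l \<in> L}" (is "left_ideal A ?N")
proof (rule left_idealI)
  note m = left_idealD[OF M] and l = left_idealD[OF L]
  show "?N \<subseteq> AC" using m(1) l(1) AC_closed(2) by blast
  show "smod ?N" unfolding smod_def
  proof (intro conjI ballI)
    show "0 \<in> ?N" using m(2) l(2) by (intro CollectI exI[of _ 0]) simp
    fix a b assume "a \<in> ?N" "b \<in> ?N"
    then obtain p q r s where h: "p \<in> M" "q \<in> L" "a = p + q" "r \<in> M" "s \<in> L" "b = r + s" by blast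
    have "a + b = (p + r) + (q + s)" unfolding h(3,6) by (simp only: add_ac)
    then show "a + b \<in> ?N" using m(3)[OF h(1,4)] l(3)[OF h(2,5)] by blast
  next
    fix c a assume c: "c \<in> S" and "a \<in> ?N"
    then obtain p q where h: "p \<in> M" "q \<in> L" "a = p + q" by blast
    have "sc c a = sc c p + sc c q" unfolding h(3) by (rule sc_add)
    then show "sc c a \<in> ?N" using m(6)[OF c h(1)] l(6)[OF c h(2)] by blast
  qed
  fix \<alpha> a assume \<alpha>: "\<alpha> \<in> G" and "a \<in> ?N"
  then obtain p q where h: "p \<in> M" "q \<in> L" "a = p + q" by blast
  have "mul (mon 1 \<alpha>) a = mul (mon 1 \<alpha>) p + mul (mon 1 \<alpha>) q" unfolding h(3) by (rule mul_add_right)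
  then show "mul (mon 1 \<alpha>) a \<in> ?N"
    using m(5)[OF mon_AC[OF S_closed(2) \<alpha>] h(1)] l(5)[OF mon_AC[OF S_closed(2) \<alpha>] h(2)] by blast
qed

lemma maximal_sum_eq:
  assumes M: "maximal_left_ideal A M" and L: "left_ideal A L" and n: "\<not> L \<subseteq> M" and a: "a \<in> AC"
  shows "\<exists>m\<in>M. \<exists>l\<in>L. a = m + l"
proof -
  have Ml: "left_ideal A M" using M by (simp add: maximal_left_ideal_def)
  obtain N where N: "N = {m + l | m l. m \<in> M \<and> l \<in> L}" by blast
  have 1: "M \<subseteq> N"
  proof
    fix m assume "m \<in> M"
    moreover have "m = m + 0" by simp
    ultimately show "m \<in> N" unfolding N using left_idealD(2)[OF L] by blast
  qed
  have 2: "L \<subseteq> N"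
  proof
    fix l assume "l \<in> L"
    moreover have "l = 0 + l" by simp
    ultimately show "l \<in> N" unfolding N using left_idealD(2)[OF Ml] by blast
  qed
  have "left_ideal A N" unfolding N by (rule left_ideal_sum[OF Ml L])
  then have "N = M \<or> N = AC" using M 1 unfolding maximal_left_ideal_def A_simps by simp
  then have "N = AC" using n 2 by blast
  then have "a \<in> {m + l | m l. m \<in> M \<and> l \<in> L}" using a unfolding N by simp
  then show ?thesis by blast
qed

lemma sc_\<omega>_AC: "{sc \<omega> a | a. a \<in> AC} = {a \<in> AC. \<forall>\<rho>\<in>G. a \<rho> \<in> J}"
proof (intro equalityI subsetI)
  fix b assume "b \<in> {sc \<omega> a | a. a \<in> AC}"
  then obtain a where a: "a \<in> AC" "b = sc \<omega> a" by blast
  then show "b \<in> {a \<in> AC. \<forall>\<rho>\<in>G. a \<rho> \<in> J}"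
    using AC_closed(4)[OF a(1) \<omega>(2)] J_mult'[OF \<omega>(1) AC_S[OF a(1)]] by auto
next
  fix b assume b: "b \<in> {a \<in> AC. \<forall>\<rho>\<in>G. a \<rho> \<in> J}"
  have "\<forall>\<rho>. \<exists>s. (\<rho> \<in> G \<longrightarrow> s \<in> S \<and> b \<rho> = \<omega> * s) \<and> (\<rho> \<notin> G \<longrightarrow> s = 0)"
    using b in_J_iff by blast
  then obtain a where a: "\<And>\<rho>. (\<rho> \<in> G \<longrightarrow> a \<rho> \<in> S \<and> b \<rho> = \<omega> * a \<rho>) \<and> (\<rho> \<notin> G \<longrightarrow> a \<rho> = 0)" by metis
  have "a \<in> AC" using a by (auto simp: AC_def Q_def)
  moreover have "b = sc \<omega> a" using a b by (intro Q_eqI) (auto simp: AC_def Q_def)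
  ultimately show "b \<in> {sc \<omega> a | a. a \<in> AC}" by blast
qed

lemma left_ideal_\<omega>: "left_ideal A {a \<in> AC. \<forall>\<rho>\<in>G. a \<rho> \<in> J}"
proof (rule left_idealI)
  show "smod {a \<in> AC. \<forall>\<rho>\<in>G. a \<rho> \<in> J}"
    using AC_closed by (auto simp: smod_def intro: J_add J_mult)
  fix \<alpha> a assume \<alpha>: "\<alpha> \<in> G" and a: "a \<in> {a \<in> AC. \<forall>\<rho>\<in>G. a \<rho> \<in> J}"
  have "mul (mon 1 \<alpha>) a \<rho> \<in> J" if \<rho>: "\<rho> \<in> G" for \<rho>
  proof -
    have g: "iv \<alpha> \<circ> \<rho> \<in> G" using G(2,3) \<alpha> \<rho> by blast
    then have "a (iv \<alpha> \<circ> \<rho>) \<in> J" using a by blast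
    then show ?thesis unfolding mul_mon[OF \<alpha> \<rho>] using GJ[OF \<alpha>] f_S[OF \<alpha> g] by (simp add: J_mult')
  qed
  then show "mul (mon 1 \<alpha>) a \<in> {a \<in> AC. \<forall>\<rho>\<in>G. a \<rho> \<in> J}"
    using AC_mul[OF mon_AC[OF S_closed(2) \<alpha>]] a by blast
qed auto

lemma maximal_left_idealD:
  assumes "maximal_left_ideal A M" shows "left_ideal A M" "mon 1 id \<notin> M"
proof -
  show M: "left_ideal A M" using assms by (simp add: maximal_left_ideal_def)
  show "mon 1 id \<notin> M" using left_ideal_eq_AC[OF M] assms by (auto simp: maximal_left_ideal_def)
qed

text \<open>A maximal left ideal not containing \<omega>\<open>A\<close> would together with it sum
  to \<open>A\<close>, and then equal \<open>A\<close> by Nakayama's lemma over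
  \<open>S\<close>.\<close>

lemma \<omega>_jacobson: "a \<in> AC \<Longrightarrow> sc \<omega> a \<in> jacobson A"
proof -
  assume a: "a \<in> AC"
  let ?W = "{a \<in> AC. \<forall>\<rho>\<in>G. a \<rho> \<in> J}"
  have "?W \<subseteq> M" if M: "maximal_left_ideal A M" for M
  proof (rule ccontr)
    assume n: "\<not> ?W \<subseteq> M"
    have "M = AC"
    proof (rule nakayama_AC[OF maximal_left_idealD(1)[OF M]])
      fix a assume "a \<in> AC"
      then obtain m l where ml: "m \<in> M" "l \<in> ?W" "a = m + l"
        using maximal_sum_eq[OF M left_ideal_\<omega> n] by blast
      then obtain b where "b \<in> AC" "l = sc \<omega> b" unfolding sc_\<omega>_AC[symmetric] by blast
      then show "\<exists>m\<in>M. \<exists>b\<in>AC. a = m + sc \<omega> b" using ml by blast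
    qed
    then show False using maximal_left_idealD(2)[OF M] one_AC by blast
  qed
  moreover have "sc \<omega> a \<in> ?W" unfolding sc_\<omega>_AC[symmetric] using a by blast
  ultimately show ?thesis using AC_closed(4)[OF a \<omega>(2)] unfolding jacobson_def A_simps by blast
qed

lemma maximal_exists:
  assumes M0: "left_ideal A M0" "mon 1 id \<notin> M0"
  shows "\<exists>M. maximal_left_ideal A M \<and> M0 \<subseteq> M"
proof -
  let ?F = "{M. left_ideal A M \<and> M0 \<subseteq> M \<and> mon 1 id \<notin> M}"
  have "\<exists>M\<in>?F. \<forall>X\<in>?F. M \<subseteq> X \<longrightarrow> X = M"
  proof (rule subset_Zorn_nonempty)
    show "?F \<noteq> {}" using M0 by blast
    fix C assume C: "C \<noteq> {}" "subset.chain ?F C"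
    have li: "left_ideal A X" if "X \<in> C" for X using C(2) that by (auto simp: subset.chain_def)
    have chain: "X \<subseteq> Y \<or> Y \<subseteq> X" if "X \<in> C" "Y \<in> C" for X Y
      using C(2) that by (auto simp: subset.chain_def)
    have "left_ideal A (\<Union>C)"
    proof (rule left_idealI)
      show "\<Union>C \<subseteq> AC" using left_idealD(1)[OF li] by blast
      show "smod (\<Union>C)" unfolding smod_def
      proof (intro conjI ballI)
        show "0 \<in> \<Union>C" using C(1) left_idealD(2)[OF li] by blast
        fix a b assume "a \<in> \<Union>C" "b \<in> \<Union>C"
        then obtain X Y where XY: "X \<in> C" "a \<in> X" "Y \<in> C" "b \<in> Y" by blast
        show "a + b \<in> \<Union>C"
        proof (cases "X \<subseteq> Y")
          case True
          then have "a + b \<in> Y" using left_idealD(3)[OF li[OF XY(3)]] XY by blast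
          then show ?thesis using XY by blast
        next
          case False
          then have "a + b \<in> X" using left_idealD(3)[OF li[OF XY(1)]] XY chain by blast
          then show ?thesis using XY by blast
        qed
      next
        fix c a assume "c \<in> S" "a \<in> \<Union>C"
        then show "sc c a \<in> \<Union>C" using left_idealD(6)[OF li] by blast
      qed
      fix \<alpha> x assume "\<alpha> \<in> G" "x \<in> \<Union>C"
      then show "mul (mon 1 \<alpha>) x \<in> \<Union>C" using left_idealD(5)[OF li mon_AC[OF S_closed(2)]] by blast
    qed
    moreover have CF: "M0 \<subseteq> X \<and> mon 1 id \<notin> X" if "X \<in> C" for X
      using C(2) that by (auto simp: subset.chain_def)
    have "M0 \<subseteq> \<Union>C" "mon 1 id \<notin> \<Union>C" using CF C(1) by blast+
    ultimately show "\<Union>C \<in> ?F" by blast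
  qed
  then obtain M where MF: "M \<in> ?F" and max: "\<forall>X\<in>?F. M \<subseteq> X \<longrightarrow> X = M" by (rule bexE)
  have M: "left_ideal A M" "M0 \<subseteq> M" "mon 1 id \<notin> M" using MF by simp_all
  have "maximal_left_ideal A M" unfolding maximal_left_ideal_def A_simps
  proof (intro conjI allI impI)
    show "M \<noteq> AC" using M(3) one_AC by blast
    fix X assume X: "left_ideal A X \<and> M \<subseteq> X"
    show "X = M \<or> X = AC"
    proof (cases "mon 1 id \<in> X")
      case True
      then show ?thesis using left_ideal_eq_AC X by blast
    next
      case False
      then have "X \<in> ?F" using X subset_trans[OF M(2)] by simp
      then show ?thesis using bspec[OF max] X by simp
    qed
  qed (rule M(1))
  then show ?thesis using M(2) by blast
qed

lemma left_ideal_jacobson: "left_ideal A (jacobson A)"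
proof (rule left_idealI)
  show "jacobson A \<subseteq> AC" by (auto simp: jacobson_def)
  show "smod (jacobson A)" unfolding smod_def jacobson_def
    using AC_closed left_idealD(2,3,6)[OF maximal_left_idealD(1)] by (simp add: AC_closed)
  fix \<alpha> x assume "\<alpha> \<in> G" "x \<in> jacobson A"
  then show "mul (mon 1 \<alpha>) x \<in> jacobson A"
    using AC_mul[OF mon_AC[OF S_closed(2)]] left_idealD(5)[OF maximal_left_idealD(1) mon_AC[OF S_closed(2)]]
    unfolding jacobson_def by simp
qed

lemma principal_left_ideal:
  assumes d: "d \<in> AC" shows "left_ideal A {mul b d | b. b \<in> AC}" (is "left_ideal A ?M")
proof (rule left_idealI)
  show "?M \<subseteq> AC" using AC_mul d by blast
  show "smod ?M" unfolding smod_def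
  proof (intro conjI ballI)
    show "0 \<in> ?M" using AC_closed(1) mul_0(1)[of d] by (metis (mono_tags, lifting) mem_Collect_eq)
    fix a b assume "a \<in> ?M" "b \<in> ?M"
    then obtain p q where h: "p \<in> AC" "q \<in> AC" "a = mul p d" "b = mul q d" by blast
    then have "a + b = mul (p + q) d" by (simp only: mul_add_left)
    then show "a + b \<in> ?M" using AC_closed(2)[OF h(1,2)] by blast
  next
    fix c a assume c: "c \<in> S" and "a \<in> ?M"
    then obtain p where h: "p \<in> AC" "a = mul p d" by blast
    then have "sc c a = mul (sc c p) d" by (simp only: mul_sc)
    then show "sc c a \<in> ?M" using AC_closed(4)[OF h(1) c] by blast
  qed
  fix \<alpha> a assume \<alpha>: "\<alpha> \<in> G" and "a \<in> ?M"
  then obtain p where h: "p \<in> AC" "a = mul p d" by blast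
  then have "mul (mon 1 \<alpha>) a = mul (mul (mon 1 \<alpha>) p) d" by (simp only: mul_assoc)
  then show "mul (mon 1 \<alpha>) a \<in> ?M" using AC_mul[OF mon_AC[OF S_closed(2) \<alpha>] h(1)] by blast
qed

text \<open>Otherwise the left ideal of \<open>1 - t\<close> is proper and lies in a maximal one,
  which also contains \<open>t\<close> and hence 1.\<close>

lemma jacobson_left_inverse:
  assumes t: "t \<in> jacobson A" shows "\<exists>b\<in>AC. mul b (mon 1 id - t) = mon 1 id"
proof (rule ccontr)
  assume n: "\<not> ?thesis"
  have tA: "t \<in> AC" using t by (simp add: jacobson_def)
  have dA: "mon 1 id - t \<in> AC" using AC_closed(3)[OF one_AC tA] .
  let ?M = "{mul b (mon 1 id - t) | b. b \<in> AC}"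
  note principal_left_ideal[OF dA]
  moreover have "mon 1 id \<notin> ?M"
  proof
    assume "mon 1 id \<in> ?M"
    then obtain b where "b \<in> AC" "mon 1 id = mul b (mon 1 id - t)" by blast
    then show False using n by metis
  qed
  ultimately obtain M where M: "maximal_left_ideal A M" "?M \<subseteq> M" using maximal_exists by blast
  have "mul (mon 1 id) (mon 1 id - t) \<in> M" using M(2) one_AC by blast
  then have 1: "mon 1 id - t \<in> M" using mul_one(2)[OF AC_Q[OF dA]] by metis
  have "t \<in> M" using t M(1) by (simp add: jacobson_def)
  then have "(mon 1 id - t) + t \<in> M" using left_idealD(3)[OF maximal_left_idealD(1)[OF M(1)] 1] by blast
  moreover have "(mon 1 id - t) + t = mon 1 id" by simp
  ultimately show False using maximal_left_idealD(2)[OF M(1)] by metis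
qed

text \<open>A left inverse of \<open>1 - t\<close> is again 1 minus an element of the radical, so it
  has a left inverse itself, which must be \<open>1 - t\<close>.\<close>

lemma jacobson_two_sided_inverse:
  assumes t: "t \<in> jacobson A" shows "\<exists>b\<in>AC. mul (mon 1 id - t) b = mon 1 id"
proof -
  have tA: "t \<in> AC" using t by (simp add: jacobson_def)
  have dA: "mon 1 id - t \<in> AC" using AC_closed(3)[OF one_AC tA] .
  obtain b where b: "b \<in> AC" "mul b (mon 1 id - t) = mon 1 id" using jacobson_left_inverse[OF t] by blast
  let ?t = "0 - mul b t"
  have "b - mul b t = mon 1 id" using b(2) mul_one(1)[OF AC_Q[OF b(1)]] by (simp only: mul_diff_right)
  moreover have "p = m - (0 - q)" if "p - q = m" for p q m :: "('k \<Rightarrow> 'k) \<Rightarrow> 'k" using that by auto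
  ultimately have bt: "b = mon 1 id - ?t" by blast
  have "?t \<in> jacobson A"
    using left_idealD(2,4,5)[OF left_ideal_jacobson] b(1) t by blast
  then obtain c where c: "c \<in> AC" "mul c b = mon 1 id" using jacobson_left_inverse[of ?t] bt by metis
  have "c = mul c (mul b (mon 1 id - t))" using b(2) mul_one(1)[OF AC_Q[OF c(1)]] by simp
  also have "\<dots> = mon 1 id - t" using c(2) mul_one(2)[OF AC_Q[OF dA]] by (simp only: mul_assoc[symmetric])
  finally show ?thesis using b(1) c(2) by blast
qed

text \<open>\<open>A\<close> is finite over \<open>S\<close>: the products of the
  \<open>x\<^sub>\<alpha>\<close> with the given generators generate the ideal over
  \<open>S\<close>.\<close>

lemma fg_left_ideal_spn:
  assumes "fg_left_ideal A I" shows "left_ideal A I" "\<exists>B0. finite B0 \<and> I = spn B0"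
proof -
  show I: "left_ideal A I" using assms by (simp add: fg_left_ideal_def)
  obtain B where B: "finite B" "B \<subseteq> I" "I = \<Inter>{J. left_ideal A J \<and> B \<subseteq> J}"
    using assms unfolding fg_left_ideal_def by blast
  define B0 where "B0 = (\<lambda>(\<alpha>, b). mul (mon 1 \<alpha>) b) ` (G \<times> B)"
  have fin: "finite B0" using finG B(1) by (simp add: B0_def)
  have B0: "mul (mon 1 \<alpha>) b \<in> B0" if "\<alpha> \<in> G" "b \<in> B" for \<alpha> b using that unfolding B0_def by force
  have sub: "B0 \<subseteq> I" unfolding B0_def using B(2) left_idealD(5)[OF I mon_AC[OF S_closed(2)]] by auto
  have spI: "spn B0 \<subseteq> I" by (rule spn_least[OF left_idealD(7)[OF I] sub])
  have "left_ideal A (spn B0)"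
  proof (rule left_idealI[OF smod_spn])
    show "spn B0 \<subseteq> AC" using spI left_idealD(1)[OF I] by blast
    fix \<beta> x assume \<beta>: "\<beta> \<in> G" and x: "x \<in> spn B0"
    have base: "mul (mon 1 \<beta>) y \<in> spn B0" if y: "y \<in> B0" for y
    proof -
      obtain \<alpha> b where a: "\<alpha> \<in> G" "b \<in> B" "y = mul (mon 1 \<alpha>) b" using y unfolding B0_def by auto
      have "mul (mon 1 \<beta>) (mon 1 \<alpha>) = sc (f \<beta> \<alpha>) (mon 1 (\<beta> \<circ> \<alpha>))"
        unfolding mon_mon[OF \<beta> a(1)] using aut_G(4)[OF \<beta>] by (auto simp: fun_eq_iff mon_def)
      then have "mul (mon 1 \<beta>) y = sc (f \<beta> \<alpha>) (mul (mon 1 (\<beta> \<circ> \<alpha>)) b)"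
        unfolding a(3) by (simp only: mul_assoc[symmetric] mul_sc)
      then show ?thesis
        using smodD(3)[OF smod_spn f_S[OF \<beta> a(1)] spn_base[OF fin B0[OF G(2)[OF \<beta> a(1)] a(2)]]] by simp
    qed
    have "mul (mon 1 \<beta>) x = mul (mon 1 \<beta>) (\<Sum>b\<in>B0. sc (coord B0 x b) b)" using coord(2)[OF x] by (rule arg_cong)
    also have "\<dots> = (\<Sum>b\<in>B0. sc (\<beta> (coord B0 x b)) (mul (mon 1 \<beta>) b))"
      unfolding mul_sum_right
      by (intro sum.cong refl Q_eqI) (auto simp: mul_mon[OF \<beta>] aut_G(2)[OF \<beta>])
    also have "\<dots> \<in> spn B0"
      using base GS[OF \<beta> coord(1)[OF x]] by (intro smod_sum[OF smod_spn] smodD(3)[OF smod_spn])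
    finally show "mul (mon 1 \<beta>) x \<in> spn B0" .
  qed
  moreover have "B \<subseteq> spn B0"
  proof
    fix b assume b: "b \<in> B"
    have "b \<in> Q" using b B(2) left_idealD(1)[OF I] AC_Q by blast
    then have "mul (mon 1 id) b = b" by (rule mul_one(2))
    then show "b \<in> spn B0" using spn_base[OF fin B0[OF G(1) b]] by simp
  qed
  ultimately have "I \<subseteq> spn B0" using B(3) by blast
  then show "\<exists>B0. finite B0 \<and> I = spn B0" using fin spI by blast
qed

end

section \<open>The ideal \<open>P\<close> and the Jacobson radical\<close>

context crossed_reduced
begin

text \<open>For \<alpha> outside \<open>H\<close>, reaching a degree in \<open>H\<close> produces a
  carry, as \<Phi> must drop to 0. For \<alpha> in \<open>H\<close>, coefficients along
  \<open>H\<close> arise only from coefficients along \<open>H\<close>.\<close>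

lemma P_left_ideal: "left_ideal A P"
proof (rule left_idealI)
  show "smod P" using AC_closed H_G by (auto simp: P_def smod_def intro: J_add J_mult)
  show "P \<subseteq> AC" by (auto simp: P_def)
  fix \<alpha> a assume \<alpha>: "\<alpha> \<in> G" and a: "a \<in> P"
  then have aA: "a \<in> AC" by (simp add: P_def)
  have "mul (mon 1 \<alpha>) a h \<in> J" if h: "h \<in> H" for h
  proof -
    have hG: "h \<in> G" using h H_G by blast
    have g: "iv \<alpha> \<circ> h \<in> G" using G(2,3) \<alpha> hG by blast
    have "\<alpha> (a (iv \<alpha> \<circ> h)) * f \<alpha> (iv \<alpha> \<circ> h) \<in> J"
    proof (cases "\<alpha> \<in> H")
      case True
      then have "iv \<alpha> \<circ> h \<in> H" using H_comp H_inv h by blast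
      then have "a (iv \<alpha> \<circ> h) \<in> J" using a by (simp add: P_def)
      then show ?thesis using GJ[OF \<alpha>] f_S[OF \<alpha> g] by (intro J_mult') auto
    next
      case False
      have "\<Phi> \<alpha> + \<Phi> (iv \<alpha> \<circ> h) = n * w \<alpha> (iv \<alpha> \<circ> h) + \<Phi> h"
        using \<Phi>_add[OF \<alpha> g] by (simp only: G_iv(1)[OF \<alpha>])
      moreover have "\<Phi> \<alpha> \<noteq> 0" "\<Phi> h = 0" using False mem_H[OF \<alpha>] mem_H[OF hG] h by auto
      ultimately have "n * w \<alpha> (iv \<alpha> \<circ> h) \<noteq> 0" by linarith
      then have "w \<alpha> (iv \<alpha> \<circ> h) \<noteq> 0" by (rule contrapos_nn) simp
      then have "f \<alpha> (iv \<alpha> \<circ> h) \<in> J" by (auto simp: w_def split: if_splits)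
      then show ?thesis using GS[OF \<alpha> AC_S[OF aA g]] by (intro J_mult)
    qed
    then show ?thesis unfolding mul_mon[OF \<alpha> hG] by simp
  qed
  then show "mul (mon 1 \<alpha>) a \<in> P" using AC_mul[OF mon_AC[OF S_closed(2) \<alpha>] aA] by (simp add: P_def)
qed

lemma pow_mul_ideal: "left_ideal A I \<Longrightarrow> x \<in> AC \<Longrightarrow> i \<in> I \<Longrightarrow> (mul x ^^ k) i \<in> I"
  by (induction k) (auto intro: left_idealD)

lemma pow_mul_add: "(mul x ^^ k) (a + b) = (mul x ^^ k) a + (mul x ^^ k) b"
  by (induction k) (simp_all only: funpow.simps comp_apply mul_add_right id_apply)

text \<open>If a maximal left ideal \<open>M\<close> did not contain \<open>P = x A\<close>, then
  \<open>M + x A = A\<close>. Iterating gives \<open>M + x\<^sup>N A = A\<close> with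
  \<open>x\<^sup>N A\<close> inside \<omega>\<open>A\<close>, and Nakayama's lemma applies.\<close>

lemma P_subset_jacobson: "P \<subseteq> jacobson A"
proof -
  obtain x N y where x: "x \<in> AC" "{mul x a | a. a \<in> AC} = P"
    and y: "y \<in> AC" "\<And>a. a \<in> Q \<Longrightarrow> (mul x ^^ N) a = sc \<omega> (mul y a)" using prime_element by blast
  have "P \<subseteq> M" if M: "maximal_left_ideal A M" for M
  proof (rule ccontr)
    assume n: "\<not> P \<subseteq> M"
    note Ml = maximal_left_idealD(1)[OF M]
    have one: "\<exists>m\<in>M. \<exists>b\<in>AC. a = m + mul x b" if a: "a \<in> AC" for a
    proof -
      obtain m p where mp: "m \<in> M" "p \<in> P" "a = m + p" using maximal_sum_eq[OF M P_left_ideal n a] by blast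
      obtain b where "b \<in> AC" "p = mul x b" using mp(2) x(2) by blast
      then show ?thesis using mp by blast
    qed
    have "\<exists>m\<in>M. \<exists>b\<in>AC. a = m + (mul x ^^ k) b" if a: "a \<in> AC" for a k
    proof (induction k)
      case 0
      have "a = 0 + (mul x ^^ 0) a" by simp
      then show ?case using left_idealD(2)[OF Ml] a by blast
    next
      case (Suc k)
      then obtain m b where mb: "m \<in> M" "b \<in> AC" "a = m + (mul x ^^ k) b" by blast
      obtain m' b' where mb': "m' \<in> M" "b' \<in> AC" "b = m' + mul x b'" using one[OF mb(2)] by blast
      have "a = (m + (mul x ^^ k) m') + (mul x ^^ Suc k) b'"
        unfolding mb(3) mb'(3) pow_mul_add funpow_Suc_right comp_apply by (simp only: add.assoc)
      moreover have "m + (mul x ^^ k) m' \<in> M" using left_idealD(3)[OF Ml mb(1) pow_mul_ideal[OF Ml x(1) mb'(1)]] .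
      ultimately show ?case using mb'(2) by blast
    qed
    then have "\<exists>m\<in>M. \<exists>b\<in>AC. a = m + sc \<omega> b" if "a \<in> AC" for a
      using that y AC_Q AC_mul by metis
    then have "M = AC" by (rule nakayama_AC[OF Ml])
    then show False using maximal_left_idealD(2)[OF M] one_AC by blast
  qed
  moreover have "P \<subseteq> AC" by (auto simp: P_def)
  ultimately show ?thesis unfolding jacobson_def A_simps by blast
qed

end

context crossed_tame
begin

text \<open>The average is left \<open>A\<close>-linear on \<open>A\<close>, hence right
  multiplication by its value \<open>t\<close> at 1. As \<open>t\<close> is in the radical,
  \<open>1 - t\<close> is invertible; since \<open>a t - a\<close> lies in the right ideal
  \<open>x A\<close>, so does \<open>a\<close>.\<close>

lemma jacobson_eq_P: "jacobson A = P"
proof (rule antisym[OF _ P_subset_jacobson], rule subsetI)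
  fix a assume a: "a \<in> jacobson A"
  obtain x where x: "x \<in> AC" "{mul x a | a. a \<in> AC} = P" using prime_element by blast
  note I = left_ideal_jacobson
  have AA: "left_ideal A AC" using smod_AC AC_mul mon_AC[OF S_closed(2)] by (intro left_idealI) auto
  have "finite (mon 1 ` G)" using finG by simp
  from relative_trace[OF I AA left_idealD(1)[OF I] this AC_spn x]
  obtain E \<phi> where E: "finite E" "E \<subseteq> jacobson A" "\<forall>e\<in>E. \<forall>i\<in>AC. \<phi> e i \<in> AC"
    and lin: "\<forall>e\<in>E. \<forall>a\<in>AC. \<forall>i\<in>AC. \<phi> e (mul a i) = mul a (\<phi> e i)"
    and T: "\<forall>i\<in>jacobson A. \<exists>j\<in>AC. (\<Sum>e\<in>E. mul (\<phi> e i) e) - i = mul x j" by blast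
  define t where "t = (\<Sum>e\<in>E. mul (\<phi> e (mon 1 id)) e)"
  have tJ: "t \<in> jacobson A" unfolding t_def
    using E one_AC by (intro smod_sum[OF left_idealD(7)[OF I]] left_idealD(5)[OF I]) auto
  have aA: "a \<in> AC" using a by (simp add: jacobson_def)
  have "(\<Sum>e\<in>E. mul (\<phi> e a) e) = (\<Sum>e\<in>E. mul a (mul (\<phi> e (mon 1 id)) e))"
  proof (intro sum.cong refl)
    fix e assume e: "e \<in> E"
    have "\<phi> e (mul a (mon 1 id)) = mul a (\<phi> e (mon 1 id))" using lin e aA one_AC by blast
    then show "mul (\<phi> e a) e = mul a (mul (\<phi> e (mon 1 id)) e)"
      by (simp only: mul_one(1)[OF AC_Q[OF aA]] mul_assoc)
  qed
  also have "\<dots> = mul a t" unfolding t_def by (rule mul_sum_right[symmetric])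
  finally have Ta: "(\<Sum>e\<in>E. mul (\<phi> e a) e) = mul a t" .
  obtain j where j: "j \<in> AC" "mul a t - a = mul x j" using bspec[OF T a] unfolding Ta by (rule bexE)
  obtain b where b: "b \<in> AC" "mul (mon 1 id - t) b = mon 1 id" using jacobson_two_sided_inverse[OF tJ] by blast
  have "a = mul a (mul (mon 1 id - t) b)" using b(2) mul_one(1)[OF AC_Q[OF aA]] by simp
  also have "\<dots> = mul (a - mul a t) b" using mul_one(1)[OF AC_Q[OF aA]] by (simp only: mul_assoc[symmetric] mul_diff_right)
  also have "a - mul a t = mul x (0 - j)"
    unfolding mul_diff_right mul_0 j(2)[symmetric] by (rule ext) simp
  also have "mul (mul x (0 - j)) b = mul x (mul (0 - j) b)" by (rule mul_assoc)
  finally have "a = mul x (mul (0 - j) b)" .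
  moreover have "mul (0 - j) b \<in> AC" using AC_closed(1,3) j(1) b(1) AC_mul by blast
  ultimately show "a \<in> P" using x(2) by blast
qed

text \<open>The average \<open>T\<close> factors through a free module and differs from the identity
  by a map \<open>D\<close> into \<open>x I\<close> that commutes with \<open>x\<close>. Hence
  \<open>D\<^sup>N\<close> maps into \<omega>\<open>I\<close>, which makes \<open>T\<close>
  bijective; composing with its inverse gives the splitting.\<close>

lemma left_projective:
  assumes "fg_left_ideal A I" shows "projective_left_ideal A I"
proof -
  have I: "left_ideal A I" by (rule fg_left_ideal_spn(1)[OF assms])
  note ID = left_idealD[OF I]
  obtain B0 where B0: "finite B0" "I = spn B0" using fg_left_ideal_spn(2)[OF assms] by blast
  obtain x N y where x: "x \<in> AC" "{mul x a | a. a \<in> AC} = P"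
    and y: "y \<in> AC" "\<And>a. a \<in> Q \<Longrightarrow> (mul x ^^ N) a = sc \<omega> (mul y a)" using prime_element by blast
  from relative_trace[OF I I subset_refl B0 x]
  obtain E \<phi> where E: "finite E" "E \<subseteq> I" and \<phi>: "\<forall>e\<in>E. \<forall>i\<in>I. \<phi> e i \<in> AC"
    and add: "\<forall>e\<in>E. \<forall>i\<in>I. \<forall>j\<in>I. \<phi> e (i + j) = \<phi> e i + \<phi> e j"
    and lin: "\<forall>e\<in>E. \<forall>a\<in>AC. \<forall>i\<in>I. \<phi> e (mul a i) = mul a (\<phi> e i)"
    and Tx: "\<forall>i\<in>I. \<exists>j\<in>I. (\<Sum>e\<in>E. mul (\<phi> e i) e) - i = mul x j" by blast
  define T where "T i = (\<Sum>e\<in>E. mul (\<phi> e i) e)" for i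
  define D where "D i = T i - i" for i
  have T_I: "T i \<in> I" if i: "i \<in> I" for i
    unfolding T_def using \<phi> i E(2) by (intro smod_sum[OF ID(7)] ID(5)) auto
  have T_add: "T (i + j) = T i + T j" if "i \<in> I" "j \<in> I" for i j
  proof -
    have "T (i + j) = (\<Sum>e\<in>E. mul (\<phi> e i) e + mul (\<phi> e j) e)" unfolding T_def
    proof (intro sum.cong refl)
      fix e assume "e \<in> E"
      then have "\<phi> e (i + j) = \<phi> e i + \<phi> e j" using add that by blast
      then show "mul (\<phi> e (i + j)) e = mul (\<phi> e i) e + mul (\<phi> e j) e" by (simp only: mul_add_left)
    qed
    then show ?thesis unfolding T_def by (simp only: sum.distrib)
  qed
  have T_mul: "T (mul a i) = mul a (T i)" if "a \<in> AC" "i \<in> I" for a i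
  proof -
    have "T (mul a i) = (\<Sum>e\<in>E. mul a (mul (\<phi> e i) e))" unfolding T_def
    proof (intro sum.cong refl)
      fix e assume "e \<in> E"
      then have "\<phi> e (mul a i) = mul a (\<phi> e i)" using lin that by blast
      then show "mul (\<phi> e (mul a i)) e = mul a (mul (\<phi> e i) e)" by (simp only: mul_assoc)
    qed
    then show ?thesis unfolding T_def by (simp only: mul_sum_right)
  qed
  have IQ: "i \<in> Q" if "i \<in> I" for i using that ID(1) AC_Q by blast
  have T_sc: "T (sc c i) = sc c (T i)" if "c \<in> S" "i \<in> I" for c i
    using T_mul[OF mon_AC[OF that(1) G(1)] that(2)] by (simp only: mon_id_mul[OF IQ[OF that(2)]] mon_id_mul[OF IQ[OF T_I[OF that(2)]]])
  have T_diff: "T (i - j) = T i - T j" if "i \<in> I" "j \<in> I" for i j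
    using T_add[OF ID(4)[OF that] that(2)] by (simp add: eq_diff_eq)
  have D_I: "D i \<in> I" if "i \<in> I" for i unfolding D_def using ID(4)[OF T_I[OF that] that] .
  have D_mul: "D (mul a i) = mul a (D i)" if "a \<in> AC" "i \<in> I" for a i
    unfolding D_def T_mul[OF that] mul_diff_right ..
  have xk: "(mul x ^^ k) i \<in> I" if "i \<in> I" for k i by (rule pow_mul_ideal[OF I x(1) that])
  have D_pow: "D ((mul x ^^ k) i) = (mul x ^^ k) (D i)" if "i \<in> I" for k i
  proof (induction k)
    case (Suc k)
    then show ?case using D_mul[OF x(1) xk[OF that]] by (simp only: funpow.simps comp_apply)
  qed simp
  have Dk: "\<exists>j\<in>I. (D ^^ k) i = (mul x ^^ k) j" if i: "i \<in> I" for k i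
  proof (induction k)
    case 0
    then show ?case using i by (intro bexI[of _ i]) simp_all
  next
    case (Suc k)
    then obtain j where j: "j \<in> I" "(D ^^ k) i = (mul x ^^ k) j" by blast
    obtain j' where j': "j' \<in> I" "D j = mul x j'" using bspec[OF Tx j(1)] unfolding D_def T_def by (rule bexE)
    have "(D ^^ Suc k) i = (mul x ^^ Suc k) j'"
      unfolding funpow.simps(2) comp_apply j(2) D_pow[OF j(1)] j'(2) funpow_swap1 ..
    then show ?case using j'(1) by blast
  qed
  have D\<omega>: "\<exists>j\<in>I. (D ^^ N) i = sc \<omega> j" if i: "i \<in> I" for i
  proof -
    obtain j where "j \<in> I" "(D ^^ N) i = (mul x ^^ N) j" using Dk[OF i] by blast
    then show ?thesis using y(2)[OF IQ] ID(5)[OF y(1)] by metis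
  qed
  have sgnS: "(-1) ^ k \<in> S" for k :: nat by (intro S_power) auto
  obtain B where B: "finite B" "spn B = I" "indep B"
    by (rule adapted_basis[OF B0(1) empty_subsetI]) (simp add: B0(2))
  \<comment> \<open>On the kernel of \<open>T\<close> the map \<open>D\<close> is -1, so kernel
    elements lie in \<omega>\<open>I\<close>. Scaling one to have a coordinate equal to 1 makes this
    impossible.\<close>
  have inj: "i = 0" if i: "i \<in> I" "T i = 0" for i
  proof (rule ccontr)
    assume i0: "i \<noteq> 0"
    have iB: "i \<in> spn B" using i B by simp
    let ?c = "coord B i"
    have "\<exists>b\<in>B. ?c b \<noteq> 0"
    proof (rule ccontr)
      assume "\<not> ?thesis"
      then have "(\<Sum>b\<in>B. sc (?c b) b) = (\<Sum>b\<in>B. 0)" by (intro sum.cong refl) simp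
      then show False using i0 coord(2)[OF iB] by simp
    qed
    then obtain b0 where b0: "b0 \<in> B" "?c b0 \<noteq> 0" "\<And>b. b \<in> B \<Longrightarrow> ?c b / ?c b0 \<in> S"
      using finite_min[OF B(1), of ?c] by metis
    define j where "j = (\<Sum>b\<in>B. sc (?c b / ?c b0) b)"
    have jI: "j \<in> I" unfolding j_def B(2)[symmetric] spn_def using b0(3)
      by (intro CollectI exI[of _ "\<lambda>b. ?c b / ?c b0"] conjI refl ballI)
    have "sc (?c b0) j = (\<Sum>b\<in>B. sc (?c b) b)" unfolding j_def sc_sum sc_sc using b0(2) by simp
    then have ij: "i = sc (?c b0) j" using coord(2)[OF iB] by simp
    have "sc (?c b0) (T j) = 0" using T_sc[OF coord(1)[OF iB b0(1)] jI] ij i(2) by simp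
    then have "sc (inverse (?c b0)) (sc (?c b0) (T j)) = 0" by simp
    then have Tj: "T j = 0" using b0(2) by (simp add: sc_sc)
    have "(D ^^ k) j = sc ((-1) ^ k) j" for k
    proof (induction k)
      case (Suc k)
      have "D (sc ((-1) ^ k) j) = sc ((-1) ^ Suc k) j"
        unfolding D_def T_sc[OF sgnS jI] Tj by (rule ext) simp
      then show ?case unfolding funpow.simps(2) comp_apply Suc .
    qed simp
    then obtain z where z: "z \<in> I" "sc ((-1) ^ N) j = sc \<omega> z" using D\<omega>[OF jI] by metis
    have "sc ((-1) ^ N) (sc ((-1) ^ N) j) = j" unfolding sc_sc by (simp add: power_mult_distrib[symmetric])
    then have j: "j = sc ((-1) ^ N * \<omega>) z" unfolding z(2) sc_sc by (rule sym)
    have zB: "z \<in> spn B" using z B by simp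
    have "coord B j b0 = (-1) ^ N * \<omega> * coord B z b0"
      unfolding j using sgnS \<omega>(2) by (intro coord_sc[OF B(3) zB _ b0(1)]) auto
    moreover have "coord B j b0 = 1" using coord_eq[OF B(3) _ j_def b0(1)] b0 by simp
    moreover have "(-1) ^ N * \<omega> * coord B z b0 \<in> J"
      by (rule J_mult'[OF J_mult[OF sgnS \<omega>(1)] coord(1)[OF zB b0(1)]])
    ultimately show False by simp
  qed
  have surj: "\<exists>j\<in>I. T j = i" if "i \<in> I" for i
  proof -
    have smodT: "smod (T ` I)" unfolding smod_def
    proof (intro conjI ballI)
      have "T 0 = 0" using T_sc[OF S_closed(1) ID(2)] by simp
      then show "0 \<in> T ` I" using ID(2) by (metis image_eqI)
      fix a b assume "a \<in> T ` I" "b \<in> T ` I"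
      then show "a + b \<in> T ` I" using T_add ID(3) by (metis (no_types, lifting) image_iff)
    next
      fix c a assume "c \<in> S" "a \<in> T ` I"
      then show "sc c a \<in> T ` I" using T_sc ID(6) by (metis (no_types, lifting) image_iff)
    qed
    have "B \<subseteq> T ` I"
    proof (rule nakayama[OF smodT \<omega>(1) B(1)])
      fix b assume "b \<in> B"
      then have b: "b \<in> I" using spn_base[OF B(1)] B(2) by blast
      \<comment> \<open>As \<open>D = T - 1\<close>, the iterate \<open>D\<^sup>k\<close> is
        \<open>(-1)\<^sup>k\<close> modulo the image of \<open>T\<close>. For \<open>k = N\<close>
        this is the hypothesis of Nakayama's lemma.\<close>
      have "\<exists>r\<in>I. (D ^^ k) b = T r + sc ((-1) ^ k) b" for k
      proof (induction k)
        case 0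
        have T0: "T 0 = 0" using T_sc[OF S_closed(1) ID(2)] by simp
        have "(D ^^ 0) b = T 0 + sc ((-1) ^ 0) b"
          by (simp only: T0 funpow.simps id_apply power_0 sc_1 add_0_left)
        then show ?case using ID(2) by blast
      next
        case (Suc k)
        then obtain r where r: "r \<in> I" "(D ^^ k) b = T r + sc ((-1) ^ k) b" by blast
        let ?b = "sc ((-1) ^ k) b"
        have bI: "?b \<in> I" using ID(6)[OF sgnS b] .
        have "D (T r + ?b) = T (D r + ?b) + sc ((-1) ^ Suc k) b"
        proof -
          have "D (T r + ?b) = (T (T r) + T ?b) - (T r + ?b)" unfolding D_def T_add[OF T_I[OF r(1)] bI] ..
          moreover have "T (D r + ?b) = (T (T r) - T r) + T ?b"
            unfolding T_add[OF D_I[OF r(1)] bI] unfolding D_def T_diff[OF T_I[OF r(1)] r(1)] ..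
          ultimately show ?thesis by (intro ext) simp
        qed
        moreover have "D r + ?b \<in> I" using ID(3)[OF D_I[OF r(1)] bI] .
        ultimately show ?case unfolding funpow.simps(2) comp_apply r(2) by blast
      qed
      then obtain r where r: "r \<in> I" "(D ^^ N) b = T r + sc ((-1) ^ N) b" by blast
      obtain z where z: "z \<in> I" "(D ^^ N) b = sc \<omega> z" using D\<omega>[OF b] by blast
      have "sc ((-1) ^ N) b = sc \<omega> z - T r" using r(2) z(2) by (simp add: algebra_simps)
      then have "sc ((-1) ^ N) (sc ((-1) ^ N) b) = sc ((-1) ^ N) (sc \<omega> z - T r)" by (rule arg_cong)
      moreover have "sc ((-1) ^ N) (sc ((-1) ^ N) b) = b" unfolding sc_sc by (simp add: power_mult_distrib[symmetric])
      ultimately have "b = sc (- ((-1) ^ N)) (T r) + sc \<omega> (sc ((-1) ^ N) z)"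
        by (simp add: fun_eq_iff algebra_simps)
      moreover have "sc (- ((-1) ^ N)) (T r) \<in> T ` I" using smodD(3)[OF smodT S_closed(6)[OF sgnS]] r(1) by blast
      moreover have "sc ((-1) ^ N) z \<in> spn B" using ID(6)[OF sgnS z(1)] B(2) by simp
      ultimately show "\<exists>n\<in>T ` I. \<exists>y\<in>spn B. b = n + sc \<omega> y" by blast
    qed
    then have "spn B \<subseteq> T ` I" by (rule spn_least[OF smodT])
    then have "i \<in> T ` I" using that B(2) by blast
    then show ?thesis by blast
  qed
  define U where "U i = (SOME j. j \<in> I \<and> T j = i)" for i
  have U: "U i \<in> I" "T (U i) = i" if "i \<in> I" for i
  proof -
    have "\<exists>j. j \<in> I \<and> T j = i" using surj[OF that] by blast
    then have "U i \<in> I \<and> T (U i) = i" unfolding U_def by (rule someI_ex)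
    then show "U i \<in> I" "T (U i) = i" by auto
  qed
  have T_inj: "i = j" if "i \<in> I" "j \<in> I" "T i = T j" for i j
    using inj[OF ID(4)[OF that(1,2)]] T_diff[OF that(1,2)] that(3) by simp
  have U_add: "U (i + j) = U i + U j" if "i \<in> I" "j \<in> I" for i j
  proof (rule T_inj)
    show "U (i + j) \<in> I" "U i + U j \<in> I"
      using U(1)[OF ID(3)[OF that]] ID(3)[OF U(1)[OF that(1)] U(1)[OF that(2)]] by blast+
    show "T (U (i + j)) = T (U i + U j)"
      by (simp only: U(2)[OF ID(3)[OF that]] T_add[OF U(1)[OF that(1)] U(1)[OF that(2)]] U(2)[OF that(1)] U(2)[OF that(2)])
  qed
  have U_mul: "U (mul a i) = mul a (U i)" if "a \<in> AC" "i \<in> I" for a i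
  proof (rule T_inj)
    show "U (mul a i) \<in> I" "mul a (U i) \<in> I"
      using U(1)[OF ID(5)[OF that]] ID(5)[OF that(1) U(1)[OF that(2)]] by blast+
    show "T (U (mul a i)) = T (mul a (U i))"
      by (simp only: U(2)[OF ID(5)[OF that]] T_mul[OF that(1) U(1)[OF that(2)]] U(2)[OF that(2)])
  qed
  obtain en where en: "bij_betw en {0..<card E} E" using ex_bij_betw_nat_finite[OF E(1)] by blast
  let ?n = "card E"
  have enE: "en k \<in> E" if "k < ?n" for k using en that by (auto simp: bij_betw_def)
  have en_sum: "(\<Sum>e\<in>E. g e) = (\<Sum>k<?n. g (en k))" for g :: "_ \<Rightarrow> ('k \<Rightarrow> 'k) \<Rightarrow> 'k"
    using sum.reindex_bij_betw[OF en, of g] by (simp only: atLeast0LessThan)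
  \<comment> \<open>Precomposing with the inverse \<open>U\<close> of \<open>T\<close> turns the
    factorization of \<open>T\<close> through a free module into one of the identity.\<close>
  define \<iota> where "\<iota> i = (\<lambda>k. if k < ?n then \<phi> (en k) (U i) else 0)" for i
  define pr where "pr v = (\<Sum>k<?n. mul (v k) (en k))" for v
  have 1: "\<iota> i \<in> vecs A ?n" if "i \<in> I" for i
    using \<phi> enE U(1)[OF that] by (auto simp: vecs_def \<iota>_def)
  have 2: "pr v \<in> I" if "v \<in> vecs A ?n" for v
    unfolding pr_def
  proof (rule smod_sum[OF ID(7)])
    fix k assume "k \<in> {..<?n}"
    then show "mul (v k) (en k) \<in> I" using that E(2) enE[of k] by (intro ID(5)) (auto simp: vecs_def)
  qed
  have 3: "\<iota> (i + j) = vadd A ?n (\<iota> i) (\<iota> j)" if "i \<in> I" "j \<in> I" for i j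
  proof (rule ext)
    fix k
    show "\<iota> (i + j) k = vadd A ?n (\<iota> i) (\<iota> j) k"
    proof (cases "k < ?n")
      case True
      then have "\<phi> (en k) (U i + U j) = \<phi> (en k) (U i) + \<phi> (en k) (U j)"
        using add enE[of k] U(1)[OF that(1)] U(1)[OF that(2)] by blast
      then show ?thesis using True by (simp only: \<iota>_def vadd_def A_simps if_True U_add[OF that])
    qed (simp add: \<iota>_def vadd_def)
  qed
  have 4: "\<iota> (mul a i) = lsmult A ?n a (\<iota> i)" if "a \<in> AC" "i \<in> I" for a i
  proof (rule ext)
    fix k
    show "\<iota> (mul a i) k = lsmult A ?n a (\<iota> i) k"
    proof (cases "k < ?n")
      case True
      then have "\<phi> (en k) (mul a (U i)) = mul a (\<phi> (en k) (U i))"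
        using lin enE[of k] U(1)[OF that(2)] that(1) by blast
      then show ?thesis using True by (simp only: \<iota>_def lsmult_def A_simps if_True U_mul[OF that])
    qed (simp add: \<iota>_def lsmult_def)
  qed
  have 5: "pr (vadd A ?n v v') = pr v + pr v'" for v v'
    unfolding pr_def sum.distrib[symmetric] by (intro sum.cong refl) (simp add: vadd_def mul_add_left)
  have 6: "pr (lsmult A ?n a v) = mul a (pr v)" for a v
    unfolding pr_def mul_sum_right by (intro sum.cong refl) (simp add: lsmult_def mul_assoc)
  have 7: "pr (\<iota> i) = i" if "i \<in> I" for i
  proof -
    have "pr (\<iota> i) = T (U i)" unfolding T_def en_sum unfolding pr_def
      by (intro sum.cong refl) (simp add: \<iota>_def)
    then show ?thesis using U(2)[OF that] by simp
  qed
  show ?thesis unfolding projective_left_ideal_def A_simps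
    by (rule exI[of _ ?n], rule exI[of _ \<iota>], rule exI[of _ pr]) (use 1 2 3 4 5 6 7 in blast)
qed

end

section \<open>The opposite order\<close>

text \<open>Writing the coefficients on the right, \<open>x\<^sub>\<sigma>\<inverse>\<close> becomes the basis element of degree \<open>\<sigma>\<close> of
  the opposite ring; this is where the following cocycle comes from.\<close>

definition op_cocycle :: "(('k \<Rightarrow> 'k) \<Rightarrow> ('k \<Rightarrow> 'k) \<Rightarrow> 'k) \<Rightarrow> ('k \<Rightarrow> 'k) \<Rightarrow> ('k \<Rightarrow> 'k) \<Rightarrow> 'k" where
  "op_cocycle f \<sigma> \<tau> = \<sigma> (\<tau> (f (iv \<tau>) (iv \<sigma>)))"

context crossed
begin

lemma op_crossed: "crossed S G (op_cocycle f) \<omega>"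
proof
  show "aut_group G" "finite G" "J = {\<omega> * s | s. s \<in> S}" by (fact autG finG J_eq)+
  show "\<sigma> x \<in> S" if "\<sigma> \<in> G" "x \<in> S" for \<sigma> x using GS that .
  show "normalized_cocycle G S (op_cocycle f)" unfolding normalized_cocycle_def
  proof (intro conjI ballI)
    fix \<sigma> \<tau> assume s: "\<sigma> \<in> G" and t: "\<tau> \<in> G"
    have "f (iv \<tau>) (iv \<sigma>) \<in> S" "f (iv \<tau>) (iv \<sigma>) \<noteq> 0" using f_S f_nz G(3) s t by auto
    then show "op_cocycle f \<sigma> \<tau> \<in> S - {0}"
      unfolding op_cocycle_def using GS[OF s GS[OF t]] aut_G(8)[OF s] aut_G(8)[OF t] by simp
  next
    fix \<sigma> \<tau> \<gamma> assume s: "\<sigma> \<in> G" and t: "\<tau> \<in> G" and g: "\<gamma> \<in> G"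
    note i = G(3)[OF s] G(3)[OF t] G(3)[OF g]
    have c: "iv \<gamma> (f (iv \<tau>) (iv \<sigma>)) * f (iv \<gamma>) (iv \<tau> \<circ> iv \<sigma>) = f (iv \<gamma>) (iv \<tau>) * f (iv \<gamma> \<circ> iv \<tau>) (iv \<sigma>)"
      by (rule cocycle[OF i(3) i(2) i(1)])
    have e1: "op_cocycle f (\<sigma> \<circ> \<tau>) \<gamma> = \<sigma> (\<tau> (\<gamma> (f (iv \<gamma>) (iv \<tau> \<circ> iv \<sigma>))))"
      unfolding op_cocycle_def G(10)[OF s t] by (rule comp_apply)
    have e2: "op_cocycle f \<sigma> (\<tau> \<circ> \<gamma>) = \<sigma> (\<tau> (\<gamma> (f (iv \<gamma> \<circ> iv \<tau>) (iv \<sigma>))))"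
      unfolding op_cocycle_def G(10)[OF t g] by (rule arg_cong[OF comp_apply])
    have "\<sigma> (\<tau> (\<gamma> (iv \<gamma> (f (iv \<tau>) (iv \<sigma>)) * f (iv \<gamma>) (iv \<tau> \<circ> iv \<sigma>))))
        = \<sigma> (\<tau> (f (iv \<tau>) (iv \<sigma>))) * \<sigma> (\<tau> (\<gamma> (f (iv \<gamma>) (iv \<tau> \<circ> iv \<sigma>))))"
      by (simp only: aut_G(2)[OF s] aut_G(2)[OF t] aut_G(2)[OF g] G(5)[OF g])
    moreover have "\<sigma> (\<tau> (\<gamma> (f (iv \<gamma>) (iv \<tau>) * f (iv \<gamma> \<circ> iv \<tau>) (iv \<sigma>))))
        = \<sigma> (\<tau> (\<gamma> (f (iv \<gamma>) (iv \<tau>)))) * \<sigma> (\<tau> (\<gamma> (f (iv \<gamma> \<circ> iv \<tau>) (iv \<sigma>))))"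
      by (simp only: aut_G(2)[OF s] aut_G(2)[OF t] aut_G(2)[OF g])
    ultimately show "\<sigma> (op_cocycle f \<tau> \<gamma>) * op_cocycle f \<sigma> (\<tau> \<circ> \<gamma>) = op_cocycle f \<sigma> \<tau> * op_cocycle f (\<sigma> \<circ> \<tau>) \<gamma>"
      unfolding e1 e2 c unfolding op_cocycle_def by (simp only: mult.commute)
  next
    fix \<sigma> assume s: "\<sigma> \<in> G"
    show "op_cocycle f id \<sigma> = 1" "op_cocycle f \<sigma> id = 1"
      using G(3)[OF s] aut_G(4)[OF s] by (simp_all add: op_cocycle_def)
  qed
qed

text \<open>Moves coefficients to the right, by
  \<open>b x\<^sub>\<sigma> = x\<^sub>\<sigma> \<sigma>\<inverse>(b)\<close>, and indexes them by
  \<rho> = \<sigma>\<inverse>. The formula does not mention \<open>f\<close>, so one map serves both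
  directions and is its own inverse on \<open>Q\<close>.\<close>

definition opm :: "(('k \<Rightarrow> 'k) \<Rightarrow> 'k) \<Rightarrow> ('k \<Rightarrow> 'k) \<Rightarrow> 'k" where
  "opm b = (\<lambda>\<rho>. if \<rho> \<in> G then \<rho> (b (iv \<rho>)) else 0)"

lemma opm_opm: assumes "b \<in> Q" shows "opm (opm b) = b"
proof (rule Q_eqI[OF _ assms])
  show "opm (opm b) \<in> Q" by (simp add: Q_def opm_def)
  fix \<rho> assume \<rho>: "\<rho> \<in> G"
  show "opm (opm b) \<rho> = b \<rho>" using \<rho> G(3,5,9)[OF \<rho>] by (simp add: opm_def)
qed

lemma opm_AC: "b \<in> AC \<Longrightarrow> opm b \<in> AC"
  using GS G(3) by (auto simp: AC_def Q_def opm_def)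

lemma opm_add: "opm (a + b) = opm a + opm b"
proof (rule Q_eqI)
  fix \<rho> assume \<rho>: "\<rho> \<in> G"
  show "opm (a + b) \<rho> = (opm a + opm b) \<rho>" using \<rho> aut_G(1)[OF \<rho>] by (simp add: opm_def)
qed (simp_all add: Q_def opm_def)

lemma opm_0: "opm 0 = 0"
proof (rule Q_eqI)
  fix \<rho> assume \<rho>: "\<rho> \<in> G"
  show "opm 0 \<rho> = (0 :: ('k \<Rightarrow> 'k) \<Rightarrow> 'k) \<rho>" using \<rho> aut_G(3)[OF \<rho>] by (simp add: opm_def)
qed (simp_all add: Q_def opm_def)

text \<open>Reindexing the sum by \<sigma> = \<rho>\<inverse>\<tau> matches the two products term by
  term.\<close>

lemma opm_mul: "opm (mul a b) = crossed.mul G (op_cocycle f) (opm b) (opm a)"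
proof (rule Q_eqI)
  interpret o: crossed S G "op_cocycle f" \<omega> by (rule op_crossed)
  show "opm (mul a b) \<in> Q" by (simp add: Q_def opm_def)
  show "o.mul (opm b) (opm a) \<in> Q" by (simp add: Q_def o.mul_def)
  fix \<rho> assume \<rho>: "\<rho> \<in> G"
  have i: "iv \<rho> \<in> G" using G(3)[OF \<rho>] .
  have "opm (mul a b) \<rho> = (\<Sum>\<sigma>\<in>G. \<rho> (a \<sigma> * \<sigma> (b (iv \<sigma> \<circ> iv \<rho>)) * f \<sigma> (iv \<sigma> \<circ> iv \<rho>)))"
    using \<rho> by (simp only: opm_def if_True mul_apply[OF i] aut_G(7)[OF \<rho>])
  also have "\<dots> = (\<Sum>\<tau>\<in>G. \<rho> (a (iv \<rho> \<circ> \<tau>) * (iv \<rho> \<circ> \<tau>) (b (iv (iv \<rho> \<circ> \<tau>) \<circ> iv \<rho>)) * f (iv \<rho> \<circ> \<tau>) (iv (iv \<rho> \<circ> \<tau>) \<circ> iv \<rho>)))"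
    by (rule sum.reindex_bij_betw[OF aut_group_bij_left[OF autG i], symmetric])
  also have "\<dots> = (\<Sum>\<tau>\<in>G. opm b \<tau> * \<tau> (opm a (iv \<tau> \<circ> \<rho>)) * op_cocycle f \<tau> (iv \<tau> \<circ> \<rho>))"
  proof (intro sum.cong refl)
    fix \<tau> assume \<tau>: "\<tau> \<in> G"
    have j: "iv \<tau> \<in> G" "iv \<tau> \<circ> \<rho> \<in> G" using G(2,3) \<tau> \<rho> by blast+
    have 1: "iv (iv \<rho> \<circ> \<tau>) \<circ> iv \<rho> = iv \<tau>"
      unfolding G(10)[OF i \<tau>] G(9)[OF \<rho>] by (rule G_iv(3)[OF \<rho>])
    have 2: "iv (iv \<tau> \<circ> \<rho>) = iv \<rho> \<circ> \<tau>" using G(10)[OF j(1) \<rho>] G(9)[OF \<tau>] by simp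
    have "opm b \<tau> * \<tau> (opm a (iv \<tau> \<circ> \<rho>)) * op_cocycle f \<tau> (iv \<tau> \<circ> \<rho>)
      = \<tau> (b (iv \<tau>)) * \<rho> (a (iv \<rho> \<circ> \<tau>)) * \<rho> (f (iv \<rho> \<circ> \<tau>) (iv \<tau>))"
    proof -
      have "\<tau> ((iv \<tau> \<circ> \<rho>) z) = \<rho> z" for z using G(5)[OF \<tau>, of "\<rho> z"] by simp
      then show ?thesis using \<tau> j by (simp only: opm_def op_cocycle_def if_True 2)
    qed
    moreover have "\<rho> (a (iv \<rho> \<circ> \<tau>) * (iv \<rho> \<circ> \<tau>) (b (iv \<tau>)) * f (iv \<rho> \<circ> \<tau>) (iv \<tau>))
      = \<rho> (a (iv \<rho> \<circ> \<tau>)) * \<tau> (b (iv \<tau>)) * \<rho> (f (iv \<rho> \<circ> \<tau>) (iv \<tau>))"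
    proof -
      have "\<rho> ((iv \<rho> \<circ> \<tau>) z) = \<tau> z" for z using G(5)[OF \<rho>, of "\<tau> z"] by simp
      then show ?thesis by (simp only: aut_G(2)[OF \<rho>])
    qed
    ultimately show "\<rho> (a (iv \<rho> \<circ> \<tau>) * (iv \<rho> \<circ> \<tau>) (b (iv (iv \<rho> \<circ> \<tau>) \<circ> iv \<rho>)) * f (iv \<rho> \<circ> \<tau>) (iv (iv \<rho> \<circ> \<tau>) \<circ> iv \<rho>))
      = opm b \<tau> * \<tau> (opm a (iv \<tau> \<circ> \<rho>)) * op_cocycle f \<tau> (iv \<tau> \<circ> \<rho>)"
      unfolding 1 by (simp only: mult_ac)
  qed
  also have "\<dots> = o.mul (opm b) (opm a) \<rho>" by (rule o.mul_apply[OF \<rho>, symmetric])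
  finally show "opm (mul a b) \<rho> = o.mul (opm b) (opm a) \<rho>" .
qed

lemma opm_Q: "opm b \<in> Q" by (simp add: Q_def opm_def)

lemma opm_diff: "opm (a - b) = opm a - opm b"
  using opm_add[of "a - b" b] by (simp add: eq_diff_eq)

lemma opm_op_mul:
  assumes "a \<in> Q" "b \<in> Q"
  shows "opm (crossed.mul G (op_cocycle f) a b) = mul (opm b) (opm a)"
proof -
  have "opm (mul (opm b) (opm a)) = crossed.mul G (op_cocycle f) a b"
    unfolding opm_mul opm_opm[OF assms(1)] opm_opm[OF assms(2)] ..
  then have "opm (opm (mul (opm b) (opm a))) = opm (crossed.mul G (op_cocycle f) a b)" by (rule arg_cong)
  then show ?thesis unfolding opm_opm[OF mul_Q] by (rule sym)
qed

lemma right_ideal_A: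
  "right_ideal A I \<longleftrightarrow> I \<subseteq> AC \<and> 0 \<in> I \<and> (\<forall>x\<in>I. \<forall>y\<in>I. x + y \<in> I \<and> x - y \<in> I)
     \<and> (\<forall>r\<in>AC. \<forall>x\<in>I. mul x r \<in> I)"
proof (cases "I \<subseteq> AC")
  case True
  then have "\<forall>x\<in>I. \<forall>y\<in>I. x \<ominus>\<^bsub>A\<^esub> y = x - y" using A_minus by blast
  then show ?thesis unfolding right_ideal_def by simp
qed (simp add: right_ideal_def)

abbreviation "A' \<equiv> crossed_product G S (op_cocycle f)"

lemma op_left_ideal: assumes "right_ideal A X" shows "left_ideal A' (opm ` X)"
proof -
  interpret o: crossed S G "op_cocycle f" \<omega> by (rule op_crossed)
  note X = assms[unfolded right_ideal_A]
  show ?thesis unfolding o.left_ideal_A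
  proof (intro conjI ballI)
    show "opm ` X \<subseteq> AC" using X opm_AC by blast
    show "0 \<in> opm ` X" using X opm_0 by (metis image_eqI)
    fix x y assume "x \<in> opm ` X" "y \<in> opm ` X"
    then obtain p q where h: "p \<in> X" "q \<in> X" "x = opm p" "y = opm q" by blast
    have "p + q \<in> X" "p - q \<in> X" using X h by blast+
    then show "x + y \<in> opm ` X" "x - y \<in> opm ` X" unfolding h opm_add[symmetric] opm_diff[symmetric] by blast+
  next
    fix r x assume r: "r \<in> AC" and "x \<in> opm ` X"
    then obtain p where h: "p \<in> X" "x = opm p" by blast
    have "mul p (opm r) \<in> X" using X h opm_AC[OF r] by blast
    moreover have "o.mul r x = opm (mul p (opm r))" unfolding opm_mul opm_opm[OF AC_Q[OF r]] h(2) ..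
    ultimately show "o.mul r x \<in> opm ` X" by blast
  qed
qed

lemma op_right_ideal: assumes "left_ideal A' X" shows "right_ideal A (opm ` X)"
proof -
  interpret o: crossed S G "op_cocycle f" \<omega> by (rule op_crossed)
  note X = assms[unfolded o.left_ideal_A]
  show ?thesis unfolding right_ideal_A
  proof (intro conjI ballI)
    show "opm ` X \<subseteq> AC" using X opm_AC by blast
    show "0 \<in> opm ` X" using X opm_0 by (metis image_eqI)
    fix x y assume "x \<in> opm ` X" "y \<in> opm ` X"
    then obtain p q where h: "p \<in> X" "q \<in> X" "x = opm p" "y = opm q" by blast
    have "p + q \<in> X" "p - q \<in> X" using X h by blast+
    then show "x + y \<in> opm ` X" "x - y \<in> opm ` X" unfolding h opm_add[symmetric] opm_diff[symmetric] by blast+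
  next
    fix r x assume r: "r \<in> AC" and "x \<in> opm ` X"
    then obtain p where h: "p \<in> X" "x = opm p" by blast
    have "o.mul (opm r) p \<in> X" using X h opm_AC[OF r] by blast
    moreover have "mul x r = opm (o.mul (opm r) p)"
      using opm_op_mul[OF opm_Q, of p r] X h AC_Q opm_opm[OF AC_Q[OF r]] by auto
    ultimately show "mul x r \<in> opm ` X" by blast
  qed
qed

lemma op_image_image: assumes "X \<subseteq> AC" shows "opm ` opm ` X = X"
proof -
  have "opm ` opm ` X = (\<lambda>x. x) ` X" unfolding image_image using opm_opm AC_Q assms by (intro image_cong) auto
  then show ?thesis by simp
qed

text \<open>Right ideals of \<open>A\<close> and left ideals of the opposite order correspond in
  both directions, so the least ideal over a finite set goes to the least one over its
  image.\<close>

lemma op_fg_left_ideal: assumes "fg_right_ideal A I" shows "fg_left_ideal A' (opm ` I)"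
proof -
  interpret o: crossed S G "op_cocycle f" \<omega> by (rule op_crossed)
  have I: "right_ideal A I" using assms by (simp add: fg_right_ideal_def)
  obtain B where B: "finite B" "B \<subseteq> I" "I = \<Inter>{J. right_ideal A J \<and> B \<subseteq> J}"
    using assms unfolding fg_right_ideal_def by blast
  have IA: "I \<subseteq> AC" using I unfolding right_ideal_A by blast
  have min: "opm ` I \<subseteq> L" if L: "left_ideal A' L" "opm ` B \<subseteq> L" for L
  proof -
    have LA: "L \<subseteq> AC" using L(1) unfolding o.left_ideal_A by blast
    have "opm ` opm ` B \<subseteq> opm ` L" using L(2) by (rule image_mono)
    then have "B \<subseteq> opm ` L" using op_image_image[of B] B(2) IA by simp
    then have "I \<subseteq> opm ` L" using op_right_ideal[OF L(1)] by (subst B(3)) (simp add: Inter_lower)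
    then have "opm ` I \<subseteq> opm ` opm ` L" by (rule image_mono)
    then show ?thesis using op_image_image[OF LA] by simp
  qed
  show ?thesis unfolding fg_left_ideal_def
  proof (intro conjI exI[of _ "opm ` B"])
    show "left_ideal A' (opm ` I)" by (rule op_left_ideal[OF I])
    show "finite (opm ` B)" using B(1) by simp
    show "opm ` B \<subseteq> opm ` I" using B(2) by (rule image_mono)
    then have "\<Inter>{J. left_ideal A' J \<and> opm ` B \<subseteq> J} \<subseteq> opm ` I"
      using op_left_ideal[OF I] by (intro Inter_lower) simp
    then show "opm ` I = \<Inter>{J. left_ideal A' J \<and> opm ` B \<subseteq> J}"
      using min by (intro antisym Inter_greatest) auto
  qed
qed

lemma op_projective:
  assumes I: "right_ideal A I" and "projective_left_ideal A' (opm ` I)"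
  shows "projective_right_ideal A I"
proof -
  interpret o: crossed S G "op_cocycle f" \<omega> by (rule op_crossed)
  have vecs: "vecs A' n = vecs A n" for n by (simp add: vecs_def)
  have IA: "I \<subseteq> AC" and I_mul: "\<And>x r. x \<in> I \<Longrightarrow> r \<in> AC \<Longrightarrow> mul x r \<in> I"
    using I unfolding right_ideal_A by blast+
  obtain n \<iota> pr where D: "(\<forall>x\<in>opm ` I. \<iota> x \<in> vecs A n) \<and> (\<forall>v\<in>vecs A n. pr v \<in> opm ` I)
     \<and> (\<forall>x\<in>opm ` I. \<forall>y\<in>opm ` I. \<iota> (x + y) = vadd A' n (\<iota> x) (\<iota> y))
     \<and> (\<forall>r\<in>AC. \<forall>x\<in>opm ` I. \<iota> (o.mul r x) = lsmult A' n r (\<iota> x))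
     \<and> (\<forall>v\<in>vecs A n. \<forall>w\<in>vecs A n. pr (vadd A' n v w) = pr v + pr w)
     \<and> (\<forall>r\<in>AC. \<forall>v\<in>vecs A n. pr (lsmult A' n r v) = o.mul r (pr v)) \<and> (\<forall>x\<in>opm ` I. pr (\<iota> x) = x)"
    using assms(2) unfolding projective_left_ideal_def o.A_simps vecs by (elim exE)
  note D2 = conjunct2[OF D] note D3 = conjunct2[OF D2] note D4 = conjunct2[OF D3]
  note D5 = conjunct2[OF D4] note D6 = conjunct2[OF D5]
  note p = conjunct1[OF D] conjunct1[OF D2] conjunct1[OF D3] conjunct1[OF D4] conjunct1[OF D5]
    conjunct1[OF D6] conjunct2[OF D6]
  have opI: "opm x \<in> opm ` I" if "x \<in> I" for x using that by blast
  have oo: "opm (opm x) = x" if "x \<in> AC" for x using opm_opm[OF AC_Q[OF that]] .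
  have opv: "(\<lambda>k. opm (v k)) \<in> vecs A n" if "v \<in> vecs A n" for v
    using that opm_AC by (auto simp: vecs_def opm_0)
  define \<iota>' where "\<iota>' x = (\<lambda>k. opm (\<iota> (opm x) k))" for x
  define pr' where "pr' v = opm (pr (\<lambda>k. opm (v k)))" for v
  have iv: "\<iota> (opm x) \<in> vecs A n" if "x \<in> I" for x using p(1) opI[OF that] by blast
  have vAC: "v k \<in> AC" if "v \<in> vecs A n" for v k
  proof (cases "k < n")
    case True
    then show ?thesis using that by (simp add: vecs_def)
  next
    case False
    then have "v k = 0" using that by (simp add: vecs_def)
    then show ?thesis using AC_closed(1) by simp
  qed
  have 1: "\<iota>' x \<in> vecs A n" if "x \<in> I" for x unfolding \<iota>'_def by (rule opv[OF iv[OF that]])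
  have 2: "pr' v \<in> I" if v: "v \<in> vecs A n" for v
  proof -
    have "pr (\<lambda>k. opm (v k)) \<in> opm ` I" using p(2) opv[OF v] by blast
    then obtain y where y: "y \<in> I" "pr (\<lambda>k. opm (v k)) = opm y" by blast
    have "pr' v = y" unfolding pr'_def y(2) using oo y(1) IA by blast
    then show ?thesis using y(1) by simp
  qed
  have 3: "\<iota>' (x + y) = vadd A n (\<iota>' x) (\<iota>' y)" if "x \<in> I" "y \<in> I" for x y
  proof (rule ext)
    fix k
    have "\<iota> (opm (x + y)) = vadd A' n (\<iota> (opm x)) (\<iota> (opm y))"
      unfolding opm_add using p(3) opI[OF that(1)] opI[OF that(2)] by blast
    then have "\<iota>' (x + y) k = opm (vadd A' n (\<iota> (opm x)) (\<iota> (opm y)) k)" unfolding \<iota>'_def by (rule arg_cong)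
    then show "\<iota>' (x + y) k = vadd A n (\<iota>' x) (\<iota>' y) k"
      by (cases "k < n") (simp_all only: vadd_def A_simps o.A_simps if_True if_False opm_add opm_0 \<iota>'_def)
  qed
  have 4: "\<iota>' (mul x r) = rsmult A n (\<iota>' x) r" if "r \<in> AC" "x \<in> I" for r x
  proof (rule ext)
    fix k
    have "\<iota> (opm (mul x r)) = lsmult A' n (opm r) (\<iota> (opm x))"
      unfolding opm_mul using p(4) opI[OF that(2)] opm_AC[OF that(1)] by blast
    then have e: "\<iota>' (mul x r) k = opm (lsmult A' n (opm r) (\<iota> (opm x)) k)" unfolding \<iota>'_def by (rule arg_cong)
    have m: "opm (o.mul (opm r) (\<iota> (opm x) k)) = mul (opm (\<iota> (opm x) k)) r"
      using opm_op_mul[OF opm_Q AC_Q[OF vAC[OF iv[OF that(2)]]]] oo[OF that(1)] by metis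
    show "\<iota>' (mul x r) k = rsmult A n (\<iota>' x) r k" unfolding e
      by (cases "k < n") (simp_all only: lsmult_def rsmult_def A_simps o.A_simps if_True if_False m opm_0 \<iota>'_def)
  qed
  have 5: "pr' (vadd A n v w) = pr' v + pr' w" if "v \<in> vecs A n" "w \<in> vecs A n" for v w
  proof -
    have "(\<lambda>k. opm (vadd A n v w k)) = vadd A' n (\<lambda>k. opm (v k)) (\<lambda>k. opm (w k))"
      by (rule ext) (auto simp only: vadd_def A_simps o.A_simps opm_add opm_0 split: if_split)
    then have "pr' (vadd A n v w) = opm (pr (vadd A' n (\<lambda>k. opm (v k)) (\<lambda>k. opm (w k))))"
      unfolding pr'_def by (simp only:)
    also have "pr (vadd A' n (\<lambda>k. opm (v k)) (\<lambda>k. opm (w k))) = pr (\<lambda>k. opm (v k)) + pr (\<lambda>k. opm (w k))"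
      using p(5) opv[OF that(1)] opv[OF that(2)] by blast
    finally show ?thesis unfolding pr'_def opm_add .
  qed
  have 6: "pr' (rsmult A n v r) = mul (pr' v) r" if "r \<in> AC" "v \<in> vecs A n" for r v
  proof -
    have "(\<lambda>k. opm (rsmult A n v r k)) = lsmult A' n (opm r) (\<lambda>k. opm (v k))"
      by (rule ext) (auto simp only: lsmult_def rsmult_def A_simps o.A_simps opm_mul opm_0 split: if_split)
    then have "pr' (rsmult A n v r) = opm (pr (lsmult A' n (opm r) (\<lambda>k. opm (v k))))"
      unfolding pr'_def by (simp only:)
    also have "pr (lsmult A' n (opm r) (\<lambda>k. opm (v k))) = o.mul (opm r) (pr (\<lambda>k. opm (v k)))"
      using p(6) opv[OF that(2)] opm_AC[OF that(1)] by blast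
    also have "opm (o.mul (opm r) (pr (\<lambda>k. opm (v k)))) = mul (opm (pr (\<lambda>k. opm (v k)))) (opm (opm r))"
    proof (rule opm_op_mul[OF opm_Q])
      have "pr (\<lambda>k. opm (v k)) \<in> opm ` I" using p(2) opv[OF that(2)] by blast
      then obtain y where "pr (\<lambda>k. opm (v k)) = opm y" by blast
      then show "pr (\<lambda>k. opm (v k)) \<in> Q" using opm_Q[of y] by (simp only:)
    qed
    finally show ?thesis unfolding pr'_def oo[OF that(1)] .
  qed
  have 7: "pr' (\<iota>' x) = x" if "x \<in> I" for x
  proof -
    have "(\<lambda>k. opm (\<iota>' x k)) = \<iota> (opm x)" unfolding \<iota>'_def
      by (rule ext) (rule oo[OF vAC[OF iv[OF that]]])
    then have "pr' (\<iota>' x) = opm (pr (\<iota> (opm x)))" unfolding pr'_def by (simp only:)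
    also have "pr (\<iota> (opm x)) = opm x" using p(7) opI[OF that] by blast
    finally show ?thesis using oo that IA by auto
  qed
  show ?thesis unfolding projective_right_ideal_def A_simps
    by (rule exI[of _ n], rule exI[of _ \<iota>'], rule exI[of _ pr']) (intro conjI ballI 1 2 3 4 5 6 7)
qed

end

section \<open>Non-projective ideals\<close>

context crossed
begin

definition "J2 = {\<omega> * \<omega> * s | s. s \<in> S}"

lemma J2_mult: "x \<in> J2 \<Longrightarrow> r \<in> S \<Longrightarrow> x * r \<in> J2"
proof -
  assume "x \<in> J2" "r \<in> S"
  then obtain s where "s \<in> S" "x = \<omega> * \<omega> * s" by (auto simp: J2_def)
  then have "x * r = \<omega> * \<omega> * (s * r)" "s * r \<in> S" using \<open>r \<in> S\<close> by auto
  then show ?thesis unfolding J2_def by blast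
qed

lemma J2_mult': "r \<in> S \<Longrightarrow> x \<in> J2 \<Longrightarrow> r * x \<in> J2"
  using J2_mult[of x r] by (simp add: mult.commute)

lemma J2_add: "x \<in> J2 \<Longrightarrow> y \<in> J2 \<Longrightarrow> x + y \<in> J2"
proof -
  assume "x \<in> J2" "y \<in> J2"
  then obtain s t where "s \<in> S" "x = \<omega> * \<omega> * s" "t \<in> S" "y = \<omega> * \<omega> * t" by (auto simp: J2_def)
  then have "x + y = \<omega> * \<omega> * (s + t)" "s + t \<in> S" by (auto simp: distrib_left)
  then show ?thesis unfolding J2_def by blast
qed

lemma J2_0: "0 \<in> J2"
proof -
  have "0 = \<omega> * \<omega> * 0" by simp
  then show ?thesis unfolding J2_def using S_closed(1) by blast
qed

lemma J2_sum: "(\<And>i. i \<in> B \<Longrightarrow> g i \<in> J2) \<Longrightarrow> sum g B \<in> J2"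
  by (induction B rule: infinite_finite_induct) (auto intro: J2_add J2_0)

lemma JJ_J2: "x \<in> J \<Longrightarrow> y \<in> J \<Longrightarrow> x * y \<in> J2"
proof -
  assume "x \<in> J" "y \<in> J"
  then obtain s t where "s \<in> S" "x = \<omega> * s" "t \<in> S" "y = \<omega> * t" by (auto simp: in_J_iff)
  then have "x * y = \<omega> * \<omega> * (s * t)" "s * t \<in> S" by auto
  then show ?thesis unfolding J2_def by blast
qed

lemma J2_J: "x \<in> J2 \<Longrightarrow> x \<in> J"
proof -
  assume "x \<in> J2"
  then obtain s where "s \<in> S" "x = \<omega> * \<omega> * s" by (auto simp: J2_def)
  then show ?thesis using J_mult'[OF \<omega>(1), of "\<omega> * s"] \<omega>(2) by (simp add: mult.assoc)
qed

lemma J2_unit: "x * v \<in> J2 \<Longrightarrow> v \<in> S \<Longrightarrow> v \<notin> J \<Longrightarrow> x \<in> J2"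
  using J2_mult[of "x * v" "inverse v"] unit_inverse[of v] unit_nz[of v] by (simp add: mult.assoc)

lemma J2_unit': "v * x \<in> J2 \<Longrightarrow> v \<in> S \<Longrightarrow> v \<notin> J \<Longrightarrow> x \<in> J2"
  using J2_unit[of x v] by (simp add: mult.commute)

lemma J2_aut: assumes "\<sigma> \<in> G" "x \<in> J2" shows "\<sigma> x \<in> J2"
proof -
  obtain s where s: "s \<in> S" "x = \<omega> * \<omega> * s" using assms(2) by (auto simp: J2_def)
  have "\<sigma> \<omega> * \<sigma> \<omega> \<in> J2" using JJ_J2 GJ[OF assms(1) \<omega>(1)] by blast
  then have "\<sigma> \<omega> * \<sigma> \<omega> * \<sigma> s \<in> J2" using J2_mult GS[OF assms(1) s(1)] by blast
  then show ?thesis using s aut_G(2)[OF assms(1)] by simp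
qed

lemma J2_aut_iff: assumes "\<sigma> \<in> G" shows "\<sigma> x \<in> J2 \<longleftrightarrow> x \<in> J2"
  using J2_aut[OF assms] J2_aut[OF G(3)[OF assms], of "\<sigma> x"] G(6)[OF assms] by auto

lemma \<omega>_notin_J2: "\<omega> \<noteq> 0 \<Longrightarrow> \<omega> \<notin> J2"
proof
  assume "\<omega> \<noteq> 0" "\<omega> \<in> J2"
  then obtain s where s: "s \<in> S" "\<omega> = \<omega> * \<omega> * s" by (auto simp: J2_def)
  then have "\<omega> * (\<omega> * s) = \<omega> * 1" by (simp add: mult.assoc)
  then have "\<omega> * s = 1" using \<open>\<omega> \<noteq> 0\<close> mult_left_cancel by blast
  then show False using J_mult'[OF \<omega>(1) s(1)] by simp
qed

lemma ideal_square_J: "ideal_square (ring_on S) J = J2"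
proof
  have "left_ideal (ring_on S) J2" unfolding left_ideal_ring_on[OF sub]
  proof (intro conjI ballI)
    show "J2 \<subseteq> S" using J2_J J_S by blast
    fix x y assume "x \<in> J2" "y \<in> J2"
    then show "x - y \<in> J2" using J2_add[of x "- y"] J2_mult'[of "-1" y] by simp
  qed (auto intro: J2_0 J2_add J2_mult')
  moreover have "{x * y | x y. x \<in> J \<and> y \<in> J} \<subseteq> J2" using JJ_J2 by blast
  ultimately show "ideal_square (ring_on S) J \<subseteq> J2" unfolding ideal_square_def by auto
  show "J2 \<subseteq> ideal_square (ring_on S) J" unfolding ideal_square_def
  proof (intro subsetI InterI)
    fix x L assume "x \<in> J2" and L: "L \<in> {L. left_ideal (ring_on S) L \<and> {x \<otimes>\<^bsub>ring_on S\<^esub> y | x y. x \<in> J \<and> y \<in> J} \<subseteq> L}"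
    then obtain s where s: "s \<in> S" "x = s * (\<omega> * \<omega>)" by (auto simp: J2_def mult_ac)
    have "\<omega> * \<omega> \<in> L" using L \<omega>(1) by auto
    then show "x \<in> L" using L s unfolding left_ideal_ring_on[OF sub] by auto
  qed
qed

text \<open>\<open>f \<sigma> \<tau>\<close> divides a conjugate of the diagonal value, so it
  suffices to exclude \<open>J2\<close> at the pairs \<tau>, \<tau>\<inverse>.\<close>

lemma f_J2_inv: assumes "\<sigma> \<in> G" "\<tau> \<in> G" "f \<sigma> \<tau> \<in> J2" shows "f \<tau> (iv \<tau>) \<in> J2"
proof -
  have "\<sigma> (f \<tau> (iv \<tau>)) \<in> J2"
    unfolding f_right_dvd[OF assms(1,2)]
    by (rule J2_mult[OF assms(3) f_S[OF G(2)[OF assms(1,2)] G(3)[OF assms(2)]]])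
  then show ?thesis using J2_aut_iff[OF assms(1)] by blast
qed

lemma mul_mon_right:
  assumes "\<beta> \<in> G" "\<rho> \<in> G"
  shows "mul a (mon d \<beta>) \<rho> = a (\<rho> \<circ> iv \<beta>) * (\<rho> \<circ> iv \<beta>) d * f (\<rho> \<circ> iv \<beta>) \<beta>"
proof -
  have g: "\<rho> \<circ> iv \<beta> \<in> G" using G(2,3) assms by blast
  have "mul a (mon d \<beta>) \<rho> = (\<Sum>\<sigma>\<in>G. if \<sigma> = \<rho> \<circ> iv \<beta> then a (\<rho> \<circ> iv \<beta>) * (\<rho> \<circ> iv \<beta>) d * f (\<rho> \<circ> iv \<beta>) \<beta> else 0)"
    unfolding mul_apply[OF assms(2)]
  proof (intro sum.cong refl)
    fix \<sigma> assume \<sigma>: "\<sigma> \<in> G"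
    have iff: "iv \<sigma> \<circ> \<rho> = \<beta> \<longleftrightarrow> \<sigma> = \<rho> \<circ> iv \<beta>"
      using G_iv(1)[OF \<sigma>, of \<rho>] G_iv(3)[OF assms(1), of \<sigma>] G_iv(2)[OF \<sigma>, of \<beta>] G_iv(4)[OF assms(1), of \<rho>] by metis
    show "a \<sigma> * \<sigma> (mon d \<beta> (iv \<sigma> \<circ> \<rho>)) * f \<sigma> (iv \<sigma> \<circ> \<rho>)
      = (if \<sigma> = \<rho> \<circ> iv \<beta> then a (\<rho> \<circ> iv \<beta>) * (\<rho> \<circ> iv \<beta>) d * f (\<rho> \<circ> iv \<beta>) \<beta> else 0)"
    proof (cases "\<sigma> = \<rho> \<circ> iv \<beta>")
      case True
      then have e: "iv \<sigma> \<circ> \<rho> = \<beta>" using iff by blast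
      have "a \<sigma> * \<sigma> (mon d \<beta> \<beta>) * f \<sigma> \<beta> = a \<sigma> * \<sigma> d * f \<sigma> \<beta>" by (simp add: mon_def)
      then show ?thesis unfolding e using True by (simp only: simp_thms if_True)
    next
      case False
      then have "mon d \<beta> (iv \<sigma> \<circ> \<rho>) = 0" using iff unfolding mon_def by (simp only: simp_thms if_False)
      then show ?thesis using False aut_G(3)[OF \<sigma>] by simp
    qed
  qed
  also have "\<dots> = a (\<rho> \<circ> iv \<beta>) * (\<rho> \<circ> iv \<beta>) d * f (\<rho> \<circ> iv \<beta>) \<beta>"
    using finG g by (simp only: sum.delta if_True)
  finally show ?thesis .
qed

text \<open>The \<open>e k\<close> are the images of the unit vectors and the
  \<open>\<phi> k\<close> the coordinates of the embedding. Projectivity is stated through maps on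
  vectors, so the formula for \<open>pr\<close> on a general vector is obtained by adding its
  entries one at a time.\<close>

lemma projective_dual_basis:
  assumes I: "left_ideal A I" and "projective_left_ideal A I"
  shows "\<exists>(n::nat) e \<phi>. (\<forall>k<n. e k \<in> I) \<and> (\<forall>k<n. \<forall>i\<in>I. \<phi> k i \<in> AC)
    \<and> (\<forall>k<n. \<forall>a\<in>AC. \<forall>i\<in>I. \<phi> k (mul a i) = mul a (\<phi> k i)) \<and> (\<forall>i\<in>I. i = (\<Sum>k<n. mul (\<phi> k i) (e k)))"
proof -
  obtain n \<iota> pr where p: "\<forall>x\<in>I. \<iota> x \<in> vecs A n" "\<forall>v\<in>vecs A n. pr v \<in> I"
     "\<forall>r\<in>AC. \<forall>x\<in>I. \<iota> (mul r x) = lsmult A n r (\<iota> x)"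
     "\<forall>v\<in>vecs A n. \<forall>w\<in>vecs A n. pr (vadd A n v w) = pr v + pr w"
     "\<forall>r\<in>AC. \<forall>v\<in>vecs A n. pr (lsmult A n r v) = mul r (pr v)" "\<forall>x\<in>I. pr (\<iota> x) = x"
    using assms(2) unfolding projective_left_ideal_def A_simps by blast
  define un :: "nat \<Rightarrow> nat \<Rightarrow> ('k \<Rightarrow> 'k) \<Rightarrow> 'k" where "un k = (\<lambda>i. if i = k then mon 1 id else 0)" for k
  have un: "un k \<in> vecs A n" if "k < n" for k using that one_AC AC_closed(1) by (auto simp: vecs_def un_def)
  have z: "(\<lambda>_. 0) \<in> vecs A n" using AC_closed(1) by (auto simp: vecs_def)
  have "pr (\<lambda>_. 0) + pr (\<lambda>_. 0) = pr (vadd A n (\<lambda>_. 0) (\<lambda>_. 0))" using p(4) z by simp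
  also have "vadd A n (\<lambda>_. 0) (\<lambda>_. 0) = (\<lambda>_. 0)" by (auto simp: vadd_def)
  finally have pr0: "pr (\<lambda>_. 0) = 0" by (rule iffD1[OF add_cancel_left_right])
  have pr: "pr (\<lambda>i. if i < j then v i else 0) = (\<Sum>k<j. mul (v k) (pr (un k)))" if v: "v \<in> vecs A n" and "j \<le> n" for v j
    using that(2)
  proof (induction j)
    case 0
    then show ?case by (simp only: less_nat_zero_code if_False lessThan_0 sum.empty pr0)
  next
    case (Suc j)
    let ?v = "\<lambda>j i. if i < j then v i else 0"
    have vj: "v j \<in> AC" using v Suc by (auto simp: vecs_def)
    have vv: "?v j \<in> vecs A n" using v Suc AC_closed(1) by (auto simp: vecs_def)
    have lu: "lsmult A n (v j) (un j) \<in> vecs A n"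
      using vj one_AC AC_mul AC_closed(1) by (auto simp: vecs_def lsmult_def un_def)
    have "?v (Suc j) = vadd A n (?v j) (lsmult A n (v j) (un j))"
    proof (rule ext)
      fix i
      show "?v (Suc j) i = vadd A n (?v j) (lsmult A n (v j) (un j)) i"
      proof (cases "i = j")
        case True
        have "mul (v j) (mon 1 id) = v j" by (rule mul_one(1)[OF AC_Q[OF vj]])
        then show ?thesis using True Suc by (simp add: vadd_def lsmult_def un_def)
      next
        case False
        then have "i < Suc j \<longleftrightarrow> i < j" by auto
        moreover have "v i = 0" if "\<not> i < n" using v that by (auto simp: vecs_def)
        ultimately show ?thesis using False by (simp add: vadd_def lsmult_def un_def)
      qed
    qed
    then have "pr (?v (Suc j)) = pr (vadd A n (?v j) (lsmult A n (v j) (un j)))" by (rule arg_cong)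
    also have "\<dots> = pr (?v j) + pr (lsmult A n (v j) (un j))" using p(4) vv lu by blast
    also have "pr (lsmult A n (v j) (un j)) = mul (v j) (pr (un j))" using p(5) vj un[of j] Suc.prems by simp
    also have "pr (?v j) = (\<Sum>k<j. mul (v k) (pr (un k)))" by (rule Suc.IH[OF Suc_leD[OF Suc.prems]])
    finally show ?case by (simp only: sum.lessThan_Suc)
  qed
  have "i = (\<Sum>k<n. mul (\<iota> i k) (pr (un k)))" if i: "i \<in> I" for i
  proof -
    have v: "\<iota> i \<in> vecs A n" using p(1) i by blast
    have "(\<lambda>k. if k < n then \<iota> i k else 0) = \<iota> i" using v by (auto simp: vecs_def fun_eq_iff)
    then have "pr (\<iota> i) = (\<Sum>k<n. mul (\<iota> i k) (pr (un k)))" using pr[OF v order_refl] by (simp only:)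
    moreover have "i = pr (\<iota> i)" using p(6) i by simp
    ultimately show ?thesis by (rule trans[rotated])
  qed
  then have c1: "\<forall>i\<in>I. i = (\<Sum>k<n. mul (\<iota> i k) (pr (un k)))" by (rule ballI)
  have c2: "\<forall>k<n. pr (un k) \<in> I" using p(2) un by blast
  have c3: "\<forall>k<n. \<forall>i\<in>I. \<iota> i k \<in> AC" using p(1) by (auto simp: vecs_def)
  have c4: "\<forall>k<n. \<forall>a\<in>AC. \<forall>i\<in>I. \<iota> (mul a i) k = mul a (\<iota> i k)" using p(3) by (simp add: lsmult_def)
  show ?thesis
    by (rule exI[of _ n], rule exI[of _ "\<lambda>k. pr (un k)"], rule exI[of _ "\<lambda>k i. \<iota> i k"])
      (intro conjI c1 c2 c3 c4)
qed

text \<open>If \<open>f(\<tau>\<inverse>, \<tau>)\<close> lies in \<open>J\<^sup>2\<close>, the left ideal generated by \<open>\<omega>\<close> and \<open>x\<^sub>\<tau>\<close> is not projective: since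
  \<open>S\<close> is local, one homogeneous term of the identity component of a dual basis representation of
  \<open>\<omega>\<close> would have to lie outside \<open>J\<^sup>2\<close>.\<close>

lemma semihereditary_not_square:
  assumes proj: "\<And>I. fg_left_ideal A I \<Longrightarrow> projective_left_ideal A I"
    and st: "\<sigma> \<in> G" "\<tau> \<in> G"
  shows "f \<sigma> \<tau> \<notin> J2"
proof
  assume "f \<sigma> \<tau> \<in> J2"
  then have f1: "f \<tau> (iv \<tau>) \<in> J2" using f_J2_inv st by blast
  note t = st(2) G(3)[OF st(2)]
  have f2: "f (iv \<tau>) \<tau> \<in> J2" using f1 f_inv_swap[OF t(1)] J2_aut_iff[OF t(1)] by metis
  then have f2J: "f (iv \<tau>) \<tau> \<in> J" by (rule J2_J)
  have \<omega>0: "\<omega> \<noteq> 0" using f1 f_nz[OF t] by (auto simp: J2_def)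
  have gA: "mon \<omega> id \<in> AC" "mon 1 \<tau> \<in> AC" using mon_AC \<omega>(2) G(1) t(1) S_closed(2) by auto
  note L1 = principal_left_ideal[OF gA(1)] and L2 = principal_left_ideal[OF gA(2)]
  define I where "I = {m + l | m l. m \<in> {mul b (mon \<omega> id) | b. b \<in> AC} \<and> l \<in> {mul b (mon 1 \<tau>) | b. b \<in> AC}}"
  have I: "left_ideal A I" unfolding I_def by (rule left_ideal_sum[OF L1 L2])
  have IE: "\<exists>b c. b \<in> AC \<and> c \<in> AC \<and> i = mul b (mon \<omega> id) + mul c (mon 1 \<tau>)" if "i \<in> I" for i
    using that unfolding I_def by blast
  have II: "mul b (mon \<omega> id) + mul c (mon 1 \<tau>) \<in> I" if "b \<in> AC" "c \<in> AC" for b c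
    using that unfolding I_def by blast
  have g1: "mon \<omega> id \<in> I"
    using II[OF one_AC AC_closed(1)] mul_one(2)[OF AC_Q[OF gA(1)]] by simp
  have g2: "mon 1 \<tau> \<in> I"
    using II[OF AC_closed(1) one_AC] mul_one(2)[OF AC_Q[OF gA(2)]] by simp
  have "fg_left_ideal A I" unfolding fg_left_ideal_def
  proof (intro conjI I exI[of _ "{mon \<omega> id, mon 1 \<tau>}"])
    show "{mon \<omega> id, mon 1 \<tau>} \<subseteq> I" using g1 g2 by blast
    show "I = \<Inter>{J. left_ideal A J \<and> {mon \<omega> id, mon 1 \<tau>} \<subseteq> J}"
    proof
      show "\<Inter>{J. left_ideal A J \<and> {mon \<omega> id, mon 1 \<tau>} \<subseteq> J} \<subseteq> I" using I g1 g2 by (intro Inter_lower) simp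
      show "I \<subseteq> \<Inter>{J. left_ideal A J \<and> {mon \<omega> id, mon 1 \<tau>} \<subseteq> J}"
      proof (intro subsetI InterI)
        fix i X assume "i \<in> I" and X: "X \<in> {J. left_ideal A J \<and> {mon \<omega> id, mon 1 \<tau>} \<subseteq> J}"
        then obtain b c where bc: "b \<in> AC" "c \<in> AC" "i = mul b (mon \<omega> id) + mul c (mon 1 \<tau>)" using IE by blast
        have X: "left_ideal A X" "mon \<omega> id \<in> X" "mon 1 \<tau> \<in> X" using X by auto
        show "i \<in> X" unfolding bc(3)
          using left_idealD(3)[OF X(1) left_idealD(5)[OF X(1) bc(1) X(2)] left_idealD(5)[OF X(1) bc(2) X(3)]] .
      qed
    qed
  qed simp
  from projective_dual_basis[OF I proj[OF this]]
  obtain n :: nat and e \<phi> where e': "\<forall>k<n. e k \<in> I" and \<phi>': "\<forall>k<n. \<forall>i\<in>I. \<phi> k i \<in> AC"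
    and lin': "\<forall>k<n. \<forall>a\<in>AC. \<forall>i\<in>I. \<phi> k (mul a i) = mul a (\<phi> k i)"
    and rep': "\<forall>i\<in>I. i = (\<Sum>k<n. mul (\<phi> k i) (e k))" by (elim exE conjE)
  have e: "e k \<in> I" if "k < n" for k using e' that by blast
  have \<phi>: "\<phi> k i \<in> AC" if "k < n" "i \<in> I" for k i using \<phi>' that by blast
  have lin: "\<phi> k (mul a i) = mul a (\<phi> k i)" if "k < n" "a \<in> AC" "i \<in> I" for k a i using lin' that by blast
  note rep = bspec[OF rep']
  let ?p = "\<lambda>k. \<phi> k (mon \<omega> id)"
  have pS: "?p k \<alpha> \<in> S" if "k < n" "\<alpha> \<in> G" for k \<alpha> using AC_S[OF \<phi>[OF that(1) g1] that(2)] .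
  have eS: "e k \<alpha> \<in> S" if "k < n" "\<alpha> \<in> G" for k \<alpha> using AC_S left_idealD(1)[OF I] e[OF that(1)] that(2) by blast
  \<comment> \<open>Applying \<open>\<phi> k\<close> to the relation
    \<open>x\<^sub>\<tau> \<omega> = \<tau>(\<omega>) x\<^sub>\<tau>\<close> between the two
    generators shows that \<open>x\<^sub>\<tau>\<close> times the value at \<omega> is divisible by
    \<open>\<tau>(\<omega>)\<close>.\<close>
  have Eq1: "\<tau> (?p k \<alpha>) * f \<tau> \<alpha> \<in> J" if k: "k < n" and \<alpha>: "\<alpha> \<in> G" for k \<alpha>
  proof -
    have "mul (mon 1 \<tau>) (mon \<omega> id) = mul (mon (\<tau> \<omega>) id) (mon 1 \<tau>)"
      using G(1) t(1) by (simp add: mon_mon)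
    then have "mul (mon 1 \<tau>) (?p k) = mul (mon (\<tau> \<omega>) id) (\<phi> k (mon 1 \<tau>))"
      using lin[OF k gA(2) g1] lin[OF k mon_AC[OF GS[OF t(1) \<omega>(2)] G(1)] g2] by simp
    also have "\<dots> = sc (\<tau> \<omega>) (\<phi> k (mon 1 \<tau>))" by (rule mon_id_mul[OF AC_Q[OF \<phi>[OF k g2]]])
    finally have "mul (mon 1 \<tau>) (?p k) (\<tau> \<circ> \<alpha>) = \<tau> \<omega> * \<phi> k (mon 1 \<tau>) (\<tau> \<circ> \<alpha>)"
      by (metis sc_apply)
    moreover have "mul (mon 1 \<tau>) (?p k) (\<tau> \<circ> \<alpha>) = \<tau> (?p k \<alpha>) * f \<tau> \<alpha>"
      unfolding mul_mon[OF t(1) G(2)[OF t(1) \<alpha>]] G_iv(2)[OF t(1)] by simp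
    moreover have "\<tau> \<omega> * \<phi> k (mon 1 \<tau>) (\<tau> \<circ> \<alpha>) \<in> J"
      using J_mult'[OF GJ[OF t(1) \<omega>(1)] AC_S[OF \<phi>[OF k g2] G(2)[OF t(1) \<alpha>]]] .
    ultimately show ?thesis by metis
  qed
  \<comment> \<open>A unit coefficient at \<gamma> can only come from the generator
    \<open>x\<^sub>\<tau>\<close>, reached by a left factor of degree
    \<gamma>\<tau>\<inverse>.\<close>
  have Eq2: "e k \<gamma> \<in> J" if k: "k < n" and \<gamma>: "\<gamma> \<in> G" and "f (\<gamma> \<circ> iv \<tau>) \<tau> \<in> J" for k \<gamma>
  proof -
    obtain b c where bc: "b \<in> AC" "c \<in> AC" "e k = mul b (mon \<omega> id) + mul c (mon 1 \<tau>)" using IE[OF e[OF k]] by blast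
    have g: "\<gamma> \<circ> iv \<tau> \<in> G" using G(2) \<gamma> t by blast
    have "mul b (mon \<omega> id) \<gamma> \<in> J" unfolding mul_mon_right[OF G(1) \<gamma>]
      using AC_S[OF bc(1) \<gamma>] GJ[OF \<gamma> \<omega>(1)] \<gamma> by (simp add: J_mult)
    moreover have "mul c (mon 1 \<tau>) \<gamma> \<in> J" unfolding mul_mon_right[OF t(1) \<gamma>]
      using J_mult[OF AC_S[OF bc(2) g] that(3)] aut_G(4)[OF g] by simp
    ultimately show ?thesis unfolding bc(3) using J_add by simp
  qed
  \<comment> \<open>These are the terms of the identity component of the representation of \<omega>,
    and \<omega> is not in \<open>J2\<close>.\<close>
  have "\<exists>k<n. \<exists>\<alpha>\<in>G. ?p k \<alpha> * \<alpha> (e k (iv \<alpha>)) * f \<alpha> (iv \<alpha>) \<notin> J2"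
  proof (rule ccontr)
    assume "\<not> ?thesis"
    then have all: "?p k \<alpha> * \<alpha> (e k (iv \<alpha>)) * f \<alpha> (iv \<alpha>) \<in> J2" if "k < n" "\<alpha> \<in> G" for k \<alpha>
      using that by blast
    have "\<omega> = mon \<omega> id id" by (simp add: mon_def)
    also have "\<dots> = (\<Sum>k<n. mul (?p k) (e k)) id" using rep[OF g1] by (rule fun_cong)
    also have "\<dots> = (\<Sum>k<n. \<Sum>\<alpha>\<in>G. ?p k \<alpha> * \<alpha> (e k (iv \<alpha>)) * f \<alpha> (iv \<alpha>))"
      by (simp add: mul_apply[OF G(1)])
    also have "\<dots> \<in> J2" using all by (intro J2_sum) auto
    finally show False using \<omega>_notin_J2[OF \<omega>0] by blast
  qed
  then obtain k \<alpha> where k: "k < n" and \<alpha>: "\<alpha> \<in> G"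
    and tm: "?p k \<alpha> * \<alpha> (e k (iv \<alpha>)) * f \<alpha> (iv \<alpha>) \<notin> J2" by blast
  note a = \<alpha> G(3)[OF \<alpha>]
  have S3: "?p k \<alpha> \<in> S" "\<alpha> (e k (iv \<alpha>)) \<in> S" "f \<alpha> (iv \<alpha>) \<in> S"
    using pS[OF k \<alpha>] GS[OF \<alpha> eS[OF k a(2)]] f_S[OF a] by auto
  \<comment> \<open>In a product outside \<open>J2\<close> at most one of the three factors is a
    nonunit; this and the next two facts are the pairwise exclusions.\<close>
  have pe: "\<not> (?p k \<alpha> \<in> J \<and> \<alpha> (e k (iv \<alpha>)) \<in> J)" using tm JJ_J2 J2_mult S3 by blast
  have pf: "\<not> (?p k \<alpha> \<in> J \<and> f \<alpha> (iv \<alpha>) \<in> J)"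
  proof
    assume "?p k \<alpha> \<in> J \<and> f \<alpha> (iv \<alpha>) \<in> J"
    then have "?p k \<alpha> * f \<alpha> (iv \<alpha>) * \<alpha> (e k (iv \<alpha>)) \<in> J2" using JJ_J2 J2_mult S3 by blast
    then show False using tm by (simp add: mult_ac)
  qed
  have ef: "\<not> (\<alpha> (e k (iv \<alpha>)) \<in> J \<and> f \<alpha> (iv \<alpha>) \<in> J)"
  proof
    assume "\<alpha> (e k (iv \<alpha>)) \<in> J \<and> f \<alpha> (iv \<alpha>) \<in> J"
    then have "?p k \<alpha> * (\<alpha> (e k (iv \<alpha>)) * f \<alpha> (iv \<alpha>)) \<in> J2" using JJ_J2 J2_mult' S3 by blast
    then show False using tm by (simp add: mult_ac)
  qed
  have eJ: "f (iv \<alpha> \<circ> iv \<tau>) \<tau> \<in> J \<Longrightarrow> \<alpha> (e k (iv \<alpha>)) \<in> J" using Eq2[OF k a(2)] GJ[OF \<alpha>] by blast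
  have g: "iv \<alpha> \<circ> iv \<tau> \<in> G" using G(2) a t by blast
  show False
  proof (cases "f \<tau> \<alpha> \<in> J")
    \<comment> \<open>Now \<open>?p k \<alpha>\<close> is the nonunit, so the other two factors are
      units; the cocycle identity would then make a conjugate of \<open>f (iv \<tau>) \<tau>\<close>
      a unit.\<close>
    case False
    then have "\<tau> (?p k \<alpha>) \<in> J"
      using Eq1[OF k \<alpha>] unit_mult[OF GS[OF t(1) S3(1)] f_S[OF t(1) \<alpha>]] by blast
    then have "?p k \<alpha> \<in> J" using GJ_iff[OF t(1)] by blast
    then have "\<alpha> \<in> H" and "f (iv \<alpha> \<circ> iv \<tau>) \<tau> \<notin> J" using pf pe eJ \<alpha> by (auto simp: H_def)
    then have "f (iv \<alpha>) (iv \<tau>) * f (iv \<alpha> \<circ> iv \<tau>) \<tau> \<notin> J"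
      using f_H_left[OF H_inv t(2)] unit_mult[OF f_S[OF a(2) t(2)] f_S[OF g t(1)]] by blast
    moreover have "iv \<alpha> (f (iv \<tau>) \<tau>) = f (iv \<alpha>) (iv \<tau>) * f (iv \<alpha> \<circ> iv \<tau>) \<tau>"
      using cocycle[OF a(2) t(2) t(1)] G(8)[OF t(1)] a(2) by simp
    ultimately show False using GJ[OF a(2) f2J] by simp
  next
    \<comment> \<open>Now \<open>f \<alpha> (iv \<alpha>)\<close> is the nonunit. The cocycle
      identity puts \<tau>\<alpha> into \<open>H\<close>, and then
      \<open>f \<alpha> (iv \<alpha>)\<close> is, up to a unit, a multiple of
      \<open>f (iv \<tau>) \<tau>\<close>, hence in \<open>J2\<close>.\<close>
    case True
    let ?\<rho> = "\<tau> \<circ> \<alpha>"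
    have \<rho>: "?\<rho> \<in> G" "iv ?\<rho> = iv \<alpha> \<circ> iv \<tau>" using G(2,10) t(1) \<alpha> by blast+
    have "\<tau> (f \<alpha> (iv \<alpha>)) \<in> J"
      unfolding f_right_dvd[OF t(1) \<alpha>] using J_mult'[OF True f_S[OF \<rho>(1) a(2)]] .
    then have fJ: "f \<alpha> (iv \<alpha>) \<in> J" using GJ_iff[OF t(1)] by blast
    then have u1: "f (iv \<alpha> \<circ> iv \<tau>) \<tau> \<notin> J" using ef eJ by blast
    have nsq: "f \<alpha> (iv \<alpha>) \<notin> J2" using tm J2_mult' S3 S_closed(5) by blast
    have nsq': "f (iv \<alpha>) \<alpha> \<notin> J2" using nsq f_inv_swap[OF \<alpha>] J2_aut_iff[OF \<alpha>] by metis
    have c1: "(iv \<alpha> \<circ> iv \<tau>) (f \<tau> \<alpha>) * f (iv \<alpha> \<circ> iv \<tau>) ?\<rho> = f (iv \<alpha> \<circ> iv \<tau>) \<tau> * f (iv \<alpha>) \<alpha>"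
      using cocycle[OF g t(1) \<alpha>] by (simp only: G_iv(4)[OF t(1)])
    have "f (iv ?\<rho>) ?\<rho> \<notin> J"
    proof
      assume "f (iv ?\<rho>) ?\<rho> \<in> J"
      then have "f (iv \<alpha> \<circ> iv \<tau>) ?\<rho> \<in> J" by (simp only: \<rho>(2))
      then have "f (iv \<alpha> \<circ> iv \<tau>) \<tau> * f (iv \<alpha>) \<alpha> \<in> J2"
        unfolding c1[symmetric] using JJ_J2[OF GJ[OF g True]] by blast
      then show False using J2_unit'[OF _ f_S[OF g t(1)] u1] nsq' by blast
    qed
    then have "iv ?\<rho> \<in> H" unfolding H_def using G(3)[OF \<rho>(1)] G(9)[OF \<rho>(1)] by simp
    then have \<rho>H: "?\<rho> \<in> H" using H_inv[of "iv ?\<rho>"] G(9)[OF \<rho>(1)] by metis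
    have c2: "iv \<tau> (f ?\<rho> (iv \<alpha>)) * f (iv \<tau>) \<tau> = f (iv \<tau>) ?\<rho> * f \<alpha> (iv \<alpha>)"
      using cocycle[OF t(2) \<rho>(1) a(2)] by (simp only: G_iv(3)[OF \<alpha>] G_iv(2)[OF t(1)])
    have "f (iv \<tau>) ?\<rho> * f \<alpha> (iv \<alpha>) \<in> J2" unfolding c2[symmetric]
      using J2_mult'[OF GS[OF t(2) f_S[OF \<rho>(1) a(2)]] f2] .
    then show False using J2_unit'[OF _ f_S[OF t(2) \<rho>(1)] f_H_right[OF \<rho>H t(2)]] nsq by blast
  qed
qed

end

section \<open>Cosets of \<open>H\<close>\<close>

context crossed
begin

definition "cst \<tau> = (\<lambda>h. \<tau> \<circ> h) ` H"

lemma cst_eq_iff: assumes "\<tau> \<in> G" "\<rho> \<in> G" shows "cst \<tau> = cst \<rho> \<longleftrightarrow> iv \<tau> \<circ> \<rho> \<in> H"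
proof
  assume e: "cst \<tau> = cst \<rho>"
  have "\<rho> \<circ> id \<in> cst \<rho>" unfolding cst_def using H_id by (rule imageI)
  then have "\<rho> \<in> cst \<tau>" using e by simp
  then obtain h where "h \<in> H" "\<rho> = \<tau> \<circ> h" unfolding cst_def by blast
  then show "iv \<tau> \<circ> \<rho> \<in> H" using G_iv(2)[OF assms(1)] by simp
next
  assume h: "iv \<tau> \<circ> \<rho> \<in> H"
  have incl: "cst (\<alpha> \<circ> k) \<subseteq> cst \<alpha>" if "k \<in> H" for \<alpha> k
    unfolding cst_def using H_comp[OF that] by (auto simp: comp_assoc)
  have "\<rho> = \<tau> \<circ> (iv \<tau> \<circ> \<rho>)" using G_iv(1)[OF assms(1)] by (rule sym)
  moreover have "\<tau> = \<rho> \<circ> iv (iv \<tau> \<circ> \<rho>)"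
    using G(10)[OF G(3)[OF assms(1)] assms(2)] G(9)[OF assms(1)] G_iv(1)[OF assms(2)] by simp
  ultimately show "cst \<tau> = cst \<rho>" using incl[OF h, of \<tau>] incl[OF H_inv[OF h], of \<rho>] by (metis antisym)
qed

text \<open>Along the chain all values of \<open>f\<close> without carry are units, so each \<open>f(\<sigma>\<^sup>i, \<sigma>\<^sup>-\<^sup>i)\<close> differs from
  \<open>f(\<sigma>, \<sigma>\<inverse>)\<close> by a unit factor, and the latter divides \<open>\<omega> \<in> J(A) = x\<^sub>\<sigma> A\<close>.\<close>

lemma chain_not_square:
  assumes ne: "H \<noteq> G" and s: "\<sigma> \<in> G" and m: "m = card (cst ` G)"
    and chain: "\<And>i j. i < m \<Longrightarrow> j < m \<Longrightarrow> f (\<sigma> ^^ i) (iv (\<sigma> ^^ i) \<circ> \<sigma> ^^ j) \<notin> J \<longleftrightarrow> i \<le> j"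
    and jac: "jacobson A = {mul (mon 1 \<sigma>) a | a. a \<in> AC}"
    and at: "\<alpha> \<in> G" "\<tau> \<in> G"
  shows "f \<alpha> \<tau> \<notin> J2"
proof -
  obtain \<gamma> where "\<gamma> \<in> G" "f \<gamma> (iv \<gamma>) \<in> J" using ne unfolding H_def by blast
  then have \<omega>0: "\<omega> \<noteq> 0" using in_J_iff f_nz[OF _ G(3)] by force
  have "sc \<omega> (mon 1 id) \<in> jacobson A" by (rule \<omega>_jacobson[OF one_AC])
  then obtain a where a: "a \<in> AC" "sc \<omega> (mon 1 id) = mul (mon 1 \<sigma>) a" unfolding jac by blast
  have "\<omega> = sc \<omega> (mon 1 id) id" by (simp add: mon_def)
  also have "\<dots> = \<sigma> (a (iv \<sigma>)) * f \<sigma> (iv \<sigma>)" unfolding a(2) mul_mon[OF s G(1)] by simp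
  finally have "\<sigma> (a (iv \<sigma>)) * f \<sigma> (iv \<sigma>) \<notin> J2" using \<omega>_notin_J2[OF \<omega>0] by simp
  then have base: "f \<sigma> (iv \<sigma>) \<notin> J2" using J2_mult'[OF GS[OF s AC_S[OF a(1) G(3)[OF s]]]] by blast
  have p: "\<sigma> ^^ i \<in> G" for i by (rule pow_G[OF s])
  \<comment> \<open>For powers in the same coset \<open>f\<close> is a unit in both orders, so the
    chain condition gives both inequalities. The \<open>m\<close> powers thus represent all
    \<open>m\<close> cosets.\<close>
  have dist: "i = j" if ij: "i < m" "j < m" "cst (\<sigma> ^^ i) = cst (\<sigma> ^^ j)" for i j
  proof -
    have le: "i \<le> j" if "i < m" "j < m" "cst (\<sigma> ^^ i) = cst (\<sigma> ^^ j)" for i j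
    proof -
      have "iv (\<sigma> ^^ i) \<circ> \<sigma> ^^ j \<in> H" using cst_eq_iff[OF p p] that(3) by blast
      then have "f (\<sigma> ^^ i) (iv (\<sigma> ^^ i) \<circ> \<sigma> ^^ j) \<notin> J" using f_H_right p by blast
      then show ?thesis using chain that by blast
    qed
    show ?thesis using le[OF ij] le[OF ij(2,1) ij(3)[symmetric]] by simp
  qed
  have all: "(\<lambda>i. cst (\<sigma> ^^ i)) ` {..<m} = cst ` G"
  proof (rule card_subset_eq)
    show "finite (cst ` G)" using finG by simp
    show "(\<lambda>i. cst (\<sigma> ^^ i)) ` {..<m} \<subseteq> cst ` G" using p by blast
    have "inj_on (\<lambda>i. cst (\<sigma> ^^ i)) {..<m}" using dist by (intro inj_onI) auto
    then show "card ((\<lambda>i. cst (\<sigma> ^^ i)) ` {..<m}) = card (cst ` G)" unfolding m[symmetric] by (simp add: card_image)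
  qed
  have rep: "\<exists>i<m. cst \<rho> = cst (\<sigma> ^^ i)" if "\<rho> \<in> G" for \<rho>
  proof -
    have "cst \<rho> \<in> (\<lambda>i. cst (\<sigma> ^^ i)) ` {..<m}" unfolding all using that by (rule imageI)
    then show ?thesis by auto
  qed
  \<comment> \<open>The coset of \<sigma>^m is that of some \<sigma>^i, so \<sigma>^(m-i) lies in
    \<open>H\<close>; for positive \<open>i\<close> this is a smaller positive exponent, excluded by
    distinctness of the cosets.\<close>
  have mH: "\<sigma> ^^ m \<in> H"
  proof -
    obtain i where i: "i < m" "cst (\<sigma> ^^ m) = cst (\<sigma> ^^ i)" using rep[OF p] by blast
    then have "iv (\<sigma> ^^ i) \<circ> \<sigma> ^^ m \<in> H" using cst_eq_iff[OF p p] by metis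
    moreover have "\<sigma> ^^ m = \<sigma> ^^ i \<circ> \<sigma> ^^ (m - i)" using i(1) by (metis funpow_add le_add_diff_inverse less_imp_le)
    ultimately have h: "\<sigma> ^^ (m - i) \<in> H" using G_iv(2)[OF p, of i "\<sigma> ^^ (m - i)"] by metis
    show ?thesis
    proof (cases "i = 0")
      case True
      then show ?thesis using h by simp
    next
      case False
      have "iv (\<sigma> ^^ 0) \<circ> \<sigma> ^^ (m - i) = \<sigma> ^^ (m - i)" using G_iv(1)[OF p, of 0 "\<sigma> ^^ (m - i)"] by simp
      then have "cst (\<sigma> ^^ 0) = cst (\<sigma> ^^ (m - i))" using cst_eq_iff[OF p p, of 0 "m - i"] h by metis
      then have "0 = m - i" using False i(1) by (intro dist) auto
      then show ?thesis using i(1) by simp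
    qed
  qed
  have diag: "f (\<sigma> ^^ i) (iv (\<sigma> ^^ i)) \<notin> J2" if i: "i < m" for i
  proof (cases i)
    case 0
    have "f (\<sigma> ^^ 0) (iv (\<sigma> ^^ 0)) = 1" using G(1) by (simp add: id_def[symmetric])
    then show ?thesis using 0 J2_J by fastforce
  next
    \<comment> \<open>Modulo \<open>H\<close> the inverse of \<sigma>^(j+1) is \<sigma>^(m-1-j), so
      the chain condition makes \<open>f (\<sigma> ^^ j) ?k\<close> a unit. The cocycle identity for
      \<sigma>, \<sigma>^j and \<open>?k\<close> then compares the diagonal value with
      \<open>f \<sigma> (iv \<sigma>)\<close>.\<close>
    case (Suc j)
    let ?k = "iv (\<sigma> ^^ Suc j)"
    have kG: "?k \<in> G" by (rule G(3)[OF p])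
    have kk: "?k = iv (\<sigma> ^^ j) \<circ> iv \<sigma>" unfolding funpow.simps(2) by (rule G(10)[OF s p])
    have "\<sigma> ^^ m = \<sigma> \<circ> \<sigma> ^^ (m - 1)" using i by (metis funpow.simps(2) Suc_diff_1 gr_implies_not0 not_gr_zero)
    then have "iv (\<sigma> ^^ j) \<circ> \<sigma> ^^ (m - 1) = ?k \<circ> \<sigma> ^^ m"
      unfolding kk comp_assoc using G_iv(2)[OF s, of "\<sigma> ^^ (m - 1)"] by metis
    moreover have "f (\<sigma> ^^ j) (iv (\<sigma> ^^ j) \<circ> \<sigma> ^^ (m - 1)) \<notin> J" using chain[of j "m - 1"] i Suc by simp
    ultimately have u: "f (\<sigma> ^^ j) (?k \<circ> \<sigma> ^^ m) \<notin> J" by metis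
    have fk: "f ?k (\<sigma> ^^ m) \<notin> J" by (rule f_H_right[OF mH kG])
    have c: "(\<sigma> ^^ j) (f ?k (\<sigma> ^^ m)) * f (\<sigma> ^^ j) (?k \<circ> \<sigma> ^^ m) = f (\<sigma> ^^ j) ?k * f (\<sigma> ^^ j \<circ> ?k) (\<sigma> ^^ m)"
      by (rule cocycle[OF p kG p])
    have "(\<sigma> ^^ j) (f ?k (\<sigma> ^^ m)) * f (\<sigma> ^^ j) (?k \<circ> \<sigma> ^^ m) \<notin> J"
      using unit_mult[OF GS[OF p f_S[OF kG p]] f_S[OF p G(2)[OF kG p]]] fk GJ_iff[OF p] u by blast
    then have u1: "f (\<sigma> ^^ j) ?k \<notin> J"
      unfolding c using unit_mult[OF f_S[OF p kG] f_S[OF G(2)[OF p kG] p]] by blast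
    have "\<sigma> ^^ j \<circ> ?k = iv \<sigma>" unfolding kk by (rule G_iv(1)[OF p])
    then have c2: "\<sigma> (f (\<sigma> ^^ j) ?k) * f \<sigma> (iv \<sigma>) = f \<sigma> (\<sigma> ^^ j) * f (\<sigma> ^^ Suc j) ?k"
      using cocycle[OF s p kG, of j] unfolding funpow.simps(2) by metis
    have "f (\<sigma> ^^ Suc j) ?k \<notin> J2"
    proof
      assume "f (\<sigma> ^^ Suc j) ?k \<in> J2"
      then have "\<sigma> (f (\<sigma> ^^ j) ?k) * f \<sigma> (iv \<sigma>) \<in> J2" unfolding c2 using J2_mult'[OF f_S[OF s p]] by blast
      moreover have "\<sigma> (f (\<sigma> ^^ j) ?k) \<notin> J" using GJ_iff[OF s] u1 by blast
      ultimately show False using J2_unit'[OF _ GS[OF s f_S[OF p kG]]] base by blast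
    qed
    then show ?thesis unfolding Suc .
  qed
  \<comment> \<open>A general \<tau> differs from some \<sigma>^i by a right factor in
    \<open>H\<close>, and the cocycle identity passes from one diagonal value to the other through
    units.\<close>
  have "f \<tau> (iv \<tau>) \<notin> J2"
  proof -
    obtain i where i: "i < m" "cst \<tau> = cst (\<sigma> ^^ i)" using rep[OF at(2)] by blast
    have "iv (\<sigma> ^^ i) \<circ> \<tau> \<in> H" using cst_eq_iff[OF p at(2)] i(2) by metis
    then obtain h where h: "h \<in> H" "h = iv (\<sigma> ^^ i) \<circ> \<tau>" by blast
    have hG: "h \<in> G" using h(1) H_G by blast
    have th: "\<sigma> ^^ i \<circ> h = \<tau>" unfolding h(2) by (rule G_iv(1)[OF p])
    have "iv \<tau> = iv h \<circ> iv (\<sigma> ^^ i)" unfolding th[symmetric] by (rule G(10)[OF p hG])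
    then have ht: "h \<circ> iv \<tau> = iv (\<sigma> ^^ i)" using G_iv(1)[OF hG] by metis
    note tG = G(3)[OF at(2)]
    have c: "(\<sigma> ^^ i) (f h (iv \<tau>)) * f (\<sigma> ^^ i) (iv (\<sigma> ^^ i)) = f (\<sigma> ^^ i) h * f \<tau> (iv \<tau>)"
      using cocycle[OF p hG tG, of i] unfolding ht th .
    show ?thesis
    proof
      assume "f \<tau> (iv \<tau>) \<in> J2"
      then have "(\<sigma> ^^ i) (f h (iv \<tau>)) * f (\<sigma> ^^ i) (iv (\<sigma> ^^ i)) \<in> J2"
        unfolding c using J2_mult'[OF f_S[OF p hG]] by blast
      moreover have "(\<sigma> ^^ i) (f h (iv \<tau>)) \<notin> J" using GJ_iff[OF p] f_H_left[OF h(1) tG] by blast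
      ultimately show False using J2_unit'[OF _ GS[OF p f_S[OF hG tG]]] diag[OF i(1)] by blast
    qed
  qed
  then show ?thesis using f_J2_inv[OF at] by blast
qed

lemma H_eq_G_not_square: assumes "H = G" "\<alpha> \<in> G" "\<tau> \<in> G" shows "f \<alpha> \<tau> \<notin> J2"
  using f_H_right[of \<tau> \<alpha>] assms J2_J by blast

end

context crossed_reduced
begin

text \<open>If the values agree, \<Phi> at \<tau>\<inverse>\<rho> is a multiple of \<open>n\<close>
  below \<open>n\<close>, hence 0. So \<Phi> is a well-defined and injective function of the
  coset.\<close>

lemma cst_eq_\<Phi>: assumes "\<tau> \<in> G" "\<rho> \<in> G" shows "cst \<tau> = cst \<rho> \<longleftrightarrow> \<Phi> \<tau> = \<Phi> \<rho>"
proof -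
  have g: "iv \<tau> \<circ> \<rho> \<in> G" using G(2,3) assms by blast
  have eq: "\<Phi> \<tau> + \<Phi> (iv \<tau> \<circ> \<rho>) = n * w \<tau> (iv \<tau> \<circ> \<rho>) + \<Phi> \<rho>"
    using \<Phi>_add[OF assms(1) g] by (simp only: G_iv(1)[OF assms(1)])
  have "\<Phi> (iv \<tau> \<circ> \<rho>) = 0 \<longleftrightarrow> \<Phi> \<tau> = \<Phi> \<rho>"
  proof
    assume z: "\<Phi> (iv \<tau> \<circ> \<rho>) = 0"
    have "w \<tau> (iv \<tau> \<circ> \<rho>) = 0" using w_0_iff[OF assms(1) g] z \<Phi>_less[OF assms(1)] by simp
    then show "\<Phi> \<tau> = \<Phi> \<rho>" using eq z by simp
  next
    assume "\<Phi> \<tau> = \<Phi> \<rho>"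
    then have e: "\<Phi> (iv \<tau> \<circ> \<rho>) = n * w \<tau> (iv \<tau> \<circ> \<rho>)" using eq by simp
    then have "w \<tau> (iv \<tau> \<circ> \<rho>) < 1" using \<Phi>_less[OF g] w_le[of \<tau> "iv \<tau> \<circ> \<rho>"] by (cases "w \<tau> (iv \<tau> \<circ> \<rho>) = 1") auto
    then show "\<Phi> (iv \<tau> \<circ> \<rho>) = 0" using e by simp
  qed
  then show ?thesis using cst_eq_iff[OF assms] mem_H[OF g] by (simp only:)
qed

lemma generator_cst:
  assumes gen: "generator \<sigma>" and "\<tau> \<in> G"
  shows "\<exists>k < n div \<Phi> \<sigma>. cst \<tau> = cst (\<sigma> ^^ k)"
proof -
  obtain k where k: "k < n div \<Phi> \<sigma>" "\<Phi> \<tau> = k * \<Phi> \<sigma>" using \<Phi>_div[OF gen assms(2)] by blast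
  then have "\<Phi> \<tau> = \<Phi> (\<sigma> ^^ k)" using \<Phi>_pow_less[OF gen k(1)] by simp
  then show ?thesis using cst_eq_\<Phi>[OF assms(2) pow_G[OF gen_G[OF gen]]] k(1) by blast
qed

lemma card_cst: assumes gen: "generator \<sigma>" shows "card (cst ` G) = n div \<Phi> \<sigma>"
proof -
  have p: "\<sigma> ^^ k \<in> G" for k by (rule pow_G[OF gen_G[OF gen]])
  have "cst ` G = (\<lambda>k. cst (\<sigma> ^^ k)) ` {..<n div \<Phi> \<sigma>}"
    using generator_cst[OF gen] p by (auto simp: image_iff) blast
  moreover have "inj_on (\<lambda>k. cst (\<sigma> ^^ k)) {..<n div \<Phi> \<sigma>}"
  proof (rule inj_onI)
    fix i j assume "i \<in> {..<n div \<Phi> \<sigma>}" "j \<in> {..<n div \<Phi> \<sigma>}" "cst (\<sigma> ^^ i) = cst (\<sigma> ^^ j)"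
    then have "i * \<Phi> \<sigma> = j * \<Phi> \<sigma>" using cst_eq_\<Phi>[OF p p] \<Phi>_pow_less[OF gen] by (metis lessThan_iff)
    then show "i = j" using gen_pos[OF gen] by simp
  qed
  ultimately show ?thesis by (simp add: card_image)
qed

end

context crossed_tame
begin

text \<open>The values of the opposite cocycle are conjugates of values of \<open>f\<close>, so they
  avoid \<open>J(S)\<^sup>2\<close> as well, and the trace condition concerns only \<open>G\<close>
  and \<open>S\<close>. This transfers the result on left ideals to right ideals.\<close>

lemma op_tame: "crossed_tame S G (op_cocycle f) \<omega>"
proof (intro crossed_tame.intro crossed_reduced.intro op_crossed crossed_reduced_axioms.intro crossed_tame_axioms.intro trace)
  fix \<sigma> \<tau> assume s: "\<sigma> \<in> G" and t: "\<tau> \<in> G"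
  have "f (iv \<tau>) (iv \<sigma>) \<notin> J2" unfolding J2_def by (rule f_not_square[OF G(3)[OF t] G(3)[OF s]])
  then have "op_cocycle f \<sigma> \<tau> \<notin> J2" unfolding op_cocycle_def using J2_aut_iff[OF s] J2_aut_iff[OF t] by blast
  then show "op_cocycle f \<sigma> \<tau> \<notin> {\<omega> * \<omega> * s | s. s \<in> S}" unfolding J2_def .
qed

lemma right_projective: assumes "fg_right_ideal A I" shows "projective_right_ideal A I"
proof -
  interpret o: crossed_tame S G "op_cocycle f" \<omega> by (rule op_tame)
  have "right_ideal A I" using assms by (simp add: fg_right_ideal_def)
  then show ?thesis using op_projective o.left_projective[OF op_fg_left_ideal[OF assms]] by blast
qed

lemma semihereditary_A: "semihereditary A"
  unfolding semihereditary_def using left_projective right_projective by blast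

end

section \<open>The Galois group as an abstract group and its cosets\<close>

context crossed
begin

lemma galois_group_simps [simp]:
  "carrier (galois_group G) = G" "monoid.mult (galois_group G) = (\<circ>)" "one (galois_group G) = id"
  by (simp_all add: galois_group_def)

lemma group_galois: "group (galois_group G)"
proof (rule groupI)
  show "\<exists>\<tau>\<in>carrier (galois_group G). \<tau> \<otimes>\<^bsub>galois_group G\<^esub> \<sigma> = \<one>\<^bsub>galois_group G\<^esub>"
    if "\<sigma> \<in> carrier (galois_group G)" for \<sigma> using that G(3,8) by auto
qed (auto simp: G(1,2) comp_assoc)

lemma galois_inv: assumes "\<sigma> \<in> G" shows "inv\<^bsub>galois_group G\<^esub> \<sigma> = iv \<sigma>"
proof -
  interpret group "galois_group G" by (rule group_galois)
  show ?thesis using assms G(3,8)[OF assms] by (intro inv_equality) auto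
qed

lemma l_coset_cst: "\<tau> <#\<^bsub>galois_group G\<^esub> H = cst \<tau>"
  by (auto simp: l_coset_def cst_def)

end

lemma (in crossed_reduced) normal_H: "normal H (galois_group G)"
proof -
  interpret group "galois_group G" by (rule group_galois)
  have "subgroup H (galois_group G)"
  proof (rule subgroupI)
    show "H \<subseteq> carrier (galois_group G)" "H \<noteq> {}" using H_G H_id by auto
    show "inv\<^bsub>galois_group G\<^esub> h \<in> H" if "h \<in> H" for h using galois_inv[OF H_G[OF that]] H_inv[OF that] by simp
    show "h \<otimes>\<^bsub>galois_group G\<^esub> k \<in> H" if "h \<in> H" "k \<in> H" for h k using H_comp[OF that] by simp
  qed
  moreover have "\<sigma> \<otimes>\<^bsub>galois_group G\<^esub> h \<otimes>\<^bsub>galois_group G\<^esub> inv\<^bsub>galois_group G\<^esub> \<sigma> \<in> H"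
    if "\<sigma> \<in> carrier (galois_group G)" "h \<in> H" for \<sigma> h
    using that H_normal[of \<sigma> h] galois_inv[of \<sigma>] by simp
  ultimately show ?thesis unfolding normal_inv_iff by blast
qed

lemma (in crossed_tame) radical_structure:
  assumes "H \<noteq> G"
  shows "\<exists>\<sigma>\<in>G. (\<forall>\<tau>\<in>G. \<exists>k::nat. cst \<tau> = cst (\<sigma> ^^ k))
    \<and> (\<forall>i<card (cst ` G). \<forall>j<card (cst ` G). f (\<sigma> ^^ i) (iv (\<sigma> ^^ i) \<circ> \<sigma> ^^ j) \<notin> J \<longleftrightarrow> i \<le> j)
    \<and> jacobson A = {mul (mon 1 \<sigma>) a | a. a \<in> AC}"
proof -
  obtain \<sigma> where gen: "generator \<sigma>" using generator_exists[OF assms] by blast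
  have "\<forall>\<tau>\<in>G. \<exists>k::nat. cst \<tau> = cst (\<sigma> ^^ k)" using generator_cst[OF gen] by blast
  moreover have "\<forall>i<card (cst ` G). \<forall>j<card (cst ` G). f (\<sigma> ^^ i) (iv (\<sigma> ^^ i) \<circ> \<sigma> ^^ j) \<notin> J \<longleftrightarrow> i \<le> j"
    unfolding card_cst[OF gen] using chain[OF gen] by blast
  moreover have "jacobson A = {mul (mon 1 \<sigma>) a | a. a \<in> AC}"
    unfolding jacobson_eq_P by (rule generator_ideal[OF gen, symmetric])
  ultimately show ?thesis using gen_G[OF gen] by blast
qed

theorem theorem3p2:
  fixes F V S :: "'k::field set"
    and f :: "('k \<Rightarrow> 'k) \<Rightarrow> ('k \<Rightarrow> 'k) \<Rightarrow> 'k"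
    and G H :: "('k \<Rightarrow> 'k) set"
  assumes F: "is_subfield F"
    and V: "valuation_ring F V"
    and JV: "\<exists>\<pi>\<in>V. jacobson (ring_on V) = {\<pi> * v | v. v \<in> V}"
    and gal: "finite_galois F"
    and G: "G = Gal F"
    and S: "S = integral_closure V"
    and indec: "valuation_ring UNIV S"
    and tame: "tame_defectless F V S"
    and f: "normalized_cocycle G S f"
    and H: "H = {\<sigma>\<in>G. f \<sigma> (Hilbert_Choice.inv \<sigma>) \<in> Units (ring_on S)}"
  shows "(semihereditary (crossed_product G S f)
            \<longleftrightarrow> (\<forall>\<sigma>\<in>G. \<forall>\<tau>\<in>G. f \<sigma> \<tau> \<notin> ideal_square (ring_on S) (jacobson (ring_on S))))
       \<and> ((\<forall>\<sigma>\<in>G. \<forall>\<tau>\<in>G. f \<sigma> \<tau> \<notin> ideal_square (ring_on S) (jacobson (ring_on S)))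
            \<longleftrightarrow>
          (normal H (galois_group G)
           \<and> (\<exists>\<sigma>\<in>G. \<forall>\<tau>\<in>G. \<exists>k::nat. \<tau> <#\<^bsub>galois_group G\<^esub> H = (\<sigma> ^^ k) <#\<^bsub>galois_group G\<^esub> H)
           \<and> (H = G \<or>
              (\<exists>\<sigma>\<in>G.
                 (\<forall>\<tau>\<in>G. \<exists>k::nat. \<tau> <#\<^bsub>galois_group G\<^esub> H = (\<sigma> ^^ k) <#\<^bsub>galois_group G\<^esub> H)
                 \<and> (let m = card {\<tau> <#\<^bsub>galois_group G\<^esub> H | \<tau>. \<tau> \<in> G} in
                     \<forall>i<m. \<forall>j<m. (f (\<sigma> ^^ i) (Hilbert_Choice.inv (\<sigma> ^^ i) \<circ> \<sigma> ^^ j) \<in> Units (ring_on S) \<longleftrightarrow> i \<le> j))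
                 \<and> jacobson (crossed_product G S f)
                     = {xbasis \<sigma> \<otimes>\<^bsub>crossed_product G S f\<^esub> a | a. a \<in> carrier (crossed_product G S f)}))))"
proof -
  interpret E: indecomposed_ext S F V
    using indec F V S gal by unfold_locales
  obtain \<pi> where "\<pi> \<in> V" "jacobson (ring_on V) = {\<pi> * v | v. v \<in> V}" using JV by blast
  then obtain \<omega> where \<omega>: "nonunits S = {\<omega> * s | s. s \<in> S}" using E.J_principal by blast
  interpret C: crossed S G f \<omega>
    using E.autG E.finG E.GS \<omega> f unfolding G by unfold_locales auto
  have fS: "f \<sigma> \<tau> \<in> Units (ring_on S) \<longleftrightarrow> f \<sigma> \<tau> \<notin> nonunits S" if "\<sigma> \<in> G" "\<tau> \<in> G" for \<sigma> \<tau>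
    using C.f_S[OF that] E.Units_S by simp
  have H_eq: "H = C.H" unfolding H C.H_def using fS C.G(3) by blast
  \<comment> \<open>Condition (2), with which (1) and (3) are each compared.\<close>
  define sq where "sq \<longleftrightarrow> (\<forall>\<sigma>\<in>G. \<forall>\<tau>\<in>G. f \<sigma> \<tau> \<notin> C.J2)"
  have tame': "crossed_tame S G f \<omega>" if sq
  proof (intro crossed_tame.intro crossed_reduced.intro C.crossed_axioms
      crossed_reduced_axioms.intro crossed_tame_axioms.intro)
    show "f \<sigma> \<tau> \<notin> {\<omega> * \<omega> * s | s. s \<in> S}" if "\<sigma> \<in> G" "\<tau> \<in> G" for \<sigma> \<tau>
      using \<open>sq\<close> that unfolding sq_def C.J2_def by blast
    show "\<exists>s\<in>S. (\<Sum>\<sigma>\<in>G. \<sigma> s) \<notin> nonunits S" unfolding G by (rule E.trace_unit[OF tame])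
  qed
  have cosets: "{C.cst \<tau> | \<tau>. \<tau> \<in> G} = C.cst ` G" by blast
  have rad: "{xbasis \<sigma> \<otimes>\<^bsub>C.A\<^esub> a | a. a \<in> carrier C.A} = {C.mul (C.mon 1 \<sigma>) a | a. a \<in> C.AC}" for \<sigma>
    unfolding C.A_simps C.xbasis_mon ..
  have chain: "(\<forall>i<m. \<forall>j<m. (f (\<sigma> ^^ i) (iv (\<sigma> ^^ i) \<circ> \<sigma> ^^ j) \<in> Units (ring_on S) \<longleftrightarrow> i \<le> j))
      \<longleftrightarrow> (\<forall>i<m. \<forall>j<m. (f (\<sigma> ^^ i) (iv (\<sigma> ^^ i) \<circ> \<sigma> ^^ j) \<notin> nonunits S \<longleftrightarrow> i \<le> j))"
    if s: "\<sigma> \<in> G" for \<sigma> and m :: nat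
  proof -
    have "f (\<sigma> ^^ i) (iv (\<sigma> ^^ i) \<circ> \<sigma> ^^ j) \<in> Units (ring_on S) \<longleftrightarrow> f (\<sigma> ^^ i) (iv (\<sigma> ^^ i) \<circ> \<sigma> ^^ j) \<notin> nonunits S" for i j
      by (rule fS[OF C.pow_G[OF s] C.G(2)[OF C.G(3)[OF C.pow_G[OF s]] C.pow_G[OF s]]])
    then show ?thesis by (simp only:)
  qed
  have semi: "semihereditary C.A \<longleftrightarrow> sq"
  proof
    assume "semihereditary C.A"
    then have "\<And>I. fg_left_ideal C.A I \<Longrightarrow> projective_left_ideal C.A I" by (simp add: semihereditary_def)
    then show sq unfolding sq_def using C.semihereditary_not_square by blast
  next
    assume sq
    then interpret T: crossed_tame S G f \<omega> by (rule tame')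
    show "semihereditary C.A" by (rule T.semihereditary_A)
  qed
  define gen where "gen \<sigma> \<longleftrightarrow> (\<forall>\<tau>\<in>G. \<exists>k::nat. C.cst \<tau> = C.cst (\<sigma> ^^ k))" for \<sigma>
  define R where "R \<sigma> \<longleftrightarrow> gen \<sigma> \<and> (\<forall>i<card (C.cst ` G). \<forall>j<card (C.cst ` G).
      (f (\<sigma> ^^ i) (iv (\<sigma> ^^ i) \<circ> \<sigma> ^^ j) \<notin> nonunits S \<longleftrightarrow> i \<le> j))
    \<and> jacobson C.A = {C.mul (C.mon 1 \<sigma>) a | a. a \<in> C.AC}" for \<sigma>
  have struct: "sq \<longleftrightarrow> normal C.H (galois_group G) \<and> (\<exists>\<sigma>\<in>G. gen \<sigma>) \<and> (C.H = G \<or> (\<exists>\<sigma>\<in>G. R \<sigma>))"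
  proof
    assume sq
    then interpret T: crossed_tame S G f \<omega> by (rule tame')
    have R: "\<exists>\<sigma>\<in>G. R \<sigma>" if "C.H \<noteq> G" unfolding R_def gen_def by (rule T.radical_structure[OF that])
    have "\<exists>\<sigma>\<in>G. gen \<sigma>"
    proof (cases "C.H = G")
      case True
      \<comment> \<open>For \<open>H = G\<close> there is a single coset, represented by the
        identity.\<close>
      have "C.cst \<tau> = C.cst (id ^^ 0)" if "\<tau> \<in> G" for \<tau>
      proof -
        have "iv \<tau> \<circ> id \<in> C.H" unfolding True using C.G(3)[OF that] by simp
        then show ?thesis using C.cst_eq_iff[OF that C.G(1)] by simp
      qed
      then show ?thesis unfolding gen_def using C.G(1) by blast
    next
      case False
      then show ?thesis using R unfolding R_def by blast
    qed
    then show "normal C.H (galois_group G) \<and> (\<exists>\<sigma>\<in>G. gen \<sigma>) \<and> (C.H = G \<or> (\<exists>\<sigma>\<in>G. R \<sigma>))"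
      using T.normal_H R by blast
  next
    assume a: "normal C.H (galois_group G) \<and> (\<exists>\<sigma>\<in>G. gen \<sigma>) \<and> (C.H = G \<or> (\<exists>\<sigma>\<in>G. R \<sigma>))"
    show sq
    \<comment> \<open>For \<open>H = G\<close> every value of \<open>f\<close> is a unit; otherwise
      the chain and the form of the radical exclude the square of \<open>J\<close>.\<close>
    proof (cases "C.H = G")
      case True
      then show ?thesis unfolding sq_def using C.H_eq_G_not_square by blast
    next
      case False
      then obtain \<sigma> where \<sigma>: "\<sigma> \<in> G" "R \<sigma>" using a by blast
      have c: "f (\<sigma> ^^ i) (iv (\<sigma> ^^ i) \<circ> \<sigma> ^^ j) \<notin> nonunits S \<longleftrightarrow> i \<le> j"
        if "i < card (C.cst ` G)" "j < card (C.cst ` G)" for i j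
        using \<sigma>(2) that unfolding R_def by blast
      have "jacobson C.A = {C.mul (C.mon 1 \<sigma>) a | a. a \<in> C.AC}" using \<sigma>(2) unfolding R_def by (elim conjE)
      then show ?thesis unfolding sq_def using C.chain_not_square[OF False \<sigma>(1) refl c] by blast
    qed
  qed
  have R_iff: "(\<exists>\<sigma>\<in>G. (\<forall>\<tau>\<in>G. \<exists>k::nat. C.cst \<tau> = C.cst (\<sigma> ^^ k))
      \<and> (\<forall>i<card (C.cst ` G). \<forall>j<card (C.cst ` G).
          (f (\<sigma> ^^ i) (iv (\<sigma> ^^ i) \<circ> \<sigma> ^^ j) \<in> Units (ring_on S) \<longleftrightarrow> i \<le> j))
      \<and> jacobson C.A = {C.mul (C.mon 1 \<sigma>) a | a. a \<in> C.AC}) \<longleftrightarrow> (\<exists>\<sigma>\<in>G. R \<sigma>)"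
    by (rule bex_cong[OF refl]) (simp only: R_def gen_def chain)
  show ?thesis
    unfolding E.jacobson_S C.ideal_square_J H_eq Let_def C.l_coset_cst rad
    unfolding cosets
    unfolding R_iff
    unfolding sq_def[symmetric] gen_def[symmetric]
    using semi struct by (rule conjI)
qed

end
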